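(* Let $A$ be a ring and $\mathcal{C}$ an $A$-coring which is finitely generated and projective as a right $A$-module. If $\mathcal{C}\in{}_{\mathcal{C}^*}\mathcal{M}$ is flat and $\mathcal{C}^*\in{}^{\mathcal{C}}\mathcal{M}$ is coflat, then the adjoint pair $(F,G)$, $$F:\mathcal{M}_{\mathcal{C}^*}\to\mathcal{M}^{\mathcal{C}},\ F(N)=N\otimes_{\mathcal{C}^*}\mathcal{C},\qquad G:\mathcal{M}^{\mathcal{C}}\to\mathcal{M}_{\mathcal{C}^*},\ G(M)=\mathrm{Hom}^{\mathcal{C}}(\mathcal{C},M)\cong M\otimes^{\mathcal{C}}\mathcal{C}^*,$$ is a pair of inverse equivalences.
   Context: An $A$-coring is an $A$-bimodule $\mathcal{C}$ with $A$-bimodule maps $\Delta:\mathcal{C}\to\mathcal{C}\otimes_A\mathcal{C}$, $\Delta(c)=c_{(1)}\otimes_A c_{(2)}$ (coassociative) and $\varepsilon:\mathcal{C}\to A$ (counit). Right $\mathcal{C}$-comodules are right $A$-modules with a right $A$-linear, coassociative, counital coaction; morphisms are right $A$-linear maps commuting with coactions; category $\mathcal{M}^{\mathcal{C}}$ with $\mathrm{Hom}^{\mathcal{C}}$. Left comodules (${}^{\mathcal{C}}\mathcal{M}$) symmetrically. $\mathcal{C}^*=\mathrm{Hom}_A(\mathcal{C},A)$ (right $A$-linear maps) is a ring with $(f\#g)(c)=f(g(c_{(1)})c_{(2)})$; $\mathcal{C}$ is a left $\mathcal{C}^*$-module via $f\cdot c=f(c_{(1)})c_{(2)}$, which identifies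 $\mathcal{C}^*\cong\mathrm{End}^{\mathcal{C}}(\mathcal{C})$; $\mathcal{M}_{\mathcal{C}^*}$, ${}_{\mathcal{C}^*}\mathcal{M}$ are right, left $\mathcal{C}^*$-modules. $F(N)$ has the coaction induced by $\Delta$; $G(M)$ is a right $\mathcal{C}^*$-module via composition with the action on $\mathcal{C}$. With dual basis $\sum_i e_i\otimes_A f_i\in\mathcal{C}\otimes_A\mathcal{C}^*$ of $\mathcal{C}$ as a right $A$-module, $\mathcal{C}^*$ is a left $\mathcal{C}$-comodule via $f\mapsto\sum_i f(e_{i(1)})e_{i(2)}\otimes_A f_i$ (with left $A$-action $(af)(c)=af(c)$). For $M\in\mathcal{M}^{\mathcal{C}}$, $N\in{}^{\mathcal{C}}\mathcal{M}$, the cotensor product $M\otimes^{\mathcal{C}}N\subset M\otimes_A N$ is the equalizer of $\rho_M\otimes_A N$ and $M\otimes_A\rho_N$. A left comodule $N$ is coflat if it is flat as a left $A$-module and $-\otimes^{\mathcal{C}}N:\mathcal{M}^{\mathcal{C}}\to\mathrm{Ab}$ is exact. $(F,G)$ has unit $n\mapsto(c\mapsto n\otimes c)$ and counit given by evaluation; it is a pair of inverse equivalences if both are isomorphisms. *)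

theory Defs
  imports "HOL-Algebra.AbelCoset" "HOL-Algebra.Free_Abelian_Groups"
begin

section \<open>Modules and bimodules over noncommutative rings\<close>

text \<open>
  As for the library's \<open>module\<close> record, only the additive part of the \<open>ring\<close> fields is used;
  \<open>mult\<close> and \<open>one\<close> are junk. One-sided modules use the same record, ignoring the other action:
  a right module has type \<open>(unit, 'm, 'r) bimod\<close>, and its field \<open>lact\<close> is never looked at.
\<close>

record ('l, 'm, 'r) bimod = "'m ring" +
  lact :: "'l \<Rightarrow> 'm \<Rightarrow> 'm" (infixl \<open>\<triangleright>\<index>\<close> 70)
  ract :: "'m \<Rightarrow> 'r \<Rightarrow> 'm" (infixl \<open>\<triangleleft>\<index>\<close> 70)

locale left_module = R: ring R + M: abelian_group M
  for R :: "('l, 'y) ring_scheme" and M :: "('l, 'm, 'r, 'z) bimod_scheme" +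
  assumes lact_closed: "\<lbrakk>a \<in> carrier R; x \<in> carrier M\<rbrakk> \<Longrightarrow> a \<triangleright>\<^bsub>M\<^esub> x \<in> carrier M"
    and lact_add_left: "\<lbrakk>a \<in> carrier R; b \<in> carrier R; x \<in> carrier M\<rbrakk>
      \<Longrightarrow> (a \<oplus>\<^bsub>R\<^esub> b) \<triangleright>\<^bsub>M\<^esub> x = (a \<triangleright>\<^bsub>M\<^esub> x) \<oplus>\<^bsub>M\<^esub> (b \<triangleright>\<^bsub>M\<^esub> x)"
    and lact_add_right: "\<lbrakk>a \<in> carrier R; x \<in> carrier M; y \<in> carrier M\<rbrakk>
      \<Longrightarrow> a \<triangleright>\<^bsub>M\<^esub> (x \<oplus>\<^bsub>M\<^esub> y) = (a \<triangleright>\<^bsub>M\<^esub> x) \<oplus>\<^bsub>M\<^esub> (a \<triangleright>\<^bsub>M\<^esub> y)"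
    and lact_mult: "\<lbrakk>a \<in> carrier R; b \<in> carrier R; x \<in> carrier M\<rbrakk>
      \<Longrightarrow> (a \<otimes>\<^bsub>R\<^esub> b) \<triangleright>\<^bsub>M\<^esub> x = a \<triangleright>\<^bsub>M\<^esub> (b \<triangleright>\<^bsub>M\<^esub> x)"
    and lact_one: "x \<in> carrier M \<Longrightarrow> \<one>\<^bsub>R\<^esub> \<triangleright>\<^bsub>M\<^esub> x = x"

locale right_module = S: ring S + M: abelian_group M
  for S :: "('r, 'y) ring_scheme" and M :: "('l, 'm, 'r, 'z) bimod_scheme" +
  assumes ract_closed: "\<lbrakk>a \<in> carrier S; x \<in> carrier M\<rbrakk> \<Longrightarrow> x \<triangleleft>\<^bsub>M\<^esub> a \<in> carrier M"
    and ract_add_right: "\<lbrakk>a \<in> carrier S; b \<in> carrier S; x \<in> carrier M\<rbrakk>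
      \<Longrightarrow> x \<triangleleft>\<^bsub>M\<^esub> (a \<oplus>\<^bsub>S\<^esub> b) = (x \<triangleleft>\<^bsub>M\<^esub> a) \<oplus>\<^bsub>M\<^esub> (x \<triangleleft>\<^bsub>M\<^esub> b)"
    and ract_add_left: "\<lbrakk>a \<in> carrier S; x \<in> carrier M; y \<in> carrier M\<rbrakk>
      \<Longrightarrow> (x \<oplus>\<^bsub>M\<^esub> y) \<triangleleft>\<^bsub>M\<^esub> a = (x \<triangleleft>\<^bsub>M\<^esub> a) \<oplus>\<^bsub>M\<^esub> (y \<triangleleft>\<^bsub>M\<^esub> a)"
    and ract_mult: "\<lbrakk>a \<in> carrier S; b \<in> carrier S; x \<in> carrier M\<rbrakk>
      \<Longrightarrow> x \<triangleleft>\<^bsub>M\<^esub> (a \<otimes>\<^bsub>S\<^esub> b) = (x \<triangleleft>\<^bsub>M\<^esub> a) \<triangleleft>\<^bsub>M\<^esub> b"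
    and ract_one: "x \<in> carrier M \<Longrightarrow> x \<triangleleft>\<^bsub>M\<^esub> \<one>\<^bsub>S\<^esub> = x"

locale bimodule = left_module R M + right_module S M
  for R :: "('l, 'y) ring_scheme" and S :: "('r, 'x) ring_scheme"
    and M :: "('l, 'm, 'r, 'z) bimod_scheme" +
  assumes lact_ract: "\<lbrakk>a \<in> carrier R; b \<in> carrier S; x \<in> carrier M\<rbrakk>
      \<Longrightarrow> (a \<triangleright>\<^bsub>M\<^esub> x) \<triangleleft>\<^bsub>M\<^esub> b = a \<triangleright>\<^bsub>M\<^esub> (x \<triangleleft>\<^bsub>M\<^esub> b)"

definition additive_map ::
  "('m, 'y) ring_scheme \<Rightarrow> ('n, 'z) ring_scheme \<Rightarrow> ('m \<Rightarrow> 'n) \<Rightarrow> bool"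
  where "additive_map M N f \<longleftrightarrow> f \<in> hom (add_monoid M) (add_monoid N)"

definition left_linear :: "('l, 'x) ring_scheme \<Rightarrow> ('l, 'm, 'r, 'y) bimod_scheme
    \<Rightarrow> ('l, 'n, 's, 'z) bimod_scheme \<Rightarrow> ('m \<Rightarrow> 'n) \<Rightarrow> bool"
  where "left_linear R M N f \<longleftrightarrow> additive_map M N f \<and>
    (\<forall>a\<in>carrier R. \<forall>x\<in>carrier M. f (a \<triangleright>\<^bsub>M\<^esub> x) = a \<triangleright>\<^bsub>N\<^esub> f x)"

definition right_linear :: "('r, 'x) ring_scheme \<Rightarrow> ('l, 'm, 'r, 'y) bimod_scheme
    \<Rightarrow> ('k, 'n, 'r, 'z) bimod_scheme \<Rightarrow> ('m \<Rightarrow> 'n) \<Rightarrow> bool"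
  where "right_linear R M N f \<longleftrightarrow> additive_map M N f \<and>
    (\<forall>a\<in>carrier R. \<forall>x\<in>carrier M. f (x \<triangleleft>\<^bsub>M\<^esub> a) = f x \<triangleleft>\<^bsub>N\<^esub> a)"

text \<open>Hom sets consist of \<^emph>\<open>extensional\<close> functions, so that equality of morphisms is equality on
  the carrier.\<close>

definition right_hom :: "('r, 'x) ring_scheme \<Rightarrow> ('l, 'm, 'r, 'y) bimod_scheme
    \<Rightarrow> ('k, 'n, 'r, 'z) bimod_scheme \<Rightarrow> ('m \<Rightarrow> 'n) set"
  where "right_hom R M N = {f \<in> extensional (carrier M). right_linear R M N f}"

text \<open>The additive group of \<open>M\<close> with the given actions.\<close>

definition with_actions :: "('m, 'z) ring_scheme \<Rightarrow> ('l \<Rightarrow> 'm \<Rightarrow> 'm) \<Rightarrow> ('m \<Rightarrow> 'r \<Rightarrow> 'm)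
    \<Rightarrow> ('l, 'm, 'r) bimod"
  where "with_actions M l r = \<lparr>carrier = carrier M, monoid.mult = monoid.mult M, one = one M,
    ring.zero = ring.zero M, ring.add = ring.add M, lact = l, ract = r\<rparr>"

definition regular :: "'r ring \<Rightarrow> ('r, 'r, 'r) bimod"
  where "regular R = with_actions R (monoid.mult R) (monoid.mult R)"


section \<open>Tensor products\<close>

text \<open>The tensor product of a right and a left \<open>R\<close>-module is the free abelian group on the pairs,
  modulo the subgroup generated by the usual biadditivity and balancing relations.\<close>

type_synonym ('m, 'n) tens = "(('m \<times> 'n) \<Rightarrow>\<^sub>0 int) set"

definition tensor_relations :: "('r, 'x) ring_scheme \<Rightarrow> ('l, 'm, 'r, 'y) bimod_scheme
    \<Rightarrow> ('r, 'n, 's, 'z) bimod_scheme \<Rightarrow> (('m \<times> 'n) \<Rightarrow>\<^sub>0 int) set"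
  where "tensor_relations R M N =
    generate (free_Abelian_group (carrier M \<times> carrier N))
     ({frag_of (x \<oplus>\<^bsub>M\<^esub> x', y) - frag_of (x, y) - frag_of (x', y) |x x' y.
         x \<in> carrier M \<and> x' \<in> carrier M \<and> y \<in> carrier N} \<union>
      {frag_of (x, y \<oplus>\<^bsub>N\<^esub> y') - frag_of (x, y) - frag_of (x, y') |x y y'.
         x \<in> carrier M \<and> y \<in> carrier N \<and> y' \<in> carrier N} \<union>
      {frag_of (x \<triangleleft>\<^bsub>M\<^esub> r, y) - frag_of (x, r \<triangleright>\<^bsub>N\<^esub> y) |x r y.
         x \<in> carrier M \<and> r \<in> carrier R \<and> y \<in> carrier N})"

definition tens :: "('r, 'x) ring_scheme \<Rightarrow> ('l, 'm, 'r, 'y) bimod_scheme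
    \<Rightarrow> ('r, 'n, 's, 'z) bimod_scheme \<Rightarrow> 'm \<Rightarrow> 'n \<Rightarrow> ('m, 'n) tens"
  where "tens R M N x y =
    tensor_relations R M N #>\<^bsub>free_Abelian_group (carrier M \<times> carrier N)\<^esub> frag_of (x, y)"

definition tensor_group :: "('r, 'x) ring_scheme \<Rightarrow> ('l, 'm, 'r, 'y) bimod_scheme
    \<Rightarrow> ('r, 'n, 's, 'z) bimod_scheme \<Rightarrow> ('m, 'n) tens ring"
  where "tensor_group R M N =
    (let Q = free_Abelian_group (carrier M \<times> carrier N) Mod tensor_relations R M N
     in \<lparr>carrier = carrier Q, monoid.mult = undefined, one = undefined,
         ring.zero = one Q, ring.add = monoid.mult Q\<rparr>)"

text \<open>The additive map \<open>M \<otimes>\<^sub>R N \<rightarrow> G\<close> with \<open>x \<otimes> y \<mapsto> b x y\<close>; it exists for biadditive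
  balanced \<open>b\<close>, and is unique.\<close>

definition tensor_lift :: "('r, 'x) ring_scheme \<Rightarrow> ('l, 'm, 'r, 'y) bimod_scheme
    \<Rightarrow> ('r, 'n, 's, 'z) bimod_scheme \<Rightarrow> ('g, 'w) ring_scheme \<Rightarrow> ('m \<Rightarrow> 'n \<Rightarrow> 'g)
    \<Rightarrow> ('m, 'n) tens \<Rightarrow> 'g"
  where "tensor_lift R M N G b =
    (THE h. h \<in> extensional (carrier (tensor_group R M N)) \<and>
       additive_map (tensor_group R M N) G h \<and>
       (\<forall>x\<in>carrier M. \<forall>y\<in>carrier N. h (tens R M N x y) = b x y))"

definition tensor :: "('r, 'x) ring_scheme \<Rightarrow> ('l, 'm, 'r, 'y) bimod_scheme
    \<Rightarrow> ('r, 'n, 's, 'z) bimod_scheme \<Rightarrow> ('l, ('m, 'n) tens, 's) bimod"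
  where "tensor R M N =
    (let T = tensor_group R M N
     in with_actions T
          (\<lambda>a. tensor_lift R M N T (\<lambda>x y. tens R M N (a \<triangleright>\<^bsub>M\<^esub> x) y))
          (\<lambda>t a. tensor_lift R M N T (\<lambda>x y. tens R M N x (y \<triangleleft>\<^bsub>N\<^esub> a)) t))"

definition tensor_map :: "('r, 'x) ring_scheme
    \<Rightarrow> ('l, 'm, 'r, 'y) bimod_scheme \<Rightarrow> ('r, 'n, 's, 'z) bimod_scheme
    \<Rightarrow> ('l', 'm', 'r, 'y') bimod_scheme \<Rightarrow> ('r, 'n', 's', 'z') bimod_scheme
    \<Rightarrow> ('m \<Rightarrow> 'm') \<Rightarrow> ('n \<Rightarrow> 'n') \<Rightarrow> ('m, 'n) tens \<Rightarrow> ('m', 'n') tens"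
  where "tensor_map R M N M' N' f g =
    tensor_lift R M N (tensor_group R M' N') (\<lambda>x y. tens R M' N' (f x) (g y))"

text \<open>The associativity isomorphism \<open>(M \<otimes>\<^sub>R N) \<otimes>\<^sub>S P \<rightarrow> M \<otimes>\<^sub>R (N \<otimes>\<^sub>S P)\<close>.\<close>

definition tensor_assoc :: "('r, 'x) ring_scheme \<Rightarrow> ('s, 'w) ring_scheme
    \<Rightarrow> ('l, 'm, 'r, 'y) bimod_scheme \<Rightarrow> ('r, 'n, 's, 'z) bimod_scheme
    \<Rightarrow> ('s, 'p, 't, 'v) bimod_scheme \<Rightarrow> (('m, 'n) tens, 'p) tens \<Rightarrow> ('m, ('n, 'p) tens) tens"
  where "tensor_assoc R S M N P =
    (let NP = tensor S N P; T = tensor_group R M NP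
     in tensor_lift S (tensor R M N) P T
          (\<lambda>t z. tensor_lift R M N T (\<lambda>x y. tens R M NP x (tens S N P y z)) t))"


section \<open>Projective and flat modules\<close>

text \<open>
  Notions that quantify over all modules or comodules take the type \<open>'u\<close> of the elements of
  the test objects as an explicit argument, which plays the role of a universe.
\<close>

definition finitely_generated :: "('r, 'x) ring_scheme \<Rightarrow> ('l, 'm, 'r, 'y) bimod_scheme \<Rightarrow> bool"
  where "finitely_generated R M \<longleftrightarrow> (\<exists>X. finite X \<and> X \<subseteq> carrier M \<and>
    (\<forall>m\<in>carrier M. \<exists>a \<in> X \<rightarrow> carrier R. m = (\<Oplus>\<^bsub>M\<^esub>x\<in>X. x \<triangleleft>\<^bsub>M\<^esub> a x)))"

definition projective ::
  "'u itself \<Rightarrow> ('r, 'x) ring_scheme \<Rightarrow> ('l, 'm, 'r, 'y) bimod_scheme \<Rightarrow> bool"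
  where "projective _ R P \<longleftrightarrow>
    (\<forall>(X :: (unit, 'u, 'r) bimod) (Y :: (unit, 'u, 'r) bimod) g f.
       right_module R X \<and> right_module R Y \<and>
       g \<in> right_hom R X Y \<and> g ` carrier X = carrier Y \<and> f \<in> right_hom R P Y \<longrightarrow>
       (\<exists>h\<in>right_hom R P X. \<forall>p\<in>carrier P. g (h p) = f p))"

definition flat ::
  "'u itself \<Rightarrow> ('r, 'x) ring_scheme \<Rightarrow> ('r, 'p, 's, 'y) bimod_scheme \<Rightarrow> bool"
  where "flat _ R P \<longleftrightarrow>
    (\<forall>(X :: (unit, 'u, 'r) bimod) (Y :: (unit, 'u, 'r) bimod) f.
       right_module R X \<and> right_module R Y \<and>
       f \<in> right_hom R X Y \<and> inj_on f (carrier X) \<longrightarrow>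
       inj_on (tensor_map R X P Y P f id) (carrier (tensor R X P)))"


section \<open>Corings and comodules\<close>

record ('a, 'c) coring = "('a, 'c, 'a) bimod" +
  comult :: "'c \<Rightarrow> ('c, 'c) tens"
  counit :: "'c \<Rightarrow> 'a"

locale coring = bimodule A A C
  for A :: "'a ring" and C :: "('a, 'c) coring" +
  assumes comult_left: "left_linear A C (tensor A C C) (comult C)"
    and comult_right: "right_linear A C (tensor A C C) (comult C)"
    and counit_left: "left_linear A C (regular A) (counit C)"
    and counit_right: "right_linear A C (regular A) (counit C)"
    and coassoc: "c \<in> carrier C \<Longrightarrow>
      tensor_assoc A A C C C (tensor_map A C C (tensor A C C) C (comult C) id (comult C c)) =
      tensor_map A C C C (tensor A C C) id (comult C) (comult C c)"
    and counit_comult_left: "c \<in> carrier C \<Longrightarrow>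
      tensor_lift A C C C (\<lambda>x y. counit C x \<triangleright>\<^bsub>C\<^esub> y) (comult C c) = c"
    and counit_comult_right: "c \<in> carrier C \<Longrightarrow>
      tensor_lift A C C C (\<lambda>x y. x \<triangleleft>\<^bsub>C\<^esub> counit C y) (comult C c) = c"

record ('a, 'c, 'm) rcomod = "(unit, 'm, 'a) bimod" +
  rcoact :: "'m \<Rightarrow> ('m, 'c) tens"

locale right_comodule = coring A C + M: right_module A M
  for A :: "'a ring" and C :: "('a, 'c) coring" and M :: "('a, 'c, 'm) rcomod" +
  assumes rcoact_linear: "right_linear A M (tensor A M C) (rcoact M)"
    and rcoact_coassoc: "m \<in> carrier M \<Longrightarrow>
      tensor_assoc A A M C C (tensor_map A M C (tensor A M C) C (rcoact M) id (rcoact M m)) =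
      tensor_map A M C M (tensor A C C) id (comult C) (rcoact M m)"
    and rcoact_counit: "m \<in> carrier M \<Longrightarrow>
      tensor_lift A M C M (\<lambda>x c. x \<triangleleft>\<^bsub>M\<^esub> counit C c) (rcoact M m) = m"

definition comodule_hom :: "'a ring \<Rightarrow> ('a, 'c) coring
    \<Rightarrow> ('a, 'c, 'm) rcomod \<Rightarrow> ('a, 'c, 'n) rcomod \<Rightarrow> ('m \<Rightarrow> 'n) set"
  where "comodule_hom A C M N = {f \<in> right_hom A M N.
    \<forall>m\<in>carrier M. rcoact N (f m) = tensor_map A M C N C f id (rcoact M m)}"

definition self_comodule :: "('a, 'c) coring \<Rightarrow> ('a, 'c, 'c) rcomod"
  where "self_comodule C =
    bimod.extend (with_actions C (\<lambda>_ x. x) (ract C)) (rcomod.fields (comult C))"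

text \<open>Data of a left comodule (the axioms are not part of the notions below); a further right
  action by a ring with elements in \<open>'s\<close> may be present, as it is for the dual of a coring.\<close>

record ('a, 'c, 'm, 's) lcomod = "('a, 'm, 's) bimod" +
  lcoact :: "'m \<Rightarrow> ('c, 'm) tens"

definition cotensor :: "'a ring \<Rightarrow> ('a, 'c) coring \<Rightarrow> ('a, 'c, 'm) rcomod
    \<Rightarrow> ('a, 'c, 'n, 's) lcomod \<Rightarrow> (unit, ('m, 'n) tens, 's) bimod"
  where "cotensor A C M N = (tensor A M N)\<lparr>carrier := {t \<in> carrier (tensor A M N).
    tensor_assoc A A M C N (tensor_map A M N (tensor A M C) N (rcoact M) id t) =
    tensor_map A M N M (tensor A C N) id (lcoact N) t}\<rparr>"

text \<open>
  A sequence of right comodules is taken to be exact if it is exact on the underlying abelian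
  groups. When \<open>C\<close> is flat as a left \<open>A\<close>-module, this is exactness in the (then abelian)
  category of comodules. That is the case if \<open>C\<close> is flat over its dual ring and the dual ring is
  flat as a left \<open>A\<close>-module, since \<open>a \<mapsto> a \<epsilon>\<close> is a ring homomorphism that induces the
  left \<open>A\<close>-actions on both.
\<close>

definition short_exact :: "('m, 'x) ring_scheme \<Rightarrow> ('n, 'y) ring_scheme \<Rightarrow> ('p, 'z) ring_scheme
    \<Rightarrow> ('m \<Rightarrow> 'n) \<Rightarrow> ('n \<Rightarrow> 'p) \<Rightarrow> bool"
  where "short_exact X Y Z f g \<longleftrightarrow>
    additive_map X Y f \<and> additive_map Y Z g \<and> inj_on f (carrier X) \<and>
    f ` carrier X = {y \<in> carrier Y. g y = \<zero>\<^bsub>Z\<^esub>} \<and> g ` carrier Y = carrier Z"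

definition coflat ::
  "'u itself \<Rightarrow> 'a ring \<Rightarrow> ('a, 'c) coring \<Rightarrow> ('a, 'c, 'n, 's) lcomod \<Rightarrow> bool"
  where "coflat u A C N \<longleftrightarrow> flat u A N \<and>
    (\<forall>(X :: ('a, 'c, 'u) rcomod) (Y :: ('a, 'c, 'u) rcomod) (Z :: ('a, 'c, 'u) rcomod) f g.
       right_comodule A C X \<and> right_comodule A C Y \<and> right_comodule A C Z \<and>
       f \<in> comodule_hom A C X Y \<and> g \<in> comodule_hom A C Y Z \<and> short_exact X Y Z f g \<longrightarrow>
       short_exact (cotensor A C X N) (cotensor A C Y N) (cotensor A C Z N)
         (tensor_map A X N Y N f id) (tensor_map A Y N Z N g id))"


section \<open>The dual ring\<close>

text \<open>\<open>f \<cdot> c = f(c\<^sub>1) c\<^sub>2\<close>\<close>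

definition dual_act :: "'a ring \<Rightarrow> ('a, 'c) coring \<Rightarrow> ('c \<Rightarrow> 'a) \<Rightarrow> 'c \<Rightarrow> 'c"
  where "dual_act A C f c = tensor_lift A C C C (\<lambda>x y. f x \<triangleright>\<^bsub>C\<^esub> y) (comult C c)"

definition dual_ring :: "'a ring \<Rightarrow> ('a, 'c) coring \<Rightarrow> ('c \<Rightarrow> 'a) ring"
  where "dual_ring A C = \<lparr>carrier = right_hom A C (regular A),
    monoid.mult = (\<lambda>f g. \<lambda>c\<in>carrier C. f (dual_act A C g c)),
    one = (\<lambda>c\<in>carrier C. counit C c),
    ring.zero = (\<lambda>c\<in>carrier C. \<zero>\<^bsub>A\<^esub>),
    ring.add = (\<lambda>f g. \<lambda>c\<in>carrier C. f c \<oplus>\<^bsub>A\<^esub> g c)\<rparr>"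

text \<open>The coring as a bimodule with its dual ring acting on the left.\<close>

definition over_dual :: "'a ring \<Rightarrow> ('a, 'c) coring \<Rightarrow> ('c \<Rightarrow> 'a, 'c, 'a) bimod"
  where "over_dual A C = with_actions C (dual_act A C) (ract C)"

text \<open>The dual ring as a bimodule, with \<open>A\<close> acting on the left by \<open>(a f)(c) = a f(c)\<close> and the
  dual ring itself on the right.\<close>

definition dual_bimodule :: "'a ring \<Rightarrow> ('a, 'c) coring \<Rightarrow> ('a, 'c \<Rightarrow> 'a, 'c \<Rightarrow> 'a) bimod"
  where "dual_bimodule A C =
    with_actions (dual_ring A C)
      (\<lambda>a f. \<lambda>c\<in>carrier C. a \<otimes>\<^bsub>A\<^esub> f c) (monoid.mult (dual_ring A C))"

definition dual_basis ::
  "'a ring \<Rightarrow> ('a, 'c) coring \<Rightarrow> nat \<times> (nat \<Rightarrow> 'c) \<times> (nat \<Rightarrow> 'c \<Rightarrow> 'a) \<Rightarrow> bool"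
  where "dual_basis A C = (\<lambda>(n, e, f).
    e \<in> {..<n} \<rightarrow> carrier C \<and> f \<in> {..<n} \<rightarrow> carrier (dual_ring A C) \<and>
    (\<forall>c\<in>carrier C. c = (\<Oplus>\<^bsub>C\<^esub>i\<in>{..<n}. e i \<triangleleft>\<^bsub>C\<^esub> f i c)))"

text \<open>The dual as a left comodule. A finitely generated projective \<open>C\<close> has a dual basis, and the
  coaction does not depend on which one is chosen.\<close>

definition dual_comodule ::
  "'a ring \<Rightarrow> ('a, 'c) coring \<Rightarrow> ('a, 'c, 'c \<Rightarrow> 'a, 'c \<Rightarrow> 'a) lcomod"
  where "dual_comodule A C =
    (let D = dual_bimodule A C; (n, e, f) = (SOME b. dual_basis A C b)
     in bimod.extend D (lcomod.fields
          (\<lambda>h. \<Oplus>\<^bsub>tensor A C D\<^esub>i\<in>{..<n}. tens A C D (dual_act A C h (e i)) (f i))))"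


section \<open>The adjoint pair\<close>

definition F_obj :: "'a ring \<Rightarrow> ('a, 'c) coring \<Rightarrow> (unit, 'n, 'c \<Rightarrow> 'a) bimod
    \<Rightarrow> ('a, 'c, ('n, 'c) tens) rcomod"
  where "F_obj A C N =
    (let D = dual_ring A C; C' = over_dual A C; T = tensor D N C'; TC = tensor_group A T C
     in bimod.extend T (rcomod.fields (tensor_lift D N C' TC
          (\<lambda>n c. tensor_lift A C C TC (\<lambda>x y. tens A T C (tens D N C' n x) y) (comult C c)))))"

definition F_map :: "'a ring \<Rightarrow> ('a, 'c) coring
    \<Rightarrow> (unit, 'n, 'c \<Rightarrow> 'a) bimod \<Rightarrow> (unit, 'm, 'c \<Rightarrow> 'a) bimod
    \<Rightarrow> ('n \<Rightarrow> 'm) \<Rightarrow> ('n, 'c) tens \<Rightarrow> ('m, 'c) tens"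
  where "F_map A C N N' f =
    tensor_map (dual_ring A C) N (over_dual A C) N' (over_dual A C) f id"

definition G_obj :: "'a ring \<Rightarrow> ('a, 'c) coring \<Rightarrow> ('a, 'c, 'm) rcomod
    \<Rightarrow> (unit, 'c \<Rightarrow> 'm, 'c \<Rightarrow> 'a) bimod"
  where "G_obj A C M = \<lparr>carrier = comodule_hom A C (self_comodule C) M,
    monoid.mult = undefined, one = undefined,
    ring.zero = (\<lambda>c\<in>carrier C. \<zero>\<^bsub>M\<^esub>),
    ring.add = (\<lambda>p q. \<lambda>c\<in>carrier C. p c \<oplus>\<^bsub>M\<^esub> q c),
    lact = (\<lambda>_ p. p),
    ract = (\<lambda>p f. \<lambda>c\<in>carrier C. p (dual_act A C f c))\<rparr>"

definition G_map :: "'a ring \<Rightarrow> ('a, 'c) coring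
    \<Rightarrow> ('a, 'c, 'm) rcomod \<Rightarrow> ('m \<Rightarrow> 'n) \<Rightarrow> ('c \<Rightarrow> 'm) \<Rightarrow> ('c \<Rightarrow> 'n)"
  where "G_map A C M g = (\<lambda>p\<in>carrier (G_obj A C M). compose (carrier C) g p)"

definition FG_unit :: "'a ring \<Rightarrow> ('a, 'c) coring \<Rightarrow> (unit, 'n, 'c \<Rightarrow> 'a) bimod
    \<Rightarrow> 'n \<Rightarrow> 'c \<Rightarrow> ('n, 'c) tens"
  where "FG_unit A C N =
    (\<lambda>n\<in>carrier N. \<lambda>c\<in>carrier C. tens (dual_ring A C) N (over_dual A C) n c)"

definition FG_counit :: "'a ring \<Rightarrow> ('a, 'c) coring \<Rightarrow> ('a, 'c, 'm) rcomod
    \<Rightarrow> ('c \<Rightarrow> 'm, 'c) tens \<Rightarrow> 'm"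
  where "FG_counit A C M =
    tensor_lift (dual_ring A C) (G_obj A C M) (over_dual A C) M (\<lambda>p c. p c)"

text \<open>Restricted to modules and comodules with elements in \<open>'u\<close>, \<open>F\<close> and \<open>G\<close> are functors, and
  \<open>FG_unit\<close> and \<open>FG_counit\<close> are natural and satisfy the triangle identities.\<close>

definition adjoint_pair :: "'u itself \<Rightarrow> 'a ring \<Rightarrow> ('a, 'c) coring \<Rightarrow> bool"
  where "adjoint_pair _ A C \<longleftrightarrow>
    (let D = dual_ring A C;
         is_mod = (\<lambda>N :: (unit, 'u, 'c \<Rightarrow> 'a) bimod. right_module D N);
         is_comod = (\<lambda>M :: ('a, 'c, 'u) rcomod. right_comodule A C M)
     in (\<forall>N. is_mod N \<longrightarrow> right_comodule A C (F_obj A C N)) \<and>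
        (\<forall>M. is_comod M \<longrightarrow> right_module D (G_obj A C M)) \<and>
        (\<forall>N N' f. is_mod N \<and> is_mod N' \<and> f \<in> right_hom D N N' \<longrightarrow>
           F_map A C N N' f \<in> comodule_hom A C (F_obj A C N) (F_obj A C N')) \<and>
        (\<forall>M M' g. is_comod M \<and> is_comod M' \<and> g \<in> comodule_hom A C M M' \<longrightarrow>
           G_map A C M g \<in> right_hom D (G_obj A C M) (G_obj A C M')) \<and>
        (\<forall>N. is_mod N \<longrightarrow>
           F_map A C N N (\<lambda>n\<in>carrier N. n) = (\<lambda>t\<in>carrier (F_obj A C N). t)) \<and>
        (\<forall>M. is_comod M \<longrightarrow>
           G_map A C M (\<lambda>m\<in>carrier M. m) = (\<lambda>p\<in>carrier (G_obj A C M). p)) \<and>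
        (\<forall>N N' N'' f f'. is_mod N \<and> is_mod N' \<and> is_mod N'' \<and>
           f \<in> right_hom D N N' \<and> f' \<in> right_hom D N' N'' \<longrightarrow>
           F_map A C N N'' (compose (carrier N) f' f) =
           compose (carrier (F_obj A C N)) (F_map A C N' N'' f') (F_map A C N N' f)) \<and>
        (\<forall>M M' M'' g g'. is_comod M \<and> is_comod M' \<and> is_comod M'' \<and>
           g \<in> comodule_hom A C M M' \<and> g' \<in> comodule_hom A C M' M'' \<longrightarrow>
           G_map A C M (compose (carrier M) g' g) =
           compose (carrier (G_obj A C M)) (G_map A C M' g') (G_map A C M g)) \<and>
        (\<forall>N. is_mod N \<longrightarrow> FG_unit A C N \<in> right_hom D N (G_obj A C (F_obj A C N))) \<and>
        (\<forall>M. is_comod M \<longrightarrow> FG_counit A C M \<in> comodule_hom A C (F_obj A C (G_obj A C M)) M) \<and>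
        (\<forall>N N' f. is_mod N \<and> is_mod N' \<and> f \<in> right_hom D N N' \<longrightarrow>
           (\<forall>n\<in>carrier N. FG_unit A C N' (f n) =
              G_map A C (F_obj A C N) (F_map A C N N' f) (FG_unit A C N n))) \<and>
        (\<forall>M M' g. is_comod M \<and> is_comod M' \<and> g \<in> comodule_hom A C M M' \<longrightarrow>
           (\<forall>t\<in>carrier (F_obj A C (G_obj A C M)). g (FG_counit A C M t) =
              FG_counit A C M' (F_map A C (G_obj A C M) (G_obj A C M') (G_map A C M g) t))) \<and>
        (\<forall>N. is_mod N \<longrightarrow> (\<forall>t\<in>carrier (F_obj A C N).
           FG_counit A C (F_obj A C N)
             (F_map A C N (G_obj A C (F_obj A C N)) (FG_unit A C N) t) = t)) \<and>
        (\<forall>M. is_comod M \<longrightarrow> (\<forall>p\<in>carrier (G_obj A C M).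
           G_map A C (F_obj A C (G_obj A C M)) (FG_counit A C M)
             (FG_unit A C (G_obj A C M) p) = p)))"

definition mutually_inverse :: "'m set \<Rightarrow> 'n set \<Rightarrow> ('m \<Rightarrow> 'n) \<Rightarrow> ('n \<Rightarrow> 'm) \<Rightarrow> bool"
  where "mutually_inverse X Y f g \<longleftrightarrow> (\<forall>x\<in>X. g (f x) = x) \<and> (\<forall>y\<in>Y. f (g y) = y)"

definition module_iso :: "('r, 'x) ring_scheme \<Rightarrow> ('l, 'm, 'r, 'y) bimod_scheme
    \<Rightarrow> ('k, 'n, 'r, 'z) bimod_scheme \<Rightarrow> ('m \<Rightarrow> 'n) \<Rightarrow> bool"
  where "module_iso R M N f \<longleftrightarrow> f \<in> right_hom R M N \<and>
    (\<exists>g\<in>right_hom R N M. mutually_inverse (carrier M) (carrier N) f g)"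

definition comodule_iso :: "'a ring \<Rightarrow> ('a, 'c) coring
    \<Rightarrow> ('a, 'c, 'm) rcomod \<Rightarrow> ('a, 'c, 'n) rcomod \<Rightarrow> ('m \<Rightarrow> 'n) \<Rightarrow> bool"
  where "comodule_iso A C M N f \<longleftrightarrow> f \<in> comodule_hom A C M N \<and>
    (\<exists>g\<in>comodule_hom A C N M. mutually_inverse (carrier M) (carrier N) f g)"

definition inverse_equivalences :: "'u itself \<Rightarrow> 'a ring \<Rightarrow> ('a, 'c) coring \<Rightarrow> bool"
  where "inverse_equivalences u A C \<longleftrightarrow> adjoint_pair u A C \<and>
    (\<forall>N :: (unit, 'u, 'c \<Rightarrow> 'a) bimod. right_module (dual_ring A C) N \<longrightarrow>
       module_iso (dual_ring A C) N (G_obj A C (F_obj A C N)) (FG_unit A C N)) \<and>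
    (\<forall>M :: ('a, 'c, 'u) rcomod. right_comodule A C M \<longrightarrow>
       comodule_iso A C (F_obj A C (G_obj A C M)) M (FG_counit A C M))"

text \<open>The canonical map \<open>m \<otimes> f \<mapsto> (c \<mapsto> m f(c))\<close> from the cotensor product of \<open>M\<close> and
  the dual of \<open>C\<close> to \<open>G(M)\<close>.\<close>

definition cotensor_to_hom :: "'a ring \<Rightarrow> ('a, 'c) coring \<Rightarrow> ('a, 'c, 'm) rcomod
    \<Rightarrow> ('m, 'c \<Rightarrow> 'a) tens \<Rightarrow> 'c \<Rightarrow> 'm"
  where "cotensor_to_hom A C M =
    (\<lambda>t\<in>carrier (cotensor A C M (dual_comodule A C)). \<lambda>c\<in>carrier C.
       tensor_lift A M (dual_comodule A C) M (\<lambda>m f. m \<triangleleft>\<^bsub>M\<^esub> f c) t)"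

text \<open>
  The universe: an infinite type into which the elements of \<open>A\<close> and \<open>C\<close> embed, and, as \<open>'x\<close> is
  arbitrary, one that can be made to contain any given set. Up to isomorphism it contains the
  modules of cardinality at most that of the type; these include \<open>A\<close>, \<open>C\<close>, all finitely generated
  modules over \<open>A\<close> and over the dual of a finitely generated \<open>C\<close>, and they are closed under
  submodules, quotients and tensor products, so that \<open>F\<close> and \<open>G\<close> do not leave it (up to
  isomorphism) and \<open>projective\<close>, \<open>flat\<close> and \<open>coflat\<close> do not depend on \<open>'x\<close>.
\<close>

type_synonym ('a, 'c, 'x) univ = "('a + 'c + 'x) list"

end

theory Submission
  imports Defs
begin

text \<open>Write \<open>D\<close> for the dual ring \<open>C\<^sup>*\<close>, let \<open>e\<^sub>i, f\<^sub>i\<close> be a dual basis of \<open>C\<close>, and write \<open>H(M)\<close> for the right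
  \<open>D\<close>-module \<open>Hom\<^sub>A(C, M)\<close>, where \<open>M\<close> is a right \<open>A\<close>-module. If \<open>M\<close> is a comodule then \<open>G(M)\<close> is a
  submodule of \<open>H(M)\<close>, the equaliser of \<open>p \<mapsto> \<rho>\<^sub>M p\<close> and \<open>p \<mapsto> (p \<otimes> C) \<Delta>\<close>.

  The counit. The dual basis shows that \<open>\<Phi>\<^sub>M : H(M) \<otimes>\<^sub>D C \<rightarrow> M \<otimes>\<^sub>A C\<close>, \<open>p \<otimes> c \<mapsto> p(c\<^sub>1) \<otimes> c\<^sub>2\<close>, is
  bijective for every \<open>M\<close>; this is \<open>M \<otimes>\<^sub>A D \<otimes>\<^sub>D C = M \<otimes>\<^sub>A C\<close>. As \<open>C\<close> is flat over \<open>D\<close>, the functor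
  \<open>- \<otimes>\<^sub>D C\<close> preserves the equaliser \<open>G(M)\<close>. Under \<open>\<Phi>\<close> the result is the equaliser of \<open>\<rho>\<^sub>M \<otimes> C\<close>
  and \<open>M \<otimes> \<Delta>\<close>, which is the image of \<open>\<rho>\<^sub>M\<close>, and the counit becomes the inverse of \<open>\<rho>\<^sub>M\<close> on
  that image (\<open>FG_counit_bij\<close>).

  The unit. It is bijective on the modules \<open>H(M)\<close>, because \<open>F(H(M))\<close> is the cofree comodule
  \<open>M \<otimes>\<^sub>A C\<close>. Every right \<open>D\<close>-module \<open>N\<close>, seen as an \<open>A\<close>-module through \<open>a \<mapsto> a \<epsilon>\<close>, is a
  quotient of \<open>N \<otimes>\<^sub>A D = H(N)\<close>; let \<open>K\<close> be the kernel. The sequence \<open>0 \<rightarrow> F(K) \<rightarrow> F(H(N)) \<rightarrow> F(N) \<rightarrow> 0\<close> is exact by flatness, and \<open>G\<close> preserves its exactness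
  because \<open>G(M)\<close> is the cotensor product of \<open>M\<close> with the coflat comodule \<open>C\<^sup>*\<close>: both are cut out
  of \<open>M \<otimes>\<^sub>A C\<^sup>* = H(M)\<close> by the same condition (\<open>cotensor_iff\<close>). Comparison with the sequence
  \<open>0 \<rightarrow> K \<rightarrow> H(N) \<rightarrow> N \<rightarrow> 0\<close> shows that the unit is surjective at every \<open>N\<close>, hence also at \<open>K\<close>, and
  then that it is injective at \<open>N\<close> (\<open>FG_unit_bij\<close>).

  Flatness and coflatness are assumed only for modules whose elements have one fixed type. All
  modules above have carriers that embed into it: \<open>H(M)\<close> because its elements are determined by
  their values at the finitely many \<open>e\<^sub>i\<close>, and tensor products because their elements are sums of
  lists of pure tensors. Their structures are transported along such embeddings (\<open>flat_inj\<close>,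
  \<open>G_lift\<close>, \<open>G_kernel\<close>).

  Maps on tensor products are compared on pure tensors throughout (\<open>additive_map_tensor_eqI\<close>).
  This takes the place of calculations with representatives \<open>c\<^sub>1 \<otimes> c\<^sub>2\<close> of \<open>\<Delta>(c)\<close>.\<close>

section \<open>Additive maps\<close>

lemma additive_map_iff:
  "additive_map M N f \<longleftrightarrow> (\<forall>x\<in>carrier M. f x \<in> carrier N) \<and>
     (\<forall>x\<in>carrier M. \<forall>y\<in>carrier M. f (x \<oplus>\<^bsub>M\<^esub> y) = f x \<oplus>\<^bsub>N\<^esub> f y)"
  by (auto simp: additive_map_def hom_def)

lemma additive_mapI [intro?]:
  assumes "\<And>x. x \<in> carrier M \<Longrightarrow> f x \<in> carrier N"
    and "\<And>x y. x \<in> carrier M \<Longrightarrow> y \<in> carrier M \<Longrightarrow> f (x \<oplus>\<^bsub>M\<^esub> y) = f x \<oplus>\<^bsub>N\<^esub> f y"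
  shows "additive_map M N f"
  using assms by (auto simp: additive_map_iff)

lemma additive_map_closed: "additive_map M N f \<Longrightarrow> x \<in> carrier M \<Longrightarrow> f x \<in> carrier N"
  and additive_map_add: "additive_map M N f \<Longrightarrow> x \<in> carrier M \<Longrightarrow> y \<in> carrier M \<Longrightarrow>
    f (x \<oplus>\<^bsub>M\<^esub> y) = f x \<oplus>\<^bsub>N\<^esub> f y"
  by (auto simp: additive_map_iff)

lemma additive_map_comp:
  assumes "additive_map M N f" "additive_map N G g"
  shows "additive_map M G (\<lambda>x. g (f x))"
  using assms by (simp add: additive_map_iff)

lemma additive_map_id: "additive_map M M (\<lambda>x. x)"
  by (simp add: additive_map_iff)

lemma additive_map_cong:
  assumes "\<And>x. x \<in> carrier M \<Longrightarrow> f x = g x" and "abelian_group M"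
  shows "additive_map M N f \<longleftrightarrow> additive_map M N g"
proof -
  interpret M: abelian_group M by fact
  show ?thesis using assms(1) by (simp add: additive_map_iff)
qed

lemma additive_map_group_hom:
  assumes "abelian_group M" "abelian_group N" "additive_map M N f"
  shows "abelian_group_hom M N f"
proof -
  interpret M: abelian_group M by fact
  interpret N: abelian_group N by fact
  show ?thesis
    by (intro abelian_group_homI abelian_group.a_group assms group_hom.intro)
      (use assms in \<open>auto simp: group_hom_axioms_def additive_map_def M.a_group N.a_group\<close>)
qed

lemma additive_map_zero:
  assumes "abelian_group M" "abelian_group N" "additive_map M N f"
  shows "f \<zero>\<^bsub>M\<^esub> = \<zero>\<^bsub>N\<^esub>"
  using abelian_group_hom.hom_zero[OF additive_map_group_hom[OF assms]] .

lemma additive_map_neg: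
  assumes "abelian_group M" "abelian_group N" "additive_map M N f" "x \<in> carrier M"
  shows "f (\<ominus>\<^bsub>M\<^esub> x) = \<ominus>\<^bsub>N\<^esub> f x"
  using abelian_group_hom.hom_a_inv[OF additive_map_group_hom[OF assms(1-3)] assms(4)] .

lemma additive_map_finsum:
  assumes "abelian_group M" "abelian_group N" "additive_map M N f"
    and "finite I" "x \<in> I \<rightarrow> carrier M"
  shows "f (\<Oplus>\<^bsub>M\<^esub>i\<in>I. x i) = (\<Oplus>\<^bsub>N\<^esub>i\<in>I. f (x i))"
proof -
  interpret M: abelian_group M by fact
  interpret N: abelian_group N by fact
  from assms(4,5) show ?thesis
  proof (induction I rule: finite_induct)
    case empty
    then show ?case by (simp add: additive_map_zero[OF assms(1-3)])
  next
    case (insert i I)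
    then have "x \<in> I \<rightarrow> carrier M" "x i \<in> carrier M"
      "(\<lambda>i. f (x i)) \<in> I \<rightarrow> carrier N" "f (x i) \<in> carrier N"
      using assms(3) by (auto simp: additive_map_iff)
    then show ?case using insert additive_map_add[OF assms(3)] by simp
  qed
qed

lemma additive_map_finsum_pointwise:
  assumes "abelian_group M" "abelian_group N" "finite I"
    and "\<And>i. i \<in> I \<Longrightarrow> additive_map M N (f i)"
  shows "additive_map M N (\<lambda>x. \<Oplus>\<^bsub>N\<^esub>i\<in>I. f i x)"
proof -
  interpret M: abelian_group M by fact
  interpret N: abelian_group N by fact
  have cl: "(\<lambda>i. f i x) \<in> I \<rightarrow> carrier N" if "x \<in> carrier M" for x
    using assms(4) that by (auto simp: additive_map_iff)
  show ?thesis
  proof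
    fix x assume "x \<in> carrier M"
    then show "(\<Oplus>\<^bsub>N\<^esub>i\<in>I. f i x) \<in> carrier N" using cl by simp
  next
    fix x y assume xy: "x \<in> carrier M" "y \<in> carrier M"
    have "(\<Oplus>\<^bsub>N\<^esub>i\<in>I. f i (x \<oplus>\<^bsub>M\<^esub> y)) = (\<Oplus>\<^bsub>N\<^esub>i\<in>I. f i x \<oplus>\<^bsub>N\<^esub> f i y)"
      using assms(4) xy cl
      by (intro N.finsum_cong') (auto simp: additive_map_iff)
    also have "\<dots> = (\<Oplus>\<^bsub>N\<^esub>i\<in>I. f i x) \<oplus>\<^bsub>N\<^esub> (\<Oplus>\<^bsub>N\<^esub>i\<in>I. f i y)"
      using cl xy by (simp add: N.finsum_addf)
    finally show "(\<Oplus>\<^bsub>N\<^esub>i\<in>I. f i (x \<oplus>\<^bsub>M\<^esub> y)) = (\<Oplus>\<^bsub>N\<^esub>i\<in>I. f i x) \<oplus>\<^bsub>N\<^esub> (\<Oplus>\<^bsub>N\<^esub>i\<in>I. f i y)" .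
  qed
qed


section \<open>The universal property of tensor products\<close>

lemma left_module_abelian: "left_module R M \<Longrightarrow> abelian_group M"
  by (rule left_module.axioms(2))

lemma right_module_abelian: "right_module R M \<Longrightarrow> abelian_group M"
  by (rule right_module.axioms(2))

text \<open>The maps \<open>M \<times> N \<rightarrow> G\<close> that factor through \<open>M \<otimes>\<^sub>R N\<close>.\<close>

definition balanced where
  "balanced R M N G b \<longleftrightarrow>
    (\<forall>x\<in>carrier M. \<forall>y\<in>carrier N. b x y \<in> carrier G) \<and>
    (\<forall>x\<in>carrier M. \<forall>x'\<in>carrier M. \<forall>y\<in>carrier N. b (x \<oplus>\<^bsub>M\<^esub> x') y = b x y \<oplus>\<^bsub>G\<^esub> b x' y) \<and>
    (\<forall>x\<in>carrier M. \<forall>y\<in>carrier N. \<forall>y'\<in>carrier N. b x (y \<oplus>\<^bsub>N\<^esub> y') = b x y \<oplus>\<^bsub>G\<^esub> b x y') \<and>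
    (\<forall>x\<in>carrier M. \<forall>r\<in>carrier R. \<forall>y\<in>carrier N. b (x \<triangleleft>\<^bsub>M\<^esub> r) y = b x (r \<triangleright>\<^bsub>N\<^esub> y))"

lemma balancedI:
  assumes "\<And>x y. x \<in> carrier M \<Longrightarrow> y \<in> carrier N \<Longrightarrow> b x y \<in> carrier G"
    and "\<And>x x' y. x \<in> carrier M \<Longrightarrow> x' \<in> carrier M \<Longrightarrow> y \<in> carrier N \<Longrightarrow>
      b (x \<oplus>\<^bsub>M\<^esub> x') y = b x y \<oplus>\<^bsub>G\<^esub> b x' y"
    and "\<And>x y y'. x \<in> carrier M \<Longrightarrow> y \<in> carrier N \<Longrightarrow> y' \<in> carrier N \<Longrightarrow>
      b x (y \<oplus>\<^bsub>N\<^esub> y') = b x y \<oplus>\<^bsub>G\<^esub> b x y'"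
    and "\<And>x r y. x \<in> carrier M \<Longrightarrow> r \<in> carrier R \<Longrightarrow> y \<in> carrier N \<Longrightarrow>
      b (x \<triangleleft>\<^bsub>M\<^esub> r) y = b x (r \<triangleright>\<^bsub>N\<^esub> y)"
  shows "balanced R M N G b"
  using assms unfolding balanced_def by auto

definition tensor_relators where
  "tensor_relators R M N =
     {frag_of (x \<oplus>\<^bsub>M\<^esub> x', y) - frag_of (x, y) - frag_of (x', y) |x x' y.
         x \<in> carrier M \<and> x' \<in> carrier M \<and> y \<in> carrier N} \<union>
     {frag_of (x, y \<oplus>\<^bsub>N\<^esub> y') - frag_of (x, y) - frag_of (x, y') |x y y'.
         x \<in> carrier M \<and> y \<in> carrier N \<and> y' \<in> carrier N} \<union>
     {frag_of (x \<triangleleft>\<^bsub>M\<^esub> r, y) - frag_of (x, r \<triangleright>\<^bsub>N\<^esub> y) |x r y.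
         x \<in> carrier M \<and> r \<in> carrier R \<and> y \<in> carrier N}"

lemma tensor_relations_eq:
  "tensor_relations R M N = generate (free_Abelian_group (carrier M \<times> carrier N)) (tensor_relators R M N)"
  by (simp add: tensor_relations_def tensor_relators_def)

lemma tensor_group_simps:
  "carrier (tensor_group R M N) =
     carrier (free_Abelian_group (carrier M \<times> carrier N) Mod tensor_relations R M N)"
  "\<zero>\<^bsub>tensor_group R M N\<^esub> = tensor_relations R M N"
  "s \<oplus>\<^bsub>tensor_group R M N\<^esub> t = s <#>\<^bsub>free_Abelian_group (carrier M \<times> carrier N)\<^esub> t"
  by (simp_all add: tensor_group_def Let_def)

lemma add_monoid_tensor_group:
  "add_monoid (tensor_group R M N) =
    free_Abelian_group (carrier M \<times> carrier N) Mod tensor_relations R M N"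
  by (simp add: tensor_group_def Let_def)

lemma r_coset_eqI:
  assumes "subgroup H G" "group G" "x \<in> carrier G" "y \<in> carrier G" "h \<in> H" "y = h \<otimes>\<^bsub>G\<^esub> x"
  shows "H #>\<^bsub>G\<^esub> x = H #>\<^bsub>G\<^esub> y"
  by (rule group.repr_independence[OF assms(2)]) (use assms in \<open>auto simp: r_coset_def\<close>)

context
  fixes R :: "('r, 'x) ring_scheme" and M :: "('l, 'm, 'r, 'y) bimod_scheme"
    and N :: "('r, 'n, 's, 'z) bimod_scheme"
  assumes M: "right_module R M" and N: "left_module R N"
begin

interpretation M: right_module R M by (fact M)
interpretation N: left_module R N by (fact N)

private abbreviation (input) "F \<equiv> free_Abelian_group (carrier M \<times> carrier N)"
private abbreviation (input) "K \<equiv> tensor_relations R M N"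
private abbreviation (input) "T \<equiv> tensor_group R M N"

interpretation F: comm_group F by (rule abelian_free_Abelian_group)

private lemma relators_subset: "tensor_relators R M N \<subseteq> carrier F"
proof -
  have diff: "a - b \<in> carrier F" if "a \<in> carrier F" "b \<in> carrier F" for a b
    using that keys_diff[of a b] by auto
  show ?thesis
    unfolding tensor_relators_def
    by (auto simp del: carrier_free_Abelian_group_iff
        intro!: diff simp: M.ract_closed N.lact_closed)
qed

private lemma K_subgroup: "subgroup K F"
  unfolding tensor_relations_eq by (rule F.generate_is_subgroup[OF relators_subset])

private lemma K_normal: "K \<lhd> F"
  using K_subgroup F.normal_iff_subgroup by blast

lemma tensor_abelian_group: "abelian_group (tensor_group R M N)"
proof -
  have "comm_group (F Mod K)"
    using F.abelian_FactGroup[OF K_subgroup] .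
  then show ?thesis
    unfolding abelian_group_def abelian_monoid_def abelian_group_axioms_def
      add_monoid_tensor_group by (blast intro: comm_group.axioms)
qed

interpretation T: abelian_group T by (rule tensor_abelian_group)

lemma tens_closed: "x \<in> carrier M \<Longrightarrow> y \<in> carrier N \<Longrightarrow> tens R M N x y \<in> carrier (tensor_group R M N)"
  by (auto simp: tensor_group_simps tens_def carrier_FactGroup)

private lemma coset_add: "a \<in> carrier F \<Longrightarrow> b \<in> carrier F \<Longrightarrow>
    (K #>\<^bsub>F\<^esub> a) \<oplus>\<^bsub>T\<^esub> (K #>\<^bsub>F\<^esub> b) = K #>\<^bsub>F\<^esub> (a + b)"
  using normal.rcos_sum[OF K_normal] by (simp add: tensor_group_simps)

private lemma coset_eq: "a \<in> carrier F \<Longrightarrow> b \<in> carrier F \<Longrightarrow> b - a \<in> K \<Longrightarrow> K #>\<^bsub>F\<^esub> a = K #>\<^bsub>F\<^esub> b"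
  by (rule r_coset_eqI[OF K_subgroup]) auto

private lemma relator: "k \<in> tensor_relators R M N \<Longrightarrow> k \<in> K"
  unfolding tensor_relations_eq by (rule generate.incl)

private lemma coset_sum: "frag_of p - frag_of q - frag_of r \<in> K \<Longrightarrow> p \<in> carrier M \<times> carrier N \<Longrightarrow>
    q \<in> carrier M \<times> carrier N \<Longrightarrow> r \<in> carrier M \<times> carrier N \<Longrightarrow>
    K #>\<^bsub>F\<^esub> frag_of p = (K #>\<^bsub>F\<^esub> frag_of q) \<oplus>\<^bsub>T\<^esub> (K #>\<^bsub>F\<^esub> frag_of r)"
proof -
  assume *: "frag_of p - frag_of q - frag_of r \<in> K" "p \<in> carrier M \<times> carrier N"
    "q \<in> carrier M \<times> carrier N" "r \<in> carrier M \<times> carrier N"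
  have "frag_of q \<otimes>\<^bsub>F\<^esub> frag_of r \<in> carrier F"
    using * by (intro F.m_closed) auto
  then have "frag_of q + frag_of r \<in> carrier F" by simp
  then have "K #>\<^bsub>F\<^esub> (frag_of q + frag_of r) = K #>\<^bsub>F\<^esub> frag_of p"
    using * by (intro coset_eq) (auto simp: algebra_simps)
  then show ?thesis using * by (simp add: coset_add)
qed

lemma tens_add_left:
  assumes "x \<in> carrier M" "x' \<in> carrier M" "y \<in> carrier N"
  shows "tens R M N (x \<oplus>\<^bsub>M\<^esub> x') y = tens R M N x y \<oplus>\<^bsub>tensor_group R M N\<^esub> tens R M N x' y"
  unfolding tens_def
  by (rule coset_sum, rule relator) (use assms in \<open>auto simp: tensor_relators_def\<close>)

lemma tens_add_right:
  assumes "x \<in> carrier M" "y \<in> carrier N" "y' \<in> carrier N"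
  shows "tens R M N x (y \<oplus>\<^bsub>N\<^esub> y') = tens R M N x y \<oplus>\<^bsub>tensor_group R M N\<^esub> tens R M N x y'"
  unfolding tens_def
  by (rule coset_sum, rule relator) (use assms in \<open>auto simp: tensor_relators_def\<close>)

lemma tens_balanced:
  assumes "x \<in> carrier M" "r \<in> carrier R" "y \<in> carrier N"
  shows "tens R M N (x \<triangleleft>\<^bsub>M\<^esub> r) y = tens R M N x (r \<triangleright>\<^bsub>N\<^esub> y)"
  unfolding tens_def
  by (rule sym, rule coset_eq)
    (use assms in \<open>auto simp: tensor_relators_def M.ract_closed N.lact_closed intro!: relator\<close>)

lemma tens_additive_left: "y \<in> carrier N \<Longrightarrow> additive_map M (tensor_group R M N) (\<lambda>x. tens R M N x y)"
  by (simp add: additive_map_iff tens_closed tens_add_left)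

lemma tens_additive_right: "x \<in> carrier M \<Longrightarrow> additive_map N (tensor_group R M N) (tens R M N x)"
  by (simp add: additive_map_iff tens_closed tens_add_right)

private lemma T_minus_induct:
  assumes t: "t \<in> carrier T" and tens: "\<And>x y. x \<in> carrier M \<Longrightarrow> y \<in> carrier N \<Longrightarrow> P (tens R M N x y)"
    and zero: "P \<zero>\<^bsub>T\<^esub>"
    and diff: "\<And>s t. s \<in> carrier T \<Longrightarrow> t \<in> carrier T \<Longrightarrow> P s \<Longrightarrow> P t \<Longrightarrow> P (s \<oplus>\<^bsub>T\<^esub> \<ominus>\<^bsub>T\<^esub> t)"
  shows "P t"
proof -
  from t obtain a where a: "a \<in> carrier F" "t = K #>\<^bsub>F\<^esub> a"
    by (auto simp: tensor_group_simps carrier_FactGroup)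
  have "P (K #>\<^bsub>F\<^esub> a)"
  proof (rule free_Abelian_group_induct[of a "carrier M \<times> carrier N"])
    show "Poly_Mapping.keys a \<subseteq> carrier M \<times> carrier N" using a by simp
    have "K #>\<^bsub>F\<^esub> \<one>\<^bsub>F\<^esub> = K" using F.coset_mult_one subgroup.subset[OF K_subgroup] by blast
    then show "P (K #>\<^bsub>F\<^esub> 0)" using zero by (simp add: tensor_group_simps)
  next
    fix p assume "p \<in> carrier M \<times> carrier N"
    then show "P (K #>\<^bsub>F\<^esub> frag_of p)" using tens by (auto simp: tens_def)
  next
    fix b c assume bc: "Poly_Mapping.keys b \<subseteq> carrier M \<times> carrier N"
      "Poly_Mapping.keys c \<subseteq> carrier M \<times> carrier N" "P (K #>\<^bsub>F\<^esub> b)" "P (K #>\<^bsub>F\<^esub> c)"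
    have cl: "K #>\<^bsub>F\<^esub> d \<in> carrier T" if "d \<in> carrier F" for d
      using that by (auto simp: tensor_group_simps carrier_FactGroup)
    have d: "b - c \<in> carrier F" using bc keys_diff[of b c] by auto
    have "(K #>\<^bsub>F\<^esub> (b - c)) \<oplus>\<^bsub>T\<^esub> (K #>\<^bsub>F\<^esub> c) = K #>\<^bsub>F\<^esub> b"
      using coset_add[of "b - c" c] d bc by simp
    then have "K #>\<^bsub>F\<^esub> (b - c) = (K #>\<^bsub>F\<^esub> b) \<oplus>\<^bsub>T\<^esub> \<ominus>\<^bsub>T\<^esub> (K #>\<^bsub>F\<^esub> c)"
      using cl d bc by (metis T.a_assoc T.a_inv_closed T.r_neg T.r_zero carrier_free_Abelian_group_iff)
    then show "P (K #>\<^bsub>F\<^esub> (b - c))"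
      using diff[of "K #>\<^bsub>F\<^esub> b" "K #>\<^bsub>F\<^esub> c"] bc cl by simp
  qed
  then show ?thesis using a by simp
qed

lemma tensor_induct [consumes 1, case_names tens add]:
  assumes t: "t \<in> carrier (tensor_group R M N)"
    and tens: "\<And>x y. x \<in> carrier M \<Longrightarrow> y \<in> carrier N \<Longrightarrow> P (tens R M N x y)"
    and add: "\<And>s t. s \<in> carrier (tensor_group R M N) \<Longrightarrow> t \<in> carrier (tensor_group R M N) \<Longrightarrow>
      P s \<Longrightarrow> P t \<Longrightarrow> P (s \<oplus>\<^bsub>tensor_group R M N\<^esub> t)"
  shows "P t"
proof -
  have neg: "\<ominus>\<^bsub>T\<^esub> tens R M N x y = tens R M N (\<ominus>\<^bsub>M\<^esub> x) y" if "x \<in> carrier M" "y \<in> carrier N" for x y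
    using additive_map_neg[OF right_module_abelian[OF M] T.abelian_group_axioms tens_additive_left] that
    by simp
  \<comment> \<open>Elements are differences, so negatives have to be carried along.\<close>
  have "P t \<and> P (\<ominus>\<^bsub>T\<^esub> t)"
    using t
  proof (rule T_minus_induct)
    show "P (tens R M N x y) \<and> P (\<ominus>\<^bsub>T\<^esub> tens R M N x y)" if "x \<in> carrier M" "y \<in> carrier N" for x y
      using that tens by (simp add: neg)
    have "\<zero>\<^bsub>T\<^esub> = tens R M N \<zero>\<^bsub>M\<^esub> \<zero>\<^bsub>N\<^esub>"
      using additive_map_zero[OF right_module_abelian[OF M] T.abelian_group_axioms
          tens_additive_left[of "\<zero>\<^bsub>N\<^esub>"]] by simp
    then show "P \<zero>\<^bsub>T\<^esub> \<and> P (\<ominus>\<^bsub>T\<^esub> \<zero>\<^bsub>T\<^esub>)"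
      using tens[of "\<zero>\<^bsub>M\<^esub>" "\<zero>\<^bsub>N\<^esub>"] by (metis M.M.zero_closed N.M.zero_closed T.minus_equality T.r_zero T.zero_closed)
  next
    fix s t assume "s \<in> carrier T" "t \<in> carrier T" "P s \<and> P (\<ominus>\<^bsub>T\<^esub> s)" "P t \<and> P (\<ominus>\<^bsub>T\<^esub> t)"
    then show "P (s \<oplus>\<^bsub>T\<^esub> \<ominus>\<^bsub>T\<^esub> t) \<and> P (\<ominus>\<^bsub>T\<^esub> (s \<oplus>\<^bsub>T\<^esub> \<ominus>\<^bsub>T\<^esub> t))"
      by (auto simp: T.minus_add intro!: add)
  qed
  then show ?thesis by blast
qed

text \<open>The uniqueness half of the universal property, and the way in which all identities between
  maps on tensor products are proved. The two maps have to be supplied explicitly: unification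
  against an equation between their values would have too many solutions.\<close>

lemma additive_map_tensor_eqI:
  assumes "additive_map (tensor_group R M N) G f" "additive_map (tensor_group R M N) G g"
    and "\<And>x y. x \<in> carrier M \<Longrightarrow> y \<in> carrier N \<Longrightarrow> f (tens R M N x y) = g (tens R M N x y)"
    and "t \<in> carrier (tensor_group R M N)"
  shows "f t = g t"
  using assms(4) by (induction rule: tensor_induct)
    (simp_all add: assms(3) additive_map_add[OF assms(1)] additive_map_add[OF assms(2)])

context
  fixes G :: "('g, 'w) ring_scheme" and b
  assumes G: "abelian_group G" and b: "balanced R M N G b"
begin

private lemma lift_exists:
  "\<exists>h. h \<in> extensional (carrier T) \<and> additive_map T G h \<and>
       (\<forall>x\<in>carrier M. \<forall>y\<in>carrier N. h (tens R M N x y) = b x y)"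
proof -
  interpret G: abelian_group G by (fact G)
  have "(\<lambda>(x, y). b x y) ` (carrier M \<times> carrier N) \<subseteq> carrier (add_monoid G)"
    using b by (auto simp: balanced_def)
  then obtain h where h: "h \<in> hom F (add_monoid G)"
    "\<And>p. p \<in> carrier M \<times> carrier N \<Longrightarrow> h (frag_of p) = (\<lambda>(x, y). b x y) p"
    using comm_group.free_Abelian_group_universal[OF G.a_comm_group] by metis
  interpret h: group_hom F "add_monoid G" h
    using h(1) by (simp add: group_hom_def group_hom_axioms_def G.a_group)
  have hdiff: "h (u - v) = h u \<ominus>\<^bsub>G\<^esub> h v" if "u \<in> carrier F" "v \<in> carrier F" for u v
  proof -
    have "h (u \<otimes>\<^bsub>F\<^esub> inv\<^bsub>F\<^esub> v) = h u \<oplus>\<^bsub>G\<^esub> \<ominus>\<^bsub>G\<^esub> h v"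
      using that h.hom_mult[of u "inv\<^bsub>F\<^esub> v"] h.hom_inv[of v] F.inv_closed[of v]
      by (simp add: a_inv_def del: inv_free_Abelian_group carrier_free_Abelian_group_iff)
    then show ?thesis using that by (simp add: a_minus_def)
  qed
  have diff: "u - v \<in> carrier F" if "u \<in> carrier F" "v \<in> carrier F" for u v
    using that keys_diff[of u v] by auto
  have sub0: "u \<oplus>\<^bsub>G\<^esub> v \<ominus>\<^bsub>G\<^esub> u \<ominus>\<^bsub>G\<^esub> v = \<zero>\<^bsub>G\<^esub>" if "u \<in> carrier G" "v \<in> carrier G" for u v
    using that G.minus_add[of u v] G.r_neg[of "u \<oplus>\<^bsub>G\<^esub> v"] by (simp add: a_minus_def G.a_assoc)
  have eq: "h k = \<zero>\<^bsub>G\<^esub>" if k: "k = frag_of p - frag_of q - frag_of r" and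
    p: "p \<in> carrier M \<times> carrier N" "q \<in> carrier M \<times> carrier N" "r \<in> carrier M \<times> carrier N"
    and "(\<lambda>(x, y). b x y) p = (\<lambda>(x, y). b x y) q \<oplus>\<^bsub>G\<^esub> (\<lambda>(x, y). b x y) r" for k p q r
  proof -
    have cl: "(\<lambda>(x, y). b x y) p \<in> carrier G" if "p \<in> carrier M \<times> carrier N" for p
      using b that by (auto simp: balanced_def)
    have "h k = h (frag_of p) \<ominus>\<^bsub>G\<^esub> h (frag_of q) \<ominus>\<^bsub>G\<^esub> h (frag_of r)"
      using p unfolding k by (subst hdiff) (auto simp del: carrier_free_Abelian_group_iff
        simp: hdiff frag_of_in_free_Abelian_group intro!: diff)
    also have "\<dots> = \<zero>\<^bsub>G\<^esub>"
      using that(5) cl[OF p(2)] cl[OF p(3)] h(2) p by (simp add: sub0)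
    finally show ?thesis .
  qed
  have eq': "h k = \<zero>\<^bsub>G\<^esub>" if "k \<in> tensor_relators R M N" for k
    using that unfolding tensor_relators_def
  proof (elim UnE CollectE exE conjE)
    fix x x' y assume "k = frag_of (x \<oplus>\<^bsub>M\<^esub> x', y) - frag_of (x, y) - frag_of (x', y)"
      "x \<in> carrier M" "x' \<in> carrier M" "y \<in> carrier N"
    then show ?thesis using b by (intro eq) (auto simp: balanced_def)
  next
    fix x y y' assume "k = frag_of (x, y \<oplus>\<^bsub>N\<^esub> y') - frag_of (x, y) - frag_of (x, y')"
      "x \<in> carrier M" "y \<in> carrier N" "y' \<in> carrier N"
    then show ?thesis using b by (intro eq) (auto simp: balanced_def)
  next
    fix x r y assume *: "k = frag_of (x \<triangleleft>\<^bsub>M\<^esub> r, y) - frag_of (x, r \<triangleright>\<^bsub>N\<^esub> y)"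
      "x \<in> carrier M" "r \<in> carrier R" "y \<in> carrier N"
    have "h k = b (x \<triangleleft>\<^bsub>M\<^esub> r) y \<ominus>\<^bsub>G\<^esub> b x (r \<triangleright>\<^bsub>N\<^esub> y)"
      using * by (simp add: hdiff h(2) M.ract_closed N.lact_closed)
    also have "\<dots> = \<zero>\<^bsub>G\<^esub>"
      using * b by (simp add: balanced_def N.lact_closed G.r_neg a_minus_def)
    finally show ?thesis .
  qed
  have "K \<subseteq> kernel F (add_monoid G) h"
    unfolding tensor_relations_eq
    by (rule F.generate_subgroup_incl[OF _ h.subgroup_kernel])
      (use relators_subset eq' in \<open>auto simp: kernel_def simp del: carrier_free_Abelian_group_iff\<close>)
  then obtain g where g: "g \<in> hom (F Mod K) (add_monoid G)" "\<And>x. x \<in> carrier F \<Longrightarrow> g (K #>\<^bsub>F\<^esub> x) = h x"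
    using h.FactGroup_universal_kernel[OF K_normal] by metis
  have "additive_map T G g" using g(1) unfolding additive_map_def add_monoid_tensor_group .
  then have "additive_map T G (restrict g (carrier T))"
    by (simp add: additive_map_iff)
  moreover have "restrict g (carrier T) (tens R M N x y) = b x y" if "x \<in> carrier M" "y \<in> carrier N" for x y
    using that g(2)[of "frag_of (x, y)"] h(2)[of "(x, y)"] tens_closed[OF that] by (simp add: tens_def)
  ultimately show ?thesis
    by (intro exI[of _ "restrict g (carrier T)"]) auto
qed

private lemma lift_unique:
  "\<exists>!h. h \<in> extensional (carrier T) \<and> additive_map T G h \<and>
       (\<forall>x\<in>carrier M. \<forall>y\<in>carrier N. h (tens R M N x y) = b x y)"
proof (rule ex_ex1I[OF lift_exists], elim conjE)
  fix h g assume *: "h \<in> extensional (carrier T)" "g \<in> extensional (carrier T)"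
    "additive_map T G h" "additive_map T G g"
    "\<forall>x\<in>carrier M. \<forall>y\<in>carrier N. h (tens R M N x y) = b x y"
    "\<forall>x\<in>carrier M. \<forall>y\<in>carrier N. g (tens R M N x y) = b x y"
  show "h = g"
    by (rule extensionalityI[OF *(1,2)]) (rule additive_map_tensor_eqI[OF *(3,4)], use *(5,6) in auto)
qed

lemma tensor_lift_extensional: "tensor_lift R M N G b \<in> extensional (carrier (tensor_group R M N))"
  and tensor_lift_additive: "additive_map (tensor_group R M N) G (tensor_lift R M N G b)"
  and tensor_lift_tens: "x \<in> carrier M \<Longrightarrow> y \<in> carrier N \<Longrightarrow>
    tensor_lift R M N G b (tens R M N x y) = b x y"
  using theI'[OF lift_unique] unfolding tensor_lift_def by auto

end

end

section \<open>Tensor products of bimodules and of linear maps\<close>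

lemma tensor_simps [simp]:
  "carrier (tensor R M N) = carrier (tensor_group R M N)"
  "ring.add (tensor R M N) = ring.add (tensor_group R M N)"
  "ring.zero (tensor R M N) = ring.zero (tensor_group R M N)"
  by (simp_all add: tensor_def with_actions_def Let_def)

lemma additive_map_from_tensor [simp]:
  "additive_map (tensor R M N) G f \<longleftrightarrow> additive_map (tensor_group R M N) G f"
  by (simp add: additive_map_iff)

lemma additive_map_into_tensor [simp]:
  "additive_map G (tensor R M N) f \<longleftrightarrow> additive_map G (tensor_group R M N) f"
  by (simp add: additive_map_iff)

lemma finsum_tensor [simp]: "finsum (tensor R M N) = finsum (tensor_group R M N)"
  by (intro ext) (simp add: finsum_def finprod_def)

lemma abelian_group_cong:
  assumes "carrier M = carrier N" "ring.add M = ring.add N" "ring.zero M = ring.zero N"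
  shows "abelian_group M \<longleftrightarrow> abelian_group N"
  using assms
  by (simp add: abelian_group_def abelian_monoid_def abelian_group_axioms_def comm_group_def
      group_def monoid_def comm_monoid_def comm_monoid_axioms_def group_axioms_def Units_def)

lemma abelian_group_tensor [simp]:
  "abelian_group (tensor R M N) \<longleftrightarrow> abelian_group (tensor_group R M N)"
  by (rule abelian_group_cong) simp_all

lemma tensor_lact: "a \<triangleright>\<^bsub>tensor R M N\<^esub> t =
    tensor_lift R M N (tensor_group R M N) (\<lambda>x y. tens R M N (a \<triangleright>\<^bsub>M\<^esub> x) y) t"
  and tensor_ract: "t \<triangleleft>\<^bsub>tensor R M N\<^esub> a' =
    tensor_lift R M N (tensor_group R M N) (\<lambda>x y. tens R M N x (y \<triangleleft>\<^bsub>N\<^esub> a')) t"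
  by (simp_all add: tensor_def with_actions_def Let_def)

text \<open>A tensor product does not see the actions on the outer sides of its factors, nor any further
  record fields. Comodules can thus be replaced by their underlying modules, and bimodules by
  one-sided modules.\<close>

lemma tensor_group_cong:
  assumes "carrier M = carrier M'" "ring.add M = ring.add M'" "ract M = ract M'"
    and "carrier N = carrier N'" "ring.add N = ring.add N'" "lact N = lact N'"
  shows tensor_relations_cong': "tensor_relations R M N = tensor_relations R M' N'"
    and tensor_group_cong': "tensor_group R M N = tensor_group R M' N'"
    and tens_cong': "tens R M N = tens R M' N'"
    and tensor_lift_cong': "tensor_lift R M N = (tensor_lift R M' N' :: ('g, 'w) ring_scheme \<Rightarrow> _)"
proof -
  show 1: "tensor_relations R M N = tensor_relations R M' N'"
    using assms by (simp add: tensor_relations_def)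
  show 2: "tensor_group R M N = tensor_group R M' N'"
    using assms 1 by (simp add: tensor_group_def)
  show 3: "tens R M N = tens R M' N'"
    using assms 1 by (intro ext) (simp add: tens_def)
  show "tensor_lift R M N = (tensor_lift R M' N' :: ('g, 'w) ring_scheme \<Rightarrow> _)"
    using assms 2 3 by (intro ext) (simp add: tensor_lift_def)
qed

lemma tensor_lift_eqI:
  assumes "\<And>x y. x \<in> carrier M \<Longrightarrow> y \<in> carrier N \<Longrightarrow> b x y = b' x y"
  shows "tensor_lift R M N G b = tensor_lift R M N G b'"
  using assms by (simp add: tensor_lift_def)

lemma tensor_map_eqI:
  assumes "\<And>x. x \<in> carrier M \<Longrightarrow> f x = f' x" "\<And>y. y \<in> carrier N \<Longrightarrow> g y = g' y"
  shows "tensor_map R M N M' N' f g = tensor_map R M N M' N' f' g'"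
  unfolding tensor_map_def using assms by (intro tensor_lift_eqI) simp

lemma additive_map_plus:
  assumes "abelian_group N" "additive_map M N f" "additive_map M N g"
  shows "additive_map M N (\<lambda>x. f x \<oplus>\<^bsub>N\<^esub> g x)"
proof -
  interpret N: abelian_group N by fact
  show ?thesis
  proof
    show "f x \<oplus>\<^bsub>N\<^esub> g x \<in> carrier N" if "x \<in> carrier M" for x
      using that assms(2,3) by (simp add: additive_map_closed)
    show "f (x \<oplus>\<^bsub>M\<^esub> y) \<oplus>\<^bsub>N\<^esub> g (x \<oplus>\<^bsub>M\<^esub> y) = f x \<oplus>\<^bsub>N\<^esub> g x \<oplus>\<^bsub>N\<^esub> (f y \<oplus>\<^bsub>N\<^esub> g y)"
      if "x \<in> carrier M" "y \<in> carrier M" for x y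
      using that assms(2,3) by (simp add: additive_map_closed additive_map_add N.a_ac)
  qed
qed

lemma left_linearI:
  assumes "additive_map M N f"
    and "\<And>a x. a \<in> carrier R \<Longrightarrow> x \<in> carrier M \<Longrightarrow> f (a \<triangleright>\<^bsub>M\<^esub> x) = a \<triangleright>\<^bsub>N\<^esub> f x"
  shows "left_linear R M N f"
  using assms by (simp add: left_linear_def)

lemma right_linearI:
  assumes "additive_map M N f"
    and "\<And>a x. a \<in> carrier R \<Longrightarrow> x \<in> carrier M \<Longrightarrow> f (x \<triangleleft>\<^bsub>M\<^esub> a) = f x \<triangleleft>\<^bsub>N\<^esub> a"
  shows "right_linear R M N f"
  using assms by (simp add: right_linear_def)

lemma left_linear_id: "left_linear R M M id" "left_linear R M M (\<lambda>x. x)"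
  by (simp_all add: left_linear_def additive_map_iff)

lemma right_linear_id: "right_linear R M M id" "right_linear R M M (\<lambda>x. x)"
  by (simp_all add: right_linear_def additive_map_iff)

lemma left_linear_lact: "left_linear R M N f \<Longrightarrow> a \<in> carrier R \<Longrightarrow> x \<in> carrier M \<Longrightarrow>
    f (a \<triangleright>\<^bsub>M\<^esub> x) = a \<triangleright>\<^bsub>N\<^esub> f x"
  and left_linear_closed: "left_linear R M N f \<Longrightarrow> x \<in> carrier M \<Longrightarrow> f x \<in> carrier N"
  and left_linear_add: "left_linear R M N f \<Longrightarrow> x \<in> carrier M \<Longrightarrow> y \<in> carrier M \<Longrightarrow>
    f (x \<oplus>\<^bsub>M\<^esub> y) = f x \<oplus>\<^bsub>N\<^esub> f y"
  by (simp_all add: left_linear_def additive_map_iff)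

lemma right_linear_additive: "right_linear R M N f \<Longrightarrow> additive_map M N f"
  and right_linear_ract: "right_linear R M N f \<Longrightarrow> a \<in> carrier R \<Longrightarrow> x \<in> carrier M \<Longrightarrow>
    f (x \<triangleleft>\<^bsub>M\<^esub> a) = f x \<triangleleft>\<^bsub>N\<^esub> a"
  and right_linear_closed: "right_linear R M N f \<Longrightarrow> x \<in> carrier M \<Longrightarrow> f x \<in> carrier N"
  and right_linear_add: "right_linear R M N f \<Longrightarrow> x \<in> carrier M \<Longrightarrow> y \<in> carrier M \<Longrightarrow>
    f (x \<oplus>\<^bsub>M\<^esub> y) = f x \<oplus>\<^bsub>N\<^esub> f y"
  by (simp_all add: right_linear_def additive_map_iff)

lemma right_linear_comp:
  assumes "right_linear R M N f" "right_linear R N P g"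
  shows "right_linear R M P (\<lambda>x. g (f x))"
  using assms by (simp add: right_linear_def additive_map_iff)

lemma right_linear_cong:
  assumes "\<And>x. x \<in> carrier M \<Longrightarrow> f x = g x" and "right_module R M"
  shows "right_linear R M N f \<longleftrightarrow> right_linear R M N g"
proof -
  interpret M: right_module R M by fact
  show ?thesis
    using assms(1) by (simp add: right_linear_def additive_map_iff M.ract_closed)
qed

lemma right_homI:
  assumes "right_linear R M N f" "f \<in> extensional (carrier M)"
  shows "f \<in> right_hom R M N"
  using assms by (simp add: right_hom_def)

lemma right_hom_linear: "f \<in> right_hom R M N \<Longrightarrow> right_linear R M N f"
  and right_hom_extensional: "f \<in> right_hom R M N \<Longrightarrow> f \<in> extensional (carrier M)"
  by (simp_all add: right_hom_def)

lemma right_hom_restrict: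
  assumes "right_module R M" "right_linear R M N f"
  shows "restrict f (carrier M) \<in> right_hom R M N"
  using assms right_linear_cong[of M "restrict f (carrier M)" f R N] by (simp add: right_hom_def)

subsection \<open>Actions on a tensor product\<close>

context
  fixes R :: "('r, 'x) ring_scheme" and S :: "('s, 'w) ring_scheme"
    and M :: "('l, 'm, 'r, 'y) bimod_scheme" and N :: "('r, 'n, 's, 'z) bimod_scheme"
  assumes M: "right_module R M" and N: "bimodule R S N"
begin

interpretation M: right_module R M by (fact M)
interpretation N: bimodule R S N by (fact N)
interpretation T: abelian_group "tensor_group R M N"
  by (rule tensor_abelian_group[OF M N.left_module_axioms])

private lemma ract_bal: "a \<in> carrier S \<Longrightarrow>
    balanced R M N (tensor_group R M N) (\<lambda>x y. tens R M N x (y \<triangleleft>\<^bsub>N\<^esub> a))"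
  by (rule balancedI) (simp_all add: tens_closed[OF M N.left_module_axioms] tens_add_left[OF M N.left_module_axioms]
      tens_add_right[OF M N.left_module_axioms] tens_balanced[OF M N.left_module_axioms] N.ract_closed N.ract_add_left N.lact_ract)

lemma tensor_ract_additive:
  "a \<in> carrier S \<Longrightarrow> additive_map (tensor_group R M N) (tensor_group R M N) (\<lambda>t. t \<triangleleft>\<^bsub>tensor R M N\<^esub> a)"
  using tensor_lift_additive[OF M N.left_module_axioms T.abelian_group_axioms ract_bal] by (simp add: tensor_ract)

lemma tens_ract:
  "a \<in> carrier S \<Longrightarrow> x \<in> carrier M \<Longrightarrow> y \<in> carrier N \<Longrightarrow>
    tens R M N x y \<triangleleft>\<^bsub>tensor R M N\<^esub> a = tens R M N x (y \<triangleleft>\<^bsub>N\<^esub> a)"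
  using tensor_lift_tens[OF M N.left_module_axioms T.abelian_group_axioms ract_bal] by (simp add: tensor_ract)

lemma tensor_right_module: "right_module S (tensor R M N)"
proof -
  note cl = additive_map_closed[OF tensor_ract_additive]
  note simps = tens_ract tens_add_right[OF M N.left_module_axioms] N.ract_closed
  show ?thesis
    unfolding right_module_def right_module_axioms_def
  proof (intro conjI allI impI)
    fix a b x assume *: "a \<in> carrier S" "b \<in> carrier S" "x \<in> carrier (tensor R M N)"
    have sum: "a \<oplus>\<^bsub>S\<^esub> b \<in> carrier S" and prod: "a \<otimes>\<^bsub>S\<^esub> b \<in> carrier S"
      using * by (simp_all add: N.S.a_closed N.S.m_closed)
    show "x \<triangleleft>\<^bsub>tensor R M N\<^esub> (a \<oplus>\<^bsub>S\<^esub> b) = x \<triangleleft>\<^bsub>tensor R M N\<^esub> a \<oplus>\<^bsub>tensor R M N\<^esub> x \<triangleleft>\<^bsub>tensor R M N\<^esub> b"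
      unfolding tensor_simps
      by (rule additive_map_tensor_eqI[OF M N.left_module_axioms tensor_ract_additive[OF sum]
            additive_map_plus[OF T.abelian_group_axioms tensor_ract_additive[OF *(1)] tensor_ract_additive[OF *(2)]] _
            *(3)[unfolded tensor_simps]])
        (use * in \<open>simp_all add: simps N.ract_add_right\<close>)
    show "x \<triangleleft>\<^bsub>tensor R M N\<^esub> (a \<otimes>\<^bsub>S\<^esub> b) = x \<triangleleft>\<^bsub>tensor R M N\<^esub> a \<triangleleft>\<^bsub>tensor R M N\<^esub> b"
      by (rule additive_map_tensor_eqI[OF M N.left_module_axioms tensor_ract_additive[OF prod]
            additive_map_comp[OF tensor_ract_additive[OF *(1)] tensor_ract_additive[OF *(2)]] _ *(3)[unfolded tensor_simps]])
        (use * in \<open>simp_all add: simps N.ract_mult\<close>)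
  next
    fix x assume *: "x \<in> carrier (tensor R M N)"
    show "x \<triangleleft>\<^bsub>tensor R M N\<^esub> \<one>\<^bsub>S\<^esub> = x"
      by (rule additive_map_tensor_eqI[OF M N.left_module_axioms tensor_ract_additive[OF N.S.one_closed] additive_map_id _ *[unfolded tensor_simps]])
        (simp_all add: simps N.ract_one)
  qed (simp_all add: N.S.ring_axioms T.abelian_group_axioms cl additive_map_add[OF tensor_ract_additive])
qed

end

context
  fixes R :: "('r, 'x) ring_scheme" and S :: "('s, 'w) ring_scheme"
    and M :: "('s, 'm, 'r, 'y) bimod_scheme" and N :: "('r, 'n, 't, 'z) bimod_scheme"
  assumes M: "bimodule S R M" and N: "left_module R N"
begin

interpretation M: bimodule S R M by (fact M)
interpretation N: left_module R N by (fact N)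
interpretation T: abelian_group "tensor_group R M N"
  by (rule tensor_abelian_group[OF M.right_module_axioms N])


private lemma lact_bal: "a \<in> carrier S \<Longrightarrow>
    balanced R M N (tensor_group R M N) (\<lambda>x y. tens R M N (a \<triangleright>\<^bsub>M\<^esub> x) y)"
  by (rule balancedI) (simp_all add: tens_closed[OF M.right_module_axioms N] tens_add_left[OF M.right_module_axioms N]
      tens_add_right[OF M.right_module_axioms N] tens_balanced[OF M.right_module_axioms N, symmetric] M.lact_closed M.lact_add_right M.lact_ract)

lemma tensor_lact_additive:
  "a \<in> carrier S \<Longrightarrow> additive_map (tensor_group R M N) (tensor_group R M N) (\<lambda>t. a \<triangleright>\<^bsub>tensor R M N\<^esub> t)"
  using tensor_lift_additive[OF M.right_module_axioms N T.abelian_group_axioms lact_bal] by (simp add: tensor_lact)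

lemma tens_lact:
  "a \<in> carrier S \<Longrightarrow> x \<in> carrier M \<Longrightarrow> y \<in> carrier N \<Longrightarrow>
    a \<triangleright>\<^bsub>tensor R M N\<^esub> tens R M N x y = tens R M N (a \<triangleright>\<^bsub>M\<^esub> x) y"
  using tensor_lift_tens[OF M.right_module_axioms N T.abelian_group_axioms lact_bal] by (simp add: tensor_lact)

lemma tensor_left_module: "left_module S (tensor R M N)"
proof -
  note cl = additive_map_closed[OF tensor_lact_additive]
  note simps = tens_lact tens_add_left[OF M.right_module_axioms N] M.lact_closed
  show ?thesis
    unfolding left_module_def left_module_axioms_def
  proof (intro conjI allI impI)
    fix a b x assume *: "a \<in> carrier S" "b \<in> carrier S" "x \<in> carrier (tensor R M N)"
    have sum: "a \<oplus>\<^bsub>S\<^esub> b \<in> carrier S" and prod: "a \<otimes>\<^bsub>S\<^esub> b \<in> carrier S"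
      using * by (simp_all add: M.R.a_closed M.R.m_closed)
    show "(a \<oplus>\<^bsub>S\<^esub> b) \<triangleright>\<^bsub>tensor R M N\<^esub> x = a \<triangleright>\<^bsub>tensor R M N\<^esub> x \<oplus>\<^bsub>tensor R M N\<^esub> b \<triangleright>\<^bsub>tensor R M N\<^esub> x"
      unfolding tensor_simps
      by (rule additive_map_tensor_eqI[OF M.right_module_axioms N tensor_lact_additive[OF sum]
            additive_map_plus[OF T.abelian_group_axioms tensor_lact_additive[OF *(1)] tensor_lact_additive[OF *(2)]] _
            *(3)[unfolded tensor_simps]])
        (use * in \<open>simp_all add: simps M.lact_add_left\<close>)
    show "(a \<otimes>\<^bsub>S\<^esub> b) \<triangleright>\<^bsub>tensor R M N\<^esub> x = a \<triangleright>\<^bsub>tensor R M N\<^esub> (b \<triangleright>\<^bsub>tensor R M N\<^esub> x)"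
      by (rule additive_map_tensor_eqI[OF M.right_module_axioms N tensor_lact_additive[OF prod]
            additive_map_comp[OF tensor_lact_additive[OF *(2)] tensor_lact_additive[OF *(1)]] _ *(3)[unfolded tensor_simps]])
        (use * in \<open>simp_all add: simps M.lact_mult\<close>)
  next
    fix x assume *: "x \<in> carrier (tensor R M N)"
    show "\<one>\<^bsub>S\<^esub> \<triangleright>\<^bsub>tensor R M N\<^esub> x = x"
      by (rule additive_map_tensor_eqI[OF M.right_module_axioms N tensor_lact_additive[OF M.R.one_closed] additive_map_id _ *[unfolded tensor_simps]])
        (simp_all add: simps M.lact_one)
  qed (simp_all add: M.R.ring_axioms T.abelian_group_axioms cl additive_map_add[OF tensor_lact_additive])
qed

end

lemma tensor_bimodule:
  assumes M: "bimodule S R M" and N: "bimodule R S' N"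
  shows "bimodule S S' (tensor R M N)"
proof -
  interpret M: bimodule S R M by fact
  interpret N: bimodule R S' N by fact
  note M' = M.right_module_axioms and N' = N.left_module_axioms
  show ?thesis
    unfolding bimodule_def bimodule_axioms_def
  proof (intro conjI allI impI tensor_left_module[OF M N'] tensor_right_module[OF M' N])
    fix a b x assume *: "a \<in> carrier S" "b \<in> carrier S'" "x \<in> carrier (tensor R M N)"
    note l = tensor_lact_additive[OF M N' *(1)] and r = tensor_ract_additive[OF M' N *(2)]
    have x: "x \<in> carrier (tensor_group R M N)" using *(3) by simp
    show "a \<triangleright>\<^bsub>tensor R M N\<^esub> x \<triangleleft>\<^bsub>tensor R M N\<^esub> b = a \<triangleright>\<^bsub>tensor R M N\<^esub> (x \<triangleleft>\<^bsub>tensor R M N\<^esub> b)"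
      by (rule additive_map_tensor_eqI[OF M' N' additive_map_comp[OF l r] additive_map_comp[OF r l] _ x])
        (use * in \<open>simp_all add: tens_lact[OF M N'] tens_ract[OF M' N] M.lact_closed N.ract_closed\<close>)
  qed
qed

subsection \<open>Functoriality\<close>

context
  fixes R :: "('r, 'x) ring_scheme"
    and M :: "('l, 'm, 'r, 'y) bimod_scheme" and N :: "('r, 'n, 's, 'z) bimod_scheme"
    and M' :: "('l', 'm', 'r, 'y') bimod_scheme" and N' :: "('r, 'n', 's', 'z') bimod_scheme"
    and f g
  assumes M: "right_module R M" and N: "left_module R N"
    and M': "right_module R M'" and N': "left_module R N'"
    and f: "right_linear R M M' f" and g: "left_linear R N N' g"
begin

private lemma map_bal: "balanced R M N (tensor_group R M' N') (\<lambda>x y. tens R M' N' (f x) (g y))"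
  by (rule balancedI)
    (simp_all add: tens_closed[OF M' N'] tens_add_left[OF M' N'] right_linear_closed[OF f]
      tens_add_right[OF M' N'] tens_balanced[OF M' N'] left_linear_closed[OF g]
      right_linear_add[OF f] right_linear_ract[OF f] left_linear_add[OF g] left_linear_lact[OF g])

lemma tensor_map_additive:
  "additive_map (tensor_group R M N) (tensor_group R M' N') (tensor_map R M N M' N' f g)"
  unfolding tensor_map_def
  by (rule tensor_lift_additive[OF M N tensor_abelian_group[OF M' N'] map_bal])

lemma tensor_map_tens: "x \<in> carrier M \<Longrightarrow> y \<in> carrier N \<Longrightarrow>
    tensor_map R M N M' N' f g (tens R M N x y) = tens R M' N' (f x) (g y)"
  unfolding tensor_map_def
  by (rule tensor_lift_tens[OF M N tensor_abelian_group[OF M' N'] map_bal])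

lemma tensor_map_extensional: "tensor_map R M N M' N' f g \<in> extensional (carrier (tensor_group R M N))"
  unfolding tensor_map_def
  by (rule tensor_lift_extensional[OF M N tensor_abelian_group[OF M' N'] map_bal])

lemma tensor_map_closed: "t \<in> carrier (tensor_group R M N) \<Longrightarrow>
    tensor_map R M N M' N' f g t \<in> carrier (tensor_group R M' N')"
  by (rule additive_map_closed[OF tensor_map_additive])

lemma tensor_lift_tensor_map:
  assumes G: "abelian_group G" and b: "balanced R M' N' G b" and t: "t \<in> carrier (tensor_group R M N)"
  shows "tensor_lift R M' N' G b (tensor_map R M N M' N' f g t) =
    tensor_lift R M N G (\<lambda>x y. b (f x) (g y)) t"
proof -
  have b': "balanced R M N G (\<lambda>x y. b (f x) (g y))"
    using b f g unfolding balanced_def right_linear_def left_linear_def additive_map_iff by simp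
  show ?thesis
    by (rule additive_map_tensor_eqI[OF M N
          additive_map_comp[OF tensor_map_additive tensor_lift_additive[OF M' N' G b]]
          tensor_lift_additive[OF M N G b'] _ t])
      (simp add: tensor_map_tens right_linear_closed[OF f] left_linear_closed[OF g]
          tensor_lift_tens[OF M' N' G b] tensor_lift_tens[OF M N G b'])
qed

end

lemma tensor_map_right_linear:
  assumes M: "right_module R M" and N: "bimodule R S N" and M': "right_module R M'" and N': "bimodule R S N'"
    and f: "right_linear R M M' f" and g: "left_linear R N N' g" "right_linear S N N' g"
  shows "right_linear S (tensor R M N) (tensor R M' N') (tensor_map R M N M' N' f g)"
proof (rule right_linearI)
  interpret N: bimodule R S N by fact
  interpret N': bimodule R S N' by fact
  note map = M N.left_module_axioms M' N'.left_module_axioms f g(1)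
  note add = tensor_map_additive[OF map]
  show "additive_map (tensor R M N) (tensor R M' N') (tensor_map R M N M' N' f g)"
    using add by simp
  fix a x assume *: "a \<in> carrier S" "x \<in> carrier (tensor R M N)"
  have x: "x \<in> carrier (tensor_group R M N)" using * by simp
  show "tensor_map R M N M' N' f g (x \<triangleleft>\<^bsub>tensor R M N\<^esub> a) = tensor_map R M N M' N' f g x \<triangleleft>\<^bsub>tensor R M' N'\<^esub> a"
    by (rule additive_map_tensor_eqI[OF M N.left_module_axioms
          additive_map_comp[OF tensor_ract_additive[OF M N *(1)] add]
          additive_map_comp[OF add tensor_ract_additive[OF M' N' *(1)]] _ x])
      (simp add: tens_ract[OF M N] tens_ract[OF M' N'] tensor_map_tens[OF map] * N.ract_closed
        right_linear_closed[OF f] left_linear_closed[OF g(1)] right_linear_ract[OF g(2)])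
qed

lemma tensor_map_ident:
  assumes M: "right_module R M" and N: "left_module R N"
    and "\<And>x. x \<in> carrier M \<Longrightarrow> f x = x" "\<And>y. y \<in> carrier N \<Longrightarrow> g y = y"
    and t: "t \<in> carrier (tensor_group R M N)"
  shows "tensor_map R M N M N f g t = t"
proof -
  have eq: "tensor_map R M N M N f g = tensor_map R M N M N id id"
    using assms by (intro tensor_map_eqI) simp_all
  note map = M N M N right_linear_id(1) left_linear_id(1)
  show ?thesis
    unfolding eq
    by (rule additive_map_tensor_eqI[OF M N tensor_map_additive[OF map] additive_map_id _ t])
      (simp add: tensor_map_tens[OF map])
qed

subsection \<open>Associativity\<close>

context
  fixes R :: "('r, 'x) ring_scheme" and S :: "('s, 'w) ring_scheme"
    and M :: "('l, 'm, 'r, 'y) bimod_scheme" and N :: "('r, 'n, 's, 'z) bimod_scheme"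
    and P :: "('s, 'p, 't, 'v) bimod_scheme"
  assumes M: "right_module R M" and N: "bimodule R S N" and P: "left_module S P"
begin

interpretation M: right_module R M by (fact M)
interpretation N: bimodule R S N by (fact N)
interpretation P: left_module S P by (fact P)

private lemmas N' = N.left_module_axioms and N'' = N.right_module_axioms
private abbreviation (input) "NP \<equiv> tensor S N P"
private abbreviation (input) "MNP \<equiv> tensor_group R M NP"
private lemmas NP = tensor_left_module[OF N P]
interpretation NP: left_module R NP by (rule NP)
private lemmas MN = tensor_right_module[OF M N]
interpretation MN: right_module S "tensor R M N" by (rule MN)
interpretation T: abelian_group MNP by (rule tensor_abelian_group[OF M NP])

private lemma bal_inner: "z \<in> carrier P \<Longrightarrow> balanced R M N MNP (\<lambda>x y. tens R M NP x (tens S N P y z))"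
  by (rule balancedI)
    (simp_all add: tens_closed[OF M NP] tens_add_left[OF M NP] tens_closed[OF N'' P] tens_add_left[OF N'' P]
      tens_add_right[OF M NP, unfolded tensor_simps] tens_balanced[OF M NP] tens_lact[OF N P] N.lact_closed)

private abbreviation (input) "inner z \<equiv> tensor_lift R M N MNP (\<lambda>x y. tens R M NP x (tens S N P y z))"

private lemmas inner_add = tensor_lift_additive[OF M N' T.abelian_group_axioms bal_inner]
private lemmas inner_tens = tensor_lift_tens[OF M N' T.abelian_group_axioms bal_inner]

private lemma bal_outer: "balanced S (tensor R M N) P MNP (\<lambda>t z. inner z t)"
proof (rule balancedI)
  fix t z z' assume *: "t \<in> carrier (tensor R M N)" "z \<in> carrier P" "z' \<in> carrier P"
  have t: "t \<in> carrier (tensor_group R M N)" using * by simp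
  show "inner (z \<oplus>\<^bsub>P\<^esub> z') t = inner z t \<oplus>\<^bsub>MNP\<^esub> inner z' t"
    by (rule additive_map_tensor_eqI[OF M N' inner_add
          additive_map_plus[OF T.abelian_group_axioms inner_add inner_add] _ t])
      (use * in \<open>simp_all add: inner_tens tens_add_right[OF N'' P]
        tens_add_right[OF M NP, unfolded tensor_simps] tens_closed[OF N'' P]\<close>)
next
  fix t r z assume *: "t \<in> carrier (tensor R M N)" "r \<in> carrier S" "z \<in> carrier P"
  have t: "t \<in> carrier (tensor_group R M N)" using * by simp
  show "inner z (t \<triangleleft>\<^bsub>tensor R M N\<^esub> r) = inner (r \<triangleright>\<^bsub>P\<^esub> z) t"
    by (rule additive_map_tensor_eqI[OF M N'
          additive_map_comp[OF tensor_ract_additive[OF M N *(2)] inner_add] inner_add _ t])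
      (use * in \<open>simp_all add: inner_tens tens_ract[OF M N] tens_balanced[OF N'' P] N.ract_closed P.lact_closed\<close>)
qed (simp_all add: additive_map_closed[OF inner_add] additive_map_add[OF inner_add])

lemma tensor_assoc_additive:
  "additive_map (tensor_group S (tensor R M N) P) (tensor_group R M (tensor S N P)) (tensor_assoc R S M N P)"
  unfolding tensor_assoc_def Let_def
  by (rule tensor_lift_additive[OF MN P T.abelian_group_axioms bal_outer])

private lemma assoc_outer: "t \<in> carrier (tensor R M N) \<Longrightarrow> z \<in> carrier P \<Longrightarrow>
    tensor_assoc R S M N P (tens S (tensor R M N) P t z) = inner z t"
  unfolding tensor_assoc_def Let_def
  by (rule tensor_lift_tens[OF MN P T.abelian_group_axioms bal_outer])

lemma tensor_assoc_tens: "x \<in> carrier M \<Longrightarrow> y \<in> carrier N \<Longrightarrow> z \<in> carrier P \<Longrightarrow>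
    tensor_assoc R S M N P (tens S (tensor R M N) P (tens R M N x y) z) =
    tens R M (tensor S N P) x (tens S N P y z)"
  by (simp add: assoc_outer tens_closed[OF M N'] inner_tens)

lemma tensor_assoc_additive_left: "z \<in> carrier P \<Longrightarrow>
    additive_map (tensor_group R M N) (tensor_group R M (tensor S N P))
      (\<lambda>t. tensor_assoc R S M N P (tens S (tensor R M N) P t z))"
  by (subst additive_map_cong[of _ _ "inner z"])
    (simp_all add: assoc_outer inner_add tensor_abelian_group[OF M N'])

end

section \<open>Corings and their dual rings\<close>

lemma with_actions_simps [simp]:
  "carrier (with_actions M l r) = carrier M"
  "ring.add (with_actions M l r) = ring.add M"
  "ring.zero (with_actions M l r) = ring.zero M"
  "lact (with_actions M l r) = l"
  "ract (with_actions M l r) = r"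
  by (simp_all add: with_actions_def)

lemma finsum_cong_ring:
  assumes "carrier M = carrier N" "ring.add M = ring.add N" "ring.zero M = ring.zero N"
  shows "finsum M = finsum N"
  using assms by (intro ext) (simp add: finsum_def finprod_def)

lemma regular_simps [simp]:
  "carrier (regular A) = carrier A"
  "ring.add (regular A) = ring.add A"
  "ring.zero (regular A) = ring.zero A"
  "lact (regular A) = monoid.mult A"
  "ract (regular A) = monoid.mult A"
  by (simp_all add: regular_def)

lemma (in coring) counit_simps:
  "x \<in> carrier C \<Longrightarrow> counit C x \<in> carrier A"
  "x \<in> carrier C \<Longrightarrow> y \<in> carrier C \<Longrightarrow> counit C (x \<oplus>\<^bsub>C\<^esub> y) = counit C x \<oplus>\<^bsub>A\<^esub> counit C y"
  "x \<in> carrier C \<Longrightarrow> a \<in> carrier A \<Longrightarrow> counit C (x \<triangleleft>\<^bsub>C\<^esub> a) = counit C x \<otimes>\<^bsub>A\<^esub> a"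
  "x \<in> carrier C \<Longrightarrow> a \<in> carrier A \<Longrightarrow> counit C (a \<triangleright>\<^bsub>C\<^esub> x) = a \<otimes>\<^bsub>A\<^esub> counit C x"
  using counit_right counit_left
  by (simp_all add: right_linear_def left_linear_def additive_map_iff)

lemma right_linear_regular:
  "right_linear A C (regular A) f \<longleftrightarrow> (\<forall>x\<in>carrier C. f x \<in> carrier A) \<and>
    (\<forall>x\<in>carrier C. \<forall>y\<in>carrier C. f (x \<oplus>\<^bsub>C\<^esub> y) = f x \<oplus>\<^bsub>A\<^esub> f y) \<and>
    (\<forall>a\<in>carrier A. \<forall>x\<in>carrier C. f (x \<triangleleft>\<^bsub>C\<^esub> a) = f x \<otimes>\<^bsub>A\<^esub> a)"
  by (simp add: right_linear_def additive_map_iff)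

lemma dual_carrier_iff: "f \<in> carrier (dual_ring A C) \<longleftrightarrow>
    f \<in> extensional (carrier C) \<and> right_linear A C (regular A) f"
  by (simp add: dual_ring_def right_hom_def)

lemma dual_ring_simps:
  "f \<otimes>\<^bsub>dual_ring A C\<^esub> g = (\<lambda>c\<in>carrier C. f (dual_act A C g c))"
  "\<one>\<^bsub>dual_ring A C\<^esub> = (\<lambda>c\<in>carrier C. counit C c)"
  "\<zero>\<^bsub>dual_ring A C\<^esub> = (\<lambda>c\<in>carrier C. \<zero>\<^bsub>A\<^esub>)"
  "f \<oplus>\<^bsub>dual_ring A C\<^esub> g = (\<lambda>c\<in>carrier C. f c \<oplus>\<^bsub>A\<^esub> g c)"
  by (simp_all add: dual_ring_def)

lemma over_dual_simps [simp]:
  "carrier (over_dual A C) = carrier C"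
  "ring.add (over_dual A C) = ring.add C"
  "ring.zero (over_dual A C) = ring.zero C"
  "lact (over_dual A C) = dual_act A C"
  "ract (over_dual A C) = ract C"
  by (simp_all add: over_dual_def)

subsection \<open>The coring as a comodule over itself\<close>

lemma self_comodule_simps [simp]:
  "carrier (self_comodule C) = carrier C"
  "ring.add (self_comodule C) = ring.add C"
  "ring.zero (self_comodule C) = ring.zero C"
  "ract (self_comodule C) = ract C"
  "rcoact (self_comodule C) = comult C"
  by (simp_all add: self_comodule_def with_actions_def bimod.extend_def rcomod.fields_def)

lemma tensor_group_self_comodule [simp]:
  "tensor_group A (self_comodule C) N = tensor_group A C N"
  by (intro tensor_group_cong; simp)

lemma tens_self_comodule [simp]: "tens A (self_comodule C) N = tens A C N"
  by (intro tensor_group_cong; simp)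

lemma tensor_lift_self_comodule [simp]: "tensor_lift A (self_comodule C) N = tensor_lift A C N"
  by (intro tensor_group_cong; simp)

lemma ract_tensor_self_comodule [simp]: "ract (tensor A (self_comodule C) N) = ract (tensor A C N)"
  by (intro ext) (simp add: tensor_ract)

lemma tensor_group_tensor_self_comodule [simp]:
  "tensor_group A (tensor A (self_comodule C) N) P = tensor_group A (tensor A C N) P"
  by (intro tensor_group_cong; simp)

lemma tens_tensor_self_comodule [simp]:
  "tens A (tensor A (self_comodule C) N) P = tens A (tensor A C N) P"
  by (intro tensor_group_cong; simp)

lemma tensor_lift_tensor_self_comodule [simp]:
  "tensor_lift A (tensor A (self_comodule C) N) P = tensor_lift A (tensor A C N) P"
  by (intro tensor_group_cong; simp)

lemma tensor_map_self_comodule [simp]: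
  "tensor_map A (self_comodule C) N M N' = tensor_map A C N M N'"
  by (intro ext; simp add: tensor_map_def)

lemma tensor_map_into_self_comodule [simp]:
  "tensor_map A M N (self_comodule C) N' = tensor_map A M N C N'"
  by (intro ext; simp add: tensor_map_def)

lemma tensor_map_tensor_self_comodule [simp]:
  "tensor_map A M N (tensor A (self_comodule C) P) N' = tensor_map A M N (tensor A C P) N'"
  by (intro ext; simp add: tensor_map_def)

lemma tensor_assoc_self_comodule [simp]:
  "tensor_assoc A A (self_comodule C) N P = tensor_assoc A A C N P"
  by (intro ext) (simp add: tensor_assoc_def)

lemma tensor_lift_into_self_comodule [simp]:
  "tensor_lift R M N (self_comodule C) b = tensor_lift R M N C b"
  by (simp add: tensor_lift_def additive_map_iff)

context coring
begin

lemma tensor_C_right_module: "right_module A N \<Longrightarrow> right_module A (tensor A N C)"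
  by (rule tensor_right_module[OF _ bimodule_axioms])

lemma tensor_C_abelian_group: "right_module A N \<Longrightarrow> abelian_group (tensor_group A N C)"
  by (rule tensor_abelian_group[OF _ left_module_axioms])

lemma CC_bimodule: "bimodule A A (tensor A C C)"
  by (rule tensor_bimodule[OF bimodule_axioms bimodule_axioms])

lemma CC_abelian_group: "abelian_group (tensor_group A C C)"
  by (rule tensor_C_abelian_group[OF right_module_axioms])

lemma comult_closed: "c \<in> carrier C \<Longrightarrow> comult C c \<in> carrier (tensor_group A C C)"
  using right_linear_closed[OF comult_right] by simp

lemma comult_additive: "additive_map C (tensor_group A C C) (comult C)"
  using right_linear_additive[OF comult_right] by simp

lemma self_right_module: "right_module A (self_comodule C)"
proof -
  have "abelian_group (self_comodule C)"
    using M.abelian_group_axioms by (subst abelian_group_cong[of _ C]) simp_all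
  then show ?thesis
    using right_module_axioms unfolding right_module_def right_module_axioms_def by simp
qed

lemma self_right_comodule: "right_comodule A C (self_comodule C)"
proof -
  have r: "ract (tensor A (self_comodule C) C) = ract (tensor A C C)"
    by (intro ext) (simp add: tensor_ract)
  have "right_linear A (self_comodule C) (tensor A (self_comodule C) C) (rcoact (self_comodule C))"
    using comult_right by (simp add: right_linear_def r additive_map_iff)
  then show ?thesis
    unfolding right_comodule_def right_comodule_axioms_def
    using coring_axioms self_right_module coassoc counit_comult_right
    by simp
qed

end

context right_comodule
begin

lemma rcoact_closed: "m \<in> carrier M \<Longrightarrow> rcoact M m \<in> carrier (tensor_group A M C)"
  using right_linear_closed[OF rcoact_linear] by simp

lemma rcoact_additive: "additive_map M (tensor_group A M C) (rcoact M)"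
  using right_linear_additive[OF rcoact_linear] by simp

lemma map_rcoact_additive: "additive_map (tensor_group A M C) (tensor_group A (tensor A M C) C)
    (tensor_map A M C (tensor A M C) C (rcoact M) id)"
  by (rule tensor_map_additive[OF M.right_module_axioms left_module_axioms
        tensor_C_right_module[OF M.right_module_axioms] left_module_axioms rcoact_linear left_linear_id(1)])

lemma map_rcoact_tens: "x \<in> carrier M \<Longrightarrow> c \<in> carrier C \<Longrightarrow>
    tensor_map A M C (tensor A M C) C (rcoact M) id (tens A M C x c) = tens A (tensor A M C) C (rcoact M x) c"
  using tensor_map_tens[OF M.right_module_axioms left_module_axioms
      tensor_C_right_module[OF M.right_module_axioms] left_module_axioms rcoact_linear left_linear_id(1)]
  by simp

lemma map_comult_additive: "additive_map (tensor_group A M C) (tensor_group A M (tensor A C C))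
    (tensor_map A M C M (tensor A C C) id (comult C))"
  using tensor_map_additive[OF M.right_module_axioms left_module_axioms M.right_module_axioms
        bimodule.axioms(1)[OF CC_bimodule] right_linear_id(1) comult_left] .

lemma map_comult_tens: "x \<in> carrier M \<Longrightarrow> c \<in> carrier C \<Longrightarrow>
    tensor_map A M C M (tensor A C C) id (comult C) (tens A M C x c) =
    tens A M (tensor A C C) x (comult C c)"
  using tensor_map_tens[OF M.right_module_axioms left_module_axioms M.right_module_axioms
      bimodule.axioms(1)[OF CC_bimodule] right_linear_id(1) comult_left] by simp

text \<open>Coassociativity in a form that needs no representatives: a map \<open>h\<close> on \<open>M \<otimes> C \<otimes> C\<close> takes the same
  value on \<open>m\<^sub>0 \<otimes> m\<^sub>1 \<otimes> m\<^sub>2\<close>, whether the left or the right factor of \<open>\<rho>(m)\<close> is split to obtain it.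
  The maps \<open>u\<close> and \<open>v\<close> are these two ways to evaluate \<open>h\<close>, as functions of \<open>\<rho>(m)\<close>.\<close>

lemma coassoc_eqI:
  assumes h: "additive_map (tensor_group A M (tensor A C C)) G h"
    and u: "additive_map (tensor_group A M C) G u" and v: "additive_map (tensor_group A M C) G v"
    and ut: "\<And>x c. x \<in> carrier M \<Longrightarrow> c \<in> carrier C \<Longrightarrow>
      u (tens A M C x c) = h (tensor_assoc A A M C C (tens A (tensor A M C) C (rcoact M x) c))"
    and vt: "\<And>x c. x \<in> carrier M \<Longrightarrow> c \<in> carrier C \<Longrightarrow>
      v (tens A M C x c) = h (tens A M (tensor A C C) x (comult C c))"
    and m: "m \<in> carrier M"
  shows "u (rcoact M m) = v (rcoact M m)"
proof -
  note R = M.right_module_axioms and L = left_module_axioms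
  have "u (rcoact M m) = h (tensor_assoc A A M C C
      (tensor_map A M C (tensor A M C) C (rcoact M) id (rcoact M m)))"
    by (rule additive_map_tensor_eqI[OF R L u additive_map_comp[OF additive_map_comp[OF
          map_rcoact_additive tensor_assoc_additive[OF R bimodule_axioms L]] h] _ rcoact_closed[OF m]])
      (simp add: ut map_rcoact_tens)
  also have "\<dots> = h (tensor_map A M C M (tensor A C C) id (comult C) (rcoact M m))"
    by (simp add: rcoact_coassoc[OF m])
  also have "\<dots> = v (rcoact M m)"
    by (rule additive_map_tensor_eqI[OF R L additive_map_comp[OF map_comult_additive h] v _ rcoact_closed[OF m]])
      (simp add: vt map_comult_tens)
  finally show ?thesis .
qed

lemma rcoact_inj: "inj_on (rcoact M) (carrier M)"
  by (rule inj_onI) (metis rcoact_counit)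

end

text \<open>Both sides of each axiom are natural in \<open>M\<close>. The comodule \<open>F(N)\<close> is covered in this way by the maps
  \<open>c \<mapsto> n \<otimes> c\<close> from \<open>C\<close>, and a copy of a comodule by the original.\<close>

lemma (in right_comodule) comodule_axioms_along:
  assumes F: "right_module A F" and r: "right_linear A F (tensor A F C) r"
    and k: "right_linear A M F k"
    and rk: "\<And>m. m \<in> carrier M \<Longrightarrow> r (k m) = tensor_map A M C F C k id (rcoact M m)"
    and m: "m \<in> carrier M"
  shows "tensor_assoc A A F C C (tensor_map A F C (tensor A F C) C r id (r (k m))) =
      tensor_map A F C F (tensor A C C) id (comult C) (r (k m))"
    and "tensor_lift A F C F (\<lambda>x c. x \<triangleleft>\<^bsub>F\<^esub> counit C c) (r (k m)) = k m"
proof -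
  interpret F: right_module A F by fact
  interpret CC: bimodule A A "tensor A C C" by (rule CC_bimodule)
  note R = M.right_module_axioms and L = left_module_axioms and B = bimodule_axioms
  note FC = tensor_C_right_module[OF F] and MC = tensor_C_right_module[OF R]
  note kid = R L F L k left_linear_id(1)
  note kid' = R CC.left_module_axioms F CC.left_module_axioms k left_linear_id(1)
  note rid = F L FC L r left_linear_id(1)
  note idD = F L F CC.left_module_axioms right_linear_id(1) comult_left
  let ?K = "tensor_map A M (tensor A C C) F (tensor A C C) k id"
  have 1: "tensor_assoc A A F C C (tens A (tensor A F C) C (tensor_map A M C F C k id s) c) =
    ?K (tensor_assoc A A M C C (tens A (tensor A M C) C s c))"
    if c: "c \<in> carrier C" and s: "s \<in> carrier (tensor_group A M C)" for s c
    by (rule additive_map_tensor_eqI[OF R L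
          additive_map_comp[OF tensor_map_additive[OF kid] tensor_assoc_additive_left[OF F B L c]]
          additive_map_comp[OF tensor_assoc_additive_left[OF R B L c] tensor_map_additive[OF kid']] _ s])
      (simp add: tensor_map_tens[OF kid] tensor_map_tens[OF kid'] tensor_assoc_tens[OF F B L]
          tensor_assoc_tens[OF R B L] c right_linear_closed[OF k] tens_closed[OF right_module_axioms L])
  have 2: "tensor_assoc A A F C C (tensor_map A F C (tensor A F C) C r id (tensor_map A M C F C k id t)) =
      ?K (tensor_assoc A A M C C (tensor_map A M C (tensor A M C) C (rcoact M) id t))"
    if t: "t \<in> carrier (tensor_group A M C)" for t
    by (rule additive_map_tensor_eqI[OF R L
          additive_map_comp[OF additive_map_comp[OF tensor_map_additive[OF kid] tensor_map_additive[OF rid]]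
            tensor_assoc_additive[OF F B L]]
          additive_map_comp[OF additive_map_comp[OF map_rcoact_additive tensor_assoc_additive[OF R B L]]
            tensor_map_additive[OF kid']] _ t])
      (simp add: tensor_map_tens[OF kid] tensor_map_tens[OF rid] map_rcoact_tens
        right_linear_closed[OF k] rk 1 rcoact_closed)
  have 3: "tensor_map A F C F (tensor A C C) id (comult C) (tensor_map A M C F C k id t) =
      ?K (tensor_map A M C M (tensor A C C) id (comult C) t)"
    if t: "t \<in> carrier (tensor_group A M C)" for t
    by (rule additive_map_tensor_eqI[OF R L
          additive_map_comp[OF tensor_map_additive[OF kid] tensor_map_additive[OF idD]]
          additive_map_comp[OF map_comult_additive tensor_map_additive[OF kid']] _ t])
      (simp add: tensor_map_tens[OF kid] tensor_map_tens[OF kid'] tensor_map_tens[OF idD] map_comult_tens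
        right_linear_closed[OF k] comult_closed)
  show "tensor_assoc A A F C C (tensor_map A F C (tensor A F C) C r id (r (k m))) =
      tensor_map A F C F (tensor A C C) id (comult C) (r (k m))"
    by (simp add: rk m 2 3 rcoact_closed rcoact_coassoc)
  have balF: "balanced A F C F (\<lambda>x c. x \<triangleleft>\<^bsub>F\<^esub> counit C c)"
    by (rule balancedI) (simp_all add: counit_simps F.ract_closed F.ract_add_left F.ract_add_right F.ract_mult)
  have balM: "balanced A M C M (\<lambda>x c. x \<triangleleft>\<^bsub>M\<^esub> counit C c)"
    by (rule balancedI) (simp_all add: counit_simps M.ract_closed M.ract_add_left M.ract_add_right M.ract_mult)
  have "tensor_lift A F C F (\<lambda>x c. x \<triangleleft>\<^bsub>F\<^esub> counit C c) (tensor_map A M C F C k id t) =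
      k (tensor_lift A M C M (\<lambda>x c. x \<triangleleft>\<^bsub>M\<^esub> counit C c) t)"
    if t: "t \<in> carrier (tensor_group A M C)" for t
    by (rule additive_map_tensor_eqI[OF R L
          additive_map_comp[OF tensor_map_additive[OF kid] tensor_lift_additive[OF F L F.M.abelian_group_axioms balF]]
          additive_map_comp[OF tensor_lift_additive[OF R L M.M.abelian_group_axioms balM] right_linear_additive[OF k]] _ t])
      (simp add: tensor_map_tens[OF kid] tensor_lift_tens[OF F L F.M.abelian_group_axioms balF]
        tensor_lift_tens[OF R L M.M.abelian_group_axioms balM] right_linear_closed[OF k]
        right_linear_ract[OF k] counit_simps)
  then show "tensor_lift A F C F (\<lambda>x c. x \<triangleleft>\<^bsub>F\<^esub> counit C c) (r (k m)) = k m"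
    by (simp add: rk m rcoact_closed rcoact_counit)
qed

context coring
begin

lemma comult_coassoc_eqI:
  assumes "additive_map (tensor_group A C (tensor A C C)) G h"
    and "additive_map (tensor_group A C C) G u" "additive_map (tensor_group A C C) G v"
    and "\<And>x c. x \<in> carrier C \<Longrightarrow> c \<in> carrier C \<Longrightarrow>
      u (tens A C C x c) = h (tensor_assoc A A C C C (tens A (tensor A C C) C (comult C x) c))"
    and "\<And>x c. x \<in> carrier C \<Longrightarrow> c \<in> carrier C \<Longrightarrow>
      v (tens A C C x c) = h (tens A C (tensor A C C) x (comult C c))"
    and "c \<in> carrier C"
  shows "u (comult C c) = v (comult C c)"
  using right_comodule.coassoc_eqI[OF self_right_comodule, of G h u v c] assms by simp

context
  fixes f
  assumes f: "right_linear A C (regular A) f"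
begin

private lemmas f' = f[unfolded right_linear_regular, rule_format]

lemma dual_act_balanced: "balanced A C C C (\<lambda>x y. f x \<triangleright>\<^bsub>C\<^esub> y)"
  by (rule balancedI) (use f' in \<open>simp_all add: lact_closed lact_add_left lact_add_right lact_mult\<close>)

lemma dual_act_lift_additive:
  "additive_map (tensor_group A C C) C (tensor_lift A C C C (\<lambda>x y. f x \<triangleright>\<^bsub>C\<^esub> y))"
  by (rule tensor_lift_additive[OF right_module_axioms left_module_axioms M.abelian_group_axioms dual_act_balanced])

lemma dual_act_lift_tens: "x \<in> carrier C \<Longrightarrow> y \<in> carrier C \<Longrightarrow>
    tensor_lift A C C C (\<lambda>x y. f x \<triangleright>\<^bsub>C\<^esub> y) (tens A C C x y) = f x \<triangleright>\<^bsub>C\<^esub> y"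
  by (rule tensor_lift_tens[OF right_module_axioms left_module_axioms M.abelian_group_axioms dual_act_balanced])

lemma dual_act_right_linear: "right_linear A C C (dual_act A C f)"
proof (rule right_linearI)
  show "additive_map C C (dual_act A C f)"
    unfolding dual_act_def by (rule additive_map_comp[OF comult_additive dual_act_lift_additive])
  fix a x assume a: "a \<in> carrier A" and x: "x \<in> carrier C"
  let ?l = "tensor_lift A C C C (\<lambda>x y. f x \<triangleright>\<^bsub>C\<^esub> y)"
  have act: "additive_map C C (\<lambda>t. t \<triangleleft>\<^bsub>C\<^esub> a)"
    using a by (simp add: additive_map_iff ract_closed ract_add_left)
  have "?l (t \<triangleleft>\<^bsub>tensor A C C\<^esub> a) = ?l t \<triangleleft>\<^bsub>C\<^esub> a" if t: "t \<in> carrier (tensor_group A C C)" for t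
    by (rule additive_map_tensor_eqI[OF right_module_axioms left_module_axioms
          additive_map_comp[OF tensor_ract_additive[OF right_module_axioms bimodule_axioms a] dual_act_lift_additive]
          additive_map_comp[OF dual_act_lift_additive act] _ t])
      (use a f' in \<open>simp add: tens_ract[OF right_module_axioms bimodule_axioms] dual_act_lift_tens ract_closed lact_ract\<close>)
  then show "dual_act A C f (x \<triangleleft>\<^bsub>C\<^esub> a) = dual_act A C f x \<triangleleft>\<^bsub>C\<^esub> a"
    using a x comult_closed[OF x] right_linear_ract[OF comult_right a x] by (simp add: dual_act_def)
qed

lemma dual_act_closed: "c \<in> carrier C \<Longrightarrow> dual_act A C f c \<in> carrier C"
  by (rule right_linear_closed[OF dual_act_right_linear])

text \<open>Both sides are \<open>f(c\<^sub>1) c\<^sub>2 \<otimes> c\<^sub>3\<close>. So \<open>c \<mapsto> f \<cdot> c\<close>, which is right linear,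
  is an endomorphism of the comodule \<open>C\<close>. This is why the dual ring acts on \<open>G(M)\<close> and why the
  coaction of \<open>F(N)\<close> is well defined.\<close>

lemma comult_dual_act:
  assumes c: "c \<in> carrier C"
  shows "comult C (dual_act A C f c) = tensor_map A C C C C (dual_act A C f) id (comult C c)"
proof -
  note R = right_module_axioms and L = left_module_axioms and B = bimodule_axioms
  interpret CC: bimodule A A "tensor A C C" by (rule CC_bimodule)
  let ?T = "tensor_group A C C"
  \<comment> \<open>\<open>h(x \<otimes> y \<otimes> z) = f(x) y \<otimes> z\<close>\<close>
  define h where "h = tensor_lift A C (tensor A C C) ?T (\<lambda>x w. f x \<triangleright>\<^bsub>tensor A C C\<^esub> w)"
  have hb: "balanced A C (tensor A C C) ?T (\<lambda>x w. f x \<triangleright>\<^bsub>tensor A C C\<^esub> w)"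
    by (rule balancedI)
      (use f' CC.lact_closed CC.lact_add_left CC.lact_add_right CC.lact_mult in simp_all)
  note h_add = tensor_lift_additive[OF R CC.left_module_axioms CC_abelian_group hb, folded h_def]
  note h_tens = tensor_lift_tens[OF R CC.left_module_axioms CC_abelian_group hb, folded h_def]
  let ?l = "tensor_lift A C C C (\<lambda>x y. f x \<triangleright>\<^bsub>C\<^esub> y)"
  note act = R L R L dual_act_right_linear left_linear_id(1)
  have 1: "h (tensor_assoc A A C C C (tens A (tensor A C C) C s y)) = tens A C C (?l s) y"
    if s: "s \<in> carrier ?T" and y: "y \<in> carrier C" for s y
    by (rule additive_map_tensor_eqI[OF R L
          additive_map_comp[OF tensor_assoc_additive_left[OF R B L y] h_add]
          additive_map_comp[OF dual_act_lift_additive tens_additive_left[OF R L y]] _ s])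
      (use y f' in \<open>simp add: tensor_assoc_tens[OF R B L] h_tens tens_closed[OF R L] dual_act_lift_tens tens_lact[OF B L]\<close>)
  have "tensor_map A C C C C (dual_act A C f) id (comult C c) = comult C (?l (comult C c))"
  proof (rule comult_coassoc_eqI[OF h_add tensor_map_additive[OF act]
        additive_map_comp[OF dual_act_lift_additive comult_additive] _ _ c])
    fix x y assume "x \<in> carrier C" "y \<in> carrier C"
    then show "tensor_map A C C C C (dual_act A C f) id (tens A C C x y) =
        h (tensor_assoc A A C C C (tens A (tensor A C C) C (comult C x) y))"
      by (simp add: tensor_map_tens[OF act] 1 comult_closed dual_act_def)
    show "comult C (?l (tens A C C x y)) = h (tens A C (tensor A C C) x (comult C y))"
      using \<open>x \<in> carrier C\<close> \<open>y \<in> carrier C\<close> f' left_linear_lact[OF comult_left]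
      by (simp add: dual_act_lift_tens h_tens comult_closed)
  qed
  then show ?thesis by (simp add: dual_act_def)
qed

text \<open>\<open>\<epsilon>(f(c\<^sub>1) c\<^sub>2) = f(c\<^sub>1) \<epsilon>(c\<^sub>2) = f(c\<^sub>1 \<epsilon>(c\<^sub>2)) = f(c)\<close>\<close>

lemma counit_dual_act:
  assumes c: "c \<in> carrier C"
  shows "counit C (dual_act A C f c) = f c"
proof -
  note R = right_module_axioms and L = left_module_axioms
  have bal: "balanced A C C C (\<lambda>x y. x \<triangleleft>\<^bsub>C\<^esub> counit C y)"
    by (rule balancedI) (simp_all add: counit_simps ract_closed ract_add_left ract_add_right ract_mult)
  note l_add = tensor_lift_additive[OF R L M.abelian_group_axioms bal]
  note l_tens = tensor_lift_tens[OF R L M.abelian_group_axioms bal]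
  have fadd: "additive_map C A f" and ead: "additive_map C A (counit C)"
    using f' counit_simps by (simp_all add: additive_map_iff)
  have "counit C (tensor_lift A C C C (\<lambda>x y. f x \<triangleright>\<^bsub>C\<^esub> y) (comult C c)) =
      f (tensor_lift A C C C (\<lambda>x y. x \<triangleleft>\<^bsub>C\<^esub> counit C y) (comult C c))"
    by (rule additive_map_tensor_eqI[OF R L additive_map_comp[OF dual_act_lift_additive ead]
          additive_map_comp[OF l_add fadd] _ comult_closed[OF c]])
      (use f' in \<open>simp add: dual_act_lift_tens l_tens counit_simps\<close>)
  then show ?thesis by (simp add: dual_act_def counit_comult_right[OF c])
qed

end

lemma dual_linear: "f \<in> carrier (dual_ring A C) \<Longrightarrow> right_linear A C (regular A) f"
  by (simp add: dual_carrier_iff)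

lemma dual_closed: "f \<in> carrier (dual_ring A C) \<Longrightarrow> c \<in> carrier C \<Longrightarrow> f c \<in> carrier A"
  and dual_add: "f \<in> carrier (dual_ring A C) \<Longrightarrow> c \<in> carrier C \<Longrightarrow> c' \<in> carrier C \<Longrightarrow>
    f (c \<oplus>\<^bsub>C\<^esub> c') = f c \<oplus>\<^bsub>A\<^esub> f c'"
  and dual_ract: "f \<in> carrier (dual_ring A C) \<Longrightarrow> c \<in> carrier C \<Longrightarrow> a \<in> carrier A \<Longrightarrow>
    f (c \<triangleleft>\<^bsub>C\<^esub> a) = f c \<otimes>\<^bsub>A\<^esub> a"
  and dual_extensional: "f \<in> carrier (dual_ring A C) \<Longrightarrow> f \<in> extensional (carrier C)"
  by (simp_all add: dual_carrier_iff right_linear_regular)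

lemma dual_eqI:
  assumes "f \<in> carrier (dual_ring A C)" "g \<in> carrier (dual_ring A C)"
    and "\<And>c. c \<in> carrier C \<Longrightarrow> f c = g c"
  shows "f = g"
  using assms by (intro extensionalityI[of _ "carrier C"]) (simp_all add: dual_extensional)

lemma dual_restrict:
  assumes "right_linear A C (regular A) f"
  shows "restrict f (carrier C) \<in> carrier (dual_ring A C)"
  using assms right_linear_cong[OF _ right_module_axioms, of "restrict f (carrier C)" f "regular A"]
  by (simp add: dual_carrier_iff)

lemma dual_act_cong:
  assumes "\<And>c. c \<in> carrier C \<Longrightarrow> f c = g c"
  shows "dual_act A C f c = dual_act A C g c"
  using tensor_lift_eqI[of C C "\<lambda>x y. f x \<triangleright>\<^bsub>C\<^esub> y" "\<lambda>x y. g x \<triangleright>\<^bsub>C\<^esub> y" A C] assms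
  by (simp add: dual_act_def)

lemma dual_mult_closed:
  assumes "f \<in> carrier (dual_ring A C)" "g \<in> carrier (dual_ring A C)"
  shows "f \<otimes>\<^bsub>dual_ring A C\<^esub> g \<in> carrier (dual_ring A C)"
  unfolding dual_ring_simps
  by (intro dual_restrict right_linear_comp[OF dual_act_right_linear dual_linear] dual_linear assms)

lemma dual_mult_app: "c \<in> carrier C \<Longrightarrow> (f \<otimes>\<^bsub>dual_ring A C\<^esub> g) c = f (dual_act A C g c)"
  by (simp add: dual_ring_simps)

lemma dual_one_app: "c \<in> carrier C \<Longrightarrow> \<one>\<^bsub>dual_ring A C\<^esub> c = counit C c"
  by (simp add: dual_ring_simps)

lemma dual_add_app: "c \<in> carrier C \<Longrightarrow> (f \<oplus>\<^bsub>dual_ring A C\<^esub> g) c = f c \<oplus>\<^bsub>A\<^esub> g c"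
  by (simp add: dual_ring_simps)

lemma dual_one_closed: "\<one>\<^bsub>dual_ring A C\<^esub> \<in> carrier (dual_ring A C)"
  unfolding dual_ring_simps by (intro dual_restrict counit_right)

lemma dual_act_one:
  assumes c: "c \<in> carrier C"
  shows "dual_act A C \<one>\<^bsub>dual_ring A C\<^esub> c = c"
proof -
  have "dual_act A C \<one>\<^bsub>dual_ring A C\<^esub> c = dual_act A C (counit C) c"
    by (rule dual_act_cong) (simp add: dual_ring_simps)
  then show ?thesis by (simp add: dual_act_def counit_comult_left c)
qed

lemma dual_act_mult:
  assumes f: "f \<in> carrier (dual_ring A C)" and g: "g \<in> carrier (dual_ring A C)" and c: "c \<in> carrier C"
  shows "dual_act A C (f \<otimes>\<^bsub>dual_ring A C\<^esub> g) c = dual_act A C f (dual_act A C g c)"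
proof -
  note R = right_module_axioms and L = left_module_axioms
  have "dual_act A C f (dual_act A C g c) = tensor_lift A C C C (\<lambda>x y. f x \<triangleright>\<^bsub>C\<^esub> y)
      (tensor_map A C C C C (dual_act A C g) id (comult C c))"
    by (simp add: dual_act_def[of A C f] comult_dual_act[OF dual_linear[OF g] c])
  also have "\<dots> = tensor_lift A C C C (\<lambda>x y. f (dual_act A C g x) \<triangleright>\<^bsub>C\<^esub> id y) (comult C c)"
    by (rule tensor_lift_tensor_map[OF R L R L dual_act_right_linear[OF dual_linear[OF g]] left_linear_id(1)
          M.abelian_group_axioms dual_act_balanced[OF dual_linear[OF f]] comult_closed[OF c]])
  also have "\<dots> = dual_act A C (f \<otimes>\<^bsub>dual_ring A C\<^esub> g) c"
    unfolding dual_act_def[of A C "f \<otimes>\<^bsub>dual_ring A C\<^esub> g"]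
    by (rule fun_cong[OF tensor_lift_eqI]) (simp add: dual_ring_simps)
  finally show ?thesis by simp
qed

lemma dual_act_add:
  assumes f: "f \<in> carrier (dual_ring A C)" and g: "g \<in> carrier (dual_ring A C)" and c: "c \<in> carrier C"
  shows "dual_act A C (f \<oplus>\<^bsub>dual_ring A C\<^esub> g) c = dual_act A C f c \<oplus>\<^bsub>C\<^esub> dual_act A C g c"
proof -
  note R = right_module_axioms and L = left_module_axioms
  have s: "right_linear A C (regular A) (f \<oplus>\<^bsub>dual_ring A C\<^esub> g)"
    using f g by (simp add: dual_ring_simps right_linear_regular dual_closed dual_add dual_ract ract_closed
        R.a_ac R.l_distr)
  have app: "(f \<oplus>\<^bsub>dual_ring A C\<^esub> g) x = f x \<oplus>\<^bsub>A\<^esub> g x" if "x \<in> carrier C" for x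
    using that by (simp add: dual_ring_simps)
  show ?thesis
    unfolding dual_act_def
    by (rule additive_map_tensor_eqI[OF R L dual_act_lift_additive[OF s]
          additive_map_plus[OF M.abelian_group_axioms dual_act_lift_additive[OF dual_linear[OF f]]
            dual_act_lift_additive[OF dual_linear[OF g]]] _ comult_closed[OF c]])
      (use f g in \<open>simp add: dual_act_lift_tens[OF s] dual_act_lift_tens[OF dual_linear] dual_closed lact_add_left app\<close>)
qed

lemma dual_add_closed:
  assumes "f \<in> carrier (dual_ring A C)" "g \<in> carrier (dual_ring A C)"
  shows "f \<oplus>\<^bsub>dual_ring A C\<^esub> g \<in> carrier (dual_ring A C)"
  unfolding dual_ring_simps using assms
  by (intro dual_restrict) (simp add: right_linear_regular dual_closed dual_add dual_ract ract_closed R.a_ac R.l_distr)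

lemma dual_ring_ring: "ring (dual_ring A C)"
proof (rule ringI)
  let ?D = "dual_ring A C"
  show "abelian_group ?D"
  proof (rule abelian_groupI)
    show "\<zero>\<^bsub>?D\<^esub> \<in> carrier ?D"
      unfolding dual_ring_simps by (intro dual_restrict) (simp add: right_linear_regular)
    fix f assume f: "f \<in> carrier ?D"
    have "(\<lambda>c\<in>carrier C. \<ominus>\<^bsub>A\<^esub> f c) \<in> carrier ?D"
      using f by (intro dual_restrict)
        (simp add: right_linear_regular dual_closed dual_add dual_ract R.minus_add R.l_minus)
    moreover have "(\<lambda>c\<in>carrier C. \<ominus>\<^bsub>A\<^esub> f c) \<oplus>\<^bsub>?D\<^esub> f = \<zero>\<^bsub>?D\<^esub>"
      using f by (auto simp: dual_ring_simps dual_closed R.l_neg intro!: restrict_ext)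
    ultimately show "\<exists>g\<in>carrier ?D. g \<oplus>\<^bsub>?D\<^esub> f = \<zero>\<^bsub>?D\<^esub>" by blast
    show "\<zero>\<^bsub>?D\<^esub> \<oplus>\<^bsub>?D\<^esub> f = f"
      using f dual_extensional[OF f]
      by (intro extensionalityI[of _ "carrier C"]) (auto simp: dual_ring_simps dual_closed)
  qed (simp_all add: dual_add_closed, auto simp: dual_ring_simps(4) dual_closed R.a_ac intro!: restrict_ext)
  show "monoid ?D"
  proof (rule monoidI)
    fix f g h assume *: "f \<in> carrier ?D" "g \<in> carrier ?D" "h \<in> carrier ?D"
    show "f \<otimes>\<^bsub>?D\<^esub> g \<otimes>\<^bsub>?D\<^esub> h = f \<otimes>\<^bsub>?D\<^esub> (g \<otimes>\<^bsub>?D\<^esub> h)"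
      by (rule dual_eqI) (simp_all add: * dual_mult_closed dual_mult_app
          dual_act_mult dual_act_closed[OF dual_linear])
  next
    fix f assume f: "f \<in> carrier ?D"
    show "f \<otimes>\<^bsub>?D\<^esub> \<one>\<^bsub>?D\<^esub> = f"
      by (rule dual_eqI) (simp_all add: f dual_mult_closed dual_one_closed dual_mult_app dual_act_one)
    show "\<one>\<^bsub>?D\<^esub> \<otimes>\<^bsub>?D\<^esub> f = f"
      by (rule dual_eqI) (simp_all add: f dual_mult_closed dual_one_closed dual_mult_app dual_one_app
          counit_dual_act dual_linear dual_act_closed)
  qed (simp_all add: dual_mult_closed dual_one_closed)
  fix f g h assume *: "f \<in> carrier ?D" "g \<in> carrier ?D" "h \<in> carrier ?D"
  show "(f \<oplus>\<^bsub>?D\<^esub> g) \<otimes>\<^bsub>?D\<^esub> h = f \<otimes>\<^bsub>?D\<^esub> h \<oplus>\<^bsub>?D\<^esub> g \<otimes>\<^bsub>?D\<^esub> h"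
    by (rule dual_eqI) (simp_all add: * dual_mult_closed dual_add_closed dual_mult_app dual_add_app dual_act_closed dual_linear)
  show "h \<otimes>\<^bsub>?D\<^esub> (f \<oplus>\<^bsub>?D\<^esub> g) = h \<otimes>\<^bsub>?D\<^esub> f \<oplus>\<^bsub>?D\<^esub> h \<otimes>\<^bsub>?D\<^esub> g"
    by (rule dual_eqI) (simp_all add: * dual_mult_closed dual_add_closed dual_mult_app dual_add_app
       dual_act_add dual_add dual_act_closed dual_linear)
qed

lemma over_dual_bimodule: "bimodule (dual_ring A C) A (over_dual A C)"
proof -
  have "abelian_group (over_dual A C)"
    using M.abelian_group_axioms by (subst abelian_group_cong[of _ C]) simp_all
  moreover have "dual_act A C f (x \<oplus>\<^bsub>C\<^esub> y) = dual_act A C f x \<oplus>\<^bsub>C\<^esub> dual_act A C f y"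
    if "f \<in> carrier (dual_ring A C)" "x \<in> carrier C" "y \<in> carrier C" for f x y
    using right_linear_add[OF dual_act_right_linear[OF dual_linear]] that by blast
  moreover have "dual_act A C f (x \<triangleleft>\<^bsub>C\<^esub> a) = dual_act A C f x \<triangleleft>\<^bsub>C\<^esub> a"
    if "f \<in> carrier (dual_ring A C)" "x \<in> carrier C" "a \<in> carrier A" for f x a
    using right_linear_ract[OF dual_act_right_linear[OF dual_linear]] that by blast
  ultimately show ?thesis
    using dual_ring_ring right_module_axioms
    unfolding bimodule_def bimodule_axioms_def left_module_def left_module_axioms_def
      right_module_def right_module_axioms_def
    by (simp add: dual_act_closed dual_linear dual_act_add dual_act_mult dual_act_one)
qed

text \<open>Through this ring homomorphism the dual ring induces the given left action of \<open>A\<close> on \<open>C\<close>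
  (\<open>dual_act_iota\<close>), and the left action of \<open>A\<close> on the dual ring (\<open>iota_mult_app\<close>).\<close>

definition iota where "iota a = (\<lambda>c\<in>carrier C. a \<otimes>\<^bsub>A\<^esub> counit C c)"

lemma iota_closed: "a \<in> carrier A \<Longrightarrow> iota a \<in> carrier (dual_ring A C)"
  unfolding iota_def
  by (rule dual_restrict) (simp add: right_linear_regular counit_simps R.r_distr R.m_assoc)

lemma iota_app: "c \<in> carrier C \<Longrightarrow> iota a c = a \<otimes>\<^bsub>A\<^esub> counit C c"
  by (simp add: iota_def)

lemma dual_act_iota:
  assumes a: "a \<in> carrier A" and c: "c \<in> carrier C"
  shows "dual_act A C (iota a) c = a \<triangleright>\<^bsub>C\<^esub> c"
proof -
  note R = right_module_axioms and L = left_module_axioms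
  have act: "additive_map C C (\<lambda>y. a \<triangleright>\<^bsub>C\<^esub> y)"
    using a by (simp add: additive_map_iff lact_closed lact_add_right)
  have "tensor_lift A C C C (\<lambda>x y. iota a x \<triangleright>\<^bsub>C\<^esub> y) (comult C c) =
      a \<triangleright>\<^bsub>C\<^esub> tensor_lift A C C C (\<lambda>x y. counit C x \<triangleright>\<^bsub>C\<^esub> y) (comult C c)"
    by (rule additive_map_tensor_eqI[OF R L dual_act_lift_additive[OF dual_linear[OF iota_closed[OF a]]]
          additive_map_comp[OF dual_act_lift_additive[OF counit_right] act] _ comult_closed[OF c]])
      (simp add: dual_act_lift_tens[OF dual_linear[OF iota_closed[OF a]]] dual_act_lift_tens[OF counit_right]
        iota_app a counit_simps lact_mult)
  then show ?thesis by (simp add: dual_act_def counit_comult_left c)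
qed

lemma iota_mult_app: "a \<in> carrier A \<Longrightarrow> f \<in> carrier (dual_ring A C) \<Longrightarrow> c \<in> carrier C \<Longrightarrow>
    (iota a \<otimes>\<^bsub>dual_ring A C\<^esub> f) c = a \<otimes>\<^bsub>A\<^esub> f c"
  by (simp add: dual_ring_simps iota_app dual_act_closed counit_dual_act dual_linear)

lemma iota_mult: "a \<in> carrier A \<Longrightarrow> b \<in> carrier A \<Longrightarrow>
    iota (a \<otimes>\<^bsub>A\<^esub> b) = iota a \<otimes>\<^bsub>dual_ring A C\<^esub> iota b"
  by (rule dual_eqI) (simp_all add: iota_closed dual_mult_closed iota_mult_app, simp add: iota_app counit_simps R.m_assoc)

lemma iota_add: "a \<in> carrier A \<Longrightarrow> b \<in> carrier A \<Longrightarrow>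
    iota (a \<oplus>\<^bsub>A\<^esub> b) = iota a \<oplus>\<^bsub>dual_ring A C\<^esub> iota b"
  by (rule dual_eqI) (simp_all add: iota_closed dual_add_closed, simp add: iota_app dual_ring_simps counit_simps R.l_distr)

lemma iota_one: "iota \<one>\<^bsub>A\<^esub> = \<one>\<^bsub>dual_ring A C\<^esub>"
  by (rule dual_eqI) (simp_all add: iota_closed dual_one_closed, simp add: iota_app dual_ring_simps counit_simps)

end

section \<open>The functors and their adjunction\<close>

lemma right_module_cong:
  assumes "carrier M = carrier N" "ring.add M = ring.add N" "ring.zero M = ring.zero N" "ract M = ract N"
  shows "right_module R M \<longleftrightarrow> right_module R N"
  using assms abelian_group_cong[of M N]
  unfolding right_module_def right_module_axioms_def by simp

text \<open>Closure under negatives follows from \<open>-x = x (-1)\<close>.\<close>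

lemma right_module_submodule:
  assumes M: "right_module R M"
    and N: "carrier N \<subseteq> carrier M" "ring.add N = ring.add M" "ring.zero N = ring.zero M" "ract N = ract M"
    and zero: "\<zero>\<^bsub>M\<^esub> \<in> carrier N"
    and add: "\<And>x y. x \<in> carrier N \<Longrightarrow> y \<in> carrier N \<Longrightarrow> x \<oplus>\<^bsub>M\<^esub> y \<in> carrier N"
    and ract: "\<And>x r. x \<in> carrier N \<Longrightarrow> r \<in> carrier R \<Longrightarrow> x \<triangleleft>\<^bsub>M\<^esub> r \<in> carrier N"
  shows "right_module R N"
proof -
  interpret M: right_module R M by fact
  have neg: "x \<triangleleft>\<^bsub>M\<^esub> (\<ominus>\<^bsub>R\<^esub> \<one>\<^bsub>R\<^esub>) \<oplus>\<^bsub>M\<^esub> x = \<zero>\<^bsub>M\<^esub>" if x: "x \<in> carrier M" for x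
  proof -
    have add: "additive_map R M (\<lambda>r. x \<triangleleft>\<^bsub>M\<^esub> r)"
      using x by (simp add: additive_map_iff M.ract_closed M.ract_add_right)
    have "x \<triangleleft>\<^bsub>M\<^esub> (\<ominus>\<^bsub>R\<^esub> \<one>\<^bsub>R\<^esub>) = \<ominus>\<^bsub>M\<^esub> x"
      using additive_map_neg[OF M.S.abelian_group_axioms M.M.abelian_group_axioms add] x
      by (simp add: M.ract_one)
    then show ?thesis using x by (simp add: M.M.l_neg)
  qed
  have sub: "x \<in> carrier N \<Longrightarrow> x \<in> carrier M" for x using N(1) by blast
  have "abelian_group N"
  proof (rule abelian_groupI)
    fix x assume x: "x \<in> carrier N"
    show "\<exists>y\<in>carrier N. y \<oplus>\<^bsub>N\<^esub> x = \<zero>\<^bsub>N\<^esub>"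
      using x by (intro bexI[of _ "x \<triangleleft>\<^bsub>M\<^esub> (\<ominus>\<^bsub>R\<^esub> \<one>\<^bsub>R\<^esub>)"]) (simp_all add: N neg sub ract)
  qed (simp_all add: N zero add sub M.M.a_ac)
  then show ?thesis
    unfolding right_module_def right_module_axioms_def
    by (simp add: N ract sub M.S.ring_axioms M.ract_add_left M.ract_add_right M.ract_mult M.ract_one)
qed

lemma comodule_homI:
  assumes "right_linear A M N f" "f \<in> extensional (carrier M)"
    and "\<And>m. m \<in> carrier M \<Longrightarrow> rcoact N (f m) = tensor_map A M C N C f id (rcoact M m)"
  shows "f \<in> comodule_hom A C M N"
  using assms by (simp add: comodule_hom_def right_hom_def)

lemma comodule_hom_linear: "f \<in> comodule_hom A C M N \<Longrightarrow> right_linear A M N f"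
  and comodule_hom_rcoact: "f \<in> comodule_hom A C M N \<Longrightarrow> m \<in> carrier M \<Longrightarrow>
    rcoact N (f m) = tensor_map A M C N C f id (rcoact M m)"
  by (simp_all add: comodule_hom_def right_hom_def)

text \<open>The module \<open>Hom\<^sub>A(C, M)\<close> over the dual ring, of which \<open>G(M)\<close> is a submodule when \<open>M\<close> is a
  comodule.\<close>

definition hom_mod :: "'a ring \<Rightarrow> ('a, 'c) coring \<Rightarrow> ('k, 'm, 'a, 'z) bimod_scheme
    \<Rightarrow> (unit, 'c \<Rightarrow> 'm, 'c \<Rightarrow> 'a) bimod"
  where "hom_mod A C M = \<lparr>carrier = right_hom A C M,
    monoid.mult = undefined, one = undefined,
    ring.zero = (\<lambda>c\<in>carrier C. \<zero>\<^bsub>M\<^esub>),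
    ring.add = (\<lambda>p q. \<lambda>c\<in>carrier C. p c \<oplus>\<^bsub>M\<^esub> q c),
    lact = (\<lambda>_ p. p),
    ract = (\<lambda>p f. \<lambda>c\<in>carrier C. p (dual_act A C f c))\<rparr>"

lemma hom_mod_simps [simp]:
  "carrier (hom_mod A C M) = right_hom A C M"
  "\<zero>\<^bsub>hom_mod A C M\<^esub> = (\<lambda>c\<in>carrier C. \<zero>\<^bsub>M\<^esub>)"
  "p \<oplus>\<^bsub>hom_mod A C M\<^esub> q = (\<lambda>c\<in>carrier C. p c \<oplus>\<^bsub>M\<^esub> q c)"
  "p \<triangleleft>\<^bsub>hom_mod A C M\<^esub> f = (\<lambda>c\<in>carrier C. p (dual_act A C f c))"
  by (simp_all add: hom_mod_def)

lemma right_hom_self_comodule: "right_hom A (self_comodule C) M = right_hom A C M"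
  by (simp add: right_hom_def right_linear_def additive_map_iff)

lemma G_obj_simps [simp]:
  "carrier (G_obj A C M) = comodule_hom A C (self_comodule C) M"
  "\<zero>\<^bsub>G_obj A C M\<^esub> = (\<lambda>c\<in>carrier C. \<zero>\<^bsub>M\<^esub>)"
  "p \<oplus>\<^bsub>G_obj A C M\<^esub> q = (\<lambda>c\<in>carrier C. p c \<oplus>\<^bsub>M\<^esub> q c)"
  "p \<triangleleft>\<^bsub>G_obj A C M\<^esub> f = (\<lambda>c\<in>carrier C. p (dual_act A C f c))"
  by (simp_all add: G_obj_def)

lemma G_obj_iff: "p \<in> comodule_hom A C (self_comodule C) M \<longleftrightarrow> p \<in> right_hom A C M \<and>
    (\<forall>c\<in>carrier C. rcoact M (p c) = tensor_map A C C M C p id (comult C c))"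
  by (simp add: comodule_hom_def right_hom_self_comodule)

lemma F_obj_simps [simp]:
  "carrier (F_obj A C N) = carrier (tensor_group (dual_ring A C) N (over_dual A C))"
  "ring.add (F_obj A C N) = ring.add (tensor_group (dual_ring A C) N (over_dual A C))"
  "ring.zero (F_obj A C N) = ring.zero (tensor_group (dual_ring A C) N (over_dual A C))"
  "ract (F_obj A C N) = ract (tensor (dual_ring A C) N (over_dual A C))"
  by (simp_all add: F_obj_def Let_def bimod.extend_def)

lemma additive_map_F_obj [simp]:
  "additive_map X (F_obj A C N) f \<longleftrightarrow> additive_map X (tensor_group (dual_ring A C) N (over_dual A C)) f"
  by (simp add: additive_map_iff)

lemma additive_map_from_F_obj [simp]:
  "additive_map (F_obj A C N) X f \<longleftrightarrow> additive_map (tensor_group (dual_ring A C) N (over_dual A C)) X f"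
  by (simp add: additive_map_iff)

lemma rcoact_F_obj: "rcoact (F_obj A C N) = tensor_lift (dual_ring A C) N (over_dual A C)
    (tensor_group A (F_obj A C N) C)
    (\<lambda>n c. tensor_map A C C (F_obj A C N) C (tens (dual_ring A C) N (over_dual A C) n) id (comult C c))"
proof -
  let ?T = "tensor (dual_ring A C) N (over_dual A C)"
  have "rcoact (F_obj A C N) = tensor_lift (dual_ring A C) N (over_dual A C) (tensor_group A ?T C)
    (\<lambda>n c. tensor_lift A C C (tensor_group A ?T C)
      (\<lambda>x y. tens A ?T C (tens (dual_ring A C) N (over_dual A C) n x) y) (comult C c))"
    by (simp add: F_obj_def Let_def bimod.extend_def rcomod.fields_def)
  moreover have "tensor_group A ?T C = tensor_group A (F_obj A C N) C"
    by (rule tensor_group_cong') simp_all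
  moreover have "tens A ?T C = tens A (F_obj A C N) C"
    by (rule tens_cong') simp_all
  ultimately show ?thesis by (simp add: tensor_map_def)
qed

context coring
begin

abbreviation "D \<equiv> dual_ring A C"
abbreviation "DC \<equiv> over_dual A C"
abbreviation "mapC M N f \<equiv> tensor_map A M C N C f id"

lemma over_dual_left: "left_module D DC"
  using over_dual_bimodule by (rule bimodule.axioms)

context
  fixes M N f
  assumes M: "right_module A M" and N: "right_module A N" and f: "right_linear A M N f"
begin

lemma mapC_additive: "additive_map (tensor_group A M C) (tensor_group A N C) (mapC M N f)"
  by (rule tensor_map_additive[OF M left_module_axioms N left_module_axioms f left_linear_id(1)])

lemma mapC_closed: "t \<in> carrier (tensor_group A M C) \<Longrightarrow> mapC M N f t \<in> carrier (tensor_group A N C)"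
  by (rule additive_map_closed[OF mapC_additive])

lemma mapC_tens: "x \<in> carrier M \<Longrightarrow> c \<in> carrier C \<Longrightarrow> mapC M N f (tens A M C x c) = tens A N C (f x) c"
  using tensor_map_tens[OF M left_module_axioms N left_module_axioms f left_linear_id(1)] by simp

lemma mapC_right_linear: "right_linear A (tensor A M C) (tensor A N C) (mapC M N f)"
  by (rule tensor_map_right_linear[OF M bimodule_axioms N bimodule_axioms f left_linear_id(1) right_linear_id(1)])

lemma mapC_comp:
  assumes P: "right_module A P" and g: "right_linear A N P g" and t: "t \<in> carrier (tensor_group A M C)"
  shows "mapC N P g (mapC M N f t) = mapC M P (\<lambda>x. g (f x)) t"
  unfolding tensor_map_def[of A N C P C g id] tensor_map_def[of A M C P C]
  using tensor_lift_tensor_map[OF M left_module_axioms N left_module_axioms f left_linear_id(1)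
      tensor_C_abelian_group[OF P] _ t, of "\<lambda>x y. tens A P C (g x) (id y)"]
  by (simp add: balanced_def right_linear_closed[OF g] right_linear_add[OF g] right_linear_ract[OF g]
      tens_closed[OF P left_module_axioms] tens_add_left[OF P left_module_axioms]
      tens_add_right[OF P left_module_axioms] tens_balanced[OF P left_module_axioms])

end

lemma mapC_cong: "(\<And>x. x \<in> carrier M \<Longrightarrow> f x = g x) \<Longrightarrow> mapC M N f = mapC M N g"
  by (rule tensor_map_eqI) simp_all

lemma mapC_ident:
  assumes "right_module A M" "\<And>x. x \<in> carrier M \<Longrightarrow> f x = x" "t \<in> carrier (tensor_group A M C)"
  shows "mapC M M f t = t"
  using assms by (intro tensor_map_ident left_module_axioms) simp_all

subsection \<open>The modules of maps from the coring\<close>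

lemma hom_mod_right_module:
  assumes M: "right_module A M"
  shows "right_module D (hom_mod A C M)"
proof -
  interpret M: right_module A M by fact
  let ?H = "right_hom A C M"
  have cl: "p \<in> ?H \<Longrightarrow> c \<in> carrier C \<Longrightarrow> p c \<in> carrier M" for p c
    by (rule right_linear_closed[OF right_hom_linear])
  have ad: "p \<in> ?H \<Longrightarrow> c \<in> carrier C \<Longrightarrow> c' \<in> carrier C \<Longrightarrow> p (c \<oplus>\<^bsub>C\<^esub> c') = p c \<oplus>\<^bsub>M\<^esub> p c'" for p c c'
    by (rule right_linear_add[OF right_hom_linear])
  have ra: "p \<in> ?H \<Longrightarrow> c \<in> carrier C \<Longrightarrow> a \<in> carrier A \<Longrightarrow> p (c \<triangleleft>\<^bsub>C\<^esub> a) = p c \<triangleleft>\<^bsub>M\<^esub> a" for p c a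
    by (rule right_linear_ract[OF right_hom_linear])
  have ext: "p \<in> ?H \<Longrightarrow> (\<lambda>c\<in>carrier C. p c) = p" for p
    using right_hom_extensional extensional_restrict by blast
  have lin: "(\<lambda>c\<in>carrier C. q c) \<in> ?H" if "right_linear A C M q" for q
    using that by (rule right_hom_restrict[OF right_module_axioms])
  have sum: "(\<lambda>c\<in>carrier C. p c \<oplus>\<^bsub>M\<^esub> q c) \<in> ?H" if "p \<in> ?H" "q \<in> ?H" for p q
    using that by (intro lin) (simp add: right_linear_def additive_map_iff cl ad ra M.M.a_ac M.ract_add_left)
  have zero_ract: "\<zero>\<^bsub>M\<^esub> \<triangleleft>\<^bsub>M\<^esub> a = \<zero>\<^bsub>M\<^esub>" if "a \<in> carrier A" for a
    using additive_map_zero[OF M.M.abelian_group_axioms M.M.abelian_group_axioms, of "\<lambda>x. x \<triangleleft>\<^bsub>M\<^esub> a"] that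
    by (simp add: additive_map_iff M.ract_closed M.ract_add_left)
  have zero: "(\<lambda>c\<in>carrier C. \<zero>\<^bsub>M\<^esub>) \<in> ?H"
    by (intro lin) (simp add: right_linear_def additive_map_iff zero_ract)
  have neg_ract: "(\<ominus>\<^bsub>M\<^esub> x) \<triangleleft>\<^bsub>M\<^esub> a = \<ominus>\<^bsub>M\<^esub> (x \<triangleleft>\<^bsub>M\<^esub> a)" if "a \<in> carrier A" "x \<in> carrier M" for x a
    using additive_map_neg[OF M.M.abelian_group_axioms M.M.abelian_group_axioms, of "\<lambda>x. x \<triangleleft>\<^bsub>M\<^esub> a"] that
    by (simp add: additive_map_iff M.ract_closed M.ract_add_left)
  have neg: "(\<lambda>c\<in>carrier C. \<ominus>\<^bsub>M\<^esub> p c) \<in> ?H" if "p \<in> ?H" for p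
    using that by (intro lin) (simp add: right_linear_def additive_map_iff cl ad ra M.M.minus_add neg_ract)
  have act: "(\<lambda>c\<in>carrier C. p (dual_act A C f c)) \<in> ?H" if "p \<in> ?H" "f \<in> carrier D" for p f
    by (intro lin right_linear_comp[OF dual_act_right_linear[OF dual_linear] right_hom_linear] that)
  have "abelian_group (hom_mod A C M)"
  proof (rule abelian_groupI)
    fix p assume p: "p \<in> carrier (hom_mod A C M)"
    then show "\<exists>q\<in>carrier (hom_mod A C M). q \<oplus>\<^bsub>hom_mod A C M\<^esub> p = \<zero>\<^bsub>hom_mod A C M\<^esub>"
      by (intro bexI[of _ "\<lambda>c\<in>carrier C. \<ominus>\<^bsub>M\<^esub> p c"])
        (auto simp: neg cl M.M.l_neg cong: restrict_cong)
    show "\<zero>\<^bsub>hom_mod A C M\<^esub> \<oplus>\<^bsub>hom_mod A C M\<^esub> p = p"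
      using p by (simp add: cl ext cong: restrict_cong)
  qed (simp_all add: sum zero cl M.M.a_ac cong: restrict_cong)
  then show ?thesis
    unfolding right_module_def right_module_axioms_def
    by (auto simp: dual_ring_ring sum act cl ad dual_act_add dual_act_closed dual_linear dual_act_mult
        dual_act_one ext cong: restrict_cong)
qed

lemma G_obj_subset: "comodule_hom A C (self_comodule C) M \<subseteq> right_hom A C M"
  by (auto simp: G_obj_iff)

lemma G_obj_act_closed:
  assumes M: "right_comodule A C M" and p: "p \<in> comodule_hom A C (self_comodule C) M"
    and f: "f \<in> carrier D"
  shows "(\<lambda>c\<in>carrier C. p (dual_act A C f c)) \<in> comodule_hom A C (self_comodule C) M"
proof -
  interpret M: right_comodule A C M by fact
  have R: "right_module A M" by (rule M.M.right_module_axioms)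
  note l = dual_act_right_linear[OF dual_linear[OF f]]
  from p have p': "p \<in> right_hom A C M" "c \<in> carrier C \<Longrightarrow> rcoact M (p c) = mapC C M p (comult C c)" for c
    by (simp_all add: G_obj_iff)
  have 1: "mapC C M (\<lambda>c\<in>carrier C. p (dual_act A C f c)) = mapC C M (\<lambda>c. p (dual_act A C f c))"
    by (rule mapC_cong) simp
  show ?thesis
    unfolding G_obj_iff
  proof (intro conjI ballI)
    show "(\<lambda>c\<in>carrier C. p (dual_act A C f c)) \<in> right_hom A C M"
      by (intro right_hom_restrict right_module_axioms right_linear_comp[OF l right_hom_linear[OF p'(1)]])
    show "rcoact M ((\<lambda>c\<in>carrier C. p (dual_act A C f c)) c) =
        mapC C M (\<lambda>c\<in>carrier C. p (dual_act A C f c)) (comult C c)" if c: "c \<in> carrier C" for c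
      unfolding 1
      using c mapC_comp[OF right_module_axioms right_module_axioms l R right_hom_linear[OF p'(1)] comult_closed[OF c]]
      by (simp add: p' dual_act_closed dual_linear f comult_dual_act)
  qed
qed

lemma G_right_module:
  assumes M: "right_comodule A C M"
  shows "right_module D (G_obj A C M)"
proof -
  interpret M: right_comodule A C M by fact
  have R: "right_module A M" by (rule M.M.right_module_axioms)
  interpret H: right_module D "hom_mod A C M" by (rule hom_mod_right_module[OF R])
  note H = H.M.zero_closed H.M.a_closed
  have CR: "right_module A C" by (rule right_module_axioms)
  interpret MC: abelian_group "tensor_group A M C" by (rule tensor_C_abelian_group[OF R])
  have zero: "(\<lambda>c\<in>carrier C. \<zero>\<^bsub>M\<^esub>) \<in> right_hom A C M" using H(1) by simp
  have sum: "(\<lambda>c\<in>carrier C. p c \<oplus>\<^bsub>M\<^esub> q c) \<in> right_hom A C M" if "p \<in> right_hom A C M" "q \<in> right_hom A C M" for p q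
    using H(2)[of p q] that by simp
  have cl: "p c \<in> carrier M" if "p \<in> right_hom A C M" "c \<in> carrier C" for p c
    using that by (rule right_linear_closed[OF right_hom_linear])
  have map0: "\<zero>\<^bsub>tensor_group A M C\<^esub> = mapC C M (\<lambda>c\<in>carrier C. \<zero>\<^bsub>M\<^esub>) t" if t: "t \<in> carrier (tensor_group A C C)" for t
    by (rule additive_map_tensor_eqI[OF CR left_module_axioms _ mapC_additive[OF CR R right_hom_linear[OF zero]] _ t])
      (use additive_map_zero[OF M.M.M.abelian_group_axioms MC.abelian_group_axioms tens_additive_left[OF R left_module_axioms]]
       in \<open>simp_all add: additive_map_iff mapC_tens[OF CR R right_hom_linear[OF zero]]\<close>)
  have maps: "mapC C M (\<lambda>c\<in>carrier C. p c \<oplus>\<^bsub>M\<^esub> q c) t = mapC C M p t \<oplus>\<^bsub>tensor_group A M C\<^esub> mapC C M q t"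
    if p: "p \<in> right_hom A C M" and q: "q \<in> right_hom A C M" and t: "t \<in> carrier (tensor_group A C C)" for p q t
    by (rule additive_map_tensor_eqI[OF CR left_module_axioms mapC_additive[OF CR R right_hom_linear[OF sum[OF p q]]]
        additive_map_plus[OF MC.abelian_group_axioms mapC_additive[OF CR R right_hom_linear[OF p]]
           mapC_additive[OF CR R right_hom_linear[OF q]]] _ t])
     (simp add: mapC_tens[OF CR R right_hom_linear[OF sum[OF p q]]] mapC_tens[OF CR R right_hom_linear[OF p]]
        mapC_tens[OF CR R right_hom_linear[OF q]] tens_add_left[OF R left_module_axioms] cl p q)
  show ?thesis
  proof (rule right_module_submodule[OF hom_mod_right_module[OF R]])
    have "rcoact M \<zero>\<^bsub>M\<^esub> = \<zero>\<^bsub>tensor_group A M C\<^esub>"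
      using additive_map_zero[OF M.M.M.abelian_group_axioms MC.abelian_group_axioms M.rcoact_additive] .
    then show "\<zero>\<^bsub>hom_mod A C M\<^esub> \<in> carrier (G_obj A C M)"
      by (simp add: G_obj_iff zero comult_closed map0[symmetric])
    fix p assume p: "p \<in> carrier (G_obj A C M)"
    show "p \<triangleleft>\<^bsub>hom_mod A C M\<^esub> f \<in> carrier (G_obj A C M)" if "f \<in> carrier D" for f
      using G_obj_act_closed[OF M] p that by simp
    fix q assume q: "q \<in> carrier (G_obj A C M)"
    from p q show "p \<oplus>\<^bsub>hom_mod A C M\<^esub> q \<in> carrier (G_obj A C M)"
      by (simp add: G_obj_iff sum maps comult_closed additive_map_add[OF M.rcoact_additive] cl)
  qed (use G_obj_subset in \<open>auto simp: fun_eq_iff\<close>)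
qed

subsection \<open>The comodules induced from modules\<close>

context
  fixes N :: "(unit, 'n, 'c \<Rightarrow> 'a) bimod"
  assumes N: "right_module D N"
begin

interpretation N: right_module D N by (fact N)
interpretation DC: bimodule D A DC by (rule over_dual_bimodule)

private abbreviation (input) "FN \<equiv> F_obj A C N"
private abbreviation (input) "k \<equiv> tens D N DC"
private abbreviation (input) "TF \<equiv> tensor_group D N DC"

lemma F_right_module: "right_module A (F_obj A C N)"
  by (subst right_module_cong[of _ "tensor D N DC"])
    (simp_all add: tensor_right_module[OF N over_dual_bimodule])

interpretation FN: right_module A FN by (rule F_right_module)

lemma tens_right_linear:
  assumes n: "n \<in> carrier N"
  shows "right_linear A C (F_obj A C N) (tens D N DC n)"
  using n tens_ract[OF N over_dual_bimodule]
  by (simp add: right_linear_def additive_map_iff tens_closed[OF N over_dual_left]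
      tens_add_right[OF N over_dual_left, unfolded over_dual_simps])

private lemmas map_n_additive = mapC_additive[OF right_module_axioms F_right_module tens_right_linear]
private lemmas map_n_tens = mapC_tens[OF right_module_axioms F_right_module tens_right_linear]

private lemma FC_abelian: "abelian_group (tensor_group A (F_obj A C N) C)"
  by (rule tensor_C_abelian_group[OF F_right_module])

text \<open>That \<open>n f \<otimes> c\<close> and \<open>n \<otimes> f \<cdot> c\<close> have the same image is the colinearity of the action of \<open>f\<close> on \<open>C\<close>.\<close>

private lemma coact_balanced: "balanced D N DC (tensor_group A (F_obj A C N) C)
    (\<lambda>n c. mapC C FN (k n) (comult C c))"
proof (rule balancedI)
  note R = right_module_axioms and L = left_module_axioms
  fix n n' c assume *: "n \<in> carrier N" "n' \<in> carrier N" "c \<in> carrier DC"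
  then have t: "comult C c \<in> carrier (tensor_group A C C)" by (simp add: comult_closed)
  have n: "n \<oplus>\<^bsub>N\<^esub> n' \<in> carrier N" using * by simp
  show "mapC C FN (k (n \<oplus>\<^bsub>N\<^esub> n')) (comult C c) =
    mapC C FN (k n) (comult C c) \<oplus>\<^bsub>tensor_group A FN C\<^esub> mapC C FN (k n') (comult C c)"
    by (rule additive_map_tensor_eqI[OF R L map_n_additive[OF n]
          additive_map_plus[OF FC_abelian map_n_additive[OF *(1)] map_n_additive[OF *(2)]] _ t])
      (use * in \<open>simp add: map_n_tens tens_add_left[OF N over_dual_left]
          tens_add_left[OF F_right_module L, unfolded F_obj_simps] tens_closed[OF N over_dual_left]\<close>)
next
  note R = right_module_axioms and L = left_module_axioms
  fix n f c assume *: "n \<in> carrier N" "f \<in> carrier D" "c \<in> carrier DC"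
  then have t: "comult C c \<in> carrier (tensor_group A C C)" by (simp add: comult_closed)
  have n: "n \<triangleleft>\<^bsub>N\<^esub> f \<in> carrier N" using * N.ract_closed by simp
  note l = dual_act_right_linear[OF dual_linear[OF *(2)]]
  have "mapC C FN (k n) (comult C (f \<triangleright>\<^bsub>DC\<^esub> c)) = mapC C FN (k n) (mapC C C (dual_act A C f) (comult C c))"
    using * by (simp add: comult_dual_act dual_linear)
  also have "\<dots> = mapC C FN (\<lambda>c. k n (dual_act A C f c)) (comult C c)"
    by (rule mapC_comp[OF R R l F_right_module tens_right_linear[OF *(1)] t])
  also have "\<dots> = mapC C FN (k (n \<triangleleft>\<^bsub>N\<^esub> f)) (comult C c)"
    using * by (intro fun_cong[OF mapC_cong]) (simp add: tens_balanced[OF N over_dual_left])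
  finally show "mapC C FN (k (n \<triangleleft>\<^bsub>N\<^esub> f)) (comult C c) = mapC C FN (k n) (comult C (f \<triangleright>\<^bsub>DC\<^esub> c))" by simp
qed (simp_all add: additive_map_closed[OF map_n_additive] comult_closed
   additive_map_add[OF comult_additive] additive_map_add[OF map_n_additive])

lemma rcoact_F_additive: "additive_map TF (tensor_group A (F_obj A C N) C) (rcoact (F_obj A C N))"
  unfolding rcoact_F_obj by (rule tensor_lift_additive[OF N over_dual_left FC_abelian coact_balanced])

text \<open>By this formula \<open>c \<mapsto> n \<otimes> c\<close> is compatible with the coactions of \<open>C\<close> and \<open>F(N)\<close>, and so \<open>F(N)\<close>
  inherits the comodule axioms from \<open>C\<close>.\<close>

lemma rcoact_F_tens: "n \<in> carrier N \<Longrightarrow> c \<in> carrier C \<Longrightarrow>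
    rcoact (F_obj A C N) (tens D N DC n c) = mapC C (F_obj A C N) (tens D N DC n) (comult C c)"
  unfolding rcoact_F_obj using tensor_lift_tens[OF N over_dual_left FC_abelian coact_balanced] by simp

lemma F_right_comodule: "right_comodule A C (F_obj A C N)"
proof -
  note R = right_module_axioms and L = left_module_axioms and F = F_right_module
  note NF = N over_dual_left
  have lin: "right_linear A FN (tensor A FN C) (rcoact FN)"
  proof (rule right_linearI)
    show "additive_map FN (tensor A FN C) (rcoact FN)"
      using rcoact_F_additive by (simp add: additive_map_iff)
    fix a x assume a: "a \<in> carrier A" and x: "x \<in> carrier FN"
    have x': "x \<in> carrier TF" using x by simp
    note ra = tensor_ract_additive[OF N over_dual_bimodule a]
    note ra' = tensor_ract_additive[OF F bimodule_axioms a]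
    have "rcoact FN (x \<triangleleft>\<^bsub>tensor D N DC\<^esub> a) = rcoact FN x \<triangleleft>\<^bsub>tensor A FN C\<^esub> a"
    proof (rule additive_map_tensor_eqI[OF NF additive_map_comp[OF ra rcoact_F_additive]
          additive_map_comp[OF rcoact_F_additive ra'] _ x'])
      fix n c assume *: "n \<in> carrier N" "c \<in> carrier DC"
      have "mapC C FN (k n) (comult C c \<triangleleft>\<^bsub>tensor A C C\<^esub> a) = mapC C FN (k n) (comult C c) \<triangleleft>\<^bsub>tensor A FN C\<^esub> a"
        using right_linear_ract[OF mapC_right_linear[OF R F tens_right_linear[OF *(1)]] a] * by (simp add: comult_closed)
      then show "rcoact FN (k n c \<triangleleft>\<^bsub>tensor D N DC\<^esub> a) = rcoact FN (k n c) \<triangleleft>\<^bsub>tensor A FN C\<^esub> a"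
        using * a tens_ract[OF N over_dual_bimodule a *] right_linear_ract[OF comult_right a]
        by (simp add: rcoact_F_tens ract_closed)
    qed
    then show "rcoact FN (x \<triangleleft>\<^bsub>FN\<^esub> a) = rcoact FN x \<triangleleft>\<^bsub>tensor A FN C\<^esub> a" by simp
  qed
  have FC: "right_module A (tensor A FN C)" by (rule tensor_C_right_module[OF F])
  note map_r = mapC_additive[OF F FC lin]
  note idD = F L F bimodule.axioms(1)[OF CC_bimodule] right_linear_id(1) comult_left
  have bal: "balanced A FN C FN (\<lambda>x c. x \<triangleleft>\<^bsub>FN\<^esub> counit C c)"
    using FN.ract_closed FN.ract_add_left FN.ract_add_right FN.ract_mult
    by (intro balancedI) (simp_all add: counit_simps)
  note l = tensor_lift_additive[OF F L FN.M.abelian_group_axioms bal]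
  have along: "tensor_assoc A A FN C C (mapC FN (tensor A FN C) (rcoact FN) (rcoact FN (k n c))) =
      tensor_map A FN C FN (tensor A C C) id (comult C) (rcoact FN (k n c))"
    "tensor_lift A FN C FN (\<lambda>x c. x \<triangleleft>\<^bsub>FN\<^esub> counit C c) (rcoact FN (k n c)) = k n c"
    if "n \<in> carrier N" "c \<in> carrier C" for n c
    using right_comodule.comodule_axioms_along[OF self_right_comodule F lin, of "k n" c]
      tens_right_linear[of n] that
    by (simp_all add: rcoact_F_tens right_linear_def additive_map_iff)
  have 1: "tensor_assoc A A FN C C (mapC FN (tensor A FN C) (rcoact FN) (rcoact FN x)) =
      tensor_map A FN C FN (tensor A C C) id (comult C) (rcoact FN x)" if x: "x \<in> carrier TF" for x
    by (rule additive_map_tensor_eqI[OF NF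
          additive_map_comp[OF additive_map_comp[OF rcoact_F_additive map_r] tensor_assoc_additive[OF F bimodule_axioms L]]
          additive_map_comp[OF rcoact_F_additive tensor_map_additive[OF idD]] _ x])
      (simp add: along)
  have 2: "tensor_lift A FN C FN (\<lambda>x c. x \<triangleleft>\<^bsub>FN\<^esub> counit C c) (rcoact FN x) = x" if x: "x \<in> carrier TF" for x
    by (rule additive_map_tensor_eqI[OF NF
          additive_map_comp[OF rcoact_F_additive l] _ _ x])
      (simp_all add: along additive_map_id del: F_obj_simps)
  show ?thesis
    unfolding right_comodule_def right_comodule_axioms_def
    using coring_axioms F lin 1 2 by (simp del: F_obj_simps(2-4))
qed

lemma comodule_hom_from_F:
  assumes M: "right_comodule A C M" and f: "right_linear A (F_obj A C N) M f"
    and eq: "\<And>n c. n \<in> carrier N \<Longrightarrow> c \<in> carrier C \<Longrightarrow>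
      rcoact M (f (tens D N DC n c)) = mapC C M (\<lambda>x. f (tens D N DC n x)) (comult C c)"
    and t: "t \<in> carrier (F_obj A C N)"
  shows "rcoact M (f t) = mapC (F_obj A C N) M f (rcoact (F_obj A C N) t)"
proof -
  interpret M: right_comodule A C M by fact
  have R: "right_module A M" by (rule M.M.right_module_axioms)
  have t': "t \<in> carrier TF" using t by simp
  have f': "additive_map TF M f" using right_linear_additive[OF f] by simp
  show ?thesis
    by (rule additive_map_tensor_eqI[OF N over_dual_left additive_map_comp[OF f' M.rcoact_additive]
          additive_map_comp[OF rcoact_F_additive mapC_additive[OF F_right_module R f]] _ t'])
     (simp add: rcoact_F_tens eq mapC_comp[OF right_module_axioms F_right_module tens_right_linear R f] comult_closed)
qed

end

end

context coring
begin

text \<open>Evaluation is needed on \<open>G(M)\<close>, where it is the counit, and on all of \<open>Hom\<^sub>A(C, M)\<close>; hence the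
  parameter \<open>X\<close>, a \<open>D\<close>-module of linear maps from \<open>C\<close> to \<open>M\<close>.\<close>

definition ev :: "(unit, 'c \<Rightarrow> 'm, 'c \<Rightarrow> 'a) bimod \<Rightarrow> ('k, 'm, 'a, 'z) bimod_scheme \<Rightarrow> ('c \<Rightarrow> 'm, 'c) tens \<Rightarrow> 'm"
  where "ev X M = tensor_lift D X DC M (\<lambda>p c. p c)"

context
  fixes M :: "('k, 'm, 'a, 'z) bimod_scheme" and X :: "(unit, 'c \<Rightarrow> 'm, 'c \<Rightarrow> 'a) bimod"
  assumes M: "right_module A M" and X: "right_module D X"
    and X_sub: "carrier X \<subseteq> right_hom A C M"
    and X_add: "\<And>p q. p \<oplus>\<^bsub>X\<^esub> q = (\<lambda>c\<in>carrier C. p c \<oplus>\<^bsub>M\<^esub> q c)"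
    and X_ract: "\<And>p f. p \<triangleleft>\<^bsub>X\<^esub> f = (\<lambda>c\<in>carrier C. p (dual_act A C f c))"
begin

interpretation M: right_module A M by (fact M)

private lemma X_linear: "p \<in> carrier X \<Longrightarrow> right_linear A C M p"
  using X_sub right_hom_linear by blast

private lemma ev_balanced: "balanced D X DC M (\<lambda>p c. p c)"
  by (rule balancedI) (simp_all add: right_linear_closed[OF X_linear] right_linear_add[OF X_linear] X_add X_ract)

lemma ev_additive: "additive_map (tensor_group D X DC) M (ev X M)"
  unfolding ev_def by (rule tensor_lift_additive[OF X over_dual_left M.M.abelian_group_axioms ev_balanced])

lemma ev_tens: "p \<in> carrier X \<Longrightarrow> c \<in> carrier C \<Longrightarrow> ev X M (tens D X DC p c) = p c"
  unfolding ev_def using tensor_lift_tens[OF X over_dual_left M.M.abelian_group_axioms ev_balanced] by simp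

lemma ev_extensional: "ev X M \<in> extensional (carrier (tensor_group D X DC))"
  unfolding ev_def by (rule tensor_lift_extensional[OF X over_dual_left M.M.abelian_group_axioms ev_balanced])

lemma ev_right_linear: "right_linear A (F_obj A C X) M (ev X M)"
proof (rule right_linearI)
  show "additive_map (F_obj A C X) M (ev X M)" using ev_additive by simp
  fix a t assume a: "a \<in> carrier A" and "t \<in> carrier (F_obj A C X)"
  then have t: "t \<in> carrier (tensor_group D X DC)" by simp
  have act: "additive_map M M (\<lambda>x. x \<triangleleft>\<^bsub>M\<^esub> a)"
    using a by (simp add: additive_map_iff M.ract_closed M.ract_add_left)
  have "ev X M (t \<triangleleft>\<^bsub>tensor D X DC\<^esub> a) = ev X M t \<triangleleft>\<^bsub>M\<^esub> a"
    by (rule additive_map_tensor_eqI[OF X over_dual_left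
        additive_map_comp[OF tensor_ract_additive[OF X over_dual_bimodule a] ev_additive]
        additive_map_comp[OF ev_additive act] _ t])
      (simp add: tens_ract[OF X over_dual_bimodule a] ev_tens ract_closed a right_linear_ract[OF X_linear])
  then show "ev X M (t \<triangleleft>\<^bsub>F_obj A C X\<^esub> a) = ev X M t \<triangleleft>\<^bsub>M\<^esub> a" by simp
qed

end


lemma FG_counit_ev: "FG_counit A C M = ev (G_obj A C M) M"
  by (simp add: FG_counit_def ev_def)

lemma G_linear: "p \<in> carrier (G_obj A C M) \<Longrightarrow> right_linear A C M p"
  using G_obj_subset right_hom_linear by fastforce

context
  fixes M :: "('a, 'c, 'm) rcomod"
  assumes M: "right_comodule A C M"
begin

interpretation M: right_comodule A C M by (fact M)

private lemmas ev_facts = M.M.right_module_axioms G_right_module[OF M]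
    G_obj_subset[of M, folded G_obj_simps(1)] G_obj_simps(3) G_obj_simps(4)

lemma FG_counit_additive: "additive_map (tensor_group D (G_obj A C M) DC) M (FG_counit A C M)"
  unfolding FG_counit_ev by (rule ev_additive[OF ev_facts])

lemma FG_counit_tens: "p \<in> carrier (G_obj A C M) \<Longrightarrow> c \<in> carrier C \<Longrightarrow>
    FG_counit A C M (tens D (G_obj A C M) DC p c) = p c"
  unfolding FG_counit_ev by (rule ev_tens[OF ev_facts])

lemma FG_counit_hom: "FG_counit A C M \<in> comodule_hom A C (F_obj A C (G_obj A C M)) M"
proof (rule comodule_homI)
  show lin: "right_linear A (F_obj A C (G_obj A C M)) M (FG_counit A C M)"
    unfolding FG_counit_ev by (rule ev_right_linear[OF ev_facts])
  show "FG_counit A C M \<in> extensional (carrier (F_obj A C (G_obj A C M)))"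
    unfolding FG_counit_ev using ev_extensional[OF ev_facts] by simp
  fix t assume t: "t \<in> carrier (F_obj A C (G_obj A C M))"
  show "rcoact M (FG_counit A C M t) =
      mapC (F_obj A C (G_obj A C M)) M (FG_counit A C M) (rcoact (F_obj A C (G_obj A C M)) t)"
  proof (rule comodule_hom_from_F[OF G_right_module[OF M] M lin _ t])
    fix p c assume p: "p \<in> carrier (G_obj A C M)" and c: "c \<in> carrier C"
    have "mapC C M p (comult C c) =
        mapC C M (\<lambda>x. FG_counit A C M (tens D (G_obj A C M) DC p x)) (comult C c)"
      using p by (intro fun_cong[OF mapC_cong]) (simp add: FG_counit_tens)
    then show "rcoact M (FG_counit A C M (tens D (G_obj A C M) DC p c)) =
        mapC C M (\<lambda>x. FG_counit A C M (tens D (G_obj A C M) DC p x)) (comult C c)"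
      using p c by (simp add: FG_counit_tens G_obj_iff)
  qed
qed

end

subsection \<open>Morphisms of induced comodules\<close>

context
  fixes N :: "(unit, 'n, 'c \<Rightarrow> 'a) bimod" and N' :: "(unit, 'm, 'c \<Rightarrow> 'a) bimod" and f
  assumes N: "right_module D N" and N': "right_module D N'" and f: "f \<in> right_hom D N N'"
begin

private lemmas Fmap = N over_dual_left N' over_dual_left right_hom_linear[OF f] left_linear_id(1)

lemma F_map_additive: "additive_map (tensor_group D N DC) (tensor_group D N' DC) (F_map A C N N' f)"
  unfolding F_map_def by (rule tensor_map_additive[OF Fmap])

lemma F_map_tens: "n \<in> carrier N \<Longrightarrow> c \<in> carrier C \<Longrightarrow>
    F_map A C N N' f (tens D N DC n c) = tens D N' DC (f n) c"
  unfolding F_map_def using tensor_map_tens[OF Fmap] by simp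

lemma F_map_closed: "t \<in> carrier (tensor_group D N DC) \<Longrightarrow> F_map A C N N' f t \<in> carrier (tensor_group D N' DC)"
  by (rule additive_map_closed[OF F_map_additive])

lemma F_map_extensional: "F_map A C N N' f \<in> extensional (carrier (tensor_group D N DC))"
  unfolding F_map_def by (rule tensor_map_extensional[OF Fmap])

lemma F_map_hom: "F_map A C N N' f \<in> comodule_hom A C (F_obj A C N) (F_obj A C N')"
proof (rule comodule_homI)
  show lin: "right_linear A (F_obj A C N) (F_obj A C N') (F_map A C N N' f)"
    using tensor_map_right_linear[OF N over_dual_bimodule N' over_dual_bimodule right_hom_linear[OF f]
        left_linear_id(1) right_linear_id(1)]
    by (simp add: F_map_def right_linear_def)
  show "F_map A C N N' f \<in> extensional (carrier (F_obj A C N))"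
    using F_map_extensional by simp
  fix t assume t: "t \<in> carrier (F_obj A C N)"
  show "rcoact (F_obj A C N') (F_map A C N N' f t) =
      mapC (F_obj A C N) (F_obj A C N') (F_map A C N N' f) (rcoact (F_obj A C N) t)"
  proof (rule comodule_hom_from_F[OF N F_right_comodule[OF N'] lin _ t])
    fix n c assume n: "n \<in> carrier N" and c: "c \<in> carrier C"
    have "mapC C (F_obj A C N') (tens D N' DC (f n)) (comult C c) =
      mapC C (F_obj A C N') (\<lambda>x. F_map A C N N' f (tens D N DC n x)) (comult C c)"
      using n by (intro fun_cong[OF mapC_cong]) (simp add: F_map_tens)
    then show "rcoact (F_obj A C N') (F_map A C N N' f (tens D N DC n c)) =
      mapC C (F_obj A C N') (\<lambda>x. F_map A C N N' f (tens D N DC n x)) (comult C c)"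
      using n c by (simp add: F_map_tens rcoact_F_tens[OF N'] right_linear_closed[OF right_hom_linear[OF f]])
  qed
qed

end

lemma right_hom_comp:
  assumes "right_module R M" "f \<in> right_hom R M N" "g \<in> right_hom R N P"
  shows "compose (carrier M) g f \<in> right_hom R M P"
  using right_hom_restrict[OF assms(1) right_linear_comp[OF right_hom_linear[OF assms(2)] right_hom_linear[OF assms(3)]]]
  by (simp add: compose_def)

lemma comodule_hom_comp:
  assumes M: "right_comodule A C M" and N: "right_comodule A C N" and P: "right_comodule A C P"
    and f: "f \<in> comodule_hom A C M N" and g: "g \<in> comodule_hom A C N P"
  shows "compose (carrier M) g f \<in> comodule_hom A C M P"
proof -
  interpret M: right_comodule A C M by fact
  interpret N: right_comodule A C N by fact
  interpret P: right_comodule A C P by fact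
  have *: "mapC M P (compose (carrier M) g f) = mapC M P (\<lambda>x. g (f x))"
    by (rule mapC_cong) (simp add: compose_def)
  have "compose (carrier M) g f \<in> right_hom A M P"
    using f g by (intro right_hom_comp[OF M.M.right_module_axioms]) (auto simp: comodule_hom_def)
  then show ?thesis
    unfolding comodule_hom_def
    using mapC_comp[OF M.M.right_module_axioms N.M.right_module_axioms comodule_hom_linear[OF f]
        P.M.right_module_axioms comodule_hom_linear[OF g]]
    by (simp add: * M.rcoact_closed compose_eq comodule_hom_rcoact[OF f] comodule_hom_rcoact[OF g]
      right_linear_closed[OF comodule_hom_linear[OF f]])
qed

subsection \<open>Morphisms of modules of colinear maps\<close>

lemma G_map_app: "p \<in> carrier (G_obj A C M) \<Longrightarrow> c \<in> carrier C \<Longrightarrow> G_map A C M g p c = g (p c)"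
  by (simp add: G_map_def compose_def)

context
  fixes M :: "('a, 'c, 'm) rcomod" and N :: "('a, 'c, 'n) rcomod" and g
  assumes M: "right_comodule A C M" and N: "right_comodule A C N" and g: "g \<in> comodule_hom A C M N"
begin

lemma G_map_closed: "p \<in> carrier (G_obj A C M) \<Longrightarrow> G_map A C M g p \<in> carrier (G_obj A C N)"
  using comodule_hom_comp[OF self_right_comodule M N _ g] by (simp add: G_map_def)

lemma G_map_hom: "G_map A C M g \<in> right_hom D (G_obj A C M) (G_obj A C N)"
proof -
  interpret G: right_module D "G_obj A C M" by (rule G_right_module[OF M])
  have ext: "q = q'" if "q \<in> carrier (G_obj A C N)" "q' \<in> carrier (G_obj A C N)"
    "\<And>c. c \<in> carrier C \<Longrightarrow> q c = q' c" for q q'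
    using that G_obj_subset[of N]
    by (intro extensionalityI[of _ "carrier C"]) (auto intro: right_hom_extensional)
  interpret GN: right_module D "G_obj A C N" by (rule G_right_module[OF N])
  show ?thesis
  proof (rule right_homI[OF right_linearI])
    show "additive_map (G_obj A C M) (G_obj A C N) (G_map A C M g)"
    proof
      fix p q assume *: "p \<in> carrier (G_obj A C M)" "q \<in> carrier (G_obj A C M)"
      show "G_map A C M g (p \<oplus>\<^bsub>G_obj A C M\<^esub> q) = G_map A C M g p \<oplus>\<^bsub>G_obj A C N\<^esub> G_map A C M g q"
      proof (rule ext)
        fix c assume c: "c \<in> carrier C"
        have pq: "p \<oplus>\<^bsub>G_obj A C M\<^esub> q \<in> carrier (G_obj A C M)" using * by (rule G.M.a_closed)
        have pc: "p c \<in> carrier M" "q c \<in> carrier M"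
          using right_linear_closed[OF G_linear[OF *(1)] c] right_linear_closed[OF G_linear[OF *(2)] c] .
        from G_map_app[OF pq c, of g] show "G_map A C M g (p \<oplus>\<^bsub>G_obj A C M\<^esub> q) c =
            (G_map A C M g p \<oplus>\<^bsub>G_obj A C N\<^esub> G_map A C M g q) c"
          using * c pc by (simp add: G_map_app right_linear_add[OF comodule_hom_linear[OF g]])
      qed (use * G_map_closed in \<open>auto simp del: G_obj_simps(1,3)\<close>)
    qed (rule G_map_closed)
    fix f p assume *: "f \<in> carrier D" "p \<in> carrier (G_obj A C M)"
    show "G_map A C M g (p \<triangleleft>\<^bsub>G_obj A C M\<^esub> f) = G_map A C M g p \<triangleleft>\<^bsub>G_obj A C N\<^esub> f"
    proof (rule ext)
      fix c assume c: "c \<in> carrier C"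
      have "p \<triangleleft>\<^bsub>G_obj A C M\<^esub> f \<in> carrier (G_obj A C M)" using * G.ract_closed by blast
      from G_map_app[OF this c] show "G_map A C M g (p \<triangleleft>\<^bsub>G_obj A C M\<^esub> f) c = (G_map A C M g p \<triangleleft>\<^bsub>G_obj A C N\<^esub> f) c"
        using * c by (simp add: G_map_app dual_act_closed dual_linear)
    qed (use * G_map_closed G.ract_closed GN.ract_closed in \<open>auto simp del: G_obj_simps(1,4)\<close>)
  qed (simp add: G_map_def)
qed

end

subsection \<open>The unit and the adjunction\<close>

context
  fixes N :: "(unit, 'n, 'c \<Rightarrow> 'a) bimod"
  assumes N: "right_module D N"
begin

interpretation N: right_module D N by (fact N)

lemma FG_unit_app: "n \<in> carrier N \<Longrightarrow> c \<in> carrier C \<Longrightarrow> FG_unit A C N n c = tens D N DC n c"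
  by (simp add: FG_unit_def)

lemma FG_unit_closed:
  assumes n: "n \<in> carrier N"
  shows "FG_unit A C N n \<in> carrier (G_obj A C (F_obj A C N))"
proof -
  have e: "FG_unit A C N n = restrict (tens D N DC n) (carrier C)" using n by (simp add: FG_unit_def)
  have m: "mapC C (F_obj A C N) (restrict (tens D N DC n) (carrier C)) = mapC C (F_obj A C N) (tens D N DC n)"
    by (rule mapC_cong) simp
  show ?thesis
    unfolding G_obj_simps G_obj_iff e m
    using n by (simp add: right_hom_restrict[OF right_module_axioms tens_right_linear[OF N]] rcoact_F_tens[OF N])
qed

lemma FG_unit_hom: "FG_unit A C N \<in> right_hom D N (G_obj A C (F_obj A C N))"
proof (rule right_homI[OF right_linearI])
  show "additive_map N (G_obj A C (F_obj A C N)) (FG_unit A C N)"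
  proof
    fix n n' assume "n \<in> carrier N" "n' \<in> carrier N"
    then show "FG_unit A C N (n \<oplus>\<^bsub>N\<^esub> n') = FG_unit A C N n \<oplus>\<^bsub>G_obj A C (F_obj A C N)\<^esub> FG_unit A C N n'"
      by (auto simp: FG_unit_def tens_add_left[OF N over_dual_left] intro!: restrict_ext)
  qed (rule FG_unit_closed)
  fix f n assume "f \<in> carrier D" "n \<in> carrier N"
  then show "FG_unit A C N (n \<triangleleft>\<^bsub>N\<^esub> f) = FG_unit A C N n \<triangleleft>\<^bsub>G_obj A C (F_obj A C N)\<^esub> f"
    using tens_balanced[OF N over_dual_left]
    by (auto simp: FG_unit_def N.ract_closed dual_act_closed dual_linear intro!: restrict_ext)
qed (simp add: FG_unit_def)

end

lemma G_eqI:
  assumes "q \<in> carrier (G_obj A C N)" "q' \<in> carrier (G_obj A C N)"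
    "\<And>c. c \<in> carrier C \<Longrightarrow> q c = q' c"
  shows "q = q'"
  using assms G_obj_subset[of N]
  by (intro extensionalityI[of _ "carrier C"]) (auto intro: right_hom_extensional)

text \<open>Each of the identities is one between maps that are determined by their values at pure tensors or
  at the elements of \<open>C\<close>.\<close>

lemma adjoint_pair_coring: "adjoint_pair TYPE('u) A C"
  unfolding adjoint_pair_def Let_def
proof (intro conjI allI impI ballI; (elim conjE)?)
  fix N :: "(unit, 'u, 'c \<Rightarrow> 'a) bimod" assume N: "right_module D N"
  show "right_comodule A C (F_obj A C N)" by (rule F_right_comodule[OF N])
  show "F_map A C N N (\<lambda>n\<in>carrier N. n) = (\<lambda>t\<in>carrier (F_obj A C N). t)"
  proof (rule extensionalityI)
    have id: "(\<lambda>n\<in>carrier N. n) \<in> right_hom D N N"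
      by (rule right_hom_restrict[OF N right_linear_id(2)])
    show "F_map A C N N (\<lambda>n\<in>carrier N. n) \<in> extensional (carrier (tensor_group D N DC))"
      by (rule F_map_extensional[OF N N id])
    fix t assume t: "t \<in> carrier (tensor_group D N DC)"
    have "F_map A C N N (\<lambda>n\<in>carrier N. n) t = t"
      unfolding F_map_def by (rule tensor_map_ident[OF N over_dual_left _ _ t]) simp_all
    then show "F_map A C N N (\<lambda>n\<in>carrier N. n) t = (\<lambda>t\<in>carrier (F_obj A C N). t) t" using t by simp
  qed simp
  show "FG_unit A C N \<in> right_hom D N (G_obj A C (F_obj A C N))" by (rule FG_unit_hom[OF N])
  fix t assume "t \<in> carrier (F_obj A C N)"
  then have t: "t \<in> carrier (tensor_group D N DC)" by simp
  note F = F_right_comodule[OF N]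
  note G = G_right_module[OF F]
  note u = FG_unit_hom[OF N]
  note u_app = FG_unit_app[OF N]
  show "FG_counit A C (F_obj A C N) (F_map A C N (G_obj A C (F_obj A C N)) (FG_unit A C N) t) = t"
    by (rule additive_map_tensor_eqI[OF N over_dual_left
          additive_map_comp[OF F_map_additive[OF N G u] FG_counit_additive[OF F, unfolded additive_map_F_obj]]
          additive_map_id _ t])
      (simp add: F_map_tens[OF N G u] FG_counit_tens[OF F] FG_unit_closed[OF N] u_app del: G_obj_simps)
next
  fix M :: "('a, 'c, 'u) rcomod" assume M: "right_comodule A C M"
  interpret M: right_comodule A C M by fact
  note G = G_right_module[OF M]
  show "right_module D (G_obj A C M)" by (rule G)
  show "G_map A C M (\<lambda>m\<in>carrier M. m) = (\<lambda>p\<in>carrier (G_obj A C M). p)"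
  proof (rule extensionalityI)
    fix p assume p: "p \<in> carrier (G_obj A C M)"
    have "G_map A C M (\<lambda>m\<in>carrier M. m) p = compose (carrier C) (\<lambda>m\<in>carrier M. m) p"
      using p by (simp add: G_map_def)
    also have "\<dots> = p"
      using p G_obj_subset[of M] right_hom_extensional[of p A C M] right_linear_closed[OF G_linear[OF p]]
      by (intro extensionalityI[of _ "carrier C"]) (auto simp: compose_def)
    finally show "G_map A C M (\<lambda>m\<in>carrier M. m) p = (\<lambda>p\<in>carrier (G_obj A C M). p) p" using p by simp
  qed (simp_all add: G_map_def)
  show "FG_counit A C M \<in> comodule_hom A C (F_obj A C (G_obj A C M)) M" by (rule FG_counit_hom[OF M])
  fix p assume p: "p \<in> carrier (G_obj A C M)"
  note F = F_right_comodule[OF G]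
  note u = FG_unit_closed[OF G p]
  show "G_map A C (F_obj A C (G_obj A C M)) (FG_counit A C M) (FG_unit A C (G_obj A C M) p) = p"
    by (rule G_eqI[OF G_map_closed[OF F M FG_counit_hom[OF M] u] p])
      (use p in \<open>simp add: G_map_app[OF u] FG_unit_app[OF G] FG_counit_tens[OF M] del: G_obj_simps\<close>)
next
  fix N N' :: "(unit, 'u, 'c \<Rightarrow> 'a) bimod" and f
  assume N: "right_module D N" and N': "right_module D N'" and f: "f \<in> right_hom D N N'"
  note Ff = F_map_hom[OF N N' f]
  show "F_map A C N N' f \<in> comodule_hom A C (F_obj A C N) (F_obj A C N')" by (rule Ff)
  fix n assume n: "n \<in> carrier N"
  note F = F_right_comodule[OF N] and F' = F_right_comodule[OF N']
  have fn: "f n \<in> carrier N'" using right_linear_closed[OF right_hom_linear[OF f] n] .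
  show "FG_unit A C N' (f n) = G_map A C (F_obj A C N) (F_map A C N N' f) (FG_unit A C N n)"
    by (rule G_eqI[OF FG_unit_closed[OF N' fn] G_map_closed[OF F F' Ff FG_unit_closed[OF N n]]])
      (simp add: G_map_app[OF FG_unit_closed[OF N n]] FG_unit_app N N' n fn F_map_tens[OF N N' f])
next
  fix M M' :: "('a, 'c, 'u) rcomod" and g
  assume M: "right_comodule A C M" and M': "right_comodule A C M'" and g: "g \<in> comodule_hom A C M M'"
  note G = G_right_module[OF M] and G' = G_right_module[OF M'] and Gg = G_map_hom[OF M M' g]
  show "G_map A C M g \<in> right_hom D (G_obj A C M) (G_obj A C M')" by (rule Gg)
  fix t assume "t \<in> carrier (F_obj A C (G_obj A C M))"
  then have t: "t \<in> carrier (tensor_group D (G_obj A C M) DC)" by simp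
  show "g (FG_counit A C M t) = FG_counit A C M' (F_map A C (G_obj A C M) (G_obj A C M') (G_map A C M g) t)"
    by (rule additive_map_tensor_eqI[OF G over_dual_left
          additive_map_comp[OF FG_counit_additive[OF M] right_linear_additive[OF comodule_hom_linear[OF g]]]
          additive_map_comp[OF F_map_additive[OF G G' Gg] FG_counit_additive[OF M']] _ t])
      (simp add: FG_counit_tens[OF M] FG_counit_tens[OF M'] F_map_tens[OF G G' Gg] G_map_closed[OF M M' g]
        G_map_app del: G_obj_simps)
next
  fix N N' N'' :: "(unit, 'u, 'c \<Rightarrow> 'a) bimod" and f f'
  assume N: "right_module D N" and N': "right_module D N'" and N'': "right_module D N''"
    and f: "f \<in> right_hom D N N'" and f': "f' \<in> right_hom D N' N''"
  note ff = right_hom_comp[OF N f f']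
  show "F_map A C N N'' (compose (carrier N) f' f) =
    compose (carrier (F_obj A C N)) (F_map A C N' N'' f') (F_map A C N N' f)"
  proof (rule extensionalityI)
    show "F_map A C N N'' (compose (carrier N) f' f) \<in> extensional (carrier (tensor_group D N DC))"
      by (rule F_map_extensional[OF N N'' ff])
    fix t assume t: "t \<in> carrier (tensor_group D N DC)"
    have "F_map A C N N'' (compose (carrier N) f' f) t = F_map A C N' N'' f' (F_map A C N N' f t)"
      by (rule additive_map_tensor_eqI[OF N over_dual_left F_map_additive[OF N N'' ff]
            additive_map_comp[OF F_map_additive[OF N N' f] F_map_additive[OF N' N'' f']] _ t])
        (simp add: F_map_tens[OF N N'' ff] F_map_tens[OF N N' f] F_map_tens[OF N' N'' f'] compose_eq
          right_linear_closed[OF right_hom_linear[OF f]])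
    then show "F_map A C N N'' (compose (carrier N) f' f) t =
        compose (carrier (F_obj A C N)) (F_map A C N' N'' f') (F_map A C N N' f) t"
      using t by (simp add: compose_def)
  qed (simp add: compose_def)
next
  fix M M' M'' :: "('a, 'c, 'u) rcomod" and g g'
  assume M: "right_comodule A C M" and M': "right_comodule A C M'" and M'': "right_comodule A C M''"
    and g: "g \<in> comodule_hom A C M M'" and g': "g' \<in> comodule_hom A C M' M''"
  note gg = comodule_hom_comp[OF M M' M'' g g']
  show "G_map A C M (compose (carrier M) g' g) =
      compose (carrier (G_obj A C M)) (G_map A C M' g') (G_map A C M g)"
  proof (rule extensionalityI)
    fix p assume p: "p \<in> carrier (G_obj A C M)"
    note 1 = G_map_closed[OF M M' g p]
    have "G_map A C M (compose (carrier M) g' g) p = G_map A C M' g' (G_map A C M g p)"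
      by (rule G_eqI[OF G_map_closed[OF M M'' gg p] G_map_closed[OF M' M'' g' 1]])
        (simp add: G_map_app[OF p] G_map_app[OF 1] compose_def right_linear_closed[OF G_linear[OF p]])
    then show "G_map A C M (compose (carrier M) g' g) p =
        compose (carrier (G_obj A C M)) (G_map A C M' g') (G_map A C M g) p"
      using p by (simp add: compose_def)
  qed (simp_all add: G_map_def compose_def)
qed

end

section \<open>Dual bases and the cotensor product with the dual\<close>

lemma module_isoI:
  assumes M: "right_module R M" and f: "f \<in> right_hom R M N" and bij: "bij_betw f (carrier M) (carrier N)"
  shows "module_iso R M N f"
proof -
  interpret M: right_module R M by fact
  let ?g = "\<lambda>y\<in>carrier N. inv_into (carrier M) f y"
  have inj: "inj_on f (carrier M)" and surj: "f ` carrier M = carrier N"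
    using bij by (auto simp: bij_betw_def)
  note lin = right_hom_linear[OF f]
  have gf: "?g (f x) = x" if "x \<in> carrier M" for x
    using that inj right_linear_closed[OF lin] by simp
  have "?g \<in> right_hom R N M"
  proof (rule right_homI[OF right_linearI[OF additive_mapI]])
    fix y assume y: "y \<in> carrier N"
    then obtain x where x: "x \<in> carrier M" "y = f x" using surj by blast
    show "?g y \<in> carrier M" using x gf by simp
    show "?g (y \<triangleleft>\<^bsub>N\<^esub> r) = ?g y \<triangleleft>\<^bsub>M\<^esub> r" if "r \<in> carrier R" for r
      using gf[OF M.ract_closed[OF that x(1)]] gf[OF x(1)] right_linear_ract[OF lin that x(1)] x(2)
      by simp
    fix y' assume "y' \<in> carrier N"
    then obtain x' where x': "x' \<in> carrier M" "y' = f x'" using surj by blast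
    show "?g (y \<oplus>\<^bsub>N\<^esub> y') = ?g y \<oplus>\<^bsub>M\<^esub> ?g y'"
      using gf[OF M.M.a_closed[OF x(1) x'(1)]] gf[OF x(1)] gf[OF x'(1)] right_linear_add[OF lin x(1) x'(1)] x(2) x'(2)
      by simp
  qed simp
  moreover have "mutually_inverse (carrier M) (carrier N) f ?g"
    unfolding mutually_inverse_def using gf surj
    by (auto simp: f_inv_into_f)
  ultimately show ?thesis using f by (auto simp: module_iso_def)
qed

lemma tensor_map_id_comp:
  assumes M: "right_module R M" and N: "right_module R N" and Q: "right_module R Q" and P: "left_module R P"
    and f: "right_linear R M N f" and g: "right_linear R N Q g" and t: "t \<in> carrier (tensor_group R M P)"
  shows "tensor_map R N P Q P g id (tensor_map R M P N P f id t) = tensor_map R M P Q P (\<lambda>x. g (f x)) id t"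
proof -
  note fm = M P N P f left_linear_id(1) and gm = N P Q P g left_linear_id(1)
    and gfm = M P Q P right_linear_comp[OF f g] left_linear_id(1)
  show ?thesis
    by (rule additive_map_tensor_eqI[OF M P additive_map_comp[OF tensor_map_additive[OF fm] tensor_map_additive[OF gm]]
          tensor_map_additive[OF gfm] _ t])
      (simp add: tensor_map_tens[OF fm] tensor_map_tens[OF gm] tensor_map_tens[OF gfm] right_linear_closed[OF f])
qed

lemma (in coring) mapC_plus:
  assumes N: "right_module A N" and M: "right_module A M"
    and p: "right_linear A N M p" and q: "right_linear A N M q"
    and t: "t \<in> carrier (tensor_group A N C)"
  shows "mapC N M (\<lambda>x. p x \<oplus>\<^bsub>M\<^esub> q x) t = mapC N M p t \<oplus>\<^bsub>tensor_group A M C\<^esub> mapC N M q t"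
proof -
  interpret M: right_module A M by fact
  have s: "right_linear A N M (\<lambda>x. p x \<oplus>\<^bsub>M\<^esub> q x)"
    using additive_map_plus[OF M.M.abelian_group_axioms right_linear_additive[OF p] right_linear_additive[OF q]]
    by (rule right_linearI) (simp add: right_linear_closed[OF p] right_linear_closed[OF q]
        right_linear_ract[OF p] right_linear_ract[OF q] M.ract_add_left)
  show ?thesis
    by (rule additive_map_tensor_eqI[OF N left_module_axioms mapC_additive[OF N M s]
        additive_map_plus[OF tensor_C_abelian_group[OF M] mapC_additive[OF N M p] mapC_additive[OF N M q]] _ t])
      (simp add: mapC_tens[OF N M s] mapC_tens[OF N M p] mapC_tens[OF N M q] tens_add_left[OF M left_module_axioms]
        right_linear_closed[OF p] right_linear_closed[OF q])
qed

lemma dual_comodule_simps [simp]: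
  "carrier (dual_comodule A C) = carrier (dual_ring A C)"
  "ring.add (dual_comodule A C) = ring.add (dual_ring A C)"
  "ring.zero (dual_comodule A C) = ring.zero (dual_ring A C)"
  "lact (dual_comodule A C) = (\<lambda>a f. \<lambda>c\<in>carrier C. a \<otimes>\<^bsub>A\<^esub> f c)"
  "ract (dual_comodule A C) = monoid.mult (dual_ring A C)"
  by (simp_all add: dual_comodule_def dual_bimodule_def Let_def bimod.extend_def split: prod.splits)

text \<open>The dual comodule is defined from a chosen dual basis. Wherever its coaction matters, the basis
  \<open>e\<^sub>i, f\<^sub>i\<close> is assumed to be that one.\<close>

lemma lcoact_dual_comodule:
  assumes "(n, e, f) = (SOME b. dual_basis A C b)"
  shows "lcoact (dual_comodule A C) h =
    (\<Oplus>\<^bsub>tensor_group A C (dual_comodule A C)\<^esub>i\<in>{..<n}. tens A C (dual_comodule A C) (dual_act A C h (e i)) (f i))"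
proof -
  have 1: "tensor_group A C (dual_bimodule A C) = tensor_group A C (dual_comodule A C)"
    by (rule tensor_group_cong') (simp_all add: dual_bimodule_def)
  have 2: "tens A C (dual_bimodule A C) = tens A C (dual_comodule A C)"
    by (rule tens_cong') (simp_all add: dual_bimodule_def)
  show ?thesis
    by (subst dual_comodule_def)
      (simp add: Let_def bimod.extend_def lcomod.fields_def assms[symmetric] 1 2)
qed

context coring
begin

abbreviation "DM \<equiv> dual_comodule A C"

lemma dual_lact: "a \<in> carrier A \<Longrightarrow> f \<in> carrier D \<Longrightarrow> (\<lambda>c\<in>carrier C. a \<otimes>\<^bsub>A\<^esub> f c) = iota a \<otimes>\<^bsub>D\<^esub> f"
  by (rule extensionalityI[of _ "carrier C"])
    (auto simp: iota_mult_app intro!: dual_extensional dual_mult_closed iota_closed)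

lemma dual_comodule_bimodule: "bimodule A D DM"
proof -
  interpret D: ring D by (rule dual_ring_ring)
  have "abelian_group DM"
    using D.abelian_group_axioms by (subst abelian_group_cong[of _ D]) simp_all
  then show ?thesis
    unfolding bimodule_def bimodule_axioms_def left_module_def left_module_axioms_def
      right_module_def right_module_axioms_def
    using dual_ring_ring R.ring_axioms
    by (simp add: dual_lact iota_closed D.m_closed iota_add iota_mult iota_one D.l_distr D.r_distr
        D.m_assoc del: restrict_apply)
qed

lemma dual_comodule_left: "left_module A DM"
  using dual_comodule_bimodule by (rule bimodule.axioms)

lemma dual_apply_additive: "c \<in> carrier C \<Longrightarrow> additive_map D A (\<lambda>f. f c)"
  by (simp add: additive_map_iff dual_closed dual_add_app)

text \<open>The map \<open>M \<otimes> C\<^sup>* \<rightarrow> Hom\<^sub>A(C, M)\<close> given by \<open>m \<otimes> f \<mapsto> (c \<mapsto> m f(c))\<close>.\<close>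

definition hom_of_tensor :: "('k, 'm, 'a, 'z) bimod_scheme \<Rightarrow> ('m, 'c \<Rightarrow> 'a) tens \<Rightarrow> 'c \<Rightarrow> 'm"
  where "hom_of_tensor M t = (\<lambda>c\<in>carrier C. tensor_lift A M DM M (\<lambda>m f. m \<triangleleft>\<^bsub>M\<^esub> f c) t)"

context
  fixes M :: "('k, 'm, 'a, 'z) bimod_scheme"
  assumes M: "right_module A M"
begin

interpretation M: right_module A M by (fact M)
interpretation H: right_module D "hom_mod A C M" by (rule hom_mod_right_module[OF M])

private lemma apply_balanced: "c \<in> carrier C \<Longrightarrow> balanced A M DM M (\<lambda>m f. m \<triangleleft>\<^bsub>M\<^esub> f c)"
  by (rule balancedI) (simp_all add: dual_closed M.ract_closed M.ract_add_left M.ract_add_right M.ract_mult dual_add_app)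

private lemmas apply_additive = tensor_lift_additive[OF M dual_comodule_left M.M.abelian_group_axioms apply_balanced]
private lemmas apply_tens = tensor_lift_tens[OF M dual_comodule_left M.M.abelian_group_axioms apply_balanced]

lemma hom_of_tensor_tens: "m \<in> carrier M \<Longrightarrow> f \<in> carrier D \<Longrightarrow> c \<in> carrier C \<Longrightarrow>
    hom_of_tensor M (tens A M DM m f) c = m \<triangleleft>\<^bsub>M\<^esub> f c"
  by (simp add: hom_of_tensor_def apply_tens)

lemma hom_of_tensor_apply_additive: "c \<in> carrier C \<Longrightarrow>
    additive_map (tensor_group A M DM) M (\<lambda>t. hom_of_tensor M t c)"
  by (simp add: hom_of_tensor_def apply_additive)

lemma hom_of_tensor_plus: "s \<in> carrier (tensor_group A M DM) \<Longrightarrow> t \<in> carrier (tensor_group A M DM) \<Longrightarrow>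
    hom_of_tensor M (s \<oplus>\<^bsub>tensor_group A M DM\<^esub> t) = hom_of_tensor M s \<oplus>\<^bsub>hom_mod A C M\<^esub> hom_of_tensor M t"
  by (rule extensionalityI[of _ "carrier C"])
    (simp_all add: additive_map_add[OF hom_of_tensor_apply_additive], simp_all add: hom_of_tensor_def)

lemma hom_of_tensor_closed: "t \<in> carrier (tensor_group A M DM) \<Longrightarrow> hom_of_tensor M t \<in> right_hom A C M"
proof (induction rule: tensor_induct[OF M dual_comodule_left, consumes 1, case_names tens add])
  case (tens m f)
  have "right_linear A C M (hom_of_tensor M (tens A M DM m f))"
    using tens by (simp add: right_linear_def additive_map_iff hom_of_tensor_tens dual_closed dual_add dual_ract
        M.ract_closed M.ract_add_right M.ract_mult ract_closed)
  then show ?case by (rule right_homI) (simp add: hom_of_tensor_def)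
next
  case (add s t)
  then show ?case using H.M.a_closed by (simp add: hom_of_tensor_plus del: hom_mod_simps(3))
qed

lemma hom_of_tensor_additive: "additive_map (tensor_group A M DM) (hom_mod A C M) (hom_of_tensor M)"
  by (rule additive_mapI) (simp_all add: hom_of_tensor_closed hom_of_tensor_plus del: hom_mod_simps(3))

lemma hom_of_tensor_ract:
  assumes t: "t \<in> carrier (tensor_group A M DM)" and g: "g \<in> carrier D"
  shows "hom_of_tensor M (t \<triangleleft>\<^bsub>tensor A M DM\<^esub> g) = hom_of_tensor M t \<triangleleft>\<^bsub>hom_mod A C M\<^esub> g"
proof (rule extensionalityI[of _ "carrier C"])
  fix c assume c: "c \<in> carrier C"
  have gc: "dual_act A C g c \<in> carrier C" using c g by (simp add: dual_act_closed dual_linear)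
  have "hom_of_tensor M (t \<triangleleft>\<^bsub>tensor A M DM\<^esub> g) c = hom_of_tensor M t (dual_act A C g c)"
    by (rule additive_map_tensor_eqI[OF M dual_comodule_left
          additive_map_comp[OF tensor_ract_additive[OF M dual_comodule_bimodule g] hom_of_tensor_apply_additive[OF c]]
          hom_of_tensor_apply_additive[OF gc] _ t])
      (simp add: tens_ract[OF M dual_comodule_bimodule g] hom_of_tensor_tens c gc g dual_mult_closed dual_mult_app)
  then show "hom_of_tensor M (t \<triangleleft>\<^bsub>tensor A M DM\<^esub> g) c = (hom_of_tensor M t \<triangleleft>\<^bsub>hom_mod A C M\<^esub> g) c"
    using c by simp
qed (simp_all add: hom_of_tensor_def)

lemma hom_of_tensor_natural:
  assumes N: "right_module A N" and g: "right_linear A M N g" and t: "t \<in> carrier (tensor_group A M DM)"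
    and c: "c \<in> carrier C"
  shows "hom_of_tensor N (tensor_map A M DM N DM g id t) c = g (hom_of_tensor M t c)"
proof -
  interpret N: right_module A N by fact
  note gm = M dual_comodule_left N dual_comodule_left g left_linear_id(1)
  have bal: "balanced A N DM N (\<lambda>m f. m \<triangleleft>\<^bsub>N\<^esub> f c)"
    using c by (intro balancedI)
      (simp_all add: dual_closed N.ract_closed N.ract_add_left N.ract_add_right N.ract_mult dual_add_app)
  have add: "additive_map (tensor_group A N DM) N (\<lambda>t. hom_of_tensor N t c)"
    using tensor_lift_additive[OF N dual_comodule_left N.M.abelian_group_axioms bal] c
    by (simp add: hom_of_tensor_def)
  have tens: "hom_of_tensor N (tens A N DM m f) c = m \<triangleleft>\<^bsub>N\<^esub> f c" if "m \<in> carrier N" "f \<in> carrier D" for m f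
    using tensor_lift_tens[OF N dual_comodule_left N.M.abelian_group_axioms bal] c that
    by (simp add: hom_of_tensor_def)
  show ?thesis
    by (rule additive_map_tensor_eqI[OF M dual_comodule_left additive_map_comp[OF tensor_map_additive[OF gm] add]
          additive_map_comp[OF hom_of_tensor_apply_additive[OF c] right_linear_additive[OF g]] _ t])
      (simp add: tensor_map_tens[OF gm] tens hom_of_tensor_tens c right_linear_closed[OF g]
        right_linear_ract[OF g] dual_closed)
qed

end

end

locale fgp_coring = coring A C for A :: "'a ring" and C :: "('a, 'c) coring" +
  fixes n :: nat and e :: "nat \<Rightarrow> 'c" and f :: "nat \<Rightarrow> 'c \<Rightarrow> 'a"
  assumes basis: "dual_basis A C (n, e, f)"
begin

lemma e_closed: "i < n \<Longrightarrow> e i \<in> carrier C"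
  and f_closed: "i < n \<Longrightarrow> f i \<in> carrier D"
  and basis_expand: "c \<in> carrier C \<Longrightarrow> c = (\<Oplus>\<^bsub>C\<^esub>i\<in>{..<n}. e i \<triangleleft>\<^bsub>C\<^esub> f i c)"
  using basis by (auto simp: dual_basis_def)

lemma fi_closed: "i < n \<Longrightarrow> c \<in> carrier C \<Longrightarrow> f i c \<in> carrier A"
  using dual_closed f_closed by blast

lemma linear_expand:
  assumes M: "right_module A M" and p: "right_linear A C M p" and c: "c \<in> carrier C"
  shows "p c = (\<Oplus>\<^bsub>M\<^esub>i\<in>{..<n}. p (e i) \<triangleleft>\<^bsub>M\<^esub> f i c)"
proof -
  interpret M: right_module A M by fact
  have "p c = p (\<Oplus>\<^bsub>C\<^esub>i\<in>{..<n}. e i \<triangleleft>\<^bsub>C\<^esub> f i c)" using basis_expand[OF c] by simp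
  also have "\<dots> = (\<Oplus>\<^bsub>M\<^esub>i\<in>{..<n}. p (e i \<triangleleft>\<^bsub>C\<^esub> f i c))"
    by (rule additive_map_finsum[OF _ M.M.abelian_group_axioms right_linear_additive[OF p]])
      (auto simp: ract_closed fi_closed e_closed c local.M.abelian_group_axioms)
  also have "\<dots> = (\<Oplus>\<^bsub>M\<^esub>i\<in>{..<n}. p (e i) \<triangleleft>\<^bsub>M\<^esub> f i c)"
    by (rule M.M.finsum_cong') (auto simp: right_linear_ract[OF p] e_closed fi_closed c M.ract_closed
        right_linear_closed[OF p])
  finally show ?thesis .
qed

lemma regular_right_module: "right_module A (regular A)"
proof -
  have "abelian_group (regular A)"
    using R.abelian_group_axioms by (subst abelian_group_cong[of _ A]) simp_all
  then show ?thesis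
    unfolding right_module_def right_module_axioms_def
    by (simp add: R.ring_axioms R.r_distr R.l_distr R.m_assoc)
qed

lemma dual_expand:
  assumes g: "g \<in> carrier D"
  shows "g = (\<Oplus>\<^bsub>D\<^esub>i\<in>{..<n}. (\<lambda>c\<in>carrier C. g (e i) \<otimes>\<^bsub>A\<^esub> f i c))"
proof -
  interpret D: ring D by (rule dual_ring_ring)
  have cl: "(\<lambda>c\<in>carrier C. g (e i) \<otimes>\<^bsub>A\<^esub> f i c) \<in> carrier D" if "i < n" for i
    using that g by (simp add: dual_lact dual_closed e_closed f_closed dual_mult_closed iota_closed)
  show ?thesis
  proof (rule dual_eqI[OF g])
    show "(\<Oplus>\<^bsub>D\<^esub>i\<in>{..<n}. (\<lambda>c\<in>carrier C. g (e i) \<otimes>\<^bsub>A\<^esub> f i c)) \<in> carrier D"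
      by (rule D.finsum_closed) (use cl in auto)
    fix c assume c: "c \<in> carrier C"
    have "(\<Oplus>\<^bsub>D\<^esub>i\<in>{..<n}. (\<lambda>c\<in>carrier C. g (e i) \<otimes>\<^bsub>A\<^esub> f i c)) c = (\<Oplus>\<^bsub>A\<^esub>i\<in>{..<n}. g (e i) \<otimes>\<^bsub>A\<^esub> f i c)"
      using additive_map_finsum[OF D.abelian_group_axioms R.abelian_group_axioms dual_apply_additive[OF c],
          of "{..<n}" "\<lambda>i. (\<lambda>c\<in>carrier C. g (e i) \<otimes>\<^bsub>A\<^esub> f i c)"] cl c by auto
    also have "\<dots> = g c"
      using linear_expand[OF regular_right_module dual_linear[OF g] c]
      by (simp add: finsum_cong_ring[of "regular A" A])
    finally show "g c = (\<Oplus>\<^bsub>D\<^esub>i\<in>{..<n}. (\<lambda>c\<in>carrier C. g (e i) \<otimes>\<^bsub>A\<^esub> f i c)) c" by simp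
  qed
qed

text \<open>The inverse of \<open>M \<otimes> C\<^sup>* \<rightarrow> Hom\<^sub>A(C, M)\<close>.\<close>

definition tensor_of_hom :: "('k, 'm, 'a, 'z) bimod_scheme \<Rightarrow> ('c \<Rightarrow> 'm) \<Rightarrow> ('m, 'c \<Rightarrow> 'a) tens"
  where "tensor_of_hom M p = (\<Oplus>\<^bsub>tensor_group A M DM\<^esub>i\<in>{..<n}. tens A M DM (p (e i)) (f i))"

context
  fixes M :: "('k, 'm, 'a, 'z) bimod_scheme"
  assumes M: "right_module A M"
begin

interpretation M: right_module A M by (fact M)
interpretation DM: bimodule A D DM by (rule dual_comodule_bimodule)
interpretation T: abelian_group "tensor_group A M DM" by (rule tensor_abelian_group[OF M dual_comodule_left])

text \<open>This is \<open>m \<otimes> h\<close> with \<open>h\<close> written as \<open>\<Sum> h(e\<^sub>i) f\<^sub>i\<close> and the coefficients moved to the left.\<close>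

lemma tens_expand:
  assumes m: "m \<in> carrier M" and h: "h \<in> carrier D"
  shows "(\<Oplus>\<^bsub>tensor_group A M DM\<^esub>i\<in>{..<n}. tens A M DM (m \<triangleleft>\<^bsub>M\<^esub> h (e i)) (f i)) = tens A M DM m h"
proof -
  interpret D: ring D by (rule dual_ring_ring)
  have cl: "(\<lambda>c\<in>carrier C. h (e i) \<otimes>\<^bsub>A\<^esub> f i c) \<in> carrier D" if "i < n" for i
    using that h by (simp add: dual_lact dual_closed e_closed f_closed dual_mult_closed iota_closed)
  have "tens A M DM m h = tens A M DM m (\<Oplus>\<^bsub>D\<^esub>i\<in>{..<n}. (\<lambda>c\<in>carrier C. h (e i) \<otimes>\<^bsub>A\<^esub> f i c))"
    using dual_expand[OF h] by simp
  also have "\<dots> = tens A M DM m (\<Oplus>\<^bsub>DM\<^esub>i\<in>{..<n}. (\<lambda>c\<in>carrier C. h (e i) \<otimes>\<^bsub>A\<^esub> f i c))"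
    by (simp add: finsum_cong_ring[of DM D])
  also have "\<dots> = (\<Oplus>\<^bsub>tensor_group A M DM\<^esub>i\<in>{..<n}. tens A M DM m (\<lambda>c\<in>carrier C. h (e i) \<otimes>\<^bsub>A\<^esub> f i c))"
    by (rule additive_map_finsum[OF left_module_abelian[OF dual_comodule_left] T.abelian_group_axioms
          tens_additive_right[OF M dual_comodule_left m]]) (use cl in auto)
  also have "\<dots> = (\<Oplus>\<^bsub>tensor_group A M DM\<^esub>i\<in>{..<n}. tens A M DM (m \<triangleleft>\<^bsub>M\<^esub> h (e i)) (f i))"
    using tens_balanced[OF M dual_comodule_left m] h
    by (intro T.finsum_cong') (auto simp: dual_closed e_closed f_closed m M.ract_closed intro!: tens_closed[OF M dual_comodule_left])
  finally show ?thesis by simp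
qed

lemma tensor_of_hom_closed: "p \<in> right_hom A C M \<Longrightarrow> tensor_of_hom M p \<in> carrier (tensor_group A M DM)"
  unfolding tensor_of_hom_def
  by (rule T.finsum_closed) (auto intro!: tens_closed[OF M dual_comodule_left]
      simp: e_closed f_closed right_linear_closed[OF right_hom_linear])

lemma tensor_of_hom_of_tensor:
  assumes t: "t \<in> carrier (tensor_group A M DM)"
  shows "tensor_of_hom M (hom_of_tensor M t) = t"
proof -
  have 1: "additive_map (tensor_group A M DM) (tensor_group A M DM)
      (\<lambda>t. tens A M DM (hom_of_tensor M t (e i)) (f i))" if "i \<in> {..<n}" for i
    using that by (intro additive_map_comp[OF hom_of_tensor_apply_additive[OF M] tens_additive_left[OF M dual_comodule_left]])
      (auto simp: e_closed f_closed)
  have 2: "(\<Oplus>\<^bsub>tensor_group A M DM\<^esub>i\<in>{..<n}. tens A M DM (hom_of_tensor M (tens A M DM m h) (e i)) (f i)) = tens A M DM m h"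
    if m: "m \<in> carrier M" and h: "h \<in> carrier DM" for m h
  proof -
    have "(\<Oplus>\<^bsub>tensor_group A M DM\<^esub>i\<in>{..<n}. tens A M DM (hom_of_tensor M (tens A M DM m h) (e i)) (f i)) =
        (\<Oplus>\<^bsub>tensor_group A M DM\<^esub>i\<in>{..<n}. tens A M DM (m \<triangleleft>\<^bsub>M\<^esub> h (e i)) (f i))"
      using m h by (intro T.finsum_cong') (auto simp: hom_of_tensor_tens[OF M] e_closed f_closed dual_closed
          M.ract_closed intro!: tens_closed[OF M dual_comodule_left])
    then show ?thesis using tens_expand[OF m] h by simp
  qed
  show ?thesis
    unfolding tensor_of_hom_def
    by (rule additive_map_tensor_eqI[OF M dual_comodule_left
          additive_map_finsum_pointwise[OF T.abelian_group_axioms T.abelian_group_axioms finite_lessThan 1]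
          additive_map_id 2 t])
qed

lemma hom_of_tensor_of_hom:
  assumes p: "p \<in> right_hom A C M"
  shows "hom_of_tensor M (tensor_of_hom M p) = p"
proof (rule extensionalityI[of _ "carrier C"])
  fix c assume c: "c \<in> carrier C"
  have "hom_of_tensor M (tensor_of_hom M p) c =
      (\<Oplus>\<^bsub>M\<^esub>i\<in>{..<n}. hom_of_tensor M (tens A M DM (p (e i)) (f i)) c)"
    unfolding tensor_of_hom_def
    by (rule additive_map_finsum[OF T.abelian_group_axioms M.M.abelian_group_axioms hom_of_tensor_apply_additive[OF M c]])
      (auto intro!: tens_closed[OF M dual_comodule_left] simp: e_closed f_closed right_linear_closed[OF right_hom_linear[OF p]])
  also have "\<dots> = (\<Oplus>\<^bsub>M\<^esub>i\<in>{..<n}. p (e i) \<triangleleft>\<^bsub>M\<^esub> f i c)"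
    by (rule M.M.finsum_cong')
      (auto simp: hom_of_tensor_tens[OF M] e_closed f_closed fi_closed c right_linear_closed[OF right_hom_linear[OF p]] M.ract_closed)
  also have "\<dots> = p c" using linear_expand[OF M right_hom_linear[OF p] c] by simp
  finally show "hom_of_tensor M (tensor_of_hom M p) c = p c" .
qed (use p right_hom_extensional in \<open>auto simp: hom_of_tensor_def\<close>)

lemma hom_of_tensor_bij: "bij_betw (hom_of_tensor M) (carrier (tensor_group A M DM)) (right_hom A C M)"
  by (rule bij_betw_byWitness[where f' = "tensor_of_hom M"])
    (auto simp: tensor_of_hom_of_tensor hom_of_tensor_of_hom tensor_of_hom_closed hom_of_tensor_closed[OF M])

end

end

lemma (in coring) C_DM_left: "left_module A (tensor A C DM)"
  by (rule tensor_left_module[OF bimodule_axioms dual_comodule_left])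

text \<open>For \<open>c \<in> C\<close>, the map \<open>C \<otimes> C\<^sup>* \<rightarrow> C\<close> with \<open>x \<otimes> f \<mapsto> x f(c)\<close>.\<close>

definition (in coring) eval_right where
  "eval_right c = tensor_lift A C DM C (\<lambda>x f. x \<triangleleft>\<^bsub>C\<^esub> f c)"

context coring
begin

context
  fixes c
  assumes c: "c \<in> carrier C"
begin

private lemma eval_right_balanced: "balanced A C DM C (\<lambda>x f. x \<triangleleft>\<^bsub>C\<^esub> f c)"
  using c by (intro balancedI)
    (simp_all add: dual_closed ract_closed ract_add_left ract_add_right ract_mult dual_add_app)

lemma eval_right_additive: "additive_map (tensor_group A C DM) C (eval_right c)"
  unfolding eval_right_def
  by (rule tensor_lift_additive[OF right_module_axioms dual_comodule_left M.abelian_group_axioms eval_right_balanced])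

lemma eval_right_tens: "x \<in> carrier C \<Longrightarrow> h \<in> carrier D \<Longrightarrow> eval_right c (tens A C DM x h) = x \<triangleleft>\<^bsub>C\<^esub> h c"
  unfolding eval_right_def
  using tensor_lift_tens[OF right_module_axioms dual_comodule_left M.abelian_group_axioms eval_right_balanced] by simp

lemma eval_right_left_linear: "left_linear A (tensor A C DM) C (eval_right c)"
proof (rule left_linearI)
  show "additive_map (tensor A C DM) C (eval_right c)" using eval_right_additive by simp
  fix a s assume a: "a \<in> carrier A" and "s \<in> carrier (tensor A C DM)"
  then have s: "s \<in> carrier (tensor_group A C DM)" by simp
  have act: "additive_map C C (\<lambda>x. a \<triangleright>\<^bsub>C\<^esub> x)"
    using a by (simp add: additive_map_iff lact_closed lact_add_right)
  show "eval_right c (a \<triangleright>\<^bsub>tensor A C DM\<^esub> s) = a \<triangleright>\<^bsub>C\<^esub> eval_right c s"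
    by (rule additive_map_tensor_eqI[OF right_module_axioms dual_comodule_left
          additive_map_comp[OF tensor_lact_additive[OF bimodule_axioms dual_comodule_left a] eval_right_additive]
          additive_map_comp[OF eval_right_additive act] _ s])
      (simp add: tens_lact[OF bimodule_axioms dual_comodule_left a] eval_right_tens lact_closed a lact_ract dual_closed c)
qed

end

end

context fgp_coring
begin

context
  assumes chosen: "(n, e, f) = (SOME b. dual_basis A C b)"
begin

private lemma CDM_abelian: "abelian_group (tensor_group A C DM)"
  by (rule tensor_abelian_group[OF right_module_axioms dual_comodule_left])

private lemma lcoact_eq: "lcoact DM h =
    (\<Oplus>\<^bsub>tensor_group A C DM\<^esub>i\<in>{..<n}. tens A C DM (dual_act A C h (e i)) (f i))"
  by (rule lcoact_dual_comodule[OF chosen])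

lemma lcoact_left_linear: "left_linear A DM (tensor A C DM) (lcoact DM)"
proof (rule left_linearI)
  interpret T: abelian_group "tensor_group A C DM" by (rule CDM_abelian)
  have 1: "additive_map DM (tensor_group A C DM) (\<lambda>h. tens A C DM (dual_act A C h (e i)) (f i))" if "i \<in> {..<n}" for i
  proof (rule additive_map_comp[of _ C])
    show "additive_map DM C (\<lambda>h. dual_act A C h (e i))"
      using that by (simp add: additive_map_iff dual_act_closed dual_linear e_closed dual_act_add)
    show "additive_map C (tensor_group A C DM) (\<lambda>x. tens A C DM x (f i))"
      using that by (intro tens_additive_left[OF right_module_axioms dual_comodule_left]) (simp add: f_closed)
  qed
  show "additive_map DM (tensor A C DM) (lcoact DM)"
    using additive_map_finsum_pointwise[OF left_module_abelian[OF dual_comodule_left] CDM_abelian finite_lessThan 1]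
    by (simp add: lcoact_eq[abs_def])
  fix a h assume a: "a \<in> carrier A" and h: "h \<in> carrier DM"
  have "lcoact DM (a \<triangleright>\<^bsub>DM\<^esub> h) = (\<Oplus>\<^bsub>tensor_group A C DM\<^esub>i\<in>{..<n}. a \<triangleright>\<^bsub>tensor A C DM\<^esub> tens A C DM (dual_act A C h (e i)) (f i))"
    unfolding lcoact_eq using a h
    by (intro T.finsum_cong')
      (auto simp: dual_lact dual_act_mult iota_closed e_closed f_closed dual_act_iota dual_act_closed dual_linear
        tens_lact[OF bimodule_axioms dual_comodule_left] lact_closed intro!: tens_closed[OF right_module_axioms dual_comodule_left])
  also have "\<dots> = a \<triangleright>\<^bsub>tensor A C DM\<^esub> lcoact DM h"
    unfolding lcoact_eq using h
    by (intro additive_map_finsum[symmetric, OF CDM_abelian CDM_abelian tensor_lact_additive[OF bimodule_axioms dual_comodule_left a]])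
      (auto intro!: tens_closed[OF right_module_axioms dual_comodule_left] simp: e_closed f_closed dual_act_closed dual_linear)
  finally show "lcoact DM (a \<triangleright>\<^bsub>DM\<^esub> h) = a \<triangleright>\<^bsub>tensor A C DM\<^esub> lcoact DM h" .
qed

text \<open>As \<open>x \<mapsto> h \<cdot> x\<close> is right linear, \<open>\<Sum> (h \<cdot> e\<^sub>i) f\<^sub>i(c) = h \<cdot> \<Sum> e\<^sub>i f\<^sub>i(c) = h \<cdot> c\<close>. So the coaction on the dual
  corresponds to the action of the dual on \<open>C\<close>.\<close>

lemma eval_right_lcoact:
  assumes c: "c \<in> carrier C" and h: "h \<in> carrier D"
  shows "eval_right c (lcoact DM h) = dual_act A C h c"
proof -
  have "eval_right c (lcoact DM h) = (\<Oplus>\<^bsub>C\<^esub>i\<in>{..<n}. eval_right c (tens A C DM (dual_act A C h (e i)) (f i)))"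
    unfolding lcoact_eq using h
    by (intro additive_map_finsum[OF CDM_abelian M.abelian_group_axioms eval_right_additive[OF c]])
      (auto intro!: tens_closed[OF right_module_axioms dual_comodule_left] simp: e_closed f_closed dual_act_closed dual_linear)
  also have "\<dots> = (\<Oplus>\<^bsub>C\<^esub>i\<in>{..<n}. dual_act A C h (e i) \<triangleleft>\<^bsub>C\<^esub> f i c)"
    using c h by (intro M.finsum_cong')
      (auto simp: eval_right_tens e_closed f_closed fi_closed dual_act_closed dual_linear ract_closed)
  also have "\<dots> = dual_act A C h c"
    using linear_expand[OF right_module_axioms dual_act_right_linear[OF dual_linear[OF h]] c] by simp
  finally show ?thesis .
qed

context
  fixes M :: "('a, 'c, 'm) rcomod"
  assumes M: "right_comodule A C M"
begin

interpretation M: right_comodule A C M by (fact M)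

private lemmas R = M.M.right_module_axioms
private lemmas RM = R dual_comodule_left
private lemmas MC = tensor_C_right_module[OF R]

interpretation MC: right_module A "tensor A M C" by (rule MC)
interpretation W: abelian_group "tensor_group A M (tensor A C DM)"
  by (rule tensor_abelian_group[OF R C_DM_left])

text \<open>The family of maps \<open>\<Psi> c : M \<otimes> C \<otimes> C\<^sup>* \<rightarrow> M \<otimes> C\<close>, \<open>m \<otimes> x \<otimes> f \<mapsto> m \<otimes> x f(c)\<close>, is jointly
  injective, since an element of the left-hand side can be recovered from its images for
  \<open>c = e\<^sub>i\<close>. It identifies the two maps whose equaliser is the cotensor product with the two sides
  of the condition that \<open>C \<rightarrow> M\<close> be a map of comodules.\<close>

private definition Psi where "Psi c = tensor_map A M (tensor A C DM) M C id (eval_right c)"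

private lemmas Psi_prems = R C_DM_left R left_module_axioms right_linear_id(1) eval_right_left_linear

private lemma Psi_additive: "c \<in> carrier C \<Longrightarrow>
    additive_map (tensor_group A M (tensor A C DM)) (tensor_group A M C) (Psi c)"
  unfolding Psi_def by (rule tensor_map_additive[OF Psi_prems])

private lemma Psi_tens: "c \<in> carrier C \<Longrightarrow> m \<in> carrier M \<Longrightarrow> s \<in> carrier (tensor_group A C DM) \<Longrightarrow>
    Psi c (tens A M (tensor A C DM) m s) = tens A M C m (eval_right c s)"
  unfolding Psi_def using tensor_map_tens[OF Psi_prems] by simp

private lemmas assoc_tens = tensor_assoc_tens[OF R bimodule_axioms dual_comodule_left]
private lemmas assoc_left = tensor_assoc_additive_left[OF R bimodule_axioms dual_comodule_left]

private lemma Psi_recover: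
  assumes w: "w \<in> carrier (tensor_group A M (tensor A C DM))"
  shows "(\<Oplus>\<^bsub>tensor_group A M (tensor A C DM)\<^esub>i\<in>{..<n}.
    tensor_assoc A A M C DM (tens A (tensor A M C) DM (Psi (e i) w) (f i))) = w"
proof -
  have add: "additive_map (tensor_group A M (tensor A C DM)) (tensor_group A M (tensor A C DM))
      (\<lambda>w. tensor_assoc A A M C DM (tens A (tensor A M C) DM (Psi (e i) w) (f i)))" if "i \<in> {..<n}" for i
    using that by (intro additive_map_comp[OF Psi_additive assoc_left]) (simp_all add: e_closed f_closed)
  note addw = additive_map_finsum_pointwise[OF W.abelian_group_axioms W.abelian_group_axioms finite_lessThan add]
  have 1: "(\<Oplus>\<^bsub>tensor_group A M (tensor A C DM)\<^esub>i\<in>{..<n}.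
    tensor_assoc A A M C DM (tens A (tensor A M C) DM (Psi (e i) (tens A M (tensor A C DM) m (tens A C DM x h))) (f i)))
    = tens A M (tensor A C DM) m (tens A C DM x h)"
    if m: "m \<in> carrier M" and x: "x \<in> carrier C" and h: "h \<in> carrier DM" for m x h
  proof -
    have "(\<Oplus>\<^bsub>tensor_group A M (tensor A C DM)\<^esub>i\<in>{..<n}.
      tensor_assoc A A M C DM (tens A (tensor A M C) DM (Psi (e i) (tens A M (tensor A C DM) m (tens A C DM x h))) (f i)))
     = (\<Oplus>\<^bsub>tensor_group A M (tensor A C DM)\<^esub>i\<in>{..<n}.
        tens A M (tensor A C DM) m (tens A C DM (x \<triangleleft>\<^bsub>C\<^esub> h (e i)) (f i)))"
      using that by (intro W.finsum_cong')
        (auto simp: Psi_tens e_closed f_closed dual_closed eval_right_tens assoc_tens ract_closed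
          tens_closed[OF right_module_axioms dual_comodule_left] intro!: tens_closed[OF R C_DM_left])
    also have "\<dots> = tens A M (tensor A C DM) m
        (\<Oplus>\<^bsub>tensor_group A C DM\<^esub>i\<in>{..<n}. tens A C DM (x \<triangleleft>\<^bsub>C\<^esub> h (e i)) (f i))"
      using additive_map_finsum[OF left_module_abelian[OF C_DM_left] W.abelian_group_axioms
          tens_additive_right[OF R C_DM_left m] finite_lessThan, of "\<lambda>i. tens A C DM (x \<triangleleft>\<^bsub>C\<^esub> h (e i)) (f i)" n]
        x h by (auto simp: tens_closed[OF right_module_axioms dual_comodule_left] e_closed f_closed dual_closed ract_closed)
    finally show ?thesis using tens_expand[OF right_module_axioms x] h by simp
  qed
  have 2: "(\<Oplus>\<^bsub>tensor_group A M (tensor A C DM)\<^esub>i\<in>{..<n}.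
    tensor_assoc A A M C DM (tens A (tensor A M C) DM (Psi (e i) (tens A M (tensor A C DM) m s)) (f i)))
    = tens A M (tensor A C DM) m s"
    if m: "m \<in> carrier M" and s: "s \<in> carrier (tensor A C DM)" for m s
  proof -
    have s': "s \<in> carrier (tensor_group A C DM)" using s by simp
    note ts = tens_additive_right[OF R C_DM_left m, unfolded additive_map_from_tensor]
    show ?thesis
      by (rule additive_map_tensor_eqI[OF right_module_axioms dual_comodule_left
            additive_map_comp[OF ts addw] ts 1[OF m] s'])
  qed
  show ?thesis
    by (rule additive_map_tensor_eqI[OF R C_DM_left addw additive_map_id 2 w])
qed

private lemma Psi_eqI:
  assumes "w \<in> carrier (tensor_group A M (tensor A C DM))" "w' \<in> carrier (tensor_group A M (tensor A C DM))"
    and "\<And>c. c \<in> carrier C \<Longrightarrow> Psi c w = Psi c w'"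
  shows "w = w'"
proof -
  have "Psi (e i) w = Psi (e i) w'" if "i < n" for i using assms(3) e_closed[OF that] .
  moreover have "tens A (tensor A M C) DM (Psi (e i) w') (f i) \<in> carrier (tensor_group A (tensor A M C) DM)" if "i < n" for i
    using that additive_map_closed[OF Psi_additive[OF e_closed[OF that]] assms(2)]
    by (intro tens_closed[OF MC dual_comodule_left]) (simp_all add: f_closed)
  moreover note additive_map_closed[OF tensor_assoc_additive[OF R bimodule_axioms dual_comodule_left]]
  ultimately have "(\<Oplus>\<^bsub>tensor_group A M (tensor A C DM)\<^esub>i\<in>{..<n}.
      tensor_assoc A A M C DM (tens A (tensor A M C) DM (Psi (e i) w) (f i))) =
    (\<Oplus>\<^bsub>tensor_group A M (tensor A C DM)\<^esub>i\<in>{..<n}.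
      tensor_assoc A A M C DM (tens A (tensor A M C) DM (Psi (e i) w') (f i)))"
    by (intro W.finsum_cong') auto
  then show ?thesis by (simp add: Psi_recover assms)
qed

private lemmas map_rho = R dual_comodule_left MC dual_comodule_left M.rcoact_linear left_linear_id(1)
private lemmas map_lco = R dual_comodule_left R C_DM_left right_linear_id(1) lcoact_left_linear
private lemmas map_rho_add = additive_map_comp[OF tensor_map_additive[OF map_rho]
    tensor_assoc_additive[OF R bimodule_axioms dual_comodule_left]]

text \<open>\<open>\<Psi> c (\<rho>(m) \<otimes> f) = \<rho>(m) f(c) = \<rho>(m f(c))\<close>\<close>

private lemma Psi_left:
  assumes t: "t \<in> carrier (tensor_group A M DM)" and c: "c \<in> carrier C"
  shows "Psi c (tensor_assoc A A M C DM (tensor_map A M DM (tensor A M C) DM (rcoact M) id t)) =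
    rcoact M (hom_of_tensor M t c)"
proof -
  have 1: "Psi c (tensor_assoc A A M C DM (tens A (tensor A M C) DM s h)) = s \<triangleleft>\<^bsub>tensor A M C\<^esub> h c"
    if s: "s \<in> carrier (tensor_group A M C)" and h: "h \<in> carrier D" for s h
  proof -
    have h': "h \<in> carrier DM" using h by simp
    show ?thesis
      by (rule additive_map_tensor_eqI[OF R left_module_axioms
            additive_map_comp[OF assoc_left[OF h'] Psi_additive[OF c]]
            tensor_ract_additive[OF R bimodule_axioms dual_closed[OF h c]] _ s])
        (simp add: assoc_tens h Psi_tens c eval_right_tens tens_closed[OF right_module_axioms dual_comodule_left]
          tens_ract[OF R bimodule_axioms] dual_closed)
  qed
  show ?thesis
    by (rule additive_map_tensor_eqI[OF RM additive_map_comp[OF map_rho_add Psi_additive[OF c]]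
          additive_map_comp[OF hom_of_tensor_apply_additive[OF R c] M.rcoact_additive] _ t])
      (simp add: tensor_map_tens[OF map_rho] 1 M.rcoact_closed hom_of_tensor_tens[OF R] c
        right_linear_ract[OF M.rcoact_linear] dual_closed)
qed

text \<open>\<open>\<Psi> c\<close> sends \<open>m \<otimes> \<Sum> h \<cdot> e\<^sub>i \<otimes> f\<^sub>i\<close> to \<open>m \<otimes> h \<cdot> c = m h(c\<^sub>1) \<otimes> c\<^sub>2\<close>, for \<open>t = m \<otimes> h\<close>.\<close>

private lemma Psi_right:
  assumes t: "t \<in> carrier (tensor_group A M DM)" and c: "c \<in> carrier C"
  shows "Psi c (tensor_map A M DM M (tensor A C DM) id (lcoact DM) t) = mapC C M (hom_of_tensor M t) (comult C c)"
proof -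
  have lco: "lcoact DM h \<in> carrier (tensor_group A C DM)" if "h \<in> carrier D" for h
    using left_linear_closed[OF lcoact_left_linear, of h] that by simp
  have add: "additive_map (tensor_group A M DM) (tensor_group A M C) (\<lambda>t. mapC C M (hom_of_tensor M t) (comult C c))"
  proof
    fix s t assume st: "s \<in> carrier (tensor_group A M DM)" "t \<in> carrier (tensor_group A M DM)"
    note ls = right_hom_linear[OF hom_of_tensor_closed[OF R st(1)]]
      and lt = right_hom_linear[OF hom_of_tensor_closed[OF R st(2)]]
    show "mapC C M (hom_of_tensor M s) (comult C c) \<in> carrier (tensor_group A M C)"
      by (rule mapC_closed[OF right_module_axioms R ls comult_closed[OF c]])
    have "mapC C M (hom_of_tensor M (s \<oplus>\<^bsub>tensor_group A M DM\<^esub> t)) =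
        mapC C M (\<lambda>x. hom_of_tensor M s x \<oplus>\<^bsub>M\<^esub> hom_of_tensor M t x)"
      by (rule mapC_cong) (simp add: hom_of_tensor_plus[OF R st])
    then show "mapC C M (hom_of_tensor M (s \<oplus>\<^bsub>tensor_group A M DM\<^esub> t)) (comult C c) =
      mapC C M (hom_of_tensor M s) (comult C c) \<oplus>\<^bsub>tensor_group A M C\<^esub> mapC C M (hom_of_tensor M t) (comult C c)"
      by (simp add: mapC_plus[OF right_module_axioms R ls lt comult_closed[OF c]])
  qed
  have 1: "mapC C M (hom_of_tensor M (tens A M DM m h)) s = tens A M C m (tensor_lift A C C C (\<lambda>x y. h x \<triangleright>\<^bsub>C\<^esub> y) s)"
    if m: "m \<in> carrier M" and h: "h \<in> carrier D" and s: "s \<in> carrier (tensor_group A C C)" for m h s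
  proof -
    have lin: "right_linear A C M (hom_of_tensor M (tens A M DM m h))"
      using m h by (intro right_hom_linear[OF hom_of_tensor_closed[OF R]] tens_closed[OF RM]) simp_all
    show ?thesis
      by (rule additive_map_tensor_eqI[OF right_module_axioms left_module_axioms
            mapC_additive[OF right_module_axioms R lin]
            additive_map_comp[OF dual_act_lift_additive[OF dual_linear[OF h]] tens_additive_right[OF R left_module_axioms m]] _ s])
        (simp add: mapC_tens[OF right_module_axioms R lin] hom_of_tensor_tens[OF R] m h
          dual_act_lift_tens[OF dual_linear[OF h]] tens_balanced[OF R left_module_axioms] dual_closed)
  qed
  show ?thesis
    by (rule additive_map_tensor_eqI[OF RM additive_map_comp[OF tensor_map_additive[OF map_lco] Psi_additive[OF c]] add _ t])
      (simp add: tensor_map_tens[OF map_lco] Psi_tens c lco eval_right_lcoact 1 comult_closed, simp add: dual_act_def)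
qed

text \<open>Apply \<open>\<Psi> c\<close>, for all \<open>c\<close>, to both sides of the equation that defines the cotensor product.\<close>

lemma cotensor_iff:
  assumes t: "t \<in> carrier (tensor_group A M DM)"
  shows "t \<in> carrier (cotensor A C M DM) \<longleftrightarrow> hom_of_tensor M t \<in> comodule_hom A C (self_comodule C) M"
proof -
  let ?l = "tensor_assoc A A M C DM (tensor_map A M DM (tensor A M C) DM (rcoact M) id t)"
  let ?r = "tensor_map A M DM M (tensor A C DM) id (lcoact DM) t"
  have "?l \<in> carrier (tensor_group A M (tensor A C DM))"
    by (rule additive_map_closed[OF map_rho_add t])
  moreover have "?r \<in> carrier (tensor_group A M (tensor A C DM))"
    by (rule additive_map_closed[OF tensor_map_additive[OF map_lco] t])
  ultimately have "?l = ?r \<longleftrightarrow> (\<forall>c\<in>carrier C. Psi c ?l = Psi c ?r)"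
    using Psi_eqI[of ?l ?r] by metis
  also have "\<dots> \<longleftrightarrow> (\<forall>c\<in>carrier C. rcoact M (hom_of_tensor M t c) = mapC C M (hom_of_tensor M t) (comult C c))"
    by (simp add: Psi_left Psi_right t)
  finally show ?thesis
    using t by (simp add: cotensor_def G_obj_iff hom_of_tensor_closed[OF R])
qed

lemma cotensor_to_hom_eq: "t \<in> carrier (cotensor A C M DM) \<Longrightarrow> cotensor_to_hom A C M t = hom_of_tensor M t"
  by (simp add: cotensor_to_hom_def hom_of_tensor_def)

lemma cotensor_subset: "carrier (cotensor A C M DM) \<subseteq> carrier (tensor_group A M DM)"
  by (auto simp: cotensor_def)

lemma cotensor_of_G:
  assumes "p \<in> comodule_hom A C (self_comodule C) M"
  obtains t where "t \<in> carrier (cotensor A C M DM)" "hom_of_tensor M t = p"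
proof -
  have p: "p \<in> right_hom A C M" using assms G_obj_subset by blast
  show ?thesis
    using that[of "tensor_of_hom M p"] assms
    by (simp add: cotensor_iff tensor_of_hom_closed[OF R p] hom_of_tensor_of_hom[OF R p])
qed

lemma cotensor_iso: "module_iso D (cotensor A C M DM) (G_obj A C M) (cotensor_to_hom A C M)"
proof -
  let ?T = "cotensor A C M DM"
  interpret T: right_module D "tensor A M DM" by (rule tensor_right_module[OF R dual_comodule_bimodule])
  interpret G: right_module D "G_obj A C M" by (rule G_right_module[OF M])
  have simps: "ring.add ?T = ring.add (tensor_group A M DM)" "ring.zero ?T = ring.zero (tensor_group A M DM)"
    "ract ?T = ract (tensor A M DM)"
    by (simp_all add: cotensor_def)
  have sub: "t \<in> carrier ?T \<Longrightarrow> t \<in> carrier (tensor_group A M DM)" for t using cotensor_subset by blast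
  have hom: "t \<in> carrier ?T \<Longrightarrow> hom_of_tensor M t \<in> carrier (G_obj A C M)" for t
    using cotensor_iff[OF sub] by simp
  have plus: "hom_of_tensor M (s \<oplus>\<^bsub>tensor_group A M DM\<^esub> t) = hom_of_tensor M s \<oplus>\<^bsub>G_obj A C M\<^esub> hom_of_tensor M t"
    if "s \<in> carrier ?T" "t \<in> carrier ?T" for s t
    using hom_of_tensor_plus[OF R sub[OF that(1)] sub[OF that(2)]] by simp
  have act: "hom_of_tensor M (t \<triangleleft>\<^bsub>tensor A M DM\<^esub> g) = hom_of_tensor M t \<triangleleft>\<^bsub>G_obj A C M\<^esub> g"
    if "t \<in> carrier ?T" "g \<in> carrier D" for t g
    using hom_of_tensor_ract[OF R sub[OF that(1)] that(2)] by simp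
  have zero: "hom_of_tensor M \<zero>\<^bsub>tensor_group A M DM\<^esub> = \<zero>\<^bsub>G_obj A C M\<^esub>"
    using additive_map_zero[OF tensor_abelian_group[OF RM] right_module_abelian[OF hom_mod_right_module[OF R]]
        hom_of_tensor_additive[OF R]] by simp
  note Tcl = T.M.a_closed[unfolded tensor_simps] T.M.zero_closed[unfolded tensor_simps] T.ract_closed[unfolded tensor_simps]
  have mod: "right_module D ?T"
  proof (rule right_module_submodule[OF T.right_module_axioms])
    show "\<zero>\<^bsub>tensor A M DM\<^esub> \<in> carrier ?T"
      using cotensor_iff[OF Tcl(2)] G.M.zero_closed by (simp add: zero del: G_obj_simps(2))
    show "s \<oplus>\<^bsub>tensor A M DM\<^esub> t \<in> carrier ?T" if "s \<in> carrier ?T" "t \<in> carrier ?T" for s t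
      using cotensor_iff[OF Tcl(1)[OF sub[OF that(1)] sub[OF that(2)]]] G.M.a_closed[OF hom[OF that(1)] hom[OF that(2)]]
      by (simp add: plus[OF that] del: G_obj_simps(3))
    show "t \<triangleleft>\<^bsub>tensor A M DM\<^esub> g \<in> carrier ?T" if "t \<in> carrier ?T" "g \<in> carrier D" for t g
      using cotensor_iff[OF Tcl(3)[OF that(2) sub[OF that(1)]]] G.ract_closed[OF that(2) hom[OF that(1)]]
      by (simp add: act[OF that] del: G_obj_simps(4))
  qed (use cotensor_subset in \<open>simp_all add: simps\<close>)
  interpret cT: right_module D ?T by (rule mod)
  show ?thesis
  proof (rule module_isoI[OF mod])
    show "cotensor_to_hom A C M \<in> right_hom D ?T (G_obj A C M)"
    proof (rule right_homI[OF right_linearI[OF additive_mapI]])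
      fix s t assume st: "s \<in> carrier ?T" "t \<in> carrier ?T"
      show "cotensor_to_hom A C M s \<in> carrier (G_obj A C M)"
        using hom[OF st(1)] by (simp add: cotensor_to_hom_eq[OF st(1)])
      show "cotensor_to_hom A C M (s \<oplus>\<^bsub>?T\<^esub> t) = cotensor_to_hom A C M s \<oplus>\<^bsub>G_obj A C M\<^esub> cotensor_to_hom A C M t"
        using plus[OF st] cT.M.a_closed[OF st]
        by (simp add: cotensor_to_hom_eq st simps del: G_obj_simps(3))
    next
      fix g t assume gt: "g \<in> carrier D" "t \<in> carrier ?T"
      show "cotensor_to_hom A C M (t \<triangleleft>\<^bsub>?T\<^esub> g) = cotensor_to_hom A C M t \<triangleleft>\<^bsub>G_obj A C M\<^esub> g"
        using act[OF gt(2,1)] cT.ract_closed[OF gt]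
        by (simp add: cotensor_to_hom_eq gt simps del: G_obj_simps(4))
    qed (simp add: cotensor_to_hom_def)
    show "bij_betw (cotensor_to_hom A C M) (carrier ?T) (carrier (G_obj A C M))"
    proof -
      have "inj_on (hom_of_tensor M) (carrier ?T)"
        using hom_of_tensor_bij[OF R] inj_on_subset[OF _ cotensor_subset] by (auto simp: bij_betw_def)
      moreover have "hom_of_tensor M ` carrier ?T = carrier (G_obj A C M)"
      proof (intro equalityI subsetI)
        fix p assume "p \<in> carrier (G_obj A C M)"
        then show "p \<in> hom_of_tensor M ` carrier ?T"
          using cotensor_of_G[of p] by auto
      qed (use hom in auto)
      ultimately show ?thesis
        by (subst bij_betw_cong[OF cotensor_to_hom_eq]) (auto simp: bij_betw_def)
    qed
  qed
qed

end

end

end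

section \<open>Modules that embed into the universe\<close>

text \<open>The type \<open>'u\<close> stands for the universe. It is to contain the lists of its own elements, which
  makes the class of sets that embed into \<open>'u\<close> closed under products
  and lists, and thereby under tensor products.\<close>

definition embeds :: "'u itself \<Rightarrow> 'm set \<Rightarrow> bool"
  where "embeds _ S \<longleftrightarrow> (\<exists>i :: 'm \<Rightarrow> 'u. inj_on i S)"

definition list_closed :: "'u itself \<Rightarrow> bool"
  where "list_closed _ \<longleftrightarrow> (\<exists>i :: 'u list \<Rightarrow> 'u. inj i)"

lemma embeds_inj:
  assumes "embeds TYPE('u) T" "inj_on h S" "h ` S \<subseteq> T"
  shows "embeds TYPE('u) S"
proof -
  obtain i :: "_ \<Rightarrow> 'u" where "inj_on i T" using assms(1) by (auto simp: embeds_def)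
  then have "inj_on (i \<circ> h) S" using assms(2,3) by (intro comp_inj_on) (auto intro: inj_on_subset)
  then show ?thesis by (auto simp: embeds_def)
qed

lemma embeds_subset: "embeds TYPE('u) T \<Longrightarrow> S \<subseteq> T \<Longrightarrow> embeds TYPE('u) S"
  by (rule embeds_inj[of _ "\<lambda>x. x"]) auto

lemma embeds_surj:
  assumes "embeds TYPE('u) T" "S \<subseteq> h ` T"
  shows "embeds TYPE('u) S"
  by (rule embeds_inj[OF assms(1), of "inv_into T h"])
    (use assms(2) in \<open>auto intro: inj_on_inv_into inv_into_into\<close>)

lemma embeds_lists:
  assumes "list_closed TYPE('u)" "embeds TYPE('u) S"
  shows "embeds TYPE('u) (lists S)"
proof -
  obtain l :: "'u list \<Rightarrow> 'u" where l: "inj l" using assms(1) by (auto simp: list_closed_def)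
  obtain i :: "_ \<Rightarrow> 'u" where i: "inj_on i S" using assms(2) by (auto simp: embeds_def)
  have "inj_on (\<lambda>xs. l (map i xs)) (lists S)"
  proof (rule inj_onI)
    fix xs ys assume "xs \<in> lists S" "ys \<in> lists S" "l (map i xs) = l (map i ys)"
    then show "xs = ys" using l i by (auto simp: inj_eq dest!: map_inj_on intro: inj_on_subset)
  qed
  then show ?thesis by (auto simp: embeds_def)
qed

lemma embeds_Times:
  assumes "list_closed TYPE('u)" "embeds TYPE('u) S" "embeds TYPE('u) T"
  shows "embeds TYPE('u) (S \<times> T)"
proof -
  obtain l :: "'u list \<Rightarrow> 'u" where l: "inj l" using assms(1) by (auto simp: list_closed_def)
  obtain i :: "_ \<Rightarrow> 'u" where i: "inj_on i S" using assms(2) by (auto simp: embeds_def)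
  obtain j :: "_ \<Rightarrow> 'u" where j: "inj_on j T" using assms(3) by (auto simp: embeds_def)
  have "inj_on (\<lambda>(x, y). l [i x, j y]) (S \<times> T)"
    using i j by (auto simp: inj_on_def inj_eq[OF l])
  then show ?thesis by (auto simp: embeds_def)
qed

text \<open>The elements of a tensor product are sums of lists of pure tensors.\<close>

lemma embeds_tensor:
  assumes u: "list_closed TYPE('u)" and M: "right_module R M" and N: "left_module R N"
    and "embeds TYPE('u) (carrier M)" "embeds TYPE('u) (carrier N)"
  shows "embeds TYPE('u) (carrier (tensor_group R M N))"
proof -
  interpret T: abelian_group "tensor_group R M N" by (rule tensor_abelian_group[OF M N])
  let ?P = "carrier M \<times> carrier N"
  let ?s = "\<lambda>xs. foldr (\<lambda>(x, y) t. tens R M N x y \<oplus>\<^bsub>tensor_group R M N\<^esub> t) xs \<zero>\<^bsub>tensor_group R M N\<^esub>"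
  have cl: "?s xs \<in> carrier (tensor_group R M N)" if "xs \<in> lists ?P" for xs
    using that by (induction xs) (auto simp: tens_closed[OF M N])
  have app: "?s (xs @ ys) = ?s xs \<oplus>\<^bsub>tensor_group R M N\<^esub> ?s ys"
    if "xs \<in> lists ?P" "ys \<in> lists ?P" for xs ys
    using that(1)
  proof (induction xs)
    case Nil
    then show ?case using cl[OF that(2)] by simp
  next
    case (Cons p xs)
    then show ?case using cl[OF Cons.hyps(2)] cl[OF that(2)]
      by (auto simp: T.a_assoc tens_closed[OF M N])
  qed
  have "t \<in> ?s ` lists ?P" if "t \<in> carrier (tensor_group R M N)" for t
    using that
  proof (induction rule: tensor_induct[OF M N, consumes 1, case_names tens add])
    case (tens x y)
    then show ?case by (intro image_eqI[of _ _ "[(x, y)]"]) (auto simp: tens_closed[OF M N])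
  next
    case (add s t)
    then obtain xs ys where "xs \<in> lists ?P" "s = ?s xs" "ys \<in> lists ?P" "t = ?s ys" by blast
    then show ?case by (intro image_eqI[of _ _ "xs @ ys"]) (simp_all add: app del: foldr_append)
  qed
  then have "carrier (tensor_group R M N) \<subseteq> ?s ` lists ?P" by blast
  then show ?thesis
    by (rule embeds_surj[OF embeds_lists[OF u embeds_Times[OF u assms(4,5)]]])
qed

text \<open>A linear map on \<open>C\<close> is determined by its values at the \<open>e\<^sub>i\<close>.\<close>

lemma (in fgp_coring) embeds_right_hom:
  assumes u: "list_closed TYPE('u)" and M: "right_module A M" and "embeds TYPE('u) (carrier M)"
  shows "embeds TYPE('u) (right_hom A C M)"
proof (rule embeds_inj[OF embeds_lists[OF u assms(3)], of "\<lambda>p. map (p \<circ> e) [0..<n]"])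
  show "inj_on (\<lambda>p. map (p \<circ> e) [0..<n]) (right_hom A C M)"
  proof (rule inj_onI)
    fix p q assume pq: "p \<in> right_hom A C M" "q \<in> right_hom A C M" and eq: "map (p \<circ> e) [0..<n] = map (q \<circ> e) [0..<n]"
    show "p = q"
    proof (rule extensionalityI[OF right_hom_extensional[OF pq(1)] right_hom_extensional[OF pq(2)]])
      fix c assume c: "c \<in> carrier C"
      have "p (e i) = q (e i)" if "i < n" for i using eq that by (auto simp: map_eq_conv)
      moreover interpret M: right_module A M by fact
      have "(\<Oplus>\<^bsub>M\<^esub>i\<in>{..<n}. p (e i) \<triangleleft>\<^bsub>M\<^esub> f i c) = (\<Oplus>\<^bsub>M\<^esub>i\<in>{..<n}. q (e i) \<triangleleft>\<^bsub>M\<^esub> f i c)"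
        using calculation c by (intro M.M.finsum_cong')
          (auto simp: M.ract_closed e_closed fi_closed right_linear_closed[OF right_hom_linear[OF pq(2)]])
      then show "p c = q c"
        using linear_expand[OF M right_hom_linear[OF pq(1)] c] linear_expand[OF M right_hom_linear[OF pq(2)] c] by simp
    qed
  qed
  show "(\<lambda>p. map (p \<circ> e) [0..<n]) ` right_hom A C M \<subseteq> lists (carrier M)"
    by (auto simp: e_closed right_linear_closed[OF right_hom_linear])
qed

text \<open>An inner list is encoded by writing \<open>a\<close> before each of its entries and \<open>b\<close> after the last one, so
  that a reader of the concatenation knows at each step whether an entry follows.\<close>

lemma list_closed_list:
  assumes "a \<noteq> (b :: 't)"
  shows "list_closed TYPE('t list)"
proof -
  define w where "w xs = concat (map (\<lambda>x. [a, x]) xs) @ [b]" for xs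
  have w: "w xs @ r = w ys @ s \<Longrightarrow> xs = ys \<and> r = s" for xs ys r s
  proof (induction xs arbitrary: ys)
    case Nil
    then show ?case using assms by (cases ys) (auto simp: w_def)
  next
    case (Cons x xs)
    then show ?case using assms by (cases ys) (auto simp: w_def)
  qed
  have "xss = yss" if "concat (map w xss) = concat (map w yss)" for xss yss
    using that
  proof (induction xss arbitrary: yss)
    case Nil
    then show ?case by (cases yss) (auto simp: w_def)
  next
    case (Cons xs xss)
    have "w xs \<noteq> []" by (simp add: w_def)
    then obtain ys yss' where yss: "yss = ys # yss'" using Cons.prems by (cases yss) auto
    have "xs = ys \<and> concat (map w xss) = concat (map w yss')"
      by (rule w) (use Cons.prems yss in simp)
    then show ?case using Cons.IH yss by blast
  qed
  then have "inj (\<lambda>xss. concat (map w xss))" by (auto intro: injI)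
  then show ?thesis unfolding list_closed_def by blast
qed

definition copy :: "('m \<Rightarrow> 'u) \<Rightarrow> ('l, 'm, 'r, 'z) bimod_scheme \<Rightarrow> (unit, 'u, 'r) bimod"
  where "copy i M = \<lparr>carrier = i ` carrier M, monoid.mult = undefined, one = undefined,
    ring.zero = i \<zero>\<^bsub>M\<^esub>,
    ring.add = (\<lambda>x y. i (inv_into (carrier M) i x \<oplus>\<^bsub>M\<^esub> inv_into (carrier M) i y)),
    lact = (\<lambda>_ x. x),
    ract = (\<lambda>x r. i (inv_into (carrier M) i x \<triangleleft>\<^bsub>M\<^esub> r))\<rparr>"

lemma copy_simps [simp]:
  "carrier (copy i M) = i ` carrier M"
  "\<zero>\<^bsub>copy i M\<^esub> = i \<zero>\<^bsub>M\<^esub>"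
  "inj_on i (carrier M) \<Longrightarrow> x \<in> carrier M \<Longrightarrow> y \<in> carrier M \<Longrightarrow> i x \<oplus>\<^bsub>copy i M\<^esub> i y = i (x \<oplus>\<^bsub>M\<^esub> y)"
  "inj_on i (carrier M) \<Longrightarrow> x \<in> carrier M \<Longrightarrow> i x \<triangleleft>\<^bsub>copy i M\<^esub> r = i (x \<triangleleft>\<^bsub>M\<^esub> r)"
  by (simp_all add: copy_def)

context
  fixes R :: "('r, 'x) ring_scheme" and M :: "('l, 'm, 'r, 'z) bimod_scheme" and i :: "'m \<Rightarrow> 'u"
  assumes M: "right_module R M" and i: "inj_on i (carrier M)"
begin

interpretation M: right_module R M by (fact M)

lemma copy_right_module: "right_module R (copy i M)"
proof -
  have "abelian_group (copy i M)"
  proof (rule abelian_groupI)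
    fix x assume "x \<in> carrier (copy i M)"
    then obtain m where m: "m \<in> carrier M" "x = i m" by auto
    then show "\<exists>y\<in>carrier (copy i M). y \<oplus>\<^bsub>copy i M\<^esub> x = \<zero>\<^bsub>copy i M\<^esub>"
      using i by (intro bexI[of _ "i (\<ominus>\<^bsub>M\<^esub> m)"]) (auto simp: M.M.l_neg)
  qed (use i in \<open>auto simp: M.M.a_ac\<close>)
  then show ?thesis
    unfolding right_module_def right_module_axioms_def using i
    by (auto simp: M.S.ring_axioms M.ract_closed M.ract_add_left M.ract_add_right M.ract_mult M.ract_one)
qed

lemma copy_linear: "right_linear R M (copy i M) i"
  using i by (simp add: right_linear_def additive_map_iff)

lemma copy_inv_linear: "right_linear R (copy i M) M (inv_into (carrier M) i)"
  using i by (auto simp: right_linear_def additive_map_iff M.ract_closed)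

end

text \<open>Tensoring with the copies of \<open>X\<close> and \<open>Y\<close> in the universe is all that flatness speaks about. The
  isomorphisms with the copies are carried over to the tensor products by functoriality.\<close>

lemma flat_inj:
  assumes flat: "flat TYPE('u) R P" and P: "left_module R P"
    and X: "right_module R X" and Y: "right_module R Y"
    and eX: "embeds TYPE('u) (carrier X)" and eY: "embeds TYPE('u) (carrier Y)"
    and g: "right_linear R X Y g" and inj: "inj_on g (carrier X)"
  shows "inj_on (tensor_map R X P Y P g id) (carrier (tensor_group R X P))"
proof (rule inj_onI)
  obtain i :: "_ \<Rightarrow> 'u" where i: "inj_on i (carrier X)" using eX by (auto simp: embeds_def)
  obtain j :: "_ \<Rightarrow> 'u" where j: "inj_on j (carrier Y)" using eY by (auto simp: embeds_def)
  let ?X = "copy i X" and ?Y = "copy j Y" and ?i' = "inv_into (carrier X) i"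
  note X' = copy_right_module[OF X i] and Y' = copy_right_module[OF Y j]
  note il = copy_linear[OF X i] and jl = copy_linear[OF Y j] and il' = copy_inv_linear[OF X i]
  let ?h = "\<lambda>x. j (g (?i' x))"
  note gj = right_linear_comp[OF g jl]
  have h: "right_linear R ?X ?Y ?h"
    by (rule right_linear_comp[OF il' gj])
  note rh = right_hom_restrict[OF X' h]
  have "inj_on (restrict ?h (carrier ?X)) (carrier ?X)"
  proof (rule inj_onI)
    fix u v assume "u \<in> carrier ?X" "v \<in> carrier ?X" and eq: "restrict ?h (carrier ?X) u = restrict ?h (carrier ?X) v"
    then obtain x y where xy: "x \<in> carrier X" "y \<in> carrier X" "u = i x" "v = i y" by auto
    then have "j (g x) = j (g y)" using eq i by simp
    then have "g x = g y" using j right_linear_closed[OF g] xy by (auto dest: inj_onD)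
    then show "u = v" using inj xy by (auto dest: inj_onD)
  qed
  then have inj_h: "inj_on (tensor_map R ?X P ?Y P (restrict ?h (carrier ?X)) id) (carrier (tensor R ?X P))"
    using flat X' Y' rh unfolding flat_def by blast
  fix s t assume st: "s \<in> carrier (tensor_group R X P)" "t \<in> carrier (tensor_group R X P)"
    and eq: "tensor_map R X P Y P g id s = tensor_map R X P Y P g id t"
  let ?T = "tensor_map R X P ?X P i id"
  note map_i = tensor_map_closed[OF X P X' P il left_linear_id(1)]
  have "tensor_map R ?X P ?Y P (restrict ?h (carrier ?X)) id (?T u) =
      tensor_map R Y P ?Y P j id (tensor_map R X P Y P g id u)" if u: "u \<in> carrier (tensor_group R X P)" for u
  proof -
    have "tensor_map R ?X P ?Y P (restrict ?h (carrier ?X)) id (?T u) =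
        tensor_map R X P ?Y P (\<lambda>x. restrict ?h (carrier ?X) (i x)) id u"
      by (rule tensor_map_id_comp[OF X X' Y' P il right_hom_linear[OF rh] u])
    also have "\<dots> = tensor_map R X P ?Y P (\<lambda>x. j (g x)) id u"
      using i by (intro fun_cong[OF tensor_map_eqI]) auto
    also have "\<dots> = tensor_map R Y P ?Y P j id (tensor_map R X P Y P g id u)"
      by (rule tensor_map_id_comp[OF X Y Y' P g jl u, symmetric])
    finally show ?thesis .
  qed
  then have "?T s = ?T t"
    using inj_h st eq map_i by (auto simp: inj_on_def)
  moreover have "tensor_map R ?X P X P ?i' id (?T u) = u" if u: "u \<in> carrier (tensor_group R X P)" for u
    unfolding tensor_map_id_comp[OF X X' X P il il' u]
    by (rule tensor_map_ident[OF X P _ _ u]) (use i in auto)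
  ultimately show "s = t" using st by metis
qed

definition copy_comodule :: "'a ring \<Rightarrow> ('a, 'c) coring \<Rightarrow> ('m \<Rightarrow> 'u) \<Rightarrow> ('a, 'c, 'm) rcomod \<Rightarrow> ('a, 'c, 'u) rcomod"
  where "copy_comodule A C i M = bimod.extend (copy i M)
    (rcomod.fields (\<lambda>x. tensor_map A M C (copy i M) C i id (rcoact M (inv_into (carrier M) i x))))"

lemma copy_comodule_simps [simp]:
  "carrier (copy_comodule A C i M) = i ` carrier M"
  "\<zero>\<^bsub>copy_comodule A C i M\<^esub> = i \<zero>\<^bsub>M\<^esub>"
  "ring.add (copy_comodule A C i M) = ring.add (copy i M)"
  "ract (copy_comodule A C i M) = ract (copy i M)"
  by (simp_all add: copy_comodule_def bimod.extend_def copy_def)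

lemma rcoact_copy_comodule: "rcoact (copy_comodule A C i M) x =
    tensor_map A M C (copy_comodule A C i M) C i id (rcoact M (inv_into (carrier M) i x))"
proof -
  have "tensor_group A (copy i M) C = tensor_group A (copy_comodule A C i M) C"
    by (rule tensor_group_cong') simp_all
  moreover have "tens A (copy i M) C = tens A (copy_comodule A C i M) C"
    by (rule tens_cong') simp_all
  moreover have "rcoact (copy_comodule A C i M) x = tensor_map A M C (copy i M) C i id (rcoact M (inv_into (carrier M) i x))"
    by (simp add: copy_comodule_def bimod.extend_def rcomod.fields_def)
  ultimately show ?thesis by (simp add: tensor_map_def)
qed

context coring
begin

context
  fixes M :: "('a, 'c, 'm) rcomod" and i :: "'m \<Rightarrow> 'u"
  assumes M: "right_comodule A C M" and i: "inj_on i (carrier M)"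
begin

interpretation M: right_comodule A C M by (fact M)

private lemmas R = M.M.right_module_axioms
private abbreviation (input) "M' \<equiv> copy_comodule A C i M"
private abbreviation (input) "i' \<equiv> inv_into (carrier M) i"

private lemma R': "right_module A M'"
  using copy_right_module[OF R i] by (subst right_module_cong[of _ "copy i M"]) simp_all

private lemma i_linear: "right_linear A M M' i"
  using copy_linear[OF R i] by (simp add: right_linear_def additive_map_iff)

private lemma i'_linear: "right_linear A M' M i'"
  using copy_inv_linear[OF R i] by (simp add: right_linear_def additive_map_iff)

private lemma rcoact_i: "m \<in> carrier M \<Longrightarrow> rcoact M' (i m) = mapC M M' i (rcoact M m)"
  using i by (simp add: rcoact_copy_comodule)

lemma copy_right_comodule: "right_comodule A C (copy_comodule A C i M)"
proof -
  have lin: "right_linear A M' (tensor A M' C) (rcoact M')"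
    unfolding rcoact_copy_comodule[abs_def]
    by (rule right_linear_comp[OF right_linear_comp[OF i'_linear M.rcoact_linear] mapC_right_linear[OF R R' i_linear]])
  note along = M.comodule_axioms_along[OF R' lin i_linear rcoact_i]
  show ?thesis
    unfolding right_comodule_def right_comodule_axioms_def
    using coring_axioms R' lin along by auto
qed

lemma copy_hom: "restrict i (carrier M) \<in> comodule_hom A C M (copy_comodule A C i M)"
proof (rule comodule_homI)
  show "right_linear A M M' (restrict i (carrier M))"
    using right_hom_linear[OF right_hom_restrict[OF R i_linear]] .
  have "mapC M M' (restrict i (carrier M)) = mapC M M' i" by (rule mapC_cong) simp
  then show "rcoact M' (restrict i (carrier M) m) = mapC M M' (restrict i (carrier M)) (rcoact M m)"
    if "m \<in> carrier M" for m
    using that by (simp add: rcoact_i)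
qed simp

lemma copy_inv_hom: "restrict (inv_into (carrier M) i) (i ` carrier M) \<in> comodule_hom A C (copy_comodule A C i M) M"
proof (rule comodule_homI)
  show "right_linear A M' M (restrict i' (i ` carrier M))"
    using right_hom_linear[OF right_hom_restrict[OF R' i'_linear]] by simp
  have e: "mapC M' M (restrict i' (i ` carrier M)) = mapC M' M i'" by (rule mapC_cong) simp
  fix x assume "x \<in> carrier M'"
  then obtain m where m: "m \<in> carrier M" "x = i m" by auto
  have "mapC M' M i' (mapC M M' i (rcoact M m)) = mapC M M (\<lambda>x. i' (i x)) (rcoact M m)"
    by (rule mapC_comp[OF R R' i_linear R i'_linear M.rcoact_closed[OF m(1)]])
  also have "\<dots> = rcoact M m"
    by (rule mapC_ident[OF R _ M.rcoact_closed[OF m(1)]]) (use i in simp)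
  finally show "rcoact M (restrict i' (i ` carrier M) x) = mapC M' M (restrict i' (i ` carrier M)) (rcoact M' x)"
    using m i by (simp add: e rcoact_i)
qed simp

end

end

context fgp_coring
begin

context
  assumes chosen: "(n, e, f) = (SOME b. dual_basis A C b)"
    and coflat: "coflat TYPE('u) A C DM"
begin

context
  fixes X Y Z :: "('a, 'c, 'u) rcomod" and g h
  assumes X: "right_comodule A C X" and Y: "right_comodule A C Y" and Z: "right_comodule A C Z"
    and g: "g \<in> comodule_hom A C X Y" and h: "h \<in> comodule_hom A C Y Z"
    and exact: "short_exact X Y Z g h"
begin

interpretation X: right_comodule A C X by (fact X)
interpretation Y: right_comodule A C Y by (fact Y)
interpretation Z: right_comodule A C Z by (fact Z)

private lemmas XM = X.M.right_module_axioms and YM = Y.M.right_module_axioms and ZM = Z.M.right_module_axioms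

private lemma cot_exact: "short_exact (cotensor A C X DM) (cotensor A C Y DM) (cotensor A C Z DM)
    (tensor_map A X DM Y DM g id) (tensor_map A Y DM Z DM h id)"
  using coflat X Y Z g h exact unfolding coflat_def by blast

text \<open>Under the identification of \<open>G\<close> with the cotensor product this is the surjectivity in the short
  exact sequence of cotensor products that coflatness provides; \<open>G_kernel_universe\<close> is its exactness
  in the middle. An elementwise argument for the latter would have to show that a colinear map \<open>C \<rightarrow> Y\<close>
  with values in a subcomodule \<open>X\<close> is colinear as a map to \<open>X\<close>, for which \<open>X \<otimes>\<^sub>A C \<rightarrow> Y \<otimes>\<^sub>A C\<close> has to be
  injective.\<close>

lemma G_lift_universe:
  assumes q: "q \<in> comodule_hom A C (self_comodule C) Z"
  shows "\<exists>p\<in>comodule_hom A C (self_comodule C) Y. \<forall>c\<in>carrier C. h (p c) = q c"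
proof -
  obtain t where t: "t \<in> carrier (cotensor A C Z DM)" "hom_of_tensor Z t = q"
    using cotensor_of_G[OF chosen Z q] .
  obtain s where s: "s \<in> carrier (cotensor A C Y DM)" "t = tensor_map A Y DM Z DM h id s"
    using cot_exact t(1) unfolding short_exact_def by blast
  have s': "s \<in> carrier (tensor_group A Y DM)" using s(1) cotensor_subset[OF chosen Y] by blast
  show ?thesis
    using cotensor_iff[OF chosen Y s'] s t hom_of_tensor_natural[OF YM ZM comodule_hom_linear[OF h] s']
    by (intro bexI[of _ "hom_of_tensor Y s"]) auto
qed

lemma G_kernel_universe:
  assumes p: "p \<in> comodule_hom A C (self_comodule C) Y" and hp: "\<And>c. c \<in> carrier C \<Longrightarrow> h (p c) = \<zero>\<^bsub>Z\<^esub>"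
  shows "\<exists>r\<in>comodule_hom A C (self_comodule C) X. \<forall>c\<in>carrier C. g (r c) = p c"
proof -
  obtain s where s: "s \<in> carrier (cotensor A C Y DM)" "hom_of_tensor Y s = p"
    using cotensor_of_G[OF chosen Y p] .
  have s': "s \<in> carrier (tensor_group A Y DM)" using s(1) cotensor_subset[OF chosen Y] by blast
  let ?t = "tensor_map A Y DM Z DM h id s"
  interpret TZ: abelian_group "tensor_group A Z DM" by (rule tensor_abelian_group[OF ZM dual_comodule_left])
  have t': "?t \<in> carrier (tensor_group A Z DM)"
    by (rule tensor_map_closed[OF YM dual_comodule_left ZM dual_comodule_left comodule_hom_linear[OF h] left_linear_id(1) s'])
  have zero: "hom_of_tensor Z \<zero>\<^bsub>tensor_group A Z DM\<^esub> = (\<lambda>c\<in>carrier C. \<zero>\<^bsub>Z\<^esub>)"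
    using additive_map_zero[OF TZ.abelian_group_axioms right_module_abelian[OF hom_mod_right_module[OF ZM]]
        hom_of_tensor_additive[OF ZM]] by simp
  have "hom_of_tensor Z ?t = hom_of_tensor Z \<zero>\<^bsub>tensor_group A Z DM\<^esub>"
  proof (rule extensionalityI[of _ "carrier C"])
    show "hom_of_tensor Z ?t c = hom_of_tensor Z \<zero>\<^bsub>tensor_group A Z DM\<^esub> c" if c: "c \<in> carrier C" for c
      using c hom_of_tensor_natural[OF YM ZM comodule_hom_linear[OF h] s' c] by (simp add: zero s(2) hp)
  qed (simp_all add: hom_of_tensor_def)
  then have "?t = \<zero>\<^bsub>tensor_group A Z DM\<^esub>"
    using hom_of_tensor_bij[OF ZM] t' TZ.zero_closed unfolding bij_betw_def by (auto dest: inj_onD)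
  moreover have "\<zero>\<^bsub>cotensor A C Z DM\<^esub> = \<zero>\<^bsub>tensor_group A Z DM\<^esub>" by (simp add: cotensor_def)
  ultimately have "s \<in> {s \<in> carrier (cotensor A C Y DM). tensor_map A Y DM Z DM h id s = \<zero>\<^bsub>cotensor A C Z DM\<^esub>}"
    using s(1) by simp
  then have "s \<in> tensor_map A X DM Y DM g id ` carrier (cotensor A C X DM)"
    using cot_exact unfolding short_exact_def by simp
  then obtain r where r: "r \<in> carrier (cotensor A C X DM)" "s = tensor_map A X DM Y DM g id r"
    by blast
  have r': "r \<in> carrier (tensor_group A X DM)" using r(1) cotensor_subset[OF chosen X] by blast
  show ?thesis
    using cotensor_iff[OF chosen X r'] r s hom_of_tensor_natural[OF XM YM comodule_hom_linear[OF g] r']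
    by (intro bexI[of _ "hom_of_tensor X r"]) auto
qed

end

context
  fixes X :: "('a, 'c, 'i) rcomod" and Y :: "('a, 'c, 'j) rcomod" and Z :: "('a, 'c, 'k) rcomod" and g h
  assumes X: "right_comodule A C X" and Y: "right_comodule A C Y" and Z: "right_comodule A C Z"
    and eX: "embeds TYPE('u) (carrier X)" and eY: "embeds TYPE('u) (carrier Y)" and eZ: "embeds TYPE('u) (carrier Z)"
    and g: "g \<in> comodule_hom A C X Y" and h: "h \<in> comodule_hom A C Y Z"
    and exact: "short_exact X Y Z g h"
begin

interpretation X: right_comodule A C X by (fact X)
interpretation Y: right_comodule A C Y by (fact Y)
interpretation Z: right_comodule A C Z by (fact Z)

private definition iX :: "'i \<Rightarrow> 'u" where "iX = (SOME i. inj_on i (carrier X))"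
private definition iY :: "'j \<Rightarrow> 'u" where "iY = (SOME i. inj_on i (carrier Y))"
private definition iZ :: "'k \<Rightarrow> 'u" where "iZ = (SOME i. inj_on i (carrier Z))"

private lemma iX: "inj_on iX (carrier X)" and iY: "inj_on iY (carrier Y)" and iZ: "inj_on iZ (carrier Z)"
  unfolding iX_def iY_def iZ_def
  by (rule someI_ex[OF eX[unfolded embeds_def]] someI_ex[OF eY[unfolded embeds_def]]
      someI_ex[OF eZ[unfolded embeds_def]])+

private abbreviation (input) "X' \<equiv> copy_comodule A C iX X"
private abbreviation (input) "Y' \<equiv> copy_comodule A C iY Y"
private abbreviation (input) "Z' \<equiv> copy_comodule A C iZ Z"

private lemmas X' = copy_right_comodule[OF X iX] and Y' = copy_right_comodule[OF Y iY]
  and Z' = copy_right_comodule[OF Z iZ]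

private definition g' where "g' = compose (carrier X') (compose (carrier X) (restrict iY (carrier Y)) g)
    (restrict (inv_into (carrier X) iX) (iX ` carrier X))"
private definition h' where "h' = compose (carrier Y') (compose (carrier Y) (restrict iZ (carrier Z)) h)
    (restrict (inv_into (carrier Y) iY) (iY ` carrier Y))"

private lemma g': "g' \<in> comodule_hom A C X' Y'"
  unfolding g'_def
  by (rule comodule_hom_comp[OF X' X Y' copy_inv_hom[OF X iX] comodule_hom_comp[OF X Y Y' g copy_hom[OF Y iY]]])

private lemma h': "h' \<in> comodule_hom A C Y' Z'"
  unfolding h'_def
  by (rule comodule_hom_comp[OF Y' Y Z' copy_inv_hom[OF Y iY] comodule_hom_comp[OF Y Z Z' h copy_hom[OF Z iZ]]])

private lemmas g_closed = right_linear_closed[OF comodule_hom_linear[OF g]]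
private lemmas h_closed = right_linear_closed[OF comodule_hom_linear[OF h]]

private lemma g'_app: "x \<in> carrier X \<Longrightarrow> g' (iX x) = iY (g x)"
  using iX g_closed by (simp add: g'_def compose_def)

private lemma h'_app: "y \<in> carrier Y \<Longrightarrow> h' (iY y) = iZ (h y)"
  using iY h_closed by (simp add: h'_def compose_def)

private lemma exact': "short_exact X' Y' Z' g' h'"
  unfolding short_exact_def
proof (intro conjI)
  have g_inj: "inj_on g (carrier X)" and g_im: "g ` carrier X = {y \<in> carrier Y. h y = \<zero>\<^bsub>Z\<^esub>}"
    and h_im: "h ` carrier Y = carrier Z"
    using exact by (simp_all add: short_exact_def)
  show "additive_map X' Y' g'" "additive_map Y' Z' h'"
    by (intro right_linear_additive[OF comodule_hom_linear[OF g']] right_linear_additive[OF comodule_hom_linear[OF h']])+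
  show "inj_on g' (carrier X')"
  proof (rule inj_onI)
    fix u v assume "u \<in> carrier X'" "v \<in> carrier X'" and eq: "g' u = g' v"
    then obtain x y where xy: "x \<in> carrier X" "y \<in> carrier X" "u = iX x" "v = iX y" by auto
    then have "iY (g x) = iY (g y)" using eq by (simp add: g'_app)
    then have "g x = g y" using iY g_closed xy by (auto dest: inj_onD)
    then show "u = v" using g_inj xy by (auto dest: inj_onD)
  qed
  have "iZ (h y) = iZ \<zero>\<^bsub>Z\<^esub> \<longleftrightarrow> h y = \<zero>\<^bsub>Z\<^esub>" if "y \<in> carrier Y" for y
    using iZ h_closed[OF that] Z.M.M.zero_closed by (auto dest: inj_onD)
  then have "{u \<in> carrier Y'. h' u = \<zero>\<^bsub>Z'\<^esub>} = iY ` {y \<in> carrier Y. h y = \<zero>\<^bsub>Z\<^esub>}"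
    by (auto simp: h'_app)
  also have "\<dots> = g' ` carrier X'"
    using g_im[symmetric] by (auto simp: g'_app image_image)
  finally show "g' ` carrier X' = {u \<in> carrier Y'. h' u = \<zero>\<^bsub>Z'\<^esub>}" by simp
  show "h' ` carrier Y' = carrier Z'"
    using h_im[symmetric] by (simp add: image_image h'_app)
qed

text \<open>The same for comodules that merely embed into the universe, by passage to copies \<open>X'\<close>, \<open>Y'\<close>, \<open>Z'\<close>
  and back.\<close>

lemma G_lift:
  assumes q: "q \<in> comodule_hom A C (self_comodule C) Z"
  shows "\<exists>p\<in>comodule_hom A C (self_comodule C) Y. \<forall>c\<in>carrier C. h (p c) = q c"
proof -
  note qcl = right_linear_closed[OF comodule_hom_linear[OF q], unfolded self_comodule_simps]
  have "compose (carrier (self_comodule C)) (restrict iZ (carrier Z)) q \<in> comodule_hom A C (self_comodule C) Z'"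
    by (rule comodule_hom_comp[OF self_right_comodule Z Z' q copy_hom[OF Z iZ]])
  from G_lift_universe[OF X' Y' Z' g' h' exact' this]
  obtain p where p: "p \<in> comodule_hom A C (self_comodule C) Y'"
    and hp: "\<And>c. c \<in> carrier C \<Longrightarrow> h' (p c) = iZ (q c)"
    using qcl by (auto simp: compose_def)
  let ?p = "compose (carrier (self_comodule C)) (restrict (inv_into (carrier Y) iY) (iY ` carrier Y)) p"
  have "?p \<in> comodule_hom A C (self_comodule C) Y"
    by (rule comodule_hom_comp[OF self_right_comodule Y' Y p copy_inv_hom[OF Y iY]])
  moreover have "h (?p c) = q c" if c: "c \<in> carrier C" for c
  proof -
    obtain y where y: "y \<in> carrier Y" "p c = iY y"
      using right_linear_closed[OF comodule_hom_linear[OF p], of c] c by auto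
    then have "iZ (h y) = iZ (q c)" using hp[OF c] by (simp add: h'_app)
    then have "h y = q c" using iZ h_closed[OF y(1)] qcl[OF c] by (auto dest: inj_onD)
    then show ?thesis using y c iY by (simp add: compose_def)
  qed
  ultimately show ?thesis by blast
qed

lemma G_kernel:
  assumes p: "p \<in> comodule_hom A C (self_comodule C) Y" and hp: "\<And>c. c \<in> carrier C \<Longrightarrow> h (p c) = \<zero>\<^bsub>Z\<^esub>"
  shows "\<exists>r\<in>comodule_hom A C (self_comodule C) X. \<forall>c\<in>carrier C. g (r c) = p c"
proof -
  note pcl = right_linear_closed[OF comodule_hom_linear[OF p], unfolded self_comodule_simps]
  let ?p = "compose (carrier (self_comodule C)) (restrict iY (carrier Y)) p"
  have p': "?p \<in> comodule_hom A C (self_comodule C) Y'"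
    by (rule comodule_hom_comp[OF self_right_comodule Y Y' p copy_hom[OF Y iY]])
  have "h' (?p c) = \<zero>\<^bsub>Z'\<^esub>" if "c \<in> carrier C" for c
    using that pcl hp by (simp add: compose_def h'_app)
  from G_kernel_universe[OF X' Y' Z' g' h' exact' p' this]
  obtain r where r: "r \<in> comodule_hom A C (self_comodule C) X'"
    and gr: "\<And>c. c \<in> carrier C \<Longrightarrow> g' (r c) = iY (p c)"
    using pcl by (auto simp: compose_def)
  let ?r = "compose (carrier (self_comodule C)) (restrict (inv_into (carrier X) iX) (iX ` carrier X)) r"
  have "?r \<in> comodule_hom A C (self_comodule C) X"
    by (rule comodule_hom_comp[OF self_right_comodule X' X r copy_inv_hom[OF X iX]])
  moreover have "g (?r c) = p c" if c: "c \<in> carrier C" for c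
  proof -
    obtain x where x: "x \<in> carrier X" "r c = iX x"
      using right_linear_closed[OF comodule_hom_linear[OF r], of c] c by auto
    then have "iY (g x) = iY (p c)" using gr[OF c] by (simp add: g'_app)
    then have "g x = p c" using iY g_closed[OF x(1)] pcl[OF c] by (auto dest: inj_onD)
    then show ?thesis using x c iX by (simp add: compose_def)
  qed
  ultimately show ?thesis by blast
qed

end

end

end

section \<open>Exactness of tensor products\<close>

lemma (in abelian_group) minus_eq_zero_iff:
  assumes "x \<in> carrier G" "y \<in> carrier G"
  shows "x \<ominus> y = \<zero> \<longleftrightarrow> x = y"
  using assms by (metis a_minus_def a_inv_closed minus_equality minus_minus r_neg a_comm)

lemma right_linear_diff:
  assumes N: "right_module R N" and f: "right_linear R M N f" and g: "right_linear R M N g"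
  shows "right_linear R M N (\<lambda>x. f x \<ominus>\<^bsub>N\<^esub> g x)"
proof -
  interpret N: right_module R N by fact
  note cl = right_linear_closed[OF f] right_linear_closed[OF g]
  have neg: "\<ominus>\<^bsub>N\<^esub> (x \<triangleleft>\<^bsub>N\<^esub> r) = (\<ominus>\<^bsub>N\<^esub> x) \<triangleleft>\<^bsub>N\<^esub> r" if "r \<in> carrier R" "x \<in> carrier N" for x r
    using additive_map_neg[OF N.M.abelian_group_axioms N.M.abelian_group_axioms, of "\<lambda>x. x \<triangleleft>\<^bsub>N\<^esub> r"] that
    by (simp add: additive_map_iff N.ract_closed N.ract_add_left)
  show ?thesis
    by (rule right_linearI[OF additive_mapI])
      (simp_all add: a_minus_def cl right_linear_add[OF f] right_linear_add[OF g] right_linear_ract[OF f]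
        right_linear_ract[OF g] N.M.minus_add N.M.a_ac neg N.ract_add_left)
qed

text \<open>The projection to the quotient \<open>T/B\<close>, reduced to the properties that tell whether an element of
  \<open>T\<close> lies in \<open>B\<close>.\<close>

lemma abelian_quotient:
  fixes T :: "('t, 'z) ring_scheme"
  assumes T: "abelian_group T" and B: "subgroup B (add_monoid T)"
  shows "\<exists>(Q :: 't set ring) \<pi>. abelian_group Q \<and> additive_map T Q \<pi> \<and>
    (\<forall>t\<in>carrier T. \<pi> t = \<zero>\<^bsub>Q\<^esub> \<longleftrightarrow> t \<in> B)"
proof -
  interpret T: abelian_group T by fact
  interpret B: subgroup B "add_monoid T" by fact
  let ?F = "add_monoid T Mod B"
  define Q :: "'t set ring" where "Q = \<lparr>carrier = carrier ?F, monoid.mult = undefined, one = undefined,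
    ring.zero = one ?F, ring.add = monoid.mult ?F\<rparr>"
  have N: "B \<lhd> add_monoid T"
    using B comm_group.normal_iff_subgroup[OF T.a_comm_group] by blast
  have "comm_group ?F" by (rule comm_group.abelian_FactGroup[OF T.a_comm_group B])
  moreover have Q: "add_monoid Q = ?F" by (simp add: Q_def)
  ultimately have 1: "abelian_group Q"
    unfolding abelian_group_def abelian_monoid_def abelian_group_axioms_def by (simp add: comm_group.axioms)
  show ?thesis
  proof (intro exI conjI ballI)
    show "abelian_group Q" by (rule 1)
    show "additive_map T Q (\<lambda>t. B #>\<^bsub>add_monoid T\<^esub> t)"
      using normal.rcos_sum[OF N] by (auto simp: additive_map_iff Q_def carrier_FactGroup)
    fix t assume t: "t \<in> carrier T"
    show "B #>\<^bsub>add_monoid T\<^esub> t = \<zero>\<^bsub>Q\<^esub> \<longleftrightarrow> t \<in> B"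
      using t T.add.coset_join1[of B t] T.add.coset_join2[of t B] B B.subset by (auto simp: Q_def)
  qed
qed

text \<open>Let \<open>B\<close> be the image of \<open>K \<otimes> P\<close>. As \<open>K\<close> is the kernel of \<open>d\<close>, the class of \<open>x \<otimes> p\<close> modulo \<open>B\<close> depends only
  on \<open>d(x)\<close> and \<open>p\<close>. This gives a map from \<open>Z \<otimes> P\<close> to the quotient by \<open>B\<close>, through which the projection
  of \<open>X \<otimes> P\<close> to the quotient factors.\<close>

lemma tensor_right_exact:
  fixes X :: "('l, 'm, 'r, 'y) bimod_scheme" and P :: "('r, 'p, 's, 'w) bimod_scheme"
  assumes P: "left_module R P" and X: "right_module R X" and Z: "right_module R Z" and K: "right_module R K"
    and d: "right_linear R X Z d" and surj: "d ` carrier X = carrier Z"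
    and K_eq: "carrier K = {x \<in> carrier X. d x = \<zero>\<^bsub>Z\<^esub>}" "ring.add K = ring.add X" "ract K = ract X"
    and t: "t \<in> carrier (tensor_group R X P)" and dt: "tensor_map R X P Z P d id t = \<zero>\<^bsub>tensor_group R Z P\<^esub>"
  shows "t \<in> tensor_map R K P X P (\<lambda>x. x) id ` carrier (tensor_group R K P)"
proof -
  let ?T = "tensor_group R X P" and ?J = "tensor_map R K P X P (\<lambda>x. x) id"
  interpret X: right_module R X by fact
  interpret Z: right_module R Z by fact
  interpret P: left_module R P by fact
  interpret T: abelian_group ?T by (rule tensor_abelian_group[OF X P])
  interpret TK: abelian_group "tensor_group R K P" by (rule tensor_abelian_group[OF K P])
  have inc: "right_linear R K X (\<lambda>x. x)" by (simp add: right_linear_def additive_map_iff K_eq)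
  note J = K P X P inc left_linear_id(1)
  note dm = X P Z P d left_linear_id(1)
  define B where "B = ?J ` carrier (tensor_group R K P)"
  interpret Jhom: abelian_group_hom "tensor_group R K P" ?T ?J
    by (rule additive_map_group_hom[OF TK.abelian_group_axioms T.abelian_group_axioms tensor_map_additive[OF J]])
  have sub: "subgroup B (add_monoid ?T)"
    using group_hom.img_is_subgroup[OF Jhom.a_group_hom] by (simp add: B_def)
  obtain Q :: "('m, 'p) tens set ring" and \<pi> where Q: "abelian_group Q" and \<pi>: "additive_map ?T Q \<pi>"
    and ker: "\<And>t. t \<in> carrier ?T \<Longrightarrow> \<pi> t = \<zero>\<^bsub>Q\<^esub> \<longleftrightarrow> t \<in> B"
    using abelian_quotient[OF T.abelian_group_axioms sub] by blast
  interpret Q: abelian_group Q by (rule Q)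
  have tens: "tens R X P x p \<in> carrier ?T" if "x \<in> carrier X" "p \<in> carrier P" for x p
    using that by (rule tens_closed[OF X P])
  have well: "\<pi> (tens R X P x p) = \<pi> (tens R X P x' p)"
    if *: "x \<in> carrier X" "x' \<in> carrier X" "p \<in> carrier P" "d x = d x'" for x x' p
  proof -
    have k: "x \<ominus>\<^bsub>X\<^esub> x' \<in> carrier X" using * by simp
    have add: "additive_map X ?T (\<lambda>x. tens R X P x p)" by (rule tens_additive_left[OF X P *(3)])
    have "d (x \<ominus>\<^bsub>X\<^esub> x') = d x \<ominus>\<^bsub>Z\<^esub> d x'"
      using * by (simp add: a_minus_def right_linear_add[OF d]
          additive_map_neg[OF X.M.abelian_group_axioms Z.M.abelian_group_axioms right_linear_additive[OF d]])
    then have "x \<ominus>\<^bsub>X\<^esub> x' \<in> carrier K"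
      using * k right_linear_closed[OF d] by (simp add: K_eq Z.M.minus_eq_zero_iff)
    then have "tens R X P (x \<ominus>\<^bsub>X\<^esub> x') p \<in> B"
      unfolding B_def using * tensor_map_tens[OF J] tens_closed[OF K P]
      by (intro image_eqI[of _ _ "tens R K P (x \<ominus>\<^bsub>X\<^esub> x') p"]) auto
    then have "\<zero>\<^bsub>Q\<^esub> = \<pi> (tens R X P (x \<ominus>\<^bsub>X\<^esub> x') p)" using ker[OF tens[OF k *(3)]] by simp
    also have "\<dots> = \<pi> (tens R X P x p) \<ominus>\<^bsub>Q\<^esub> \<pi> (tens R X P x' p)"
      using additive_map_neg[OF X.M.abelian_group_axioms Q additive_map_comp[OF add \<pi>] *(2)]
        additive_map_add[OF additive_map_comp[OF add \<pi>] *(1), of "\<ominus>\<^bsub>X\<^esub> x'"] *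
      by (simp add: a_minus_def)
    finally show ?thesis
      using Q.minus_eq_zero_iff[OF additive_map_closed[OF \<pi> tens[OF *(1,3)]] additive_map_closed[OF \<pi> tens[OF *(2,3)]]]
      by simp
  qed
  define s where "s = inv_into (carrier X) d"
  have s: "s z \<in> carrier X" "d (s z) = z" if "z \<in> carrier Z" for z
    using that surj by (auto simp: s_def inv_into_into f_inv_into_f)
  have bal: "balanced R Z P Q (\<lambda>z p. \<pi> (tens R X P (s z) p))"
  proof (rule balancedI)
    fix z z' p assume *: "z \<in> carrier Z" "z' \<in> carrier Z" "p \<in> carrier P"
    have "\<pi> (tens R X P (s (z \<oplus>\<^bsub>Z\<^esub> z')) p) = \<pi> (tens R X P (s z \<oplus>\<^bsub>X\<^esub> s z') p)"
      by (rule well) (use * s in \<open>simp_all add: right_linear_add[OF d]\<close>)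
    then show "\<pi> (tens R X P (s (z \<oplus>\<^bsub>Z\<^esub> z')) p) = \<pi> (tens R X P (s z) p) \<oplus>\<^bsub>Q\<^esub> \<pi> (tens R X P (s z') p)"
      using * s by (simp add: tens_add_left[OF X P] additive_map_add[OF \<pi>] tens)
  next
    fix z r p assume *: "z \<in> carrier Z" "r \<in> carrier R" "p \<in> carrier P"
    have "\<pi> (tens R X P (s (z \<triangleleft>\<^bsub>Z\<^esub> r)) p) = \<pi> (tens R X P (s z \<triangleleft>\<^bsub>X\<^esub> r) p)"
      by (rule well) (use * s in \<open>simp_all add: right_linear_ract[OF d] Z.ract_closed X.ract_closed\<close>)
    then show "\<pi> (tens R X P (s (z \<triangleleft>\<^bsub>Z\<^esub> r)) p) = \<pi> (tens R X P (s z) (r \<triangleright>\<^bsub>P\<^esub> p))"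
      using * s by (simp add: tens_balanced[OF X P])
  qed (use s in \<open>simp_all add: additive_map_closed[OF \<pi>] tens tens_add_right[OF X P] additive_map_add[OF \<pi>]\<close>)
  note l_add = tensor_lift_additive[OF Z P Q bal] and l_tens = tensor_lift_tens[OF Z P Q bal]
  have "tensor_lift R Z P Q (\<lambda>z p. \<pi> (tens R X P (s z) p)) (tensor_map R X P Z P d id t) = \<pi> t"
    by (rule additive_map_tensor_eqI[OF X P additive_map_comp[OF tensor_map_additive[OF dm] l_add] \<pi> _ t])
      (simp add: tensor_map_tens[OF dm] l_tens right_linear_closed[OF d], rule well;
        simp add: s right_linear_closed[OF d])
  then have "\<pi> t = \<zero>\<^bsub>Q\<^esub>"
    using additive_map_zero[OF tensor_abelian_group[OF Z P] Q l_add] by (simp add: dt)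
  then show ?thesis using ker[OF t] by (simp add: B_def)
qed

lemma tensor_map_surj:
  assumes P: "left_module R P" and X: "right_module R X" and Z: "right_module R Z"
    and d: "right_linear R X Z d" and surj: "d ` carrier X = carrier Z"
  shows "tensor_map R X P Z P d id ` carrier (tensor_group R X P) = carrier (tensor_group R Z P)"
proof (intro equalityI subsetI)
  note dm = X P Z P d left_linear_id(1)
  interpret TX: abelian_group "tensor_group R X P" by (rule tensor_abelian_group[OF X P])
  fix t assume "t \<in> carrier (tensor_group R Z P)"
  then show "t \<in> tensor_map R X P Z P d id ` carrier (tensor_group R X P)"
  proof (induction rule: tensor_induct[OF Z P, consumes 1, case_names tens add])
    case (tens z p)
    then obtain x where "x \<in> carrier X" "z = d x" using surj by blast
    then show ?case using tens tensor_map_tens[OF dm, of x p] tens_closed[OF X P]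
      by (intro image_eqI[of _ _ "tens R X P x p"]) (simp_all add: id_def)
  next
    case (add s t)
    then obtain u v where "u \<in> carrier (tensor_group R X P)" "s = tensor_map R X P Z P d id u"
      "v \<in> carrier (tensor_group R X P)" "t = tensor_map R X P Z P d id v" by blast
    then show ?case
      by (intro image_eqI[of _ _ "u \<oplus>\<^bsub>tensor_group R X P\<^esub> v"]) (simp_all add: additive_map_add[OF tensor_map_additive[OF dm, unfolded id_def]] id_def)
  qed
qed (auto simp: tensor_map_closed[OF X P Z P d left_linear_id(1)])

text \<open>The equaliser is the kernel of \<open>d = a - b\<close>, seen as a map onto its image \<open>I\<close>. Right exactness
  applies to \<open>X \<rightarrow> I\<close>, flatness to \<open>I \<rightarrow> Y\<close>.\<close>

lemma flat_equalizer:
  assumes flat: "flat TYPE('u) R P" and P: "left_module R P"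
    and X: "right_module R X" and Y: "right_module R Y" and K: "right_module R K"
    and eY: "embeds TYPE('u) (carrier Y)"
    and a: "right_linear R X Y a" and b: "right_linear R X Y b"
    and K_eq: "carrier K = {x \<in> carrier X. a x = b x}" "ring.add K = ring.add X" "ract K = ract X"
    and t: "t \<in> carrier (tensor_group R X P)"
    and ab: "tensor_map R X P Y P a id t = tensor_map R X P Y P b id t"
  shows "t \<in> tensor_map R K P X P (\<lambda>x. x) id ` carrier (tensor_group R K P)"
proof -
  interpret X: right_module R X by fact
  interpret Y: right_module R Y by fact
  interpret TY: abelian_group "tensor_group R Y P" by (rule tensor_abelian_group[OF Y P])
  let ?d = "\<lambda>x. a x \<ominus>\<^bsub>Y\<^esub> b x"
  let ?I = "Y\<lparr>carrier := ?d ` carrier X\<rparr>"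
  have d: "right_linear R X Y ?d" by (rule right_linear_diff[OF Y a b])
  note d_cl = right_linear_closed[OF d]
  note a_cl = right_linear_closed[OF a] and b_cl = right_linear_closed[OF b]
  have I: "right_module R ?I"
  proof (rule right_module_submodule[OF Y])
    have "?d \<zero>\<^bsub>X\<^esub> = \<zero>\<^bsub>Y\<^esub>"
      by (rule additive_map_zero[OF X.M.abelian_group_axioms Y.M.abelian_group_axioms right_linear_additive[OF d]])
    then show "\<zero>\<^bsub>Y\<^esub> \<in> carrier ?I" by (auto intro!: image_eqI[of _ _ "\<zero>\<^bsub>X\<^esub>"])
    fix x assume "x \<in> carrier ?I"
    then obtain u where u: "u \<in> carrier X" "x = ?d u" by auto
    show "x \<triangleleft>\<^bsub>Y\<^esub> r \<in> carrier ?I" if "r \<in> carrier R" for r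
      using right_linear_ract[OF d that u(1)] X.ract_closed[OF that u(1)] u(2)
      by (auto intro!: image_eqI[of _ _ "u \<triangleleft>\<^bsub>X\<^esub> r"])
    fix y assume "y \<in> carrier ?I"
    then obtain v where v: "v \<in> carrier X" "y = ?d v" by auto
    show "x \<oplus>\<^bsub>Y\<^esub> y \<in> carrier ?I"
      using right_linear_add[OF d u(1) v(1)] u v by (auto intro!: image_eqI[of _ _ "u \<oplus>\<^bsub>X\<^esub> v"])
  qed (use d_cl in auto)
  have dI: "right_linear R X ?I ?d" and inc: "right_linear R ?I Y (\<lambda>y. y)"
    using d d_cl by (auto simp: right_linear_def additive_map_iff)
  have "embeds TYPE('u) (carrier ?I)" by (rule embeds_subset[OF eY]) (use d_cl in auto)
  then have inj: "inj_on (tensor_map R ?I P Y P (\<lambda>y. y) id) (carrier (tensor_group R ?I P))"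
    using flat_inj[OF flat P I Y _ eY inc] by (simp add: inj_on_def)
  note dm = X P I P dI left_linear_id(1) and dm' = X P Y P d left_linear_id(1)
    and am = X P Y P a left_linear_id(1) and bm = X P Y P b left_linear_id(1)
  interpret TI: abelian_group "tensor_group R ?I P" by (rule tensor_abelian_group[OF I P])
  have neg: "\<ominus>\<^bsub>tensor_group R Y P\<^esub> tens R Y P y p = tens R Y P (\<ominus>\<^bsub>Y\<^esub> y) p" if "y \<in> carrier Y" "p \<in> carrier P" for y p
    using additive_map_neg[OF Y.M.abelian_group_axioms TY.abelian_group_axioms tens_additive_left[OF Y P that(2)] that(1)] by simp
  have negm: "additive_map (tensor_group R X P) (tensor_group R Y P) (\<lambda>t. \<ominus>\<^bsub>tensor_group R Y P\<^esub> tensor_map R X P Y P b id t)"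
    using tensor_map_closed[OF bm] by (intro additive_mapI)
      (simp_all add: additive_map_add[OF tensor_map_additive[OF bm]] TY.minus_add)
  have "tensor_map R ?I P Y P (\<lambda>y. y) id (tensor_map R X P ?I P ?d id t) = tensor_map R X P Y P ?d id t"
    by (rule tensor_map_id_comp[OF X I Y P dI inc t])
  also have "\<dots> = tensor_map R X P Y P a id t \<oplus>\<^bsub>tensor_group R Y P\<^esub> \<ominus>\<^bsub>tensor_group R Y P\<^esub> tensor_map R X P Y P b id t"
    by (rule additive_map_tensor_eqI[OF X P tensor_map_additive[OF dm']
          additive_map_plus[OF TY.abelian_group_axioms tensor_map_additive[OF am] negm] _ t])
      (simp add: tensor_map_tens[OF dm'] tensor_map_tens[OF am] tensor_map_tens[OF bm] neg a_cl b_cl,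
        simp add: a_minus_def a_cl b_cl tens_add_left[OF Y P])
  also have "\<dots> = \<zero>\<^bsub>tensor_group R Y P\<^esub>"
    unfolding ab using tensor_map_closed[OF bm t] by (rule TY.r_neg)
  also have "\<dots> = tensor_map R ?I P Y P (\<lambda>y. y) id \<zero>\<^bsub>tensor_group R ?I P\<^esub>"
    using additive_map_zero[OF TI.abelian_group_axioms TY.abelian_group_axioms
        tensor_map_additive[OF I P Y P inc left_linear_id(1)]] by simp
  finally have 0: "tensor_map R X P ?I P ?d id t = \<zero>\<^bsub>tensor_group R ?I P\<^esub>"
    using inj tensor_map_closed[OF dm t] by (auto dest: inj_onD)
  show ?thesis
    by (rule tensor_right_exact[OF P X I K dI _ _ K_eq(2,3) t 0])
      (use a_cl b_cl in \<open>auto simp: K_eq(1) Y.M.minus_eq_zero_iff\<close>)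
qed

section \<open>The counit is an isomorphism\<close>

definition (in coring) times_counit :: "('k, 'm, 'a, 'z) bimod_scheme \<Rightarrow> 'm \<Rightarrow> 'c \<Rightarrow> 'm"
  where "times_counit M m = (\<lambda>c\<in>carrier C. m \<triangleleft>\<^bsub>M\<^esub> counit C c)"

text \<open>The comparison map \<open>Hom\<^sub>A(C, M) \<otimes>\<^sub>D C \<rightarrow> M \<otimes>\<^sub>A C\<close>, \<open>p \<otimes> c \<mapsto> p(c\<^sub>1) \<otimes> c\<^sub>2\<close>.\<close>

definition (in coring) Phi :: "('k, 'm, 'a, 'z) bimod_scheme \<Rightarrow> ('c \<Rightarrow> 'm, 'c) tens \<Rightarrow> ('m, 'c) tens"
  where "Phi M t = mapC (F_obj A C (hom_mod A C M)) M (ev (hom_mod A C M) M) (rcoact (F_obj A C (hom_mod A C M)) t)"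

abbreviation (in coring) (input) "Hom M \<equiv> hom_mod A C M"

text \<open>Its inverse, \<open>m \<otimes> c \<mapsto> (m \<epsilon>) \<otimes> c\<close>.\<close>

definition (in coring) Kappa :: "('k, 'm, 'a, 'z) bimod_scheme \<Rightarrow> ('m, 'c) tens \<Rightarrow> ('c \<Rightarrow> 'm, 'c) tens"
  where "Kappa M = tensor_lift A M C (tensor_group D (hom_mod A C M) DC)
    (\<lambda>m c. tens D (hom_mod A C M) DC (times_counit M m) c)"

context coring
begin

context
  fixes M :: "('k, 'm, 'a, 'z) bimod_scheme"
  assumes M: "right_module A M"
  notes HM = hom_mod_right_module[OF M]
  notes FH = F_right_module[OF HM]
begin

interpretation M: right_module A M by (fact M)

interpretation H: right_module D "Hom M" by (rule HM)
private lemmas Hom_ev_facts = M HM equalityD1[OF hom_mod_simps(1)] hom_mod_simps(3) hom_mod_simps(4)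
private lemmas ev_H_linear = ev_right_linear[OF Hom_ev_facts]
private lemmas ev_H_tens = ev_tens[OF Hom_ev_facts]

lemma hom_ev_right_linear: "right_linear A (F_obj A C (hom_mod A C M)) M (ev (hom_mod A C M) M)"
  by (rule ev_H_linear)

lemma hom_ev_tens: "p \<in> right_hom A C M \<Longrightarrow> c \<in> carrier C \<Longrightarrow>
    ev (hom_mod A C M) M (tens D (hom_mod A C M) DC p c) = p c"
  using ev_H_tens by simp

private lemma T_abelian: "abelian_group (tensor_group D (hom_mod A C M) DC)"
  by (rule tensor_abelian_group[OF HM over_dual_left])

lemma Phi_additive: "additive_map (tensor_group D (hom_mod A C M) DC) (tensor_group A M C) (Phi M)"
  unfolding Phi_def by (rule additive_map_comp[OF rcoact_F_additive[OF HM] mapC_additive[OF FH M ev_H_linear]])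

lemma Phi_tens:
  assumes p: "p \<in> right_hom A C M" and c: "c \<in> carrier C"
  shows "Phi M (tens D (hom_mod A C M) DC p c) = mapC C M p (comult C c)"
proof -
  have p': "p \<in> carrier (Hom M)" using p by simp
  have "Phi M (tens D (Hom M) DC p c) = mapC C M (\<lambda>x. ev (Hom M) M (tens D (Hom M) DC p x)) (comult C c)"
    unfolding Phi_def rcoact_F_tens[OF HM p' c]
    by (rule mapC_comp[OF right_module_axioms FH tens_right_linear[OF HM p'] M ev_H_linear comult_closed[OF c]])
  also have "\<dots> = mapC C M p (comult C c)"
    using p by (intro fun_cong[OF mapC_cong]) (simp add: hom_ev_tens)
  finally show ?thesis .
qed

lemma times_counit_closed: "m \<in> carrier M \<Longrightarrow> times_counit M m \<in> right_hom A C M"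
  unfolding times_counit_def
  by (rule right_hom_restrict[OF right_module_axioms])
    (simp add: right_linear_def additive_map_iff counit_simps M.ract_closed M.ract_add_right M.ract_mult)

lemma times_counit_add: "m \<in> carrier M \<Longrightarrow> m' \<in> carrier M \<Longrightarrow>
    times_counit M (m \<oplus>\<^bsub>M\<^esub> m') = times_counit M m \<oplus>\<^bsub>hom_mod A C M\<^esub> times_counit M m'"
  by (auto simp: times_counit_def counit_simps M.ract_add_left intro!: restrict_ext)

lemma times_counit_ract: "m \<in> carrier M \<Longrightarrow> a \<in> carrier A \<Longrightarrow>
    times_counit M (m \<triangleleft>\<^bsub>M\<^esub> a) = times_counit M m \<triangleleft>\<^bsub>hom_mod A C M\<^esub> iota a"
  by (auto simp: times_counit_def counit_simps dual_act_iota lact_closed M.ract_mult intro!: restrict_ext)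

lemma times_counit_dual: "m \<in> carrier M \<Longrightarrow> f \<in> carrier D \<Longrightarrow> c \<in> carrier C \<Longrightarrow>
    (times_counit M m \<triangleleft>\<^bsub>hom_mod A C M\<^esub> f) c = m \<triangleleft>\<^bsub>M\<^esub> f c"
  by (simp add: times_counit_def counit_dual_act dual_linear dual_act_closed)

private lemma Kappa_balanced: "balanced A M C (tensor_group D (hom_mod A C M) DC)
    (\<lambda>m c. tens D (hom_mod A C M) DC (times_counit M m) c)"
proof (rule balancedI)
  fix m a c assume *: "m \<in> carrier M" "a \<in> carrier A" "c \<in> carrier C"
  have "tens D (Hom M) DC (times_counit M m \<triangleleft>\<^bsub>Hom M\<^esub> iota a) c = tens D (Hom M) DC (times_counit M m) (iota a \<triangleright>\<^bsub>DC\<^esub> c)"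
    by (rule tens_balanced[OF HM over_dual_left]) (use * in \<open>simp_all add: times_counit_closed iota_closed\<close>)
  then show "tens D (Hom M) DC (times_counit M (m \<triangleleft>\<^bsub>M\<^esub> a)) c = tens D (Hom M) DC (times_counit M m) (a \<triangleright>\<^bsub>C\<^esub> c)"
    using * by (simp add: times_counit_ract dual_act_iota)
qed (simp_all add: times_counit_closed times_counit_add tens_closed[OF HM over_dual_left]
    tens_add_left[OF HM over_dual_left] tens_add_right[OF HM over_dual_left, unfolded over_dual_simps] del: hom_mod_simps(3))

lemma Kappa_additive: "additive_map (tensor_group A M C) (tensor_group D (hom_mod A C M) DC) (Kappa M)"
  unfolding Kappa_def by (rule tensor_lift_additive[OF M left_module_axioms T_abelian Kappa_balanced])

lemma Kappa_tens: "m \<in> carrier M \<Longrightarrow> c \<in> carrier C \<Longrightarrow>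
    Kappa M (tens A M C m c) = tens D (hom_mod A C M) DC (times_counit M m) c"
  unfolding Kappa_def by (rule tensor_lift_tens[OF M left_module_axioms T_abelian Kappa_balanced])

lemma mapC_times_counit:
  assumes m: "m \<in> carrier M" and c: "c \<in> carrier C"
  shows "mapC C M (times_counit M m) (comult C c) = tens A M C m c"
proof -
  note lin = right_hom_linear[OF times_counit_closed[OF m]]
  have "mapC C M (times_counit M m) s = tens A M C m (tensor_lift A C C C (\<lambda>x y. counit C x \<triangleright>\<^bsub>C\<^esub> y) s)"
    if s: "s \<in> carrier (tensor_group A C C)" for s
    by (rule additive_map_tensor_eqI[OF right_module_axioms left_module_axioms mapC_additive[OF right_module_axioms M lin]
          additive_map_comp[OF dual_act_lift_additive[OF counit_right] tens_additive_right[OF M left_module_axioms m]] _ s])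
      (simp add: mapC_tens[OF right_module_axioms M lin] dual_act_lift_tens[OF counit_right],
        simp add: times_counit_def m tens_balanced[OF M left_module_axioms] counit_simps)
  then show ?thesis using c by (simp add: comult_closed counit_comult_left)
qed

end

end

context fgp_coring
begin

context
  fixes M :: "('k, 'm, 'a, 'z) bimod_scheme"
  assumes M: "right_module A M"
  notes HM = hom_mod_right_module[OF M]
begin

interpretation M: right_module A M by (fact M)

interpretation H: right_module D "Hom M" by (rule HM)

lemma hom_apply_additive: "c \<in> carrier C \<Longrightarrow> additive_map (hom_mod A C M) M (\<lambda>p. p c)"
  by (auto simp: additive_map_iff intro: right_linear_closed[OF right_hom_linear])

text \<open>In the form \<open>p = \<Sum> (p(e\<^sub>i) \<epsilon>) \<cdot> f\<^sub>i\<close> the expansion of \<open>p\<close> in the dual basis is a relation in the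
  \<open>D\<close>-module \<open>Hom\<^sub>A(C, M)\<close>: the maps \<open>m \<epsilon>\<close> generate it.\<close>

lemma hom_expand:
  assumes p: "p \<in> right_hom A C M"
  shows "p = (\<Oplus>\<^bsub>Hom M\<^esub>i\<in>{..<n}. times_counit M (p (e i)) \<triangleleft>\<^bsub>hom_mod A C M\<^esub> f i)"
proof (rule extensionalityI[OF right_hom_extensional[OF p]])
  have pe: "p (e i) \<in> carrier M" if "i < n" for i
    using right_linear_closed[OF right_hom_linear[OF p] e_closed[OF that]] .
  have cl: "times_counit M (p (e i)) \<triangleleft>\<^bsub>Hom M\<^esub> f i \<in> carrier (Hom M)" if "i < n" for i
    using that times_counit_closed[OF M pe[OF that]] f_closed by (intro H.ract_closed) simp_all
  have "(\<Oplus>\<^bsub>Hom M\<^esub>i\<in>{..<n}. times_counit M (p (e i)) \<triangleleft>\<^bsub>Hom M\<^esub> f i) \<in> carrier (Hom M)"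
    by (rule H.M.finsum_closed) (use cl in \<open>auto simp del: hom_mod_simps\<close>)
  then show "(\<Oplus>\<^bsub>Hom M\<^esub>i\<in>{..<n}. times_counit M (p (e i)) \<triangleleft>\<^bsub>Hom M\<^esub> f i) \<in> extensional (carrier C)"
    using right_hom_extensional by simp
  fix c assume c: "c \<in> carrier C"
  have "(\<Oplus>\<^bsub>Hom M\<^esub>i\<in>{..<n}. times_counit M (p (e i)) \<triangleleft>\<^bsub>Hom M\<^esub> f i) c =
      (\<Oplus>\<^bsub>M\<^esub>i\<in>{..<n}. (times_counit M (p (e i)) \<triangleleft>\<^bsub>Hom M\<^esub> f i) c)"
    by (rule additive_map_finsum[OF H.M.abelian_group_axioms M.M.abelian_group_axioms hom_apply_additive[OF c]])
      (use cl in \<open>auto simp del: hom_mod_simps\<close>)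
  also have "\<dots> = (\<Oplus>\<^bsub>M\<^esub>i\<in>{..<n}. p (e i) \<triangleleft>\<^bsub>M\<^esub> f i c)"
    by (rule M.M.finsum_cong')
      (auto simp: times_counit_dual[OF M] pe f_closed c fi_closed M.ract_closed simp del: hom_mod_simps)
  also have "\<dots> = p c" using linear_expand[OF M right_hom_linear[OF p] c] by simp
  finally show "p c = (\<Oplus>\<^bsub>Hom M\<^esub>i\<in>{..<n}. times_counit M (p (e i)) \<triangleleft>\<^bsub>Hom M\<^esub> f i) c" by simp
qed

interpretation T: abelian_group "tensor_group D (hom_mod A C M) DC"
  by (rule tensor_abelian_group[OF HM over_dual_left])

text \<open>For \<open>s = x \<otimes> y\<close> both sides are \<open>(p(x) \<epsilon>) \<otimes> y\<close>, where \<open>p(x) = \<Sum> p(e\<^sub>i) f\<^sub>i(x)\<close> and the coefficients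
  \<open>f\<^sub>i(x)\<close> are moved across the tensor sign. The case \<open>s = \<Delta>(c)\<close> is of interest.\<close>

lemma Kappa_mapC:
  assumes p: "p \<in> right_hom A C M" and s: "s \<in> carrier (tensor_group A C C)"
  shows "Kappa M (mapC C M p s) = (\<Oplus>\<^bsub>tensor_group D (Hom M) DC\<^esub>i\<in>{..<n}.
    tens D (Hom M) DC (times_counit M (p (e i))) (tensor_lift A C C C (\<lambda>x y. f i x \<triangleright>\<^bsub>C\<^esub> y) s))"
proof -
  note lin = right_hom_linear[OF p]
  have pe: "p (e i) \<in> carrier M" if "i < n" for i
    using right_linear_closed[OF lin e_closed[OF that]] .
  have tc: "times_counit M (p (e i)) \<in> carrier (Hom M)" if "i < n" for i
    using times_counit_closed[OF M pe[OF that]] by simp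
  have 1: "additive_map (tensor_group A C C) (tensor_group D (Hom M) DC)
      (\<lambda>s. tens D (Hom M) DC (times_counit M (p (e i))) (tensor_lift A C C C (\<lambda>x y. f i x \<triangleright>\<^bsub>C\<^esub> y) s))"
    if "i \<in> {..<n}" for i
  proof (rule additive_map_comp[of _ C])
    show "additive_map (tensor_group A C C) C (tensor_lift A C C C (\<lambda>x y. f i x \<triangleright>\<^bsub>C\<^esub> y))"
      using that by (intro dual_act_lift_additive dual_linear f_closed) simp
    show "additive_map C (tensor_group D (Hom M) DC) (tens D (Hom M) DC (times_counit M (p (e i))))"
      using that tens_additive_right[OF HM over_dual_left tc] by (simp add: additive_map_iff)
  qed
  have 2: "Kappa M (mapC C M p (tens A C C x y)) = (\<Oplus>\<^bsub>tensor_group D (Hom M) DC\<^esub>i\<in>{..<n}.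
      tens D (Hom M) DC (times_counit M (p (e i))) (tensor_lift A C C C (\<lambda>x y. f i x \<triangleright>\<^bsub>C\<^esub> y) (tens A C C x y)))"
    if x: "x \<in> carrier C" and y: "y \<in> carrier C" for x y
  proof -
    have fx: "f i x \<in> carrier A" if "i < n" for i using fi_closed[OF that x] .
    have add: "additive_map M (tensor_group D (Hom M) DC) (\<lambda>m. tens D (Hom M) DC (times_counit M m) y)"
      using y times_counit_closed[OF M] times_counit_add[OF M] tens_closed[OF HM over_dual_left]
        tens_add_left[OF HM over_dual_left] by (simp add: additive_map_iff del: hom_mod_simps(3))
    have "Kappa M (mapC C M p (tens A C C x y)) = tens D (Hom M) DC (times_counit M (p x)) y"
      using x y by (simp add: mapC_tens[OF right_module_axioms M lin] Kappa_tens[OF M] right_linear_closed[OF lin])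
    also have "p x = (\<Oplus>\<^bsub>M\<^esub>i\<in>{..<n}. p (e i) \<triangleleft>\<^bsub>M\<^esub> f i x)" by (rule linear_expand[OF M lin x])
    also have "tens D (Hom M) DC (times_counit M (\<Oplus>\<^bsub>M\<^esub>i\<in>{..<n}. p (e i) \<triangleleft>\<^bsub>M\<^esub> f i x)) y =
        (\<Oplus>\<^bsub>tensor_group D (Hom M) DC\<^esub>i\<in>{..<n}. tens D (Hom M) DC (times_counit M (p (e i) \<triangleleft>\<^bsub>M\<^esub> f i x)) y)"
      by (rule additive_map_finsum[OF M.M.abelian_group_axioms T.abelian_group_axioms add])
        (auto simp: pe fx M.ract_closed)
    also have "\<dots> = (\<Oplus>\<^bsub>tensor_group D (Hom M) DC\<^esub>i\<in>{..<n}.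
      tens D (Hom M) DC (times_counit M (p (e i))) (tensor_lift A C C C (\<lambda>x y. f i x \<triangleright>\<^bsub>C\<^esub> y) (tens A C C x y)))"
    proof (rule T.finsum_cong')
      fix i assume "i \<in> {..<n}"
      then have i: "i < n" by simp
      have "tens D (Hom M) DC (times_counit M (p (e i)) \<triangleleft>\<^bsub>Hom M\<^esub> iota (f i x)) y =
          tens D (Hom M) DC (times_counit M (p (e i))) (iota (f i x) \<triangleright>\<^bsub>DC\<^esub> y)"
        by (rule tens_balanced[OF HM over_dual_left]) (use i tc fx y in \<open>simp_all add: iota_closed\<close>)
      then show "tens D (Hom M) DC (times_counit M (p (e i) \<triangleleft>\<^bsub>M\<^esub> f i x)) y =
        tens D (Hom M) DC (times_counit M (p (e i))) (tensor_lift A C C C (\<lambda>x y. f i x \<triangleright>\<^bsub>C\<^esub> y) (tens A C C x y))"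
        using i x y fx pe
        by (simp add: times_counit_ract[OF M] dual_act_iota dual_act_lift_tens[OF dual_linear[OF f_closed]] del: hom_mod_simps(4))
    qed (auto simp: x y fx tc dual_act_lift_tens[OF dual_linear[OF f_closed]] lact_closed
          intro!: tens_closed[OF HM over_dual_left] simp del: hom_mod_simps)
    finally show ?thesis .
  qed
  show ?thesis
    by (rule additive_map_tensor_eqI[OF right_module_axioms left_module_axioms
          additive_map_comp[OF mapC_additive[OF right_module_axioms M lin] Kappa_additive[OF M]]
          additive_map_finsum_pointwise[OF CC_abelian_group T.abelian_group_axioms finite_lessThan 1] 2 s])
qed

text \<open>\<open>\<Sum> (p(e\<^sub>i) \<epsilon>) \<otimes> f\<^sub>i \<cdot> c = \<Sum> (p(e\<^sub>i) \<epsilon>) \<cdot> f\<^sub>i \<otimes> c = p \<otimes> c\<close>\<close>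

lemma Kappa_Phi:
  assumes t: "t \<in> carrier (tensor_group D (hom_mod A C M) DC)"
  shows "Kappa M (Phi M t) = t"
proof (rule additive_map_tensor_eqI[OF HM over_dual_left
      additive_map_comp[OF Phi_additive[OF M] Kappa_additive[OF M]] additive_map_id _ t])
  fix p c assume p: "p \<in> carrier (Hom M)" and c: "c \<in> carrier DC"
  have p': "p \<in> right_hom A C M" and c': "c \<in> carrier C" using p c by simp_all
  have tc: "times_counit M (p (e i)) \<in> carrier (Hom M)" if "i < n" for i
    using times_counit_closed[OF M right_linear_closed[OF right_hom_linear[OF p'] e_closed[OF that]]] by simp
  have "Kappa M (Phi M (tens D (Hom M) DC p c)) =
      (\<Oplus>\<^bsub>tensor_group D (Hom M) DC\<^esub>i\<in>{..<n}. tens D (Hom M) DC (times_counit M (p (e i))) (dual_act A C (f i) c))"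
    unfolding Phi_tens[OF M p' c'] Kappa_mapC[OF p' comult_closed[OF c']] by (simp add: dual_act_def)
  also have "\<dots> = (\<Oplus>\<^bsub>tensor_group D (Hom M) DC\<^esub>i\<in>{..<n}. tens D (Hom M) DC (times_counit M (p (e i)) \<triangleleft>\<^bsub>Hom M\<^esub> f i) c)"
    using tc c' tens_balanced[OF HM over_dual_left] H.ract_closed f_closed
    by (intro T.finsum_cong') (auto intro!: tens_closed[OF HM over_dual_left] simp del: hom_mod_simps)
  also have "\<dots> = tens D (Hom M) DC (\<Oplus>\<^bsub>Hom M\<^esub>i\<in>{..<n}. times_counit M (p (e i)) \<triangleleft>\<^bsub>Hom M\<^esub> f i) c"
    by (rule additive_map_finsum[symmetric, OF H.M.abelian_group_axioms T.abelian_group_axioms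
          tens_additive_left[OF HM over_dual_left c]])
      (use tc H.ract_closed f_closed in \<open>auto simp del: hom_mod_simps\<close>)
  also have "\<dots> = tens D (Hom M) DC p c" using hom_expand[OF p'] by simp
  finally show "Kappa M (Phi M (tens D (Hom M) DC p c)) = tens D (Hom M) DC p c" .
qed

lemma Phi_inj: "inj_on (Phi M) (carrier (tensor_group D (hom_mod A C M) DC))"
  by (rule inj_on_inverseI[of _ "Kappa M"]) (rule Kappa_Phi)

lemma Phi_Kappa:
  assumes s: "s \<in> carrier (tensor_group A M C)"
  shows "Phi M (Kappa M s) = s"
  by (rule additive_map_tensor_eqI[OF M left_module_axioms
        additive_map_comp[OF Kappa_additive[OF M] Phi_additive[OF M]] additive_map_id _ s])
    (simp add: Kappa_tens[OF M] Phi_tens[OF M] times_counit_closed[OF M] mapC_times_counit[OF M])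

end

end

text \<open>The two maps from \<open>Hom\<^sub>A(C, M)\<close> to \<open>Hom\<^sub>A(C, M \<otimes> C)\<close> whose equaliser is \<open>G(M)\<close>.\<close>

definition (in coring) post_coact :: "('a, 'c, 'm) rcomod \<Rightarrow> ('c \<Rightarrow> 'm) \<Rightarrow> 'c \<Rightarrow> ('m, 'c) tens"
  where "post_coact M p = (\<lambda>c\<in>carrier C. rcoact M (p c))"

definition (in coring) pre_comult :: "('a, 'c, 'm) rcomod \<Rightarrow> ('c \<Rightarrow> 'm) \<Rightarrow> 'c \<Rightarrow> ('m, 'c) tens"
  where "pre_comult M p = (\<lambda>c\<in>carrier C. mapC C M p (comult C c))"

context coring
begin

context
  fixes M :: "('a, 'c, 'm) rcomod"
  assumes M: "right_comodule A C M"
  notes R = right_comodule.axioms(2)[OF M]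
  notes MC = tensor_C_right_module[OF R]
  notes CR = right_module_axioms
begin

interpretation M: right_comodule A C M by (fact M)


lemma post_coact_closed: "p \<in> right_hom A C M \<Longrightarrow> post_coact M p \<in> right_hom A C (tensor A M C)"
  unfolding post_coact_def
  by (intro right_hom_restrict[OF CR] right_linear_comp[OF right_hom_linear M.rcoact_linear])

lemma pre_comult_closed: "p \<in> right_hom A C M \<Longrightarrow> pre_comult M p \<in> right_hom A C (tensor A M C)"
  unfolding pre_comult_def
  by (intro right_hom_restrict[OF CR] right_linear_comp[OF comult_right mapC_right_linear[OF CR R right_hom_linear]])

lemma post_coact_linear: "right_linear D (Hom M) (Hom (tensor A M C)) (post_coact M)"
proof (rule right_linearI[OF additive_mapI])
  fix p q assume "p \<in> carrier (Hom M)" "q \<in> carrier (Hom M)"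
  then show "post_coact M (p \<oplus>\<^bsub>Hom M\<^esub> q) = post_coact M p \<oplus>\<^bsub>Hom (tensor A M C)\<^esub> post_coact M q"
    using right_linear_closed[OF right_hom_linear, of p A C M] right_linear_closed[OF right_hom_linear, of q A C M]
    by (auto simp: post_coact_def additive_map_add[OF M.rcoact_additive] intro!: restrict_ext)
next
  fix g p assume "g \<in> carrier D" "p \<in> carrier (Hom M)"
  then show "post_coact M (p \<triangleleft>\<^bsub>Hom M\<^esub> g) = post_coact M p \<triangleleft>\<^bsub>Hom (tensor A M C)\<^esub> g"
    by (auto simp: post_coact_def dual_act_closed dual_linear intro!: restrict_ext)
qed (simp add: post_coact_closed)

lemma pre_comult_linear: "right_linear D (Hom M) (Hom (tensor A M C)) (pre_comult M)"
proof (rule right_linearI[OF additive_mapI])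
  fix p q assume pq: "p \<in> carrier (Hom M)" "q \<in> carrier (Hom M)"
  have "mapC C M (\<lambda>c\<in>carrier C. p c \<oplus>\<^bsub>M\<^esub> q c) = mapC C M (\<lambda>c. p c \<oplus>\<^bsub>M\<^esub> q c)"
    by (rule mapC_cong) simp
  then show "pre_comult M (p \<oplus>\<^bsub>Hom M\<^esub> q) = pre_comult M p \<oplus>\<^bsub>Hom (tensor A M C)\<^esub> pre_comult M q"
    using pq mapC_plus[OF CR R right_hom_linear right_hom_linear comult_closed]
    by (auto simp: pre_comult_def intro!: restrict_ext)
next
  fix g p assume gp: "g \<in> carrier D" "p \<in> carrier (Hom M)"
  note l = dual_act_right_linear[OF dual_linear[OF gp(1)]]
  have "mapC C M (\<lambda>c\<in>carrier C. p (dual_act A C g c)) = mapC C M (\<lambda>c. p (dual_act A C g c))"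
    by (rule mapC_cong) simp
  then show "pre_comult M (p \<triangleleft>\<^bsub>Hom M\<^esub> g) = pre_comult M p \<triangleleft>\<^bsub>Hom (tensor A M C)\<^esub> g"
    using gp mapC_comp[OF CR CR l R right_hom_linear comult_closed, of p]
    by (auto simp: pre_comult_def dual_act_closed dual_linear comult_dual_act intro!: restrict_ext)
qed (simp add: pre_comult_closed)

lemma G_obj_equalizer: "carrier (G_obj A C M) = {p \<in> carrier (hom_mod A C M). post_coact M p = pre_comult M p}"
  by (auto simp: G_obj_iff post_coact_def pre_comult_def fun_eq_iff restrict_def)

end

end

context fgp_coring
begin

context
  fixes M :: "('a, 'c, 'm) rcomod"
  assumes M: "right_comodule A C M"
  notes R = right_comodule.axioms(2)[OF M]
  notes MC = tensor_C_right_module[OF R]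
  notes CR = right_module_axioms
  notes CL = left_module_axioms
  notes HM = hom_mod_right_module[OF R]
  notes H2M = hom_mod_right_module[OF MC]
begin

interpretation M: right_comodule A C M by (fact M)

private lemmas a_prems = HM over_dual_left H2M over_dual_left post_coact_linear[OF M] left_linear_id(1)
private lemmas b_prems = HM over_dual_left H2M over_dual_left pre_comult_linear[OF M] left_linear_id(1)

private lemma tens_linear: "m \<in> carrier M \<Longrightarrow> right_linear A C (tensor A M C) (tens A M C m)"
  by (simp add: right_linear_def additive_map_iff tens_closed[OF R CL] tens_add_right[OF R CL] tens_ract[OF R bimodule_axioms])

text \<open>By \<open>\<Phi>\<close> this is coassociativity: the two sides correspond to \<open>\<rho>(m\<^sub>0) \<otimes> m\<^sub>1\<close> and \<open>m\<^sub>0 \<otimes> \<Delta>(m\<^sub>1)\<close>.\<close>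

lemma post_pre_Kappa:
  assumes m: "m \<in> carrier M"
  shows "tensor_map D (Hom M) DC (Hom (tensor A M C)) DC (post_coact M) id (Kappa M (rcoact M m)) =
    tensor_map D (Hom M) DC (Hom (tensor A M C)) DC (pre_comult M) id (Kappa M (rcoact M m))"
proof -
  let ?MC = "tensor A M C"
  let ?G = "tensor_group A ?MC C"
  let ?a = "\<lambda>s. Phi ?MC (tensor_map D (Hom M) DC (Hom (tensor A M C)) DC (post_coact M) id (Kappa M s))"
  let ?b = "\<lambda>s. Phi ?MC (tensor_map D (Hom M) DC (Hom (tensor A M C)) DC (pre_comult M) id (Kappa M s))"
  have a_add: "additive_map (tensor_group A M C) ?G ?a"
    by (rule additive_map_comp[OF additive_map_comp[OF Kappa_additive[OF R] tensor_map_additive[OF a_prems]] Phi_additive[OF MC]])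
  have b_add: "additive_map (tensor_group A M C) ?G ?b"
    by (rule additive_map_comp[OF additive_map_comp[OF Kappa_additive[OF R] tensor_map_additive[OF b_prems]] Phi_additive[OF MC]])
  note tc = times_counit_closed[OF R]
  have a_tens: "?a (tens A M C x c) = tens A ?MC C (rcoact M x) c" if x: "x \<in> carrier M" and c: "c \<in> carrier C" for x c
  proof -
    have eq: "mapC C ?MC (post_coact M (times_counit M x)) = mapC C ?MC (times_counit ?MC (rcoact M x))"
      using x by (intro mapC_cong) (simp add: post_coact_def times_counit_def right_linear_ract[OF M.rcoact_linear] counit_simps)
    have "?a (tens A M C x c) = mapC C ?MC (post_coact M (times_counit M x)) (comult C c)"
      using x c by (simp add: Kappa_tens[OF R] tensor_map_tens[OF a_prems] tc Phi_tens[OF MC] post_coact_closed[OF M])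
    then show ?thesis using x c mapC_times_counit[OF MC] by (simp add: eq M.rcoact_closed)
  qed
  have b_tens: "?b (tens A M C x c) = mapC C ?MC (tens A M C x) (comult C c)" if x: "x \<in> carrier M" and c: "c \<in> carrier C" for x c
  proof -
    have eq: "mapC C ?MC (pre_comult M (times_counit M x)) = mapC C ?MC (tens A M C x)"
      using x by (intro mapC_cong) (simp add: pre_comult_def mapC_times_counit[OF R])
    have "?b (tens A M C x c) = mapC C ?MC (pre_comult M (times_counit M x)) (comult C c)"
      using x c by (simp add: Kappa_tens[OF R] tensor_map_tens[OF b_prems] tc Phi_tens[OF MC] pre_comult_closed[OF M])
    then show ?thesis by (simp add: eq)
  qed
  interpret CC: bimodule A A "tensor A C C" by (rule CC_bimodule)
  interpret G: abelian_group ?G by (rule tensor_C_abelian_group[OF MC])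
  \<comment> \<open>\<open>h\<close> is the inverse of the associativity isomorphism.\<close>
  define h where "h = tensor_lift A M (tensor A C C) ?G (\<lambda>m w. mapC C ?MC (tens A M C m) w)"
  note mt = mapC_tens[OF CR MC tens_linear] and ma = mapC_additive[OF CR MC tens_linear]
  have h_bal: "balanced A M (tensor A C C) ?G (\<lambda>m w. mapC C ?MC (tens A M C m) w)"
  proof (rule balancedI)
    fix x x' w assume *: "x \<in> carrier M" "x' \<in> carrier M" "w \<in> carrier (tensor A C C)"
    have w: "w \<in> carrier (tensor_group A C C)" and xx: "x \<oplus>\<^bsub>M\<^esub> x' \<in> carrier M" using * by simp_all
    show "mapC C ?MC (tens A M C (x \<oplus>\<^bsub>M\<^esub> x')) w = mapC C ?MC (tens A M C x) w \<oplus>\<^bsub>?G\<^esub> mapC C ?MC (tens A M C x') w"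
      by (rule additive_map_tensor_eqI[OF CR CL ma[OF xx] additive_map_plus[OF G.abelian_group_axioms ma[OF *(1)] ma[OF *(2)]] _ w])
        (use * in \<open>simp add: mt tens_add_left[OF R CL] tens_add_left[OF MC CL, unfolded tensor_simps] tens_closed[OF R CL]\<close>)
  next
    fix x r w assume *: "x \<in> carrier M" "r \<in> carrier A" "w \<in> carrier (tensor A C C)"
    have w: "w \<in> carrier (tensor_group A C C)" and xr: "x \<triangleleft>\<^bsub>M\<^esub> r \<in> carrier M" using * M.M.ract_closed by simp_all
    show "mapC C ?MC (tens A M C (x \<triangleleft>\<^bsub>M\<^esub> r)) w = mapC C ?MC (tens A M C x) (r \<triangleright>\<^bsub>tensor A C C\<^esub> w)"
      by (rule additive_map_tensor_eqI[OF CR CL ma[OF xr]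
            additive_map_comp[OF tensor_lact_additive[OF bimodule_axioms CL *(2)] ma[OF *(1)]] _ w])
        (use * in \<open>simp add: mt tens_lact[OF bimodule_axioms CL] lact_closed tens_balanced[OF R CL] M.M.ract_closed\<close>)
  qed (simp_all add: additive_map_closed[OF ma] additive_map_add[OF ma])
  note h_add = tensor_lift_additive[OF R CC.left_module_axioms G.abelian_group_axioms h_bal, folded h_def]
  note h_tens = tensor_lift_tens[OF R CC.left_module_axioms G.abelian_group_axioms h_bal, folded h_def]
  have h_assoc: "h (tensor_assoc A A M C C (tens A ?MC C s c)) = tens A ?MC C s c"
    if s: "s \<in> carrier (tensor_group A M C)" and c: "c \<in> carrier C" for s c
    by (rule additive_map_tensor_eqI[OF R CL
          additive_map_comp[OF tensor_assoc_additive_left[OF R bimodule_axioms CL c] h_add]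
          tens_additive_left[OF MC CL c, unfolded additive_map_from_tensor] _ s])
      (simp add: tensor_assoc_tens[OF R bimodule_axioms CL] c h_tens tens_closed[OF CR CL] mt)
  have "?a (rcoact M m) = ?b (rcoact M m)"
    by (rule M.coassoc_eqI[OF h_add a_add b_add _ _ m])
      (simp_all add: a_tens b_tens h_assoc M.rcoact_closed h_tens comult_closed)
  moreover have "Kappa M (rcoact M m) \<in> carrier (tensor_group D (Hom M) DC)"
    by (rule additive_map_closed[OF Kappa_additive[OF R] M.rcoact_closed[OF m]])
  ultimately show ?thesis
    using Phi_inj[OF MC] tensor_map_closed[OF a_prems] tensor_map_closed[OF b_prems] by (auto dest: inj_onD)
qed

context
  assumes u: "list_closed TYPE('u)" and flat: "flat TYPE('u) D DC"
    and eM: "embeds TYPE('u) (carrier M)" and eC: "embeds TYPE('u) (carrier C)"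
  notes GM = G_right_module[OF M]
begin

private abbreviation (input) "G \<equiv> G_obj A C M"
private abbreviation (input) "J \<equiv> tensor_map D G DC (Hom M) DC (\<lambda>x. x) id"

private lemma inc: "right_linear D G (Hom M) (\<lambda>x. x)"
  using G_obj_subset by (auto simp: right_linear_def additive_map_iff)

text \<open>Both sides send \<open>p \<otimes> c\<close> to \<open>p(c\<^sub>1) \<otimes> c\<^sub>2\<close>. As \<open>\<Phi>\<close>, \<open>\<rho>\<close> and, by flatness, \<open>J\<close> are injective, it follows that
  the counit is injective, and that its values can be computed from those of \<open>\<Phi> J\<close>.\<close>

private lemma Phi_J:
  assumes s: "s \<in> carrier (tensor_group D G DC)"
  shows "Phi M (J s) = rcoact M (FG_counit A C M s)"
proof -
  note j = GM over_dual_left HM over_dual_left inc left_linear_id(1)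
  show ?thesis
    by (rule additive_map_tensor_eqI[OF GM over_dual_left additive_map_comp[OF tensor_map_additive[OF j] Phi_additive[OF R]]
          additive_map_comp[OF FG_counit_additive[OF M] M.rcoact_additive] _ s])
      (simp add: tensor_map_tens[OF j] Phi_tens[OF R] G_obj_iff FG_counit_tens[OF M])
qed

text \<open>For surjectivity, the element \<open>\<Phi>\<^sup>-\<^sup>1(\<rho>(m))\<close> of \<open>Hom\<^sub>A(C, M) \<otimes>\<^sub>D C\<close> comes from \<open>G(M) \<otimes>\<^sub>D C\<close> by flatness,
  and there it is a preimage of \<open>m\<close>.\<close>

lemma FG_counit_bij: "bij_betw (FG_counit A C M) (carrier (tensor_group D (G_obj A C M) DC)) (carrier M)"
  unfolding bij_betw_def
proof (intro conjI equalityI subsetI)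
  note j = GM over_dual_left HM over_dual_left inc left_linear_id(1)
  have eH: "embeds TYPE('u) (carrier (Hom M))" using embeds_right_hom[OF u R eM] by simp
  have eG: "embeds TYPE('u) (carrier G)" by (rule embeds_subset[OF eH]) (use G_obj_subset in auto)
  have "inj_on J (carrier (tensor_group D G DC))"
    by (rule flat_inj[OF flat over_dual_left GM HM eG eH inc]) (simp add: inj_on_def)
  then show "inj_on (FG_counit A C M) (carrier (tensor_group D G DC))"
    using Phi_inj[OF R] Phi_J tensor_map_closed[OF j]
    by (intro inj_onI) (metis inj_onD)
  show "m \<in> carrier M" if "m \<in> FG_counit A C M ` carrier (tensor_group D G DC)" for m
    using that additive_map_closed[OF FG_counit_additive[OF M]] by auto
  fix m assume m: "m \<in> carrier M"
  have eH2: "embeds TYPE('u) (carrier (Hom (tensor A M C)))"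
    using embeds_right_hom[OF u MC] embeds_tensor[OF u R CL eM eC] by simp
  have "Kappa M (rcoact M m) \<in> J ` carrier (tensor_group D G DC)"
    by (rule flat_equalizer[OF flat over_dual_left HM H2M GM eH2 post_coact_linear[OF M] pre_comult_linear[OF M]
          G_obj_equalizer[OF M] _ _ additive_map_closed[OF Kappa_additive[OF R] M.rcoact_closed[OF m]]
          post_pre_Kappa[OF m]])
      (simp_all add: fun_eq_iff)
  then obtain s where s: "s \<in> carrier (tensor_group D G DC)" "Kappa M (rcoact M m) = J s" by blast
  have "rcoact M (FG_counit A C M s) = rcoact M m"
    using Phi_J[OF s(1)] Phi_Kappa[OF R M.rcoact_closed[OF m]] s(2) by simp
  then have "FG_counit A C M s = m"
    using M.rcoact_inj additive_map_closed[OF FG_counit_additive[OF M] s(1)] m by (auto dest: inj_onD)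
  then show "m \<in> FG_counit A C M ` carrier (tensor_group D G DC)" using s(1) by blast
qed

end

end

end

section \<open>The unit is an isomorphism\<close>

lemma (in coring) comodule_isoI:
  assumes M: "right_comodule A C M" and N: "right_comodule A C N"
    and f: "f \<in> comodule_hom A C M N" and bij: "bij_betw f (carrier M) (carrier N)"
  shows "comodule_iso A C M N f"
proof -
  interpret M: right_comodule A C M by fact
  interpret N: right_comodule A C N by fact
  note MR = M.M.right_module_axioms and NR = N.M.right_module_axioms
  have "f \<in> right_hom A M N" using f by (simp add: comodule_hom_def)
  from module_isoI[OF MR this bij] obtain g where g: "g \<in> right_hom A N M"
    and gf: "\<And>x. x \<in> carrier M \<Longrightarrow> g (f x) = x" and fg: "\<And>y. y \<in> carrier N \<Longrightarrow> f (g y) = y"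
    by (auto simp: module_iso_def mutually_inverse_def)
  have "g \<in> comodule_hom A C N M"
  proof (rule comodule_homI[OF right_hom_linear[OF g] right_hom_extensional[OF g]])
    fix y assume y: "y \<in> carrier N"
    have x: "g y \<in> carrier M" using right_linear_closed[OF right_hom_linear[OF g] y] .
    have "mapC N M g (rcoact N y) = mapC N M g (mapC M N f (rcoact M (g y)))"
      using comodule_hom_rcoact[OF f x] fg[OF y] by simp
    also have "\<dots> = mapC M M (\<lambda>x. g (f x)) (rcoact M (g y))"
      by (rule mapC_comp[OF MR NR comodule_hom_linear[OF f] MR right_hom_linear[OF g] M.rcoact_closed[OF x]])
    also have "\<dots> = rcoact M (g y)"
      by (rule mapC_ident[OF MR gf M.rcoact_closed[OF x]])
    finally show "rcoact M (g y) = mapC N M g (rcoact N y)" by simp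
  qed
  then show ?thesis
    using f gf fg by (auto simp: comodule_iso_def mutually_inverse_def)
qed

definition (in coring) restrict_scalars :: "(unit, 'n, 'c \<Rightarrow> 'a) bimod \<Rightarrow> (unit, 'n, 'a) bimod"
  where "restrict_scalars N = with_actions N (\<lambda>_ x. x) (\<lambda>x a. x \<triangleleft>\<^bsub>N\<^esub> iota a)"

lemma (in coring) restrict_scalars_simps [simp]:
  "carrier (restrict_scalars N) = carrier N"
  "ring.add (restrict_scalars N) = ring.add N"
  "ring.zero (restrict_scalars N) = ring.zero N"
  "x \<triangleleft>\<^bsub>restrict_scalars N\<^esub> a = x \<triangleleft>\<^bsub>N\<^esub> iota a"
  by (simp_all add: restrict_scalars_def)

context fgp_coring
begin

context
  fixes M :: "(unit, 'm, 'a) bimod"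
  assumes M: "right_module A M"
  notes HM = hom_mod_right_module[OF M]
begin

interpretation M: right_module A M by (fact M)

text \<open>A colinear map \<open>q\<close> into the cofree comodule \<open>F(Hom\<^sub>A(C, M)) = M \<otimes> C\<close> is determined by the linear map
  \<open>(M \<otimes> \<epsilon>) q\<close>, which here is evaluation after \<open>q\<close>; this is the required \<open>p\<close>. Indeed
  \<open>\<Phi>(q(c)) = (p \<otimes> C)(\<Delta>(c)) = \<Phi>(p \<otimes> c)\<close>.\<close>

lemma FG_unit_Hom_surj:
  assumes q: "q \<in> comodule_hom A C (self_comodule C) (F_obj A C (Hom M))"
  shows "\<exists>p\<in>right_hom A C M. \<forall>c\<in>carrier C. q c = tens D (Hom M) DC p c"
proof -
  let ?F = "F_obj A C (Hom M)"
  let ?ev = "ev (Hom M) M"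
  note FR = F_right_module[OF HM] and evl = hom_ev_right_linear[OF M]
  have q': "q \<in> right_hom A C ?F" "\<And>c. c \<in> carrier C \<Longrightarrow> rcoact ?F (q c) = mapC C ?F q (comult C c)"
    using q by (simp_all add: G_obj_iff)
  note ql = right_hom_linear[OF q'(1)]
  define p where "p = restrict (\<lambda>c. ?ev (q c)) (carrier C)"
  have p: "p \<in> right_hom A C M"
    unfolding p_def by (rule right_hom_restrict[OF right_module_axioms right_linear_comp[OF ql evl]])
  have "q c = tens D (Hom M) DC p c" if c: "c \<in> carrier C" for c
  proof -
    have "Phi M (q c) = mapC ?F M ?ev (mapC C ?F q (comult C c))"
      by (simp add: Phi_def q'(2)[OF c])
    also have "\<dots> = mapC C M (\<lambda>c. ?ev (q c)) (comult C c)"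
      by (rule mapC_comp[OF right_module_axioms FR ql M evl comult_closed[OF c]])
    also have "\<dots> = mapC C M p (comult C c)"
      by (rule fun_cong[OF mapC_cong]) (simp add: p_def)
    also have "\<dots> = Phi M (tens D (Hom M) DC p c)"
      using Phi_tens[OF M p c] by simp
    finally have "Phi M (q c) = Phi M (tens D (Hom M) DC p c)" .
    moreover have "q c \<in> carrier (tensor_group D (Hom M) DC)"
      using right_linear_closed[OF ql c] by simp
    moreover have "tens D (Hom M) DC p c \<in> carrier (tensor_group D (Hom M) DC)"
      using p c by (intro tens_closed[OF HM over_dual_left]) simp_all
    ultimately show ?thesis using Phi_inj[OF M] by (auto dest: inj_onD)
  qed
  then show ?thesis using p by blast
qed

lemma FG_unit_Hom_inj:
  assumes p: "p \<in> right_hom A C M" "p' \<in> right_hom A C M"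
    and eq: "\<And>c. c \<in> carrier C \<Longrightarrow> tens D (Hom M) DC p c = tens D (Hom M) DC p' c"
  shows "p = p'"
proof (rule extensionalityI[OF right_hom_extensional[OF p(1)] right_hom_extensional[OF p(2)]])
  fix c assume c: "c \<in> carrier C"
  show "p c = p' c"
    using hom_ev_tens[OF M p(1) c] hom_ev_tens[OF M p(2) c] eq[OF c] by simp
qed

end

context
  fixes N :: "(unit, 'n, 'c \<Rightarrow> 'a) bimod"
  assumes N: "right_module D N"
begin

interpretation N: right_module D N by (fact N)
interpretation D: ring D by (rule dual_ring_ring)


lemma restrict_scalars_module: "right_module A (restrict_scalars N)"
proof -
  have "abelian_group (restrict_scalars N)"
    using N.M.abelian_group_axioms by (subst abelian_group_cong[of _ N]) simp_all
  then show ?thesis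
    unfolding right_module_def right_module_axioms_def
    by (simp add: R.ring_axioms iota_closed N.ract_closed iota_add iota_mult iota_one N.ract_add_left
        N.ract_add_right N.ract_mult N.ract_one)
qed

private lemma act_balanced: "balanced A (restrict_scalars N) DM N (\<lambda>x f. x \<triangleleft>\<^bsub>N\<^esub> f)"
  by (rule balancedI)
    (simp_all add: N.ract_closed N.ract_add_left N.ract_add_right dual_lact N.ract_mult iota_closed)

definition act_tensor where "act_tensor = tensor_lift A (restrict_scalars N) DM N (\<lambda>x f. x \<triangleleft>\<^bsub>N\<^esub> f)"

private lemmas act_additive = tensor_lift_additive[OF restrict_scalars_module dual_comodule_left
    N.M.abelian_group_axioms act_balanced, folded act_tensor_def]
private lemmas act_tens = tensor_lift_tens[OF restrict_scalars_module dual_comodule_left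
    N.M.abelian_group_axioms act_balanced, folded act_tensor_def]

private lemma act_ract:
  assumes t: "t \<in> carrier (tensor_group A (restrict_scalars N) DM)" and g: "g \<in> carrier D"
  shows "act_tensor (t \<triangleleft>\<^bsub>tensor A (restrict_scalars N) DM\<^esub> g) = act_tensor t \<triangleleft>\<^bsub>N\<^esub> g"
proof -
  have r: "additive_map N N (\<lambda>x. x \<triangleleft>\<^bsub>N\<^esub> g)"
    using g by (simp add: additive_map_iff N.ract_closed N.ract_add_left)
  show ?thesis
    by (rule additive_map_tensor_eqI[OF restrict_scalars_module dual_comodule_left
          additive_map_comp[OF tensor_ract_additive[OF restrict_scalars_module dual_comodule_bimodule g] act_additive]
          additive_map_comp[OF act_additive r] _ t])
      (use g in \<open>simp add: tens_ract[OF restrict_scalars_module dual_comodule_bimodule] act_tens dual_mult_closed N.ract_mult\<close>)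
qed

text \<open>The projection of \<open>Hom\<^sub>A(C, N)\<close> onto \<open>N\<close>, \<open>p \<mapsto> \<Sum> p(e\<^sub>i) \<cdot> f\<^sub>i\<close>. It is obtained from the action
  \<open>N \<otimes>\<^sub>A D \<rightarrow> N\<close>, since from there its linearity over \<open>D\<close> is evident, while on sums over the dual basis
  it would have to be calculated.\<close>

definition cover where "cover p = act_tensor (tensor_of_hom (restrict_scalars N) p)"

private lemma hom_tensor: "p \<in> right_hom A C (restrict_scalars N) \<Longrightarrow>
    \<exists>t\<in>carrier (tensor_group A (restrict_scalars N) DM). hom_of_tensor (restrict_scalars N) t = p \<and> cover p = act_tensor t"
  using tensor_of_hom_closed[OF restrict_scalars_module] hom_of_tensor_of_hom[OF restrict_scalars_module]
  unfolding cover_def by blast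

private lemma cover_hom: "t \<in> carrier (tensor_group A (restrict_scalars N) DM) \<Longrightarrow> cover (hom_of_tensor (restrict_scalars N) t) = act_tensor t"
  unfolding cover_def by (simp add: tensor_of_hom_of_tensor[OF restrict_scalars_module])

lemma cover_linear: "right_linear D (Hom (restrict_scalars N)) N cover"
proof (rule right_linearI[OF additive_mapI])
  note NM = restrict_scalars_module
  interpret T: abelian_group "tensor_group A (restrict_scalars N) DM" by (rule tensor_abelian_group[OF NM dual_comodule_left])
  fix p assume "p \<in> carrier (Hom (restrict_scalars N))"
  then obtain t where t: "t \<in> carrier (tensor_group A (restrict_scalars N) DM)" "p = hom_of_tensor (restrict_scalars N) t" "cover p = act_tensor t"
    using hom_tensor[of p] by auto
  show "cover p \<in> carrier N" using additive_map_closed[OF act_additive t(1)] t(3) by simp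
  show "cover (p \<triangleleft>\<^bsub>Hom (restrict_scalars N)\<^esub> g) = cover p \<triangleleft>\<^bsub>N\<^esub> g" if g: "g \<in> carrier D" for g
    using hom_of_tensor_ract[OF NM t(1) g] act_ract[OF t(1) g] t
      cover_hom[OF additive_map_closed[OF tensor_ract_additive[OF NM dual_comodule_bimodule g] t(1)]]
    by (simp del: hom_mod_simps(4))
  fix q assume "q \<in> carrier (Hom (restrict_scalars N))"
  then obtain s where s: "s \<in> carrier (tensor_group A (restrict_scalars N) DM)" "q = hom_of_tensor (restrict_scalars N) s" "cover q = act_tensor s"
    using hom_tensor[of q] by auto
  show "cover (p \<oplus>\<^bsub>Hom (restrict_scalars N)\<^esub> q) = cover p \<oplus>\<^bsub>N\<^esub> cover q"
    using hom_of_tensor_plus[OF NM t(1) s(1)] additive_map_add[OF act_additive t(1) s(1)] t s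
      cover_hom[OF T.a_closed[OF t(1) s(1)]]
    by (simp del: hom_mod_simps(3))
qed

lemma cover_surj: "cover ` carrier (Hom (restrict_scalars N)) = carrier N"
proof (intro equalityI subsetI)
  note NM = restrict_scalars_module
  fix x assume x: "x \<in> carrier N"
  have t: "tens A (restrict_scalars N) DM x \<one>\<^bsub>D\<^esub> \<in> carrier (tensor_group A (restrict_scalars N) DM)"
    using x by (intro tens_closed[OF NM dual_comodule_left]) (simp_all add: dual_one_closed)
  have "cover (hom_of_tensor (restrict_scalars N) (tens A (restrict_scalars N) DM x \<one>\<^bsub>D\<^esub>)) = x"
    using cover_hom[OF t] x by (simp add: act_tens dual_one_closed N.ract_one)
  then show "x \<in> cover ` carrier (Hom (restrict_scalars N))"
    using hom_of_tensor_closed[OF NM t] by (intro image_eqI[of _ _ "hom_of_tensor (restrict_scalars N) (tens A (restrict_scalars N) DM x \<one>\<^bsub>D\<^esub>)"]) auto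
qed (use right_linear_closed[OF cover_linear] in auto)

definition cover_kernel where "cover_kernel = (Hom (restrict_scalars N))\<lparr>carrier := {p \<in> right_hom A C (restrict_scalars N). cover p = \<zero>\<^bsub>N\<^esub>}\<rparr>"

lemma cover_kernel_module: "right_module D cover_kernel"
proof -
  note HM = hom_mod_right_module[OF restrict_scalars_module]
  interpret H: right_module D "Hom (restrict_scalars N)" by (rule HM)
  have zero_ract: "\<zero>\<^bsub>N\<^esub> \<triangleleft>\<^bsub>N\<^esub> g = \<zero>\<^bsub>N\<^esub>" if "g \<in> carrier D" for g
    using additive_map_zero[OF N.M.abelian_group_axioms N.M.abelian_group_axioms, of "\<lambda>x. x \<triangleleft>\<^bsub>N\<^esub> g"] that
    by (simp add: additive_map_iff N.ract_closed N.ract_add_left)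
  have simps: "carrier cover_kernel = {p \<in> carrier (Hom (restrict_scalars N)). cover p = \<zero>\<^bsub>N\<^esub>}"
    "ring.add cover_kernel = ring.add (Hom (restrict_scalars N))" "ring.zero cover_kernel = ring.zero (Hom (restrict_scalars N))"
    "ract cover_kernel = ract (Hom (restrict_scalars N))" by (simp_all add: cover_kernel_def)
  show ?thesis
    by (rule right_module_submodule[OF HM])
      (auto simp: simps additive_map_zero[OF H.M.abelian_group_axioms N.M.abelian_group_axioms right_linear_additive[OF cover_linear]]
        right_linear_add[OF cover_linear] right_linear_ract[OF cover_linear] zero_ract H.ract_closed
        simp del: hom_mod_simps)
qed

end

context
  assumes u: "list_closed TYPE('u)" and eC: "embeds TYPE('u) (carrier C)"
    and flat: "flat TYPE('u) D DC" and coflat: "coflat TYPE('u) A C DM"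
    and chosen: "(n, e, f) = (SOME b. dual_basis A C b)"
begin

context
  fixes N :: "(unit, 'n, 'c \<Rightarrow> 'a) bimod"
  assumes N: "right_module D N" and eN: "embeds TYPE('u) (carrier N)"
  notes NM = restrict_scalars_module[OF N]
  notes HM = hom_mod_right_module[OF restrict_scalars_module[OF N]]
  notes KM = cover_kernel_module[OF N]
begin

interpretation N: right_module D N by (fact N)

private abbreviation (input) "K \<equiv> cover_kernel N"

private lemma K_simps: "carrier K = {p \<in> carrier (Hom (restrict_scalars N)). cover N p = \<zero>\<^bsub>N\<^esub>}"
  "ring.add K = ring.add (Hom (restrict_scalars N))" "ract K = ract (Hom (restrict_scalars N))"
  by (simp_all add: cover_kernel_def[OF N])

private abbreviation (input) "\<iota> \<equiv> restrict (\<lambda>p. p) (carrier K)"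
private definition \<sigma> where "\<sigma> = restrict (cover N) (carrier (Hom (restrict_scalars N)))"

private lemma inc_linear: "right_linear D K (Hom (restrict_scalars N)) (\<lambda>p. p)"
  by (simp add: right_linear_def additive_map_iff K_simps)

private lemma \<iota>: "\<iota> \<in> right_hom D K (Hom (restrict_scalars N))"
  by (rule right_hom_restrict[OF KM inc_linear])

private lemma \<sigma>: "\<sigma> \<in> right_hom D (Hom (restrict_scalars N)) N"
  unfolding \<sigma>_def by (rule right_hom_restrict[OF HM cover_linear[OF N]])

private lemma embeds_Hom: "embeds TYPE('u) (carrier (Hom (restrict_scalars N)))"
  using embeds_right_hom[OF u NM] eN by simp

private lemma embeds_K: "embeds TYPE('u) (carrier K)"
  by (rule embeds_subset[OF embeds_Hom]) (auto simp: K_simps)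

private lemma embeds_F: "right_module D X \<Longrightarrow> embeds TYPE('u) (carrier X) \<Longrightarrow> embeds TYPE('u) (carrier (F_obj A C X))"
  using embeds_tensor[OF u _ over_dual_left, of X] eC by simp

private lemma F_exact: "short_exact (F_obj A C K) (F_obj A C (Hom (restrict_scalars N))) (F_obj A C N)
    (F_map A C K (Hom (restrict_scalars N)) \<iota>) (F_map A C (Hom (restrict_scalars N)) N \<sigma>)"
  unfolding short_exact_def
proof (intro conjI)
  have Fi: "F_map A C K (Hom (restrict_scalars N)) \<iota> = tensor_map D K DC (Hom (restrict_scalars N)) DC (\<lambda>p. p) id"
    unfolding F_map_def by (rule tensor_map_eqI) simp_all
  have Fs: "F_map A C (Hom (restrict_scalars N)) N \<sigma> = tensor_map D (Hom (restrict_scalars N)) DC N DC (cover N) id"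
    unfolding F_map_def by (rule tensor_map_eqI) (simp_all add: \<sigma>_def)
  show "additive_map (F_obj A C K) (F_obj A C (Hom (restrict_scalars N))) (F_map A C K (Hom (restrict_scalars N)) \<iota>)"
    using F_map_additive[OF KM HM \<iota>] by simp
  show "additive_map (F_obj A C (Hom (restrict_scalars N))) (F_obj A C N) (F_map A C (Hom (restrict_scalars N)) N \<sigma>)"
    using F_map_additive[OF HM N \<sigma>] by simp
  show "inj_on (F_map A C K (Hom (restrict_scalars N)) \<iota>) (carrier (F_obj A C K))"
    using flat_inj[OF flat over_dual_left KM HM embeds_K embeds_Hom inc_linear] by (simp add: Fi inj_on_def)
  show "F_map A C (Hom (restrict_scalars N)) N \<sigma> ` carrier (F_obj A C (Hom (restrict_scalars N))) = carrier (F_obj A C N)"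
    using tensor_map_surj[OF over_dual_left HM N cover_linear[OF N] cover_surj[OF N]] by (simp add: Fs)
  have zero: "F_map A C (Hom (restrict_scalars N)) N \<sigma> (F_map A C K (Hom (restrict_scalars N)) \<iota> t) = \<zero>\<^bsub>F_obj A C N\<^esub>"
    if t: "t \<in> carrier (tensor_group D K DC)" for t
  proof -
    interpret T: abelian_group "tensor_group D N DC" by (rule tensor_abelian_group[OF N over_dual_left])
    have z: "additive_map (tensor_group D K DC) (tensor_group D N DC) (\<lambda>_. \<zero>\<^bsub>tensor_group D N DC\<^esub>)"
      by (simp add: additive_map_iff)
    have "F_map A C (Hom (restrict_scalars N)) N \<sigma> (F_map A C K (Hom (restrict_scalars N)) \<iota> t) = \<zero>\<^bsub>tensor_group D N DC\<^esub>"
    proof (rule additive_map_tensor_eqI[OF KM over_dual_left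
          additive_map_comp[OF F_map_additive[OF KM HM \<iota>] F_map_additive[OF HM N \<sigma>]] z _ t])
      fix p c assume p: "p \<in> carrier K" and c: "c \<in> carrier DC"
      have p': "p \<in> carrier (Hom (restrict_scalars N))" "cover N p = \<zero>\<^bsub>N\<^esub>" and \<iota>p: "\<iota> p = p"
        using p by (auto simp: K_simps)
      have "tens D N DC \<zero>\<^bsub>N\<^esub> c = \<zero>\<^bsub>tensor_group D N DC\<^esub>"
        by (rule additive_map_zero[OF N.M.abelian_group_axioms T.abelian_group_axioms tens_additive_left[OF N over_dual_left c]])
      then show "F_map A C (Hom (restrict_scalars N)) N \<sigma> (F_map A C K (Hom (restrict_scalars N)) \<iota> (tens D K DC p c)) = \<zero>\<^bsub>tensor_group D N DC\<^esub>"
        using p p' c \<iota>p F_map_tens[OF KM HM \<iota> p] F_map_tens[OF HM N \<sigma> p'(1)]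
        by (simp add: \<sigma>_def)
    qed
    then show ?thesis by simp
  qed
  show "F_map A C K (Hom (restrict_scalars N)) \<iota> ` carrier (F_obj A C K) =
      {t \<in> carrier (F_obj A C (Hom (restrict_scalars N))). F_map A C (Hom (restrict_scalars N)) N \<sigma> t = \<zero>\<^bsub>F_obj A C N\<^esub>}"
  proof (intro equalityI subsetI)
    fix t assume "t \<in> {t \<in> carrier (F_obj A C (Hom (restrict_scalars N))). F_map A C (Hom (restrict_scalars N)) N \<sigma> t = \<zero>\<^bsub>F_obj A C N\<^esub>}"
    then show "t \<in> F_map A C K (Hom (restrict_scalars N)) \<iota> ` carrier (F_obj A C K)"
      using tensor_right_exact[OF over_dual_left HM N KM cover_linear[OF N] cover_surj[OF N] K_simps, of t]
      by (simp add: Fi Fs)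
  qed (use zero F_map_closed[OF KM HM \<iota>] in auto)
qed

private lemmas F_comods = F_right_comodule[OF KM] F_right_comodule[OF HM] F_right_comodule[OF N]
private lemmas F_embeds = embeds_F[OF KM embeds_K] embeds_F[OF HM embeds_Hom] embeds_F[OF N eN]
private lemmas lift_facts = chosen coflat F_comods F_embeds F_map_hom[OF KM HM \<iota>] F_map_hom[OF HM N \<sigma>] F_exact

text \<open>A map \<open>q\<close> in \<open>G(F(N))\<close> lifts to \<open>G(F(Hom\<^sub>A(C, N)))\<close>, where it is the value of the unit at some \<open>p\<close>. By
  naturality \<open>q\<close> is the value of the unit at the image of \<open>p\<close> in \<open>N\<close>.\<close>

lemma FG_unit_surj: "FG_unit A C N ` carrier N = carrier (G_obj A C (F_obj A C N))"
proof (intro equalityI subsetI)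
  fix q assume "q \<in> carrier (G_obj A C (F_obj A C N))"
  then have q: "q \<in> comodule_hom A C (self_comodule C) (F_obj A C N)" by simp
  obtain q' where q': "q' \<in> comodule_hom A C (self_comodule C) (F_obj A C (Hom (restrict_scalars N)))"
    "\<And>c. c \<in> carrier C \<Longrightarrow> F_map A C (Hom (restrict_scalars N)) N \<sigma> (q' c) = q c"
    using G_lift[OF lift_facts q] by blast
  obtain p where p: "p \<in> right_hom A C (restrict_scalars N)" "\<And>c. c \<in> carrier C \<Longrightarrow> q' c = tens D (Hom (restrict_scalars N)) DC p c"
    using FG_unit_Hom_surj[OF NM q'(1)] by blast
  have x: "cover N p \<in> carrier N" using right_linear_closed[OF cover_linear[OF N]] p(1) by simp
  have "FG_unit A C N (cover N p) = q"
  proof (rule G_eqI[OF FG_unit_closed[OF N x]])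
    show "q \<in> carrier (G_obj A C (F_obj A C N))" using q by simp
    fix c assume c: "c \<in> carrier C"
    have "q c = F_map A C (Hom (restrict_scalars N)) N \<sigma> (tens D (Hom (restrict_scalars N)) DC p c)" using q'(2)[OF c] p(2)[OF c] by simp
    also have "\<dots> = tens D N DC (cover N p) c"
      using F_map_tens[OF HM N \<sigma>, of p c] p(1) c by (simp add: \<sigma>_def)
    finally show "FG_unit A C N (cover N p) c = q c" using FG_unit_app[OF N x c] by simp
  qed
  then show "q \<in> FG_unit A C N ` carrier N" using x by blast
qed (use FG_unit_closed[OF N] in blast)

text \<open>If the unit kills the image \<open>x\<close> of \<open>p\<close> then its value at \<open>p\<close> comes from \<open>G(F(K))\<close>.\<close>

lemma FG_unit_kernel_lift:
  assumes x: "x \<in> carrier N" and zero: "\<And>c. c \<in> carrier C \<Longrightarrow> tens D N DC x c = \<zero>\<^bsub>tensor_group D N DC\<^esub>"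
  shows "\<exists>p\<in>right_hom A C (restrict_scalars N). cover N p = x \<and> (\<exists>r\<in>carrier (G_obj A C (F_obj A C K)).
    \<forall>c\<in>carrier C. F_map A C K (Hom (restrict_scalars N)) \<iota> (r c) = tens D (Hom (restrict_scalars N)) DC p c)"
proof -
  have "x \<in> cover N ` carrier (Hom (restrict_scalars N))" using cover_surj[OF N] x by simp
  then obtain p where "p \<in> carrier (Hom (restrict_scalars N))" "x = cover N p" by blast
  then have p: "p \<in> right_hom A C (restrict_scalars N)" "cover N p = x" by simp_all
  have p': "p \<in> carrier (Hom (restrict_scalars N))" using p by simp
  let ?q = "FG_unit A C (Hom (restrict_scalars N)) p"
  have q: "?q \<in> comodule_hom A C (self_comodule C) (F_obj A C (Hom (restrict_scalars N)))"
    using FG_unit_closed[OF HM p'] by simp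
  have "F_map A C (Hom (restrict_scalars N)) N \<sigma> (?q c) = \<zero>\<^bsub>F_obj A C N\<^esub>" if c: "c \<in> carrier C" for c
    using FG_unit_app[OF HM p' c] F_map_tens[OF HM N \<sigma> p' c] p zero[OF c] by (simp add: \<sigma>_def)
  from G_kernel[OF lift_facts q this] show ?thesis
    using p FG_unit_app[OF HM p'] by auto
qed

end

text \<open>Surjectivity at the kernel \<open>K\<close> of the projection gives injectivity at \<open>N\<close>: in the situation of
  \<open>FG_unit_kernel_lift\<close>, the map from \<open>G(F(K))\<close> is the value of the unit at some \<open>k \<in> K\<close>, and \<open>k = p\<close>
  by injectivity at \<open>Hom\<^sub>A(C, N)\<close>, so that \<open>x = 0\<close>.\<close>

lemma FG_unit_bij:
  fixes N :: "(unit, 'n, 'c \<Rightarrow> 'a) bimod"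
  assumes N: "right_module D N" and eN: "embeds TYPE('u) (carrier N)"
  shows "bij_betw (FG_unit A C N) (carrier N) (carrier (G_obj A C (F_obj A C N)))"
  unfolding bij_betw_def
proof
  note NM = restrict_scalars_module[OF N]
  note HM = hom_mod_right_module[OF NM] and KM = cover_kernel_module[OF N]
  let ?H = "Hom (restrict_scalars N)" and ?K = "cover_kernel N"
  interpret N: right_module D N by fact
  interpret G: right_module D "G_obj A C (F_obj A C N)" by (rule G_right_module[OF F_right_comodule[OF N]])
  note lin = right_hom_linear[OF FG_unit_hom[OF N]]
  have eK: "embeds TYPE('u) (carrier ?K)"
    using embeds_subset[OF embeds_right_hom[OF u NM], of "carrier ?K"] eN by (auto simp: cover_kernel_def[OF N])
  show "inj_on (FG_unit A C N) (carrier N)"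
  proof (rule inj_onI)
    fix y z assume yz: "y \<in> carrier N" "z \<in> carrier N" and eq: "FG_unit A C N y = FG_unit A C N z"
    let ?x = "y \<ominus>\<^bsub>N\<^esub> z"
    have x: "?x \<in> carrier N" using yz by simp
    have zero: "tens D N DC ?x c = \<zero>\<^bsub>tensor_group D N DC\<^esub>" if c: "c \<in> carrier C" for c
    proof -
      interpret T: abelian_group "tensor_group D N DC" by (rule tensor_abelian_group[OF N over_dual_left])
      have c': "c \<in> carrier DC" using c by simp
      note add = tens_additive_left[OF N over_dual_left c']
      have e: "tens D N DC y c = tens D N DC z c"
        using fun_cong[OF eq, of c] FG_unit_app[OF N _ c] yz by simp
      have "tens D N DC ?x c = tens D N DC y c \<oplus>\<^bsub>tensor_group D N DC\<^esub> \<ominus>\<^bsub>tensor_group D N DC\<^esub> tens D N DC z c"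
        using additive_map_add[OF add yz(1), of "\<ominus>\<^bsub>N\<^esub> z"] yz
          additive_map_neg[OF N.M.abelian_group_axioms T.abelian_group_axioms add yz(2)]
        by (simp add: a_minus_def)
      then show ?thesis using tens_closed[OF N over_dual_left yz(2) c'] by (simp add: e T.r_neg)
    qed
    obtain p r where p: "p \<in> right_hom A C (restrict_scalars N)" "cover N p = ?x"
      and r: "r \<in> carrier (G_obj A C (F_obj A C ?K))"
        "\<And>c. c \<in> carrier C \<Longrightarrow> F_map A C ?K ?H (restrict (\<lambda>p. p) (carrier ?K)) (r c) = tens D ?H DC p c"
      using FG_unit_kernel_lift[OF N eN x zero] by blast
    obtain k where k: "k \<in> carrier ?K" "r = FG_unit A C ?K k"
      using r(1) FG_unit_surj[OF KM eK] by blast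
    have k': "k \<in> right_hom A C (restrict_scalars N)" "cover N k = \<zero>\<^bsub>N\<^esub>"
      using k(1) by (simp_all add: cover_kernel_def[OF N])
    have inc: "restrict (\<lambda>p. p) (carrier ?K) \<in> right_hom D ?K ?H"
      by (rule right_hom_restrict[OF KM]) (auto simp: right_linear_def additive_map_iff cover_kernel_def[OF N])
    have "tens D ?H DC p c = tens D ?H DC k c" if c: "c \<in> carrier C" for c
      using r(2)[OF c] F_map_tens[OF KM HM inc k(1) c] FG_unit_app[OF KM k(1) c] k by simp
    then have "p = k" by (rule FG_unit_Hom_inj[OF NM p(1) k'(1)])
    then show "y = z" using p(2) k'(2) N.M.minus_eq_zero_iff[OF yz] by metis
  qed
  show "FG_unit A C N ` carrier N = carrier (G_obj A C (F_obj A C N))"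
    by (rule FG_unit_surj[OF N eN])
qed

end

end

section \<open>Existence of dual bases\<close>

definition free_module :: "'a ring \<Rightarrow> nat \<Rightarrow> (unit, nat \<Rightarrow> 'a, 'a) bimod"
  where "free_module A k = \<lparr>carrier = {..<k} \<rightarrow>\<^sub>E carrier A, monoid.mult = undefined, one = undefined,
    ring.zero = (\<lambda>i\<in>{..<k}. \<zero>\<^bsub>A\<^esub>), ring.add = (\<lambda>g h. \<lambda>i\<in>{..<k}. g i \<oplus>\<^bsub>A\<^esub> h i),
    lact = (\<lambda>_ g. g), ract = (\<lambda>g a. \<lambda>i\<in>{..<k}. g i \<otimes>\<^bsub>A\<^esub> a)\<rparr>"

lemma free_module_simps [simp]:
  "carrier (free_module A k) = {..<k} \<rightarrow>\<^sub>E carrier A"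
  "\<zero>\<^bsub>free_module A k\<^esub> = (\<lambda>i\<in>{..<k}. \<zero>\<^bsub>A\<^esub>)"
  "g \<oplus>\<^bsub>free_module A k\<^esub> h = (\<lambda>i\<in>{..<k}. g i \<oplus>\<^bsub>A\<^esub> h i)"
  "g \<triangleleft>\<^bsub>free_module A k\<^esub> a = (\<lambda>i\<in>{..<k}. g i \<otimes>\<^bsub>A\<^esub> a)"
  by (simp_all add: free_module_def)

lemma free_module_right_module:
  assumes "ring A"
  shows "right_module A (free_module A k)"
proof -
  interpret A: ring A by fact
  let ?P = "{..<k} \<rightarrow>\<^sub>E carrier A"
  have cl: "g i \<in> carrier A" if "g \<in> ?P" "i < k" for g i using that by auto
  have res: "(\<lambda>i\<in>{..<k}. h i) \<in> ?P" if "\<And>i. i < k \<Longrightarrow> h i \<in> carrier A" for h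
    using that by auto
  have eq: "(\<lambda>i\<in>{..<k}. h i) = g" if "\<And>i. i < k \<Longrightarrow> h i = g i" "g \<in> ?P" for g h
    using that by (intro extensionalityI[of _ "{..<k}"]) (simp_all add: PiE_def)
  have ab: "abelian_group (free_module A k)"
  proof (rule abelian_groupI)
    fix g h l assume "g \<in> carrier (free_module A k)" "h \<in> carrier (free_module A k)" "l \<in> carrier (free_module A k)"
    then have g: "g \<in> ?P" "h \<in> ?P" "l \<in> ?P" by simp_all
    show "g \<oplus>\<^bsub>free_module A k\<^esub> h \<oplus>\<^bsub>free_module A k\<^esub> l = g \<oplus>\<^bsub>free_module A k\<^esub> (h \<oplus>\<^bsub>free_module A k\<^esub> l)"
      unfolding free_module_simps by (rule restrict_ext) (simp add: cl[OF g(1)] cl[OF g(2)] cl[OF g(3)] A.a_assoc)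
  next
    fix g h assume "g \<in> carrier (free_module A k)" "h \<in> carrier (free_module A k)"
    then have g: "g \<in> ?P" "h \<in> ?P" by simp_all
    show "g \<oplus>\<^bsub>free_module A k\<^esub> h \<in> carrier (free_module A k)"
      unfolding free_module_simps by (rule res) (simp add: cl[OF g(1)] cl[OF g(2)])
    show "g \<oplus>\<^bsub>free_module A k\<^esub> h = h \<oplus>\<^bsub>free_module A k\<^esub> g"
      unfolding free_module_simps by (rule restrict_ext) (simp add: cl[OF g(1)] cl[OF g(2)] A.a_comm)
  next
    show "\<zero>\<^bsub>free_module A k\<^esub> \<in> carrier (free_module A k)"
      unfolding free_module_simps by (rule res) simp
    fix g assume "g \<in> carrier (free_module A k)"
    then have g: "g \<in> ?P" by simp
    show "\<zero>\<^bsub>free_module A k\<^esub> \<oplus>\<^bsub>free_module A k\<^esub> g = g"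
      unfolding free_module_simps by (rule eq[OF _ g]) (simp add: cl[OF g])
    have "(\<lambda>i\<in>{..<k}. \<ominus>\<^bsub>A\<^esub> g i) \<in> carrier (free_module A k)"
      unfolding free_module_simps by (rule res) (simp add: cl[OF g])
    moreover have "(\<lambda>i\<in>{..<k}. \<ominus>\<^bsub>A\<^esub> g i) \<oplus>\<^bsub>free_module A k\<^esub> g = \<zero>\<^bsub>free_module A k\<^esub>"
      unfolding free_module_simps by (rule restrict_ext) (simp add: cl[OF g] A.l_neg)
    ultimately show "\<exists>h\<in>carrier (free_module A k). h \<oplus>\<^bsub>free_module A k\<^esub> g = \<zero>\<^bsub>free_module A k\<^esub>" by blast
  qed
  show ?thesis
    unfolding right_module_def right_module_axioms_def
  proof (intro conjI allI impI)
    fix a b g assume ab: "a \<in> carrier A" "b \<in> carrier A" and "g \<in> carrier (free_module A k)"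
    then have g: "g \<in> ?P" by simp
    show "g \<triangleleft>\<^bsub>free_module A k\<^esub> (a \<oplus>\<^bsub>A\<^esub> b) = g \<triangleleft>\<^bsub>free_module A k\<^esub> a \<oplus>\<^bsub>free_module A k\<^esub> g \<triangleleft>\<^bsub>free_module A k\<^esub> b"
      unfolding free_module_simps by (rule restrict_ext) (simp add: cl[OF g] ab A.r_distr)
    show "g \<triangleleft>\<^bsub>free_module A k\<^esub> (a \<otimes>\<^bsub>A\<^esub> b) = g \<triangleleft>\<^bsub>free_module A k\<^esub> a \<triangleleft>\<^bsub>free_module A k\<^esub> b"
      unfolding free_module_simps by (rule restrict_ext) (simp add: cl[OF g] ab A.m_assoc)
  next
    fix a g h assume a: "a \<in> carrier A" and "g \<in> carrier (free_module A k)" "h \<in> carrier (free_module A k)"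
    then have g: "g \<in> ?P" "h \<in> ?P" by simp_all
    show "(g \<oplus>\<^bsub>free_module A k\<^esub> h) \<triangleleft>\<^bsub>free_module A k\<^esub> a = g \<triangleleft>\<^bsub>free_module A k\<^esub> a \<oplus>\<^bsub>free_module A k\<^esub> h \<triangleleft>\<^bsub>free_module A k\<^esub> a"
      unfolding free_module_simps by (rule restrict_ext) (simp add: cl[OF g(1)] cl[OF g(2)] a A.l_distr)
  next
    fix a g assume a: "a \<in> carrier A" and "g \<in> carrier (free_module A k)"
    then have g: "g \<in> ?P" by simp
    show "g \<triangleleft>\<^bsub>free_module A k\<^esub> a \<in> carrier (free_module A k)"
      unfolding free_module_simps by (rule res) (simp add: cl[OF g] a)
  next
    fix g assume "g \<in> carrier (free_module A k)"
    then have g: "g \<in> ?P" by simp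
    show "g \<triangleleft>\<^bsub>free_module A k\<^esub> \<one>\<^bsub>A\<^esub> = g"
      unfolding free_module_simps by (rule eq[OF _ g]) (simp add: cl[OF g])
  qed (rule A.ring_axioms ab)+
qed

text \<open>A surjection \<open>\<pi> : A\<^sup>k \<rightarrow> C\<close> is split by a linear map, the components of which are the \<open>f\<^sub>i\<close>. As
  projectivity refers to modules in the universe, the lifting problem is posed for copies of
  \<open>A\<^sup>k\<close> and \<open>C\<close>.\<close>

lemma (in coring) dual_basis_exists:
  assumes fg: "finitely_generated A C" and proj: "projective TYPE('u) A C"
    and u: "list_closed TYPE('u)" and eA: "embeds TYPE('u) (carrier A)" and eC: "embeds TYPE('u) (carrier C)"
  shows "\<exists>b. dual_basis A C b"
proof -
  obtain X where X: "finite X" "X \<subseteq> carrier C"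
    "\<And>c. c \<in> carrier C \<Longrightarrow> \<exists>a \<in> X \<rightarrow> carrier A. c = (\<Oplus>\<^bsub>C\<^esub>x\<in>X. x \<triangleleft>\<^bsub>C\<^esub> a x)"
    using fg unfolding finitely_generated_def by blast
  define k where "k = card X"
  obtain e where e: "bij_betw e {..<k} X"
    using ex_bij_betw_nat_finite[OF X(1)] unfolding k_def by (auto simp: atLeast0LessThan)
  have e_cl: "e i \<in> carrier C" if "i < k" for i using e X(2) that by (auto simp: bij_betw_def)
  let ?P = "free_module A k"
  note P = free_module_right_module[OF R.ring_axioms, of k]
  have "inj_on (\<lambda>g. map g [0..<k]) (carrier ?P)"
  proof (rule inj_onI)
    fix g h assume "g \<in> carrier ?P" "h \<in> carrier ?P" "map g [0..<k] = map h [0..<k]"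
    then show "g = h" by (intro extensionalityI[of _ "{..<k}"]) (simp_all add: PiE_def map_eq_conv)
  qed
  then have "embeds TYPE('u) (carrier ?P)"
    by (rule embeds_inj[OF embeds_lists[OF u eA]], intro image_subsetI)
      (simp add: in_lists_conv_set PiE_iff)
  then obtain i :: "_ \<Rightarrow> 'u" where i: "inj_on i (carrier ?P)" by (auto simp: embeds_def)
  obtain j :: "_ \<Rightarrow> 'u" where j: "inj_on j (carrier C)" using eC by (auto simp: embeds_def)
  note CR = right_module_axioms
  define \<pi> where "\<pi> g = (\<Oplus>\<^bsub>C\<^esub>l\<in>{..<k}. e l \<triangleleft>\<^bsub>C\<^esub> g l)" for g
  have summand: "additive_map ?P C (\<lambda>g. e l \<triangleleft>\<^bsub>C\<^esub> g l)" if "l \<in> {..<k}" for l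
    using that e_cl[of l] by (simp add: additive_map_iff ract_closed ract_add_right PiE_iff)
  have \<pi>: "right_linear A ?P C \<pi>"
  proof (rule right_linearI)
    show "additive_map ?P C \<pi>"
      unfolding \<pi>_def by (rule additive_map_finsum_pointwise[OF right_module_abelian[OF P] M.abelian_group_axioms _ summand]) auto
    fix a g assume a: "a \<in> carrier A" and g: "g \<in> carrier ?P"
    have act: "additive_map C C (\<lambda>x. x \<triangleleft>\<^bsub>C\<^esub> a)" using a by (simp add: additive_map_iff ract_closed ract_add_left)
    have gl: "g l \<in> carrier A" if "l < k" for l using g that by (simp add: PiE_iff)
    have "\<pi> g \<triangleleft>\<^bsub>C\<^esub> a = (\<Oplus>\<^bsub>C\<^esub>l\<in>{..<k}. e l \<triangleleft>\<^bsub>C\<^esub> g l \<triangleleft>\<^bsub>C\<^esub> a)"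
      unfolding \<pi>_def by (rule additive_map_finsum[OF M.abelian_group_axioms M.abelian_group_axioms act])
        (auto simp: ract_closed e_cl gl)
    also have "\<dots> = \<pi> (g \<triangleleft>\<^bsub>?P\<^esub> a)"
      unfolding \<pi>_def by (rule M.finsum_cong') (auto simp: ract_mult e_cl gl a ract_closed)
    finally show "\<pi> (g \<triangleleft>\<^bsub>?P\<^esub> a) = \<pi> g \<triangleleft>\<^bsub>C\<^esub> a" by simp
  qed
  have \<pi>_surj: "\<exists>g\<in>carrier ?P. \<pi> g = c" if c: "c \<in> carrier C" for c
  proof -
    obtain a where a: "a \<in> X \<rightarrow> carrier A" "c = (\<Oplus>\<^bsub>C\<^esub>x\<in>X. x \<triangleleft>\<^bsub>C\<^esub> a x)" using X(3)[OF c] by blast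
    let ?g = "\<lambda>l\<in>{..<k}. a (e l)"
    have eX: "e l \<in> X" if "l < k" for l using e that by (auto simp: bij_betw_def)
    have eX': "X = e ` {..<k}" "inj_on e {..<k}" using e by (auto simp: bij_betw_def)
    have g: "?g \<in> carrier ?P" using a(1) eX by (simp add: PiE_iff Pi_iff)
    have "c = (\<Oplus>\<^bsub>C\<^esub>x\<in>e ` {..<k}. x \<triangleleft>\<^bsub>C\<^esub> a x)" using a(2) eX'(1) by simp
    also have "\<dots> = (\<Oplus>\<^bsub>C\<^esub>l\<in>{..<k}. e l \<triangleleft>\<^bsub>C\<^esub> a (e l))"
      by (rule M.finsum_reindex[OF _ eX'(2)]) (use a(1) X(2) eX'(1) in \<open>auto intro!: ract_closed\<close>)
    also have "\<dots> = \<pi> ?g"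
      unfolding \<pi>_def by (rule M.finsum_cong') (use a(1) eX e_cl in \<open>auto intro!: ract_closed\<close>)
    finally show ?thesis using g by blast
  qed
  note P' = copy_right_module[OF P i] and C' = copy_right_module[OF CR j]
  let ?i' = "inv_into (carrier ?P) i"
  let ?g = "restrict (\<lambda>x. j (\<pi> (?i' x))) (carrier (copy i ?P))"
  have g: "?g \<in> right_hom A (copy i ?P) (copy j C)"
    by (rule right_hom_restrict[OF P' right_linear_comp[OF copy_inv_linear[OF P i] right_linear_comp[OF \<pi> copy_linear[OF CR j]]]])
  have g_app: "?g (i p) = j (\<pi> p)" if "p \<in> carrier ?P" for p using that i by simp
  have g_surj: "?g ` carrier (copy i ?P) = carrier (copy j C)"
  proof -
    have "?g ` carrier (copy i ?P) = (\<lambda>p. j (\<pi> p)) ` carrier ?P"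
      unfolding copy_simps image_image by (rule image_cong[OF refl]) (use g_app in simp)
    also have "\<dots> = j ` \<pi> ` carrier ?P" by (simp only: image_image)
    also have "\<pi> ` carrier ?P = carrier C"
    proof (intro equalityI subsetI)
      show "c \<in> \<pi> ` carrier ?P" if "c \<in> carrier C" for c using \<pi>_surj[OF that] by blast
      show "c \<in> carrier C" if "c \<in> \<pi> ` carrier ?P" for c using that right_linear_closed[OF \<pi>] by blast
    qed
    finally show ?thesis by (simp only: copy_simps(1))
  qed
  have j_hom: "restrict j (carrier C) \<in> right_hom A C (copy j C)"
    by (rule right_hom_restrict[OF CR copy_linear[OF CR j]])
  have "\<exists>h\<in>right_hom A C (copy i ?P). \<forall>c\<in>carrier C. ?g (h c) = restrict j (carrier C) c"
    by (rule proj[unfolded projective_def, rule_format, of "copy i ?P" "copy j C"])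
      (intro conjI P' C' g g_surj j_hom)
  then obtain h where h: "h \<in> right_hom A C (copy i ?P)"
    and gh: "\<And>c. c \<in> carrier C \<Longrightarrow> ?g (h c) = restrict j (carrier C) c" by blast
  let ?h = "\<lambda>c. ?i' (h c)"
  have hl: "right_linear A C ?P ?h"
    by (rule right_linear_comp[OF right_hom_linear[OF h] copy_inv_linear[OF P i]])
  have h_cl: "?h c \<in> carrier ?P" if "c \<in> carrier C" for c by (rule right_linear_closed[OF hl that])
  have \<pi>h: "\<pi> (?h c) = c" if c: "c \<in> carrier C" for c
  proof -
    have "h c \<in> i ` carrier ?P" using right_linear_closed[OF right_hom_linear[OF h] c] by simp
    then have "?g (h c) = j (\<pi> (?h c))" by simp
    then have "j (\<pi> (?h c)) = j c" using gh[OF c] c by simp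
    then show ?thesis using j c right_linear_closed[OF \<pi> h_cl[OF c]] by (auto dest: inj_onD)
  qed
  define f where "f l = (\<lambda>c\<in>carrier C. ?h c l)" for l
  have "f l \<in> carrier D" if l: "l < k" for l
    unfolding f_def
  proof (rule dual_restrict)
    show "right_linear A C (regular A) (\<lambda>c. ?h c l)"
      using h_cl l right_linear_add[OF hl] right_linear_ract[OF hl]
      by (simp add: right_linear_regular PiE_iff)
  qed
  moreover have "c = (\<Oplus>\<^bsub>C\<^esub>l\<in>{..<k}. e l \<triangleleft>\<^bsub>C\<^esub> f l c)" if "c \<in> carrier C" for c
    using \<pi>h[OF that] that by (simp add: \<pi>_def f_def)
  ultimately have "dual_basis A C (k, e, f)"
    unfolding dual_basis_def using e_cl by simp
  then show ?thesis by blast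
qed


section \<open>The equivalence\<close>

theorem theorem7p3:
  fixes A :: "'a ring" and C :: "('a, 'c) coring"
  assumes "coring A C"
    and "finitely_generated A C"
    and "projective TYPE(('a, 'c, 'x) univ) A C"
    and "flat TYPE(('a, 'c, 'x) univ) (dual_ring A C) (over_dual A C)"
    and "coflat TYPE(('a, 'c, 'x) univ) A C (dual_comodule A C)"
  shows "inverse_equivalences TYPE(('a, 'c, 'x) univ) A C \<and>
    (\<forall>M :: ('a, 'c, ('a, 'c, 'x) univ) rcomod. right_comodule A C M \<longrightarrow>
      module_iso (dual_ring A C) (cotensor A C M (dual_comodule A C)) (G_obj A C M)
        (cotensor_to_hom A C M))"
proof -
  interpret coring A C by fact
  \<comment> \<open>Any two distinct letters serve for the encoding of lists of lists.\<close>
  have u: "list_closed TYPE(('a, 'c, 'x) univ)"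
    by (rule list_closed_list[of "Inl undefined" "Inr (Inl undefined)"]) simp
  have eA: "embeds TYPE(('a, 'c, 'x) univ) (carrier A)"
    unfolding embeds_def by (intro exI[of _ "\<lambda>a. [Inl a]"]) (simp add: inj_on_def)
  have eC: "embeds TYPE(('a, 'c, 'x) univ) (carrier C)"
    unfolding embeds_def by (intro exI[of _ "\<lambda>c. [Inr (Inl c)]"]) (simp add: inj_on_def)
  have eu: "embeds TYPE(('a, 'c, 'x) univ) S" for S :: "('a, 'c, 'x) univ set"
    unfolding embeds_def by (intro exI[of _ "\<lambda>x. x"]) (simp add: inj_on_def)
  obtain n e f where chosen: "(n, e, f) = (SOME b. dual_basis A C b)" by (metis prod_cases3)
  have "dual_basis A C (n, e, f)"
    unfolding chosen by (rule someI_ex[OF dual_basis_exists[OF assms(2,3) u eA eC]])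
  then interpret fgp_coring A C n e f by unfold_locales
  have "module_iso D N (G_obj A C (F_obj A C N)) (FG_unit A C N)"
    if N: "right_module D N" for N :: "(unit, ('a, 'c, 'x) univ, 'c \<Rightarrow> 'a) bimod"
    by (rule module_isoI[OF N FG_unit_hom[OF N] FG_unit_bij[OF u eC assms(4,5) chosen N eu]])
  moreover have "comodule_iso A C (F_obj A C (G_obj A C M)) M (FG_counit A C M)"
    if M: "right_comodule A C M" for M :: "('a, 'c, ('a, 'c, 'x) univ) rcomod"
    using FG_counit_bij[OF M u assms(4) eu eC]
    by (intro comodule_isoI[OF F_right_comodule[OF G_right_module[OF M]] M FG_counit_hom[OF M]]) simp
  ultimately show ?thesis
    unfolding inverse_equivalences_def
    using adjoint_pair_coring cotensor_iso[OF chosen] by blast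
qed

end
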